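(* Let $k\ge1$ and let $[\bar z_1,\dots,\bar z_k]\in\pi_k(X_{2k})$ be such that the associated sum operator $[S_1\cdots S_{k+1}]\in L[N_0\times\cdots\times N_k,\bar B]$ is surjective. Let $z(\varepsilon,n_1,\dots,n_{k+1})$ be the family of solution curves of $G[z]=0$ described in the context, let $l$ be the minimal index in $\{1,\dots,k\}$ with $\bar z_l\ne0$, let $P$ be a closed complement of the line $\{\bar z_l\}$ spanned by $\bar z_l$ in $N_{k+1}$, i.e. $N_{k+1}=P\oplus\{\bar z_l\}$, and set $$z_{red}(\varepsilon,p):=z(\varepsilon,0,\dots,0,p),\ p\in P,\qquad z_0(\varepsilon):=\tfrac1{l!}\varepsilon^l\bar z_l+\cdots+\tfrac1{k!}\varepsilon^k\bar z_k+\Big[\tfrac1{(2k+1)!}\varepsilon^{2k+1}\ \cdots\ \tfrac1{(k+1)!}\varepsilon^{k+1}\Big]\cdot\hat I_{k+1}.$$ Let $c>0$ be arbitrarily large but fixed, and consider $p\in P$ with $|p|<c$ and $\varepsilon\in\mathbb K$ with $|\varepsilon|$ sufficiently small. Then: (i) The map $z_{red}(\varepsilon,p)$ defines a regular Banach manifold in $B$ for $\varepsilon\ne0$ (i.e. the derivative $z_{red}'(\varepsilon,p)\in L[\mathbb K\times P,B]$ has trivial null space for $\varepsilon\neq 0$). (ii) There exists an open neighborhood $W_0\subset B$ of the curve $z_0(\varepsilon)$, $\varepsilon\ne0$, such that all solutions of $G[z]=0$ in $W_0$ are given by $z_{red}(\varepsilon,p)$. (iii) The solutions $z(\varepsilon,n_1,\dots,n_k,\alpha\bar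 z_l+p)$, $\alpha\in\mathbb K$, $p\in P$, are contained in the manifold $z_{red}(\varepsilon,p)$ for $n_1,\dots,n_k$ and $\alpha$ sufficiently small (uniformly in $\varepsilon$).
   Context: $\mathbb K\in\{\mathbb R,\mathbb C\}$; $B,\bar B$ are Banach spaces over $\mathbb K$; $G:B\to\bar B$ is analytic near $0$ with $G[0]=0$. $L[\cdot,\cdot]$ denotes bounded linear operators. System of undetermined coefficients: $T^i[z_1,\dots,z_i]:=\frac{d^i}{d\varepsilon^i}\big|_{\varepsilon=0}G\big[\sum_{j=1}^{i}\frac1{j!}\varepsilon^jz_j\big]$. $X_n\subset B^n$ is the set of $[z_1,\dots,z_n]$ with $T^1[z_1]=0,\dots,T^n[z_1,\dots,z_n]=0$. $\pi_l$ denotes truncation to the first $l$ components. For a fixed $[\bar z_1,\dots,\bar z_k]\in\pi_k(X_{2k})$ and $n\ge k$, $\bar X_n:=\{[z_1,\dots,z_n]\in X_n: z_1=\bar z_1,\dots,z_k=\bar z_k\}$. Operators and decompositions: define $A_0,\dots,A_k\in L[B,\bar B]$ as the coefficients of $\varepsilon^0,\dots,\varepsilon^k$ in the expansion $G'\big[\sum_{j=1}^k\frac1{j!}\varepsilon^j\bar z_j\big]=\sum_{i\ge0}\varepsilon^iA_i$ (so $A_0=G'[0]$). Put $N_0:=B$, $R_0^c:=\bar B$, $S_1:=A_0$. Recursively for $i=1,\dots,k+1$, $N_i\subset N_{i-1}$ is the kernel and $R_i\subset R_{i-1}^c$ the range of $S_i\in L[N_{i-1},R_{i-1}^c]$; it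 is a standing assumption that there are direct sums of closed subspaces $N_{i-1}=N_i^c\oplus N_i$ and $R_{i-1}^c=R_i\oplus R_i^c$, with $S_i:N_i^c\to R_i$ a continuous bijection (complements fixed once and for all). For $1\le i\le k$ the next operator $S_{i+1}\in L[N_i,R_i^c]$ is defined as follows: for $v_0\in N_i$ there exist $v_1,\dots,v_{i-1}\in B$ with $\sum_{j=0}^{s}A_jv_{s-j}=0$ for $s=0,\dots,i-1$, and $S_{i+1}v_0:=\tfrac{(2i)!}{i!}P_{R_i^c}\sum_{j=1}^{i}A_jv_{i-j}$, where $P_{R_i^c}$ is the projection onto $R_i^c$ along $R_1\oplus\cdots\oplus R_i$; this does not depend on the choice of $v_1,\dots,v_{i-1}$. The sum operator is $[S_1\cdots S_{k+1}](n_0,\dots,n_k)=S_1n_0+\cdots+S_{k+1}n_k$. If it is surjective, some $\bar z_j$ with $1\le j\le k$ is nonzero, and the first nonzero one, $\bar z_l$, lies in $N_{k+1}$. The family $z(\varepsilon,\bar n)$, $\bar n=(n_1,\dots,n_{k+1})\in N_1\times\cdots\times N_{k+1}$ bounded, $|\varepsilon|$ sufficiently small: if the sum operator is surjective, there is a smooth family of solution curves $G[z(\varepsilon,\bar n)]=0$ of the form $z(\varepsilon,\bar n)=\sum_{j=1}^k\frac1{j!}\varepsilon^j\bar z_j+\sum_{j=k+1}^{2k+1}\frac1{j!}\varepsilon^jz_j(\varepsilon,\bar n)$ with $$(z_{2k+1},\dots,z_{k+1})^T(\varepsilon,\bar n)=\hat I_{k+1}+\hat M_{k+1}\big[(n_1^c,\dots,n_{k+1}^c)^T(\varepsilon,\bar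 n)+\hat L_{k+1}(n_1,\dots,n_{k+1})^T\big].$$ Here $\hat I_{k+1}\in B^{k+1}$ is a constant vector (whose components, in the order $z_{2k+1},\dots,z_{k+1}$, complete $\bar z_1,\dots,\bar z_k$ to an element of $\bar X_{2k+1}$); $\hat M_{k+1},\hat L_{k+1}\in GL[B^{k+1},B^{k+1}]$ are constant upper triangular operator matrices with identities on the diagonal, such that $\hat I_{k+1}+\hat M_{k+1}(N_0\times\cdots\times N_k)$ is the set of all $(z_{2k+1},\dots,z_{k+1})$ with $[\bar z_1,\dots,\bar z_k,z_{k+1},\dots,z_{2k}]\in\bar X_{2k}$, $\hat L_{k+1}$ maps $N_1\times\cdots\times N_{k+1}$ into $N_0\times\cdots\times N_k$, and $\hat I_{k+1}+\hat M_{k+1}\hat L_{k+1}(N_1\times\cdots\times N_{k+1})$ is the set of all $(z_{2k+1},\dots,z_{k+1})$ with $[\bar z_1,\dots,\bar z_k,z_{k+1},\dots,z_{2k+1}]\in\bar X_{2k+1}$; the functions $n_i^c(\varepsilon,\bar n)\in N_i^c$ are smooth with $n_i^c(0,\bar n)=0$ and are the locally unique solutions, by the implicit function theorem, of $\varepsilon^{-(2k+1)}G[z]=0$ (extended analytically to $\varepsilon=0$) with $z=\sum_{j=1}^k\frac1{j!}\varepsilon^j\bar z_j+\sum_{j=k+1}^{2k+1}\frac1{j!}\varepsilon^jz_j$, where $(z_{2k+1},\dots,z_{k+1})^T=\hat I_{k+1}+\hat M_{k+1}\big[(n_1^c,\dots,n_{k+1}^c)^T+\hat L_{k+1}(n_1,\dots,n_{k+1})^T\big]$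 and $n_i^c\in N_i^c$, $n_i\in N_i$ for $i=1,\dots,k+1$. *)

theory Defs
  imports "HOL-Analysis.Analysis"
begin

text \<open>
  The ground field is a type \<open>'k :: {real_normed_field, banach}\<close>. By the Gelfand--Mazur
  theorem the only such fields, up to isometric isomorphism, are the reals and the complex
  numbers. A Banach space over \<open>'k\<close> is a (real) Banach space type together with a scalar
  multiplication by \<open>'k\<close> that extends the real one and makes the norm homogeneous.
\<close>

definition kbanach :: "('k::{real_normed_field,banach} \<Rightarrow> 'b::banach \<Rightarrow> 'b) \<Rightarrow> bool" where
  "kbanach s \<longleftrightarrow> vector_space s \<and> (\<forall>r x. s (of_real r) x = r *\<^sub>R x) \<and>
     (\<forall>a x. norm (s a x) = norm a * norm x)"

lemma kbanach_real: "kbanach ((*\<^sub>R) :: real \<Rightarrow> 'b::banach \<Rightarrow> 'b)"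
  unfolding kbanach_def by (simp add: real_vector.vector_space_axioms)

lemma kbanach_complex: "kbanach ((*) :: complex \<Rightarrow> complex \<Rightarrow> complex)"
  unfolding kbanach_def
  by (auto simp: norm_mult scaleR_conv_of_real vector_space_def algebra_simps)

definition klinear_on ::
  "('k \<Rightarrow> 'x::real_normed_vector \<Rightarrow> 'x) \<Rightarrow> ('k \<Rightarrow> 'y::real_normed_vector \<Rightarrow> 'y) \<Rightarrow> 'x set \<Rightarrow> ('x \<Rightarrow> 'y) \<Rightarrow> bool"
  where
  "klinear_on sX sY E f \<longleftrightarrow>
     (\<forall>x\<in>E. \<forall>y\<in>E. f (x + y) = f x + f y) \<and> (\<forall>a. \<forall>x\<in>E. f (sX a x) = sY a (f x)) \<and>
     (\<exists>C. \<forall>x\<in>E. norm (f x) \<le> C * norm x)"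

definition closed_direct_sum ::
  "('k::field \<Rightarrow> 'x::real_normed_vector \<Rightarrow> 'x) \<Rightarrow> 'x set \<Rightarrow> 'x set \<Rightarrow> 'x set \<Rightarrow> bool" where
  "closed_direct_sum s V X Y \<longleftrightarrow>
     module.subspace s X \<and> closed X \<and> module.subspace s Y \<and> closed Y \<and>
     X \<inter> Y = {0} \<and> V = {x + y | x y. x \<in> X \<and> y \<in> Y}"

text \<open>
  An \<open>n\<close>-linear map on \<open>E\<close> with norm bound \<open>C\<close>; its \<open>n\<close> arguments are
  \<open>v 0, \<dots>, v (n - 1)\<close>.
\<close>

definition kmultilinear_on ::
  "('k \<Rightarrow> 'x::real_normed_vector \<Rightarrow> 'x) \<Rightarrow> ('k \<Rightarrow> 'y::real_normed_vector \<Rightarrow> 'y) \<Rightarrow> 'x set \<Rightarrow>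
   nat \<Rightarrow> ((nat \<Rightarrow> 'x) \<Rightarrow> 'y) \<Rightarrow> real \<Rightarrow> bool" where
  "kmultilinear_on sX sY E n f C \<longleftrightarrow>
     (\<forall>v w. (\<forall>i<n. v i = w i) \<longrightarrow> f v = f w) \<and>
     (\<forall>v i x y a. (\<forall>j<n. v j \<in> E) \<and> i < n \<and> x \<in> E \<and> y \<in> E \<longrightarrow>
        f (v(i := sX a x + y)) = sY a (f (v(i := x))) + f (v(i := y))) \<and>
     (\<forall>v. (\<forall>j<n. v j \<in> E) \<longrightarrow> norm (f v) \<le> C * (\<Prod>j<n. norm (v j)))"

definition kanalytic_at ::
  "('k \<Rightarrow> 'b::real_normed_vector \<Rightarrow> 'b) \<Rightarrow> ('k \<Rightarrow> 'c::real_normed_vector \<Rightarrow> 'c) \<Rightarrow> ('b \<Rightarrow> 'c) \<Rightarrow> 'b \<Rightarrow> bool"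
  where
  "kanalytic_at sB sC G x \<longleftrightarrow>
     (\<exists>r>0. \<exists>a C. (\<forall>n. kmultilinear_on sB sC UNIV n (a n) (C n)) \<and> summable (\<lambda>n. C n * r ^ n) \<and>
        (\<forall>h. norm h < r \<longrightarrow> (\<lambda>n. a n (\<lambda>_. h)) sums G (x + h)))"

text \<open>
  Infinitely often Frechet differentiable over the scalars, for \<open>f\<close> on a relatively open subset
  \<open>U\<close> of a closed subspace \<open>E\<close>: \<open>D m x\<close> is the \<open>m\<close>-th derivative at \<open>x\<close>, a bounded
  \<open>m\<close>-linear map on \<open>E\<close>, and \<open>x \<mapsto> D m x\<close> is differentiable in operator norm with
  derivative \<open>D (Suc m)\<close>.
\<close>

definition ksmooth_on ::
  "('k \<Rightarrow> 'x::real_normed_vector \<Rightarrow> 'x) \<Rightarrow> ('k \<Rightarrow> 'y::real_normed_vector \<Rightarrow> 'y) \<Rightarrow> 'x set \<Rightarrow> 'x set \<Rightarrow>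
   ('x \<Rightarrow> 'y) \<Rightarrow> bool" where
  "ksmooth_on sX sY E U f \<longleftrightarrow>
     (\<exists>D. (\<forall>x\<in>U. \<forall>v. D 0 x v = f x) \<and>
        (\<forall>m. \<forall>x\<in>U. (\<exists>C. kmultilinear_on sX sY E m (D m x) C) \<and>
           (\<forall>e>0. \<exists>d>0. \<forall>y\<in>U. norm (y - x) < d \<longrightarrow>
              (\<forall>v. (\<forall>i<m. v i \<in> E) \<longrightarrow>
                 norm (D m y v - D m x v - D (Suc m) x (v(m := y - x)))
                   \<le> e * norm (y - x) * (\<Prod>i<m. norm (v i))))))"

definition has_kderivative_on ::
  "('k \<Rightarrow> 'x::real_normed_vector \<Rightarrow> 'x) \<Rightarrow> ('k \<Rightarrow> 'y::real_normed_vector \<Rightarrow> 'y) \<Rightarrow> 'x set \<Rightarrow> 'x set \<Rightarrow>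
   ('x \<Rightarrow> 'y) \<Rightarrow> 'x \<Rightarrow> ('x \<Rightarrow> 'y) \<Rightarrow> bool" where
  "has_kderivative_on sX sY E U f x D \<longleftrightarrow>
     klinear_on sX sY E D \<and>
     ((\<lambda>y. norm (f y - f x - D (y - x)) / norm (y - x)) \<longlongrightarrow> 0) (at x within U)"

definition scale_prod :: "('k::times \<Rightarrow> 'x \<Rightarrow> 'x) \<Rightarrow> 'k \<Rightarrow> 'k \<times> 'x \<Rightarrow> 'k \<times> 'x" where
  "scale_prod s a = (\<lambda>(e, x). (a * e, s a x))"

definition scale_seq ::
  "('k \<Rightarrow> 'b::real_normed_vector \<Rightarrow> 'b) \<Rightarrow> 'k \<Rightarrow> (nat \<Rightarrow>\<^sub>C 'b) \<Rightarrow> (nat \<Rightarrow>\<^sub>C 'b)" where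
  "scale_seq s a m = Bcontfun (\<lambda>i. s a (apply_bcontfun m i))"

text \<open>Derivative of a curve with respect to the scalar variable.\<close>

definition kderiv ::
  "('k::{real_normed_field,banach} \<Rightarrow> 'c::banach \<Rightarrow> 'c) \<Rightarrow> ('k \<Rightarrow> 'c) \<Rightarrow> 'k \<Rightarrow> 'c" where
  "kderiv s u t = Lim (at 0) (\<lambda>h. s (inverse h) (u (t + h) - u t))"

text \<open>
  Tuples \<open>[z\<^sub>1, \<dots>, z\<^sub>n]\<close> are functions on \<open>nat\<close> of which only the values at \<open>1, \<dots>, n\<close> matter.
\<close>

definition poly_curve ::
  "('k::{real_normed_field,banach} \<Rightarrow> 'b::banach \<Rightarrow> 'b) \<Rightarrow> nat \<Rightarrow> (nat \<Rightarrow> 'b) \<Rightarrow> 'k \<Rightarrow> 'b" where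
  "poly_curve s n z \<epsilon> = (\<Sum>j=1..n. s (\<epsilon> ^ j / fact j) (z j))"

definition T_sys ::
  "('k::{real_normed_field,banach} \<Rightarrow> 'b::banach \<Rightarrow> 'b) \<Rightarrow> ('k \<Rightarrow> 'c::banach \<Rightarrow> 'c) \<Rightarrow> ('b \<Rightarrow> 'c) \<Rightarrow>
   nat \<Rightarrow> (nat \<Rightarrow> 'b) \<Rightarrow> 'c" where
  "T_sys sB sC G i z = ((kderiv sC) ^^ i) (\<lambda>\<epsilon>. G (poly_curve sB i z \<epsilon>)) 0"

definition X_set ::
  "('k::{real_normed_field,banach} \<Rightarrow> 'b::banach \<Rightarrow> 'b) \<Rightarrow> ('k \<Rightarrow> 'c::banach \<Rightarrow> 'c) \<Rightarrow> ('b \<Rightarrow> 'c) \<Rightarrow>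
   nat \<Rightarrow> (nat \<Rightarrow> 'b) set" where
  "X_set sB sC G n = {z. \<forall>i\<in>{1..n}. T_sys sB sC G i z = 0}"

definition X_bar ::
  "('k::{real_normed_field,banach} \<Rightarrow> 'b::banach \<Rightarrow> 'b) \<Rightarrow> ('k \<Rightarrow> 'c::banach \<Rightarrow> 'c) \<Rightarrow> ('b \<Rightarrow> 'c) \<Rightarrow>
   nat \<Rightarrow> (nat \<Rightarrow> 'b) \<Rightarrow> nat \<Rightarrow> (nat \<Rightarrow> 'b) set" where
  "X_bar sB sC G k zbar n = {z \<in> X_set sB sC G n. \<forall>j\<in>{1..k}. z j = zbar j}"

text \<open>
  \<open>\<Sum>\<^sub>i \<epsilon>\<^sup>i A\<^sub>i\<close> is the expansion, convergent in operator norm, of \<open>G'\<close> along the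
  curve with coefficients \<open>zbar\<close>.
\<close>

definition deriv_expansion ::
  "('k::{real_normed_field,banach} \<Rightarrow> 'b::banach \<Rightarrow> 'b) \<Rightarrow> ('k \<Rightarrow> 'c::banach \<Rightarrow> 'c) \<Rightarrow> ('b \<Rightarrow> 'c) \<Rightarrow>
   nat \<Rightarrow> (nat \<Rightarrow> 'b) \<Rightarrow> (nat \<Rightarrow> 'b \<Rightarrow> 'c) \<Rightarrow> bool" where
  "deriv_expansion sB sC G k zbar A \<longleftrightarrow>
     (\<forall>i. klinear_on sB sC UNIV (A i)) \<and>
     (\<exists>r>0. \<exists>C. (\<forall>i v. norm (A i v) \<le> C i * norm v) \<and> summable (\<lambda>i. C i * r ^ i) \<and>
        (\<forall>\<epsilon> v. norm \<epsilon> < r \<longrightarrow>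
           (\<lambda>i. sC (\<epsilon> ^ i) (A i v)) sums frechet_derivative G (at (poly_curve sB k zbar \<epsilon>)) v))"

text \<open>Projection onto \<open>Rc i\<close> along \<open>R 1 \<oplus> \<dots> \<oplus> R i\<close>.\<close>

definition proj_Rc :: "(nat \<Rightarrow> 'c::real_normed_vector set) \<Rightarrow> (nat \<Rightarrow> 'c set) \<Rightarrow> nat \<Rightarrow> 'c \<Rightarrow> 'c" where
  "proj_Rc R Rc i y =
     (THE w. w \<in> Rc i \<and> (\<exists>r. (\<forall>j\<in>{1..i}. r j \<in> R j) \<and> y = w + (\<Sum>j=1..i. r j)))"

definition null_chain :: "(nat \<Rightarrow> 'b \<Rightarrow> 'c::real_normed_vector) \<Rightarrow> nat \<Rightarrow> 'b \<Rightarrow> (nat \<Rightarrow> 'b) \<Rightarrow> bool" where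
  "null_chain A i v0 v \<longleftrightarrow> v 0 = v0 \<and> (\<forall>s<i. (\<Sum>j=0..s. A j (v (s - j))) = 0)"

text \<open>
  The operators \<open>S 1, \<dots>, S (k+1)\<close> with the decompositions \<open>N (i-1) = Nc i \<oplus> N i\<close> and
  \<open>Rc (i-1) = R i \<oplus> Rc i\<close>.
\<close>

definition operator_chain ::
  "('k::{real_normed_field,banach} \<Rightarrow> 'b::banach \<Rightarrow> 'b) \<Rightarrow> ('k \<Rightarrow> 'c::banach \<Rightarrow> 'c) \<Rightarrow> (nat \<Rightarrow> 'b \<Rightarrow> 'c) \<Rightarrow>
   nat \<Rightarrow> (nat \<Rightarrow> 'b set) \<Rightarrow> (nat \<Rightarrow> 'b set) \<Rightarrow> (nat \<Rightarrow> 'c set) \<Rightarrow> (nat \<Rightarrow> 'c set) \<Rightarrow> (nat \<Rightarrow> 'b \<Rightarrow> 'c) \<Rightarrow> bool"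
  where
  "operator_chain sB sC A k N Nc R Rc S \<longleftrightarrow>
     N 0 = UNIV \<and> Rc 0 = UNIV \<and> (\<forall>v. S 1 v = A 0 v) \<and>
     (\<forall>i\<in>{1..k+1}.
        klinear_on sB sC (N (i-1)) (S i) \<and> S i ` N (i-1) \<subseteq> Rc (i-1) \<and>
        N i = {v \<in> N (i-1). S i v = 0} \<and> R i = S i ` N (i-1) \<and>
        closed_direct_sum sB (N (i-1)) (Nc i) (N i) \<and>
        closed_direct_sum sC (Rc (i-1)) (R i) (Rc i) \<and>
        bij_betw (S i) (Nc i) (R i)) \<and>
     (\<forall>i\<in>{1..k}. \<forall>v0\<in>N i.
        (\<exists>v. null_chain A i v0 v) \<and>
        (\<forall>v. null_chain A i v0 v \<longrightarrow>
           S (i+1) v0 =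
             sC (fact (2*i) / fact i) (proj_Rc R Rc i (\<Sum>j=1..i. A j (v (i - j))))))"

definition sum_operator_surj ::
  "nat \<Rightarrow> (nat \<Rightarrow> 'b set) \<Rightarrow> (nat \<Rightarrow> 'b \<Rightarrow> 'c::real_normed_vector) \<Rightarrow> bool" where
  "sum_operator_surj k N S \<longleftrightarrow>
     (\<forall>y. \<exists>n. (\<forall>i\<in>{0..k}. n i \<in> N i) \<and> y = (\<Sum>i=0..k. S (i+1) (n i)))"

text \<open>
  A vector \<open>(y 1, \<dots>, y (k+1))\<close> in \<open>B\<^sup>k\<^sup>+\<^sup>1\<close> lists the coefficients in the order
  \<open>z\<^sub>2\<^sub>k\<^sub>+\<^sub>1, \<dots>, z\<^sub>k\<^sub>+\<^sub>1\<close>: row \<open>i\<close> is the coefficient with index \<open>2k+2-i\<close>.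
\<close>

definition completion :: "nat \<Rightarrow> (nat \<Rightarrow> 'b) \<Rightarrow> (nat \<Rightarrow> 'b) \<Rightarrow> nat \<Rightarrow> 'b" where
  "completion k zbar y j = (if j \<le> k then zbar j else y (2*k+2-j))"

definition mat_app :: "nat \<Rightarrow> (nat \<Rightarrow> nat \<Rightarrow> 'b \<Rightarrow> 'b::real_normed_vector) \<Rightarrow> (nat \<Rightarrow> 'b) \<Rightarrow> nat \<Rightarrow> 'b" where
  "mat_app k M v i = (\<Sum>j=1..k+1. M i j (v j))"

definition unit_upper_matrix ::
  "('k \<Rightarrow> 'b::real_normed_vector \<Rightarrow> 'b) \<Rightarrow> nat \<Rightarrow> (nat \<Rightarrow> nat \<Rightarrow> 'b \<Rightarrow> 'b) \<Rightarrow> bool" where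
  "unit_upper_matrix s k M \<longleftrightarrow>
     (\<forall>i\<in>{1..k+1}. \<forall>j\<in>{1..k+1}. klinear_on s s UNIV (M i j) \<and>
        (j < i \<longrightarrow> (\<forall>x. M i j x = 0)) \<and> (j = i \<longrightarrow> (\<forall>x. M i j x = x)))"

definition param_space :: "nat \<Rightarrow> (nat \<Rightarrow> 'b::zero set) \<Rightarrow> (nat \<Rightarrow> 'b) set" where
  "param_space k N = {n. (\<forall>i\<in>{1..k+1}. n i \<in> N i) \<and> (\<forall>i. i \<notin> {1..k+1} \<longrightarrow> n i = 0)}"

definition solution_matrices ::
  "('k::{real_normed_field,banach} \<Rightarrow> 'b::banach \<Rightarrow> 'b) \<Rightarrow> ('k \<Rightarrow> 'c::banach \<Rightarrow> 'c) \<Rightarrow> ('b \<Rightarrow> 'c) \<Rightarrow>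
   nat \<Rightarrow> (nat \<Rightarrow> 'b) \<Rightarrow> (nat \<Rightarrow> 'b set) \<Rightarrow>
   (nat \<Rightarrow> 'b) \<Rightarrow> (nat \<Rightarrow> nat \<Rightarrow> 'b \<Rightarrow> 'b) \<Rightarrow> (nat \<Rightarrow> nat \<Rightarrow> 'b \<Rightarrow> 'b) \<Rightarrow> bool" where
  "solution_matrices sB sC G k zbar N I M L \<longleftrightarrow>
     unit_upper_matrix sB k M \<and> unit_upper_matrix sB k L \<and>
     completion k zbar I \<in> X_bar sB sC G k zbar (2*k+1) \<and>
     (\<forall>y. completion k zbar y \<in> X_bar sB sC G k zbar (2*k) \<longleftrightarrow>
        (\<exists>v. (\<forall>i\<in>{1..k+1}. v i \<in> N (i-1)) \<and> (\<forall>i\<in>{1..k+1}. y i = I i + mat_app k M v i))) \<and>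
     (\<forall>n. (\<forall>i\<in>{1..k+1}. n i \<in> N i) \<longrightarrow> (\<forall>i\<in>{1..k+1}. mat_app k L n i \<in> N (i-1))) \<and>
     (\<forall>y. completion k zbar y \<in> X_bar sB sC G k zbar (2*k+1) \<longleftrightarrow>
        (\<exists>n. (\<forall>i\<in>{1..k+1}. n i \<in> N i) \<and>
             (\<forall>i\<in>{1..k+1}. y i = I i + mat_app k M (mat_app k L n) i)))"

text \<open>The curve with coefficients \<open>I + M (w + L n)\<close>, and the equation for \<open>w\<close>.\<close>

definition ansatz ::
  "('k::{real_normed_field,banach} \<Rightarrow> 'b::banach \<Rightarrow> 'b) \<Rightarrow> nat \<Rightarrow> (nat \<Rightarrow> 'b) \<Rightarrow>
   (nat \<Rightarrow> 'b) \<Rightarrow> (nat \<Rightarrow> nat \<Rightarrow> 'b \<Rightarrow> 'b) \<Rightarrow> (nat \<Rightarrow> nat \<Rightarrow> 'b \<Rightarrow> 'b) \<Rightarrow>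
   'k \<Rightarrow> (nat \<Rightarrow> 'b) \<Rightarrow> (nat \<Rightarrow> 'b) \<Rightarrow> 'b" where
  "ansatz sB k zbar I M L \<epsilon> w n =
     poly_curve sB (2*k+1)
       (completion k zbar (\<lambda>i. I i + mat_app k M (\<lambda>j. w j + mat_app k L n j) i)) \<epsilon>"

definition scaled_eq ::
  "('k::{real_normed_field,banach} \<Rightarrow> 'b::banach \<Rightarrow> 'b) \<Rightarrow> ('k \<Rightarrow> 'c::banach \<Rightarrow> 'c) \<Rightarrow> ('b \<Rightarrow> 'c) \<Rightarrow>
   nat \<Rightarrow> (nat \<Rightarrow> 'b) \<Rightarrow> (nat \<Rightarrow> 'b) \<Rightarrow> (nat \<Rightarrow> nat \<Rightarrow> 'b \<Rightarrow> 'b) \<Rightarrow> (nat \<Rightarrow> nat \<Rightarrow> 'b \<Rightarrow> 'b) \<Rightarrow>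
   'k \<Rightarrow> (nat \<Rightarrow> 'b) \<Rightarrow> (nat \<Rightarrow> 'b) \<Rightarrow> 'c" where
  "scaled_eq sB sC G k zbar I M L \<epsilon> w n =
     (let F = (\<lambda>e. sC (inverse (e ^ (2*k+1))) (G (ansatz sB k zbar I M L e w n)))
      in if \<epsilon> = 0 then Lim (at 0) F else F \<epsilon>)"

text \<open>
  \<open>nc\<close> is the family of locally unique solutions \<open>w\<close> of the scaled equation. For the
  differentiability in \<open>(\<epsilon>, n)\<close> the parameter tuples, which vanish outside \<open>1, \<dots>, k+1\<close>,
  are regarded as elements of the Banach space of bounded sequences \<open>nat \<Rightarrow>\<^sub>C 'b\<close>
  (\<open>nat\<close> is discrete), i.e. they carry the maximum norm.
\<close>

definition solution_family ::
  "('k::{real_normed_field,banach} \<Rightarrow> 'b::banach \<Rightarrow> 'b) \<Rightarrow> ('k \<Rightarrow> 'c::banach \<Rightarrow> 'c) \<Rightarrow> ('b \<Rightarrow> 'c) \<Rightarrow>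
   nat \<Rightarrow> (nat \<Rightarrow> 'b) \<Rightarrow> (nat \<Rightarrow> 'b set) \<Rightarrow> (nat \<Rightarrow> 'b set) \<Rightarrow>
   (nat \<Rightarrow> 'b) \<Rightarrow> (nat \<Rightarrow> nat \<Rightarrow> 'b \<Rightarrow> 'b) \<Rightarrow> (nat \<Rightarrow> nat \<Rightarrow> 'b \<Rightarrow> 'b) \<Rightarrow>
   ('k \<Rightarrow> (nat \<Rightarrow> 'b) \<Rightarrow> nat \<Rightarrow> 'b) \<Rightarrow> bool" where
  "solution_family sB sC G k zbar N Nc I M L nc \<longleftrightarrow>
     (\<forall>b>0. \<exists>\<epsilon>0>0. \<exists>\<delta>>0.
        (\<forall>n\<in>param_space k N. (\<forall>i\<in>{1..k+1}. norm (n i) < b) \<longrightarrow>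
           (\<forall>i\<in>{1..k+1}. nc 0 n i = 0) \<and>
           (\<forall>\<epsilon>. norm \<epsilon> < \<epsilon>0 \<longrightarrow>
              (\<forall>i\<in>{1..k+1}. nc \<epsilon> n i \<in> Nc i \<and> norm (nc \<epsilon> n i) < \<delta>) \<and>
              (\<forall>w. (\<forall>i\<in>{1..k+1}. w i \<in> Nc i \<and> norm (w i) < \<delta>) \<longrightarrow>
                 (scaled_eq sB sC G k zbar I M L \<epsilon> w n = 0 \<longleftrightarrow>
                    (\<forall>i\<in>{1..k+1}. w i = nc \<epsilon> n i))))) \<and>
        (\<forall>i\<in>{1..k+1}.
           ksmooth_on (scale_prod (scale_seq sB)) sB
             (UNIV \<times> {m. apply_bcontfun m \<in> param_space k N})
             {(\<epsilon>, m). norm \<epsilon> < \<epsilon>0 \<and> apply_bcontfun m \<in> param_space k N \<and> norm m < b}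
             (\<lambda>(\<epsilon>, m). nc \<epsilon> (apply_bcontfun m) i)))"

definition z_fam ::
  "('k::{real_normed_field,banach} \<Rightarrow> 'b::banach \<Rightarrow> 'b) \<Rightarrow> nat \<Rightarrow> (nat \<Rightarrow> 'b) \<Rightarrow>
   (nat \<Rightarrow> 'b) \<Rightarrow> (nat \<Rightarrow> nat \<Rightarrow> 'b \<Rightarrow> 'b) \<Rightarrow> (nat \<Rightarrow> nat \<Rightarrow> 'b \<Rightarrow> 'b) \<Rightarrow>
   ('k \<Rightarrow> (nat \<Rightarrow> 'b) \<Rightarrow> nat \<Rightarrow> 'b) \<Rightarrow> 'k \<Rightarrow> (nat \<Rightarrow> 'b) \<Rightarrow> 'b" where
  "z_fam sB k zbar I M L nc \<epsilon> n = ansatz sB k zbar I M L \<epsilon> (nc \<epsilon> n) n"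

definition z_red ::
  "('k::{real_normed_field,banach} \<Rightarrow> 'b::banach \<Rightarrow> 'b) \<Rightarrow> nat \<Rightarrow> (nat \<Rightarrow> 'b) \<Rightarrow>
   (nat \<Rightarrow> 'b) \<Rightarrow> (nat \<Rightarrow> nat \<Rightarrow> 'b \<Rightarrow> 'b) \<Rightarrow> (nat \<Rightarrow> nat \<Rightarrow> 'b \<Rightarrow> 'b) \<Rightarrow>
   ('k \<Rightarrow> (nat \<Rightarrow> 'b) \<Rightarrow> nat \<Rightarrow> 'b) \<Rightarrow> 'k \<Rightarrow> 'b \<Rightarrow> 'b" where
  "z_red sB k zbar I M L nc \<epsilon> p = z_fam sB k zbar I M L nc \<epsilon> ((\<lambda>_. 0)(k+1 := p))"

definition z_zero ::
  "('k::{real_normed_field,banach} \<Rightarrow> 'b::banach \<Rightarrow> 'b) \<Rightarrow> nat \<Rightarrow> nat \<Rightarrow> (nat \<Rightarrow> 'b) \<Rightarrow>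
   (nat \<Rightarrow> 'b) \<Rightarrow> 'k \<Rightarrow> 'b" where
  "z_zero sB l k zbar I \<epsilon> =
     (\<Sum>j=l..k. sB (\<epsilon> ^ j / fact j) (zbar j)) +
     (\<Sum>i=1..k+1. sB (\<epsilon> ^ (2*k+2-i) / fact (2*k+2-i)) (I i))"

end

theory Submission
  imports Defs
begin

text \<open>Near the approximate solution, a curve whose coefficients solve the first \<open>2k\<close> equations can be
  written as the approximate solution plus \<open>E \<epsilon> y\<close>, where \<open>E \<epsilon>\<close> is, for \<open>\<epsilon> \<noteq> 0\<close>, a linear
  isomorphism of \<open>B\<close> and \<open>y\<close> has coordinates in the splitting of \<open>B\<close> into the complements
  \<open>Nc 1, \<dots>, Nc (k+1)\<close>, the space \<open>P\<close> and the line through \<open>zbar l\<close>: parameters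
  \<open>n\<^sub>1, \<dots>, n\<^sub>k\<close> are only higher order corrections of \<open>y\<close>, since the system is invariant under division
  of a perturbation by \<open>\<epsilon>\<close>. The coordinate along \<open>zbar l\<close> is redundant as well: it is produced by the
  reparametrisation \<open>\<epsilon> (1 + \<epsilon>\<^sup>q \<sigma>)\<close> with \<open>q = k + 1 - l\<close>. Replacing it by \<open>\<sigma>\<close>
  turns the coordinates into a map \<open>F \<epsilon>\<close> that is uniformly Lipschitz close to the identity, hence a chart:
  its image is open, the curves \<open>z_red\<close> are an immersed graph in it, and by the uniqueness in the
  implicit function theorem every solution in it lies on this graph.\<close>

text \<open>The obstacle is that \<open>E \<epsilon>\<close> degenerates as \<epsilon> tends to 0:
  it scales the coordinates by powers between \<open>\<epsilon>^(k+1)\<close> and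
  \<open>\<epsilon>^(2k+1)\<close>, so an inverse function theorem applied directly in
  \<open>B\<close> would not be uniform in \<epsilon>. All uniform estimates are therefore made for
  \<open>F \<epsilon>\<close>, on the coordinate side, and \<open>E \<epsilon>\<close> is inverted
  only for one fixed \<epsilon> at a time. The exponent \<open>q\<close> is forced:
  \<open>zbar l\<close> is the first nonzero coefficient, and
  \<open>(\<epsilon> (1 + \<epsilon>^q \<sigma>))^l\<close> first differs from
  \<open>\<epsilon>^l\<close> by \<open>l \<sigma> \<epsilon>^(k+1)\<close>, which is the lowest
  order at which the coefficients are free. Closeness of \<open>F \<epsilon>\<close> to the identity
  is delicate because \<open>p\<close> is bounded but not small. It rests on an exactness: curves
  with parameter \<open>p\<close> alone solve the first \<open>2k+1\<close> equations, a
  reparametrisation preserves this, and so they yield precisely \<open>p + s zbar l\<close>. The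
  remaining errors carry a factor \<epsilon> or a product of two small coordinates. The trivial
  kernel of the derivative is deduced from a local lower Lipschitz bound of
  \<open>z_red\<close>.\<close>

locale kspace =
  fixes s :: "'k::{real_normed_field,banach} \<Rightarrow> 'b::banach \<Rightarrow> 'b"
  assumes kb: "kbanach s"
begin

sublocale vector_space s
  using kb by (simp add: kbanach_def)

lemma norm_s [simp]: "norm (s a x) = norm a * norm x"
  using kb by (simp add: kbanach_def)

lemma s_of_real [simp]: "s (of_real r) x = r *\<^sub>R x"
  using kb by (simp add: kbanach_def)

lemma s_scaleR_right: "s a (r *\<^sub>R x) = r *\<^sub>R s a x"
  by (metis s_of_real scale_left_commute)

lemma s_scaleR_left: "s (r *\<^sub>R a) x = r *\<^sub>R s a x"
  by (metis s_of_real scale_scale scaleR_conv_of_real)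

sublocale bb: bounded_bilinear s
  by (rule bounded_bilinear.intro)
     (auto simp: scale_left_distrib scale_right_distrib s_scaleR_right s_scaleR_left
       intro!: exI[of _ 1])

lemma bounded_linear_s: "bounded_linear (s a)"
  by (rule bb.bounded_linear_right)

lemma s_inverse_cancel [simp]: "a \<noteq> 0 \<Longrightarrow> s (inverse a) (s a x) = x"
  by simp

end

text \<open>With the field as a Banach space over itself, the results on analytic maps also apply to
  power series in one scalar variable.\<close>

lemma kspace_mult: "kspace ((*) :: 'k::{real_normed_field,banach} \<Rightarrow> 'k \<Rightarrow> 'k)"
  unfolding kspace_def kbanach_def
  by (auto simp: norm_mult scaleR_conv_of_real vector_space_def algebra_simps)

section \<open>Multilinear maps: expansion and Taylor estimates\<close>

context
  fixes sX :: "'k::{real_normed_field,banach} \<Rightarrow> 'x::banach \<Rightarrow> 'x"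
    and sY :: "'k \<Rightarrow> 'y::banach \<Rightarrow> 'y"
    and f :: "(nat \<Rightarrow> 'x) \<Rightarrow> 'y" and n :: nat and C :: real
  assumes kX: "kspace sX" and kY: "kspace sY"
    and ml: "kmultilinear_on sX sY UNIV n f C"
begin

interpretation X: kspace sX by (rule kX)
interpretation Y: kspace sY by (rule kY)

lemma kmultilinear_cong: "(\<And>i. i < n \<Longrightarrow> v i = w i) \<Longrightarrow> f v = f w"
  using ml by (auto simp: kmultilinear_on_def)

lemma kmultilinear_upd_scale_add:
  "i < n \<Longrightarrow> f (v(i := sX a x + y)) = sY a (f (v(i := x))) + f (v(i := y))"
  using ml by (auto simp: kmultilinear_on_def)

lemma kmultilinear_bound: "norm (f v) \<le> C * (\<Prod>j<n. norm (v j))"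
  using ml by (auto simp: kmultilinear_on_def)

lemma kmultilinear_upd_add:
  "i < n \<Longrightarrow> f (v(i := x + y)) = f (v(i := x)) + f (v(i := y))"
  using kmultilinear_upd_scale_add[of i v 1 x y] by simp

lemma kmultilinear_upd_0: "i < n \<Longrightarrow> f (v(i := 0)) = 0"
  using kmultilinear_upd_add[of i v 0 0] by simp

lemma kmultilinear_upd_scale: "i < n \<Longrightarrow> f (v(i := sX a x)) = sY a (f (v(i := x)))"
  using kmultilinear_upd_scale_add[of i v a x 0] kmultilinear_upd_0[of i v] by simp

lemma kmultilinear_upd_sum:
  assumes "i < n" "finite J"
  shows "f (v(i := (\<Sum>j\<in>J. sX (e j) (x j)))) = (\<Sum>j\<in>J. sY (e j) (f (v(i := x j))))"
  using assms(2)
proof (induction J rule: finite_induct)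
  case empty
  show ?case unfolding sum.empty by (rule kmultilinear_upd_0[OF assms(1)])
next
  case (insert a J)
  show ?case
    unfolding sum.insert[OF insert.hyps] kmultilinear_upd_scale_add[OF assms(1)] insert.IH ..
qed

text \<open>The hybrid tuples that agree with \<open>v\<close> before position \<open>i\<close> and
  with \<open>w\<close> from there on change in one argument at a time.\<close>

lemma kmultilinear_diff_telescope:
  "f v - f w = (\<Sum>i<n. f (\<lambda>j. if j < i then v j else if j = i then v i - w i else w j))"
proof -
  define h where "h i = (\<lambda>j. if j < i then v j else w j)" for i
  have step: "f (\<lambda>j. if j < i then v j else if j = i then v i - w i else w j) = f (h (Suc i)) - f (h i)"
    if "i < n" for i
  proof -
    have "h (Suc i) = (h i)(i := (v i - w i) + w i)" "h i = (h i)(i := w i)"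
      by (auto simp: h_def fun_eq_iff)
    moreover have "(\<lambda>j. if j < i then v j else if j = i then v i - w i else w j) = (h i)(i := v i - w i)"
      by (auto simp: h_def fun_eq_iff)
    ultimately show ?thesis
      using kmultilinear_upd_add[OF that, of "h i" "v i - w i" "w i"] by (metis add_diff_cancel_right')
  qed
  have "f v = f (h n)" by (rule kmultilinear_cong) (simp add: h_def)
  moreover have "w = h 0" by (simp add: h_def)
  ultimately have "f v - f w = (\<Sum>i<n. f (h (Suc i)) - f (h i))"
    using sum_lessThan_telescope[of "\<lambda>i. f (h i)" n] by (metis (no_types, lifting))
  then show ?thesis by (simp add: step)
qed

text \<open>A tuple that contains the increment \<open>h\<close> at two places is the source of the
  factor \<open>(norm h)^2\<close> in the Taylor remainder.\<close>

lemma kmultilinear_two_bound: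
  assumes "m < n" "i < n" "m \<noteq> i" "\<And>j. norm (v j) \<le> R" "v m = h" "v i = h" "C \<ge> 0"
  shows "norm (f v) \<le> C * (R ^ (n - 2) * (norm h)\<^sup>2)"
proof -
  have "(\<Prod>j<n. norm (v j)) = norm (v m) * (norm (v i) * (\<Prod>j\<in>{..<n}-{m}-{i}. norm (v j)))"
    using assms by (simp add: prod.remove[of "{..<n}" m] prod.remove[of "{..<n}-{m}" i])
  moreover have "(\<Prod>j\<in>{..<n}-{m}-{i}. norm (v j)) \<le> (\<Prod>j\<in>{..<n}-{m}-{i}. R)"
    by (rule prod_mono) (use assms in auto)
  moreover have "card ({..<n}-{m}-{i}) = n - 2" using assms by (simp add: card_Diff_singleton_if)
  ultimately have "(\<Prod>j<n. norm (v j)) \<le> R ^ (n - 2) * (norm h)\<^sup>2"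
    using assms by (simp add: power2_eq_square mult.assoc mult_left_mono
        mult.commute[of "R ^ (n - 2)"])
  with kmultilinear_bound[of v] assms(7) show ?thesis
    by (meson mult_left_mono order_trans)
qed

lemma kmultilinear_one_bound:
  assumes "i < n" "norm x \<le> R" "C \<ge> 0"
  shows "norm (f (\<lambda>j. if j = i then h else x)) \<le> C * (R ^ (n - 1) * norm h)"
proof -
  let ?v = "\<lambda>j. if j = i then h else x"
  have "(\<Prod>j<n. norm (?v j)) = norm h * (\<Prod>j\<in>{..<n}-{i}. norm x)"
    using assms by (simp add: prod.remove[of "{..<n}" i])
  also have "\<dots> = norm h * norm x ^ (n - 1)" using assms by (simp add: card_Diff_singleton_if)
  also have "\<dots> \<le> norm h * R ^ (n - 1)"
    using assms by (intro mult_left_mono power_mono) auto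
  finally have "(\<Prod>j<n. norm (?v j)) \<le> R ^ (n - 1) * norm h" by (simp only: mult.commute)
  then show ?thesis by (rule order_trans[OF kmultilinear_bound mult_left_mono[OF _ assms(3)]])
qed

text \<open>Two telescoping steps: the first writes the increment as a sum over the position
  \<open>i\<close> that holds \<open>h\<close>; the second compares each summand with the one whose
  other arguments are all \<open>x\<close>. Nonzero terms of the second step carry \<open>h\<close>
  at two positions \<open>m < i\<close>, and there are at most \<open>n^2\<close> of them.\<close>

lemma homogeneous_taylor_bound:
  assumes "norm x \<le> R" "norm (x + h) \<le> R" "norm h \<le> R" "C \<ge> 0"
  shows "norm (f (\<lambda>_. x + h) - f (\<lambda>_. x) - (\<Sum>i<n. f (\<lambda>j. if j = i then h else x)))
    \<le> C * (real n ^ 2 * R ^ (n - 2)) * (norm h)\<^sup>2"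
proof -
  have R0: "R \<ge> 0" using assms(1) norm_ge_zero order_trans by blast
  define a where "a i = (\<lambda>j::nat. if j < i then x + h else if j = i then h else x)" for i
  define b where "b i = (\<lambda>j::nat. if j = i then h else x)" for i
  have eq: "f (\<lambda>_. x + h) - f (\<lambda>_. x) = (\<Sum>i<n. f (a i))"
    unfolding a_def by (subst kmultilinear_diff_telescope) (auto intro!: sum.cong arg_cong[of _ _ f])
  have ab: "norm (f (a i) - f (b i)) \<le> real n * (C * (R ^ (n - 2) * (norm h)\<^sup>2))" if i: "i < n" for i
  proof -
    have "f (a i) - f (b i) = (\<Sum>m<n. f (\<lambda>j. if j < m then a i j else if j = m then a i m - b i m else b i j))"
      by (rule kmultilinear_diff_telescope)
    moreover have "norm (f (\<lambda>j. if j < m then a i j else if j = m then a i m - b i m else b i j))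
        \<le> C * (R ^ (n - 2) * (norm h)\<^sup>2)" if m: "m < n" for m
    proof (cases "m < i")
      case True
      show ?thesis
        by (rule kmultilinear_two_bound[of m i]) (use True m i assms in \<open>auto simp: a_def b_def\<close>)
    next
      case False
      then have "a i m - b i m = 0" by (auto simp: a_def b_def)
      then have "(\<lambda>j. if j < m then a i j else if j = m then a i m - b i m else b i j)
        = (\<lambda>j. if j < m then a i j else b i j)(m := 0)"
        by (auto simp: fun_eq_iff)
      then have "f (\<lambda>j. if j < m then a i j else if j = m then a i m - b i m else b i j) = 0"
        using kmultilinear_upd_0[OF m] by simp
      then show ?thesis using assms R0 by simp
    qed
    ultimately show ?thesis
      using sum_norm_le[of "{..<n}" "\<lambda>m. f (\<lambda>j. if j < m then a i j else if j = m then a i m - b i m else b i j)"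
          "\<lambda>_. C * (R ^ (n - 2) * (norm h)\<^sup>2)"] by simp
  qed
  have "f (\<lambda>_. x + h) - f (\<lambda>_. x) - (\<Sum>i<n. f (\<lambda>j. if j = i then h else x)) = (\<Sum>i<n. f (a i) - f (b i))"
    by (simp add: eq b_def sum_subtractf)
  also have "norm \<dots> \<le> (\<Sum>i<n. real n * (C * (R ^ (n - 2) * (norm h)\<^sup>2)))"
    by (rule sum_norm_le) (use ab in auto)
  finally show ?thesis by (simp add: power2_eq_square algebra_simps)
qed

text \<open>The arguments are expanded from left to right; after \<open>i\<close> of them the terms
  are indexed by the words of length \<open>i\<close> over \<open>J\<close>, and
  \<open>g i xs\<close> still holds the full sum in the positions from \<open>i\<close> on.\<close>

lemma kmultilinear_expand:
  assumes "finite J"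
  shows "f (\<lambda>_. \<Sum>j\<in>J. sX (e j) (x j)) =
    (\<Sum>xs\<in>{xs. set xs \<subseteq> J \<and> length xs = n}. sY (prod_list (map e xs)) (f (\<lambda>t. x (xs ! t))))"
proof -
  define P where "P = (\<Sum>j\<in>J. sX (e j) (x j))"
  define L where "L i = {xs. set xs \<subseteq> J \<and> length xs = i}" for i
  define g where "g i xs = (\<lambda>t. if t < i then x (xs ! t) else P)" for i xs
  have "f (\<lambda>_. P) = (\<Sum>xs\<in>L i. sY (prod_list (map e xs)) (f (g i xs)))" if "i \<le> n" for i
    using that
  proof (induction i)
    case 0
    have "L 0 = {[]}" by (auto simp: L_def)
    moreover have "g 0 [] = (\<lambda>_. P)" by (simp add: g_def)
    ultimately show ?case by simp
  next
    case (Suc i)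
    then have i: "i < n" by simp
    have LS: "L (Suc i) = (\<lambda>(xs, y). xs @ [y]) ` (L i \<times> J)"
    proof (intro equalityI subsetI)
      fix zs assume zs: "zs \<in> L (Suc i)"
      then have "zs \<noteq> []" by (auto simp: L_def)
      then have "zs = butlast zs @ [last zs]" by simp
      moreover have "set (butlast zs) \<subseteq> J" "last zs \<in> J" "length (butlast zs) = i"
        using zs \<open>zs \<noteq> []\<close> by (auto simp: L_def dest: in_set_butlastD)
      ultimately show "zs \<in> (\<lambda>(xs, y). xs @ [y]) ` (L i \<times> J)"
        by (intro image_eqI[of _ _ "(butlast zs, last zs)"]) (auto simp: L_def)
    qed (auto simp: L_def)
    have inj: "inj_on (\<lambda>(xs, y). xs @ [y]) (L i \<times> J)" by (auto simp: inj_on_def)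
    have step: "f (g i xs) = (\<Sum>y\<in>J. sY (e y) (f (g (Suc i) (xs @ [y]))))" if xs: "xs \<in> L i" for xs
    proof -
      have "g i xs = (g i xs)(i := P)" by (rule ext) (simp add: g_def)
      then have "f (g i xs) = f ((g i xs)(i := P))" by (rule arg_cong)
      also have "\<dots> = (\<Sum>y\<in>J. sY (e y) (f ((g i xs)(i := x y))))"
        unfolding P_def by (rule kmultilinear_upd_sum[OF i assms])
      also have "\<dots> = (\<Sum>y\<in>J. sY (e y) (f (g (Suc i) (xs @ [y]))))"
      proof (rule sum.cong[OF refl])
        fix y
        have "(g i xs)(i := x y) = g (Suc i) (xs @ [y])"
          using xs by (intro ext) (auto simp: L_def g_def nth_append)
        then show "sY (e y) (f ((g i xs)(i := x y))) = sY (e y) (f (g (Suc i) (xs @ [y])))" by simp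
      qed
      finally show ?thesis .
    qed
    have "f (\<lambda>_. P) = (\<Sum>xs\<in>L i. sY (prod_list (map e xs)) (f (g i xs)))"
      using Suc i by simp
    also have "\<dots> = (\<Sum>xs\<in>L i. \<Sum>y\<in>J. sY (prod_list (map e (xs @ [y]))) (f (g (Suc i) (xs @ [y]))))"
      by (rule sum.cong[OF refl]) (simp add: step Y.scale_sum_right)
    also have "\<dots> = (\<Sum>(xs,y)\<in>L i \<times> J. sY (prod_list (map e (xs @ [y]))) (f (g (Suc i) (xs @ [y]))))"
      by (rule sum.cartesian_product)
    also have "\<dots> = (\<Sum>xs\<in>L (Suc i). sY (prod_list (map e xs)) (f (g (Suc i) xs)))"
      unfolding LS by (subst sum.reindex[OF inj]) (simp add: case_prod_unfold)
    finally show ?case .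
  qed
  from this[of n] have "f (\<lambda>_. P) = (\<Sum>xs\<in>L n. sY (prod_list (map e xs)) (f (g n xs)))"
    by simp
  also have "\<dots> = (\<Sum>xs\<in>L n. sY (prod_list (map e xs)) (f (\<lambda>t. x (xs ! t))))"
    by (intro sum.cong refl arg_cong2[where f=sY] kmultilinear_cong) (simp add: g_def)
  finally show ?thesis unfolding P_def L_def .
qed

end

text \<open>Serves to absorb the factor \<open>n^2\<close> of a second-order remainder when the
  radius is halved.\<close>

lemma nat_square_le_two_power: "n\<^sup>2 \<le> 2 * 2 ^ n" for n :: nat
proof (induction n rule: less_induct)
  case (less n)
  show ?case
  proof (cases "n < 4")
    case True
    then have "n = 0 \<or> n = 1 \<or> n = 2 \<or> n = 3" by auto
    then show ?thesis by (auto simp: power2_eq_square)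
  next
    case False
    define m where "m = n - 1"
    then have n: "n = Suc m" "3 \<le> m" using False by auto
    have "m\<^sup>2 \<le> 2 * 2 ^ m" using less n by simp
    moreover have "3 * m \<le> m * m" using n(2) by simp
    then have "2 * m + 1 \<le> m\<^sup>2" using n(2) unfolding power2_eq_square by linarith
    ultimately show ?thesis by (simp add: n power2_eq_square)
  qed
qed

text \<open>On the radius \<open>r / 2\<close> the factors \<open>n\<close> and \<open>n^2\<close>
  lost by differentiation are compensated by powers of 2, so \<open>C n * r ^ n\<close> remains a
  summable majorant up to constants. The further restriction to \<open>r / 4\<close> keeps the
  increment \<open>h\<close>, a difference of two admissible points, below
  \<open>r / 2\<close>.\<close>

theorem analytic_quadratic_remainder:
  fixes sX :: "'k::{real_normed_field,banach} \<Rightarrow> 'x::banach \<Rightarrow> 'x"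
    and sY :: "'k \<Rightarrow> 'y::banach \<Rightarrow> 'y"
  assumes kX: "kspace sX" and kY: "kspace sY"
    and ml: "\<And>n. kmultilinear_on sX sY UNIV n (a n) (C n)"
    and C: "\<And>n. C n \<ge> 0" and r: "r > 0" and sumC: "summable (\<lambda>n. C n * r ^ n)"
    and G: "\<And>h. norm h < r \<Longrightarrow> (\<lambda>n. a n (\<lambda>_. h)) sums G h"
  obtains K G' where "K \<ge> 0"
    and "\<And>x h. norm x \<le> r / 4 \<Longrightarrow> (\<lambda>n. \<Sum>i<n. a n (\<lambda>j. if j = i then h else x)) sums G' x h"
    and "\<And>x. norm x \<le> r / 4 \<Longrightarrow> bounded_linear (G' x)"
    and "\<And>x h. norm x \<le> r / 4 \<Longrightarrow> norm (x + h) \<le> r / 4 \<Longrightarrow>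
       norm (G (x + h) - G x - G' x h) \<le> K * (norm h)\<^sup>2"
    and "\<And>x h. norm x \<le> r / 4 \<Longrightarrow> norm (G' x h) \<le> K * norm h"
proof -
  interpret X: kspace sX by (rule kX)
  interpret Y: kspace sY by (rule kY)
  note mul = kmultilinear_upd_add[OF kX kY ml] kmultilinear_upd_scale[OF kX kY ml]
  define R where "R = r / 2"
  have R: "R > 0" using r by (simp add: R_def)
  define p' where "p' n x h = (\<Sum>i<n. a n (\<lambda>j. if j = i then h else x))" for n x h
  define S where "S = (\<Sum>n. C n * r ^ n)"
  have Cr: "C n * r ^ n \<ge> 0" for n using C r by simp
  have S0: "S \<ge> 0" unfolding S_def by (rule suminf_nonneg[OF sumC]) (use Cr in auto)
  have n1: "real n * R ^ (n - 1) \<le> 2 / r * r ^ n" for n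
  proof (cases n)
    case (Suc m)
    have "real (Suc m) \<le> 2 ^ m" by (induction m) auto
    then have "real (Suc m) / 2 ^ m * r ^ m \<le> 1 * r ^ m"
      using r by (intro mult_right_mono) auto
    moreover have "real n * R ^ (n - 1) = real (Suc m) / 2 ^ m * r ^ m"
      by (simp add: Suc R_def power_divide)
    moreover have "2 / r * r ^ n = 2 * r ^ m" using Suc r by simp
    moreover have "r ^ m \<ge> 0" using r by simp
    ultimately show ?thesis by linarith
  qed (use r in simp)
  have n2: "real n ^ 2 * R ^ (n - 2) \<le> 8 / r ^ 2 * r ^ n" if "n \<ge> 2" for n
  proof -
    from that obtain m where m: "n = Suc (Suc m)" by (metis add_2_eq_Suc le_Suc_ex)
    have "real (n\<^sup>2) \<le> real (2 * 2 ^ n)" using nat_square_le_two_power of_nat_le_iff by blast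
    then have "real n ^ 2 \<le> 8 * 2 ^ m" using m by simp
    then have "real n ^ 2 / 2 ^ m * r ^ m \<le> 8 * r ^ m"
      using r by (intro mult_right_mono) (auto simp: pos_divide_le_eq)
    moreover have "real n ^ 2 * R ^ (n - 2) = real n ^ 2 / 2 ^ m * r ^ m"
      by (simp add: m R_def power_divide)
    moreover have "8 / r ^ 2 * r ^ n = 8 * r ^ m" using m r by (simp add: power2_eq_square)
    ultimately show ?thesis by linarith
  qed
  have p'bound: "norm (p' n x h) \<le> 2 / r * norm h * (C n * r ^ n)" if "norm x \<le> R" for n x h
  proof -
    have "norm (p' n x h) \<le> (\<Sum>i<n. C n * (R ^ (n - 1) * norm h))"
      unfolding p'_def
      by (rule sum_norm_le) (use kmultilinear_one_bound[OF kX kY ml] that C in auto)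
    also have "\<dots> = (C n * norm h) * (real n * R ^ (n - 1))" by simp
    also have "\<dots> \<le> (C n * norm h) * (2 / r * r ^ n)"
      by (rule mult_left_mono[OF n1]) (use C in simp)
    finally show ?thesis by (simp add: algebra_simps)
  qed
  have sumb: "summable (\<lambda>n. c * (C n * r ^ n))" for c by (rule summable_mult[OF sumC])
  have sp': "summable (\<lambda>n. p' n x h)" if "norm x \<le> R" for x h
    by (rule summable_comparison_test'[OF sumb[of "2 / r * norm h"]]) (use p'bound that in auto)
  define G' where "G' x h = (\<Sum>n. p' n x h)" for x h
  have G's: "(\<lambda>n. p' n x h) sums G' x h" if "norm x \<le> R" for x h
    unfolding G'_def by (rule summable_sums[OF sp'[OF that]])
  have G'b: "norm (G' x h) \<le> 2 / r * S * norm h" if "norm x \<le> R" for x h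
  proof -
    have "norm (G' x h) \<le> (\<Sum>n. 2 / r * norm h * (C n * r ^ n))"
      unfolding G'_def by (rule norm_suminf_le) (use sumb p'bound that in auto)
    also have "\<dots> = 2 / r * norm h * S"
      unfolding S_def by (rule suminf_mult[OF sumC])
    finally show ?thesis by (simp add: algebra_simps)
  qed
  have upd: "(\<lambda>j. if j = i then h else x) = (\<lambda>_. x)(i := h)" for i :: nat and h x :: 'x
    by (rule ext) (simp add: fun_upd_def)
  have G'lin: "bounded_linear (G' x)" if "norm x \<le> R" for x
  proof (rule bounded_linear_intro)
    fix h1 h2
    have "p' n x (h1 + h2) = p' n x h1 + p' n x h2" for n
      unfolding p'_def upd by (simp add: mul(1) sum.distrib)
    then show "G' x (h1 + h2) = G' x h1 + G' x h2"
      unfolding G'_def using suminf_add[OF sp'[OF that, of h1] sp'[OF that, of h2]] by simp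
  next
    fix c h
    have "p' n x (c *\<^sub>R h) = c *\<^sub>R p' n x h" for n
      unfolding p'_def upd using mul(2)[of _ _ _ "of_real c"] by (simp add: scaleR_sum_right)
    then show "G' x (c *\<^sub>R h) = c *\<^sub>R G' x h"
      unfolding G'_def using suminf_scaleR_right[OF sp'[OF that, of h], of c] by simp
  next
    fix h show "norm (G' x h) \<le> norm h * (2 / r * S)" using G'b[OF that, of h] by (simp add: algebra_simps)
  qed
  have quad: "norm (G (x + h) - G x - G' x h) \<le> 8 / r ^ 2 * S * (norm h)\<^sup>2"
    if x: "norm x \<le> r / 4" and xh: "norm (x + h) \<le> r / 4" for x h
  proof -
    have hR: "norm h \<le> R" "norm x \<le> R" "norm (x + h) \<le> R"
      using norm_triangle_ineq4[of "x + h" x] x xh r by (auto simp: R_def)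
    have sums: "(\<lambda>n. a n (\<lambda>_. x + h) - a n (\<lambda>_. x) - p' n x h) sums (G (x + h) - G x - G' x h)"
      by (intro sums_diff G G's) (use x xh hR r in auto)
    have bnd: "norm (a n (\<lambda>_. x + h) - a n (\<lambda>_. x) - p' n x h) \<le> 8 / r ^ 2 * (norm h)\<^sup>2 * (C n * r ^ n)" for n
    proof (cases "n \<ge> 2")
      case True
      have "norm (a n (\<lambda>_. x + h) - a n (\<lambda>_. x) - p' n x h) \<le> C n * (real n ^ 2 * R ^ (n - 2)) * (norm h)\<^sup>2"
        unfolding p'_def by (rule homogeneous_taylor_bound[OF kX kY ml]) (use hR C in auto)
      also have "\<dots> \<le> C n * (8 / r ^ 2 * r ^ n) * (norm h)\<^sup>2"
        by (intro mult_right_mono mult_left_mono n2 True C) simp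
      finally show ?thesis by (simp add: algebra_simps)
    next
      \<comment> \<open>Degrees 0 and 1 have no second-order remainder; they are treated apart
        because \<open>n - 2\<close> truncates there and the bound \<open>n2\<close> may
        fail.\<close>
      case False
      then have "n = 0 \<or> n = 1" by auto
      then have "a n (\<lambda>_. x + h) - a n (\<lambda>_. x) - p' n x h = 0"
      proof
        assume "n = 0"
        then show ?thesis
          using kmultilinear_cong[OF kX kY ml[of n], of "\<lambda>_. x + h" "\<lambda>_. x"] by (simp add: p'_def)
      next
        assume n: "n = 1"
        have "a 1 (\<lambda>_. z) = a 1 ((\<lambda>_. 0)(0 := z))" for z
          by (rule kmultilinear_cong[OF kX kY ml]) auto
        moreover have "a 1 (\<lambda>j. if j = 0 then h else x) = a 1 ((\<lambda>_. 0)(0 := h))"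
          by (rule kmultilinear_cong[OF kX kY ml]) auto
        ultimately show ?thesis using n mul(1)[of 0 1 "\<lambda>_. 0" x h] by (simp add: p'_def)
      qed
      then show ?thesis using Cr[of n] by (simp del: times_divide_eq_left)
    qed
    have "norm (G (x + h) - G x - G' x h) \<le> (\<Sum>n. 8 / r ^ 2 * (norm h)\<^sup>2 * (C n * r ^ n))"
      using norm_suminf_le[OF bnd sumb] sums_unique[OF sums] by simp
    also have "\<dots> = 8 / r ^ 2 * (norm h)\<^sup>2 * S" unfolding S_def by (rule suminf_mult[OF sumC])
    finally show ?thesis by (simp add: ac_simps)
  qed
  show thesis
  proof (rule that[of "max (2 / r * S) (8 / r ^ 2 * S)" G'])
    show "max (2 / r * S) (8 / r ^ 2 * S) \<ge> 0" using S0 r by (simp add: max_def)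
    show "norm (G (x + h) - G x - G' x h) \<le> max (2 / r * S) (8 / r ^ 2 * S) * (norm h)\<^sup>2"
      if "norm x \<le> r / 4" "norm (x + h) \<le> r / 4" for x h
      using quad[of x h] that by (smt (verit) R_def mult_right_mono zero_le_power2)
    show "norm (G' x h) \<le> max (2 / r * S) (8 / r ^ 2 * S) * norm h" if "norm x \<le> r / 4" for x h
    proof -
      have "norm x \<le> R" using that r by (simp add: R_def)
      from G'b[OF this, of h] show ?thesis by (smt (verit) mult_right_mono norm_ge_zero)
    qed
    show "(\<lambda>n. \<Sum>i<n. a n (\<lambda>j. if j = i then h else x)) sums G' x h" if "norm x \<le> r / 4" for x h
    proof -
      have "norm x \<le> R" using that r by (simp add: R_def)
      from G's[OF this, of h] show ?thesis unfolding p'_def .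
    qed
    show "bounded_linear (G' x)" if "norm x \<le> r / 4" for x
      by (rule G'lin) (use that r in \<open>simp add: R_def\<close>)
  qed
qed

subsection \<open>Power series in one scalar variable\<close>

definition has_ps ::
  "('k::{real_normed_field,banach} \<Rightarrow> 'c::banach \<Rightarrow> 'c) \<Rightarrow> ('k \<Rightarrow> 'c) \<Rightarrow> (nat \<Rightarrow> 'c) \<Rightarrow> bool" where
  "has_ps s u c \<longleftrightarrow> (\<exists>r>0. summable (\<lambda>n. norm (c n) * r ^ n) \<and>
      (\<forall>\<epsilon>. norm \<epsilon> < r \<longrightarrow> (\<lambda>n. s (\<epsilon> ^ n) (c n)) sums u \<epsilon>))"

text \<open>The bound includes \<epsilon> = 0, so for \<open>n \<ge> 1\<close> it forces
  \<open>u 0 = 0\<close>.\<close>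

definition bigO :: "nat \<Rightarrow> ('k::real_normed_field \<Rightarrow> 'c::real_normed_vector) \<Rightarrow> bool" where
  "bigO n u \<longleftrightarrow> (\<exists>K. \<exists>r>0. \<forall>\<epsilon>. norm \<epsilon> < r \<longrightarrow> norm (u \<epsilon>) \<le> K * norm \<epsilon> ^ n)"

lemma bigOE:
  assumes "bigO n u"
  obtains K r where "K \<ge> 0" "r > 0" "r \<le> 1" "\<And>\<epsilon>. norm \<epsilon> < r \<Longrightarrow> norm (u \<epsilon>) \<le> K * norm \<epsilon> ^ n"
proof -
  from assms obtain K r where K: "r > 0" "\<And>\<epsilon>. norm \<epsilon> < r \<Longrightarrow> norm (u \<epsilon>) \<le> K * norm \<epsilon> ^ n"
    by (auto simp: bigO_def)
  show thesis
  proof (rule that[of "\<bar>K\<bar>" "min r 1"])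
    fix \<epsilon> :: 'a assume "norm \<epsilon> < min r 1"
    then have "norm (u \<epsilon>) \<le> K * norm \<epsilon> ^ n" using K by simp
    also have "\<dots> \<le> \<bar>K\<bar> * norm \<epsilon> ^ n" by (intro mult_right_mono) auto
    finally show "norm (u \<epsilon>) \<le> \<bar>K\<bar> * norm \<epsilon> ^ n" .
  qed (use K in auto)
qed

lemma bigOI: "r > 0 \<Longrightarrow> (\<And>\<epsilon>. norm \<epsilon> < r \<Longrightarrow> norm (u \<epsilon>) \<le> K * norm \<epsilon> ^ n) \<Longrightarrow> bigO n u"
  unfolding bigO_def by blast

lemma bigO_add:
  assumes "bigO n u" "bigO n v"
  shows "bigO n (\<lambda>\<epsilon>. u \<epsilon> + v \<epsilon>)"
proof -
  from assms(1) obtain K r where K: "r > 0" "\<And>\<epsilon>. norm \<epsilon> < r \<Longrightarrow> norm (u \<epsilon>) \<le> K * norm \<epsilon> ^ n"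
    by (rule bigOE) blast
  from assms(2) obtain K' r' where K': "r' > 0" "\<And>\<epsilon>. norm \<epsilon> < r' \<Longrightarrow> norm (v \<epsilon>) \<le> K' * norm \<epsilon> ^ n"
    by (rule bigOE) blast
  show ?thesis
  proof (rule bigOI[of "min r r'"])
    fix \<epsilon> :: 'a assume "norm \<epsilon> < min r r'"
    then show "norm (u \<epsilon> + v \<epsilon>) \<le> (K + K') * norm \<epsilon> ^ n"
      using K(2)[of \<epsilon>] K'(2)[of \<epsilon>] norm_triangle_ineq[of "u \<epsilon>" "v \<epsilon>"]
      by (simp add: distrib_right)
  qed (use K K' in auto)
qed

lemma bigO_uminus [simp]: "bigO n (\<lambda>\<epsilon>. - u \<epsilon>) \<longleftrightarrow> bigO n u"
  by (simp add: bigO_def)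

lemma bigO_diff: "bigO n u \<Longrightarrow> bigO n v \<Longrightarrow> bigO n (\<lambda>\<epsilon>. u \<epsilon> - v \<epsilon>)"
  using bigO_add[of n u "\<lambda>\<epsilon>. - v \<epsilon>"] by simp

lemma bigO_mono:
  assumes "bigO n u" "m \<le> n"
  shows "bigO m u"
proof -
  from assms(1) obtain K r where K: "K \<ge> 0" "r > 0" "r \<le> 1" "\<And>\<epsilon>. norm \<epsilon> < r \<Longrightarrow> norm (u \<epsilon>) \<le> K * norm \<epsilon> ^ n"
    by (rule bigOE) blast
  show ?thesis
  proof (rule bigOI[OF K(2)])
    fix \<epsilon> :: 'a assume e: "norm \<epsilon> < r"
    have "norm \<epsilon> ^ n \<le> norm \<epsilon> ^ m" using e K by (intro power_decreasing assms(2)) auto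
    then show "norm (u \<epsilon>) \<le> K * norm \<epsilon> ^ m" using K(4)[OF e] K(1)
      by (meson mult_left_mono order_trans)
  qed
qed

context kspace
begin

lemma bigO_pow: "m \<le> n \<Longrightarrow> bigO m (\<lambda>\<epsilon>. s (\<epsilon> ^ n) b)"
  by (rule bigO_mono[of n], rule bigOI[of 1 _ "norm b"]) (auto simp: norm_power)

lemma bigO_sum:
  assumes "finite J" "\<And>j. j \<in> J \<Longrightarrow> bigO n (\<lambda>\<epsilon>::'k. u j \<epsilon> :: 'b)"
  shows "bigO n (\<lambda>\<epsilon>. \<Sum>j\<in>J. u j \<epsilon>)"
  using assms by (induction J rule: finite_induct) (auto intro: bigO_add bigOI[of 1 "\<lambda>_. 0" 0])

text \<open>Once the lower coefficients are known to vanish, dividing by \<open>\<epsilon>^d\<close>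
  along positive real \<epsilon> = t leaves \<open>norm (c d) \<le> K * t\<close>, and t tends to
  0.\<close>

lemma bigO_poly_zero:
  assumes "bigO (Suc n) (\<lambda>\<epsilon>. \<Sum>d\<le>n. s (\<epsilon> ^ d) (c d))" "d \<le> n"
  shows "c d = 0"
  using assms(2)
proof (induction d rule: less_induct)
  case (less d)
  have eq: "(\<Sum>j\<le>n. s (\<epsilon> ^ j) (c j)) = s (\<epsilon> ^ d) (c d) + (\<Sum>j\<in>{d<..n}. s (\<epsilon> ^ j) (c j))" for \<epsilon>
  proof -
    have "{..n} = {..<d} \<union> ({d} \<union> {d<..n})" using less.prems by auto
    moreover have "(\<Sum>j\<in>{..<d} \<union> ({d} \<union> {d<..n}). s (\<epsilon> ^ j) (c j))
        = (\<Sum>j<d. s (\<epsilon> ^ j) (c j)) + (\<Sum>j\<in>{d} \<union> {d<..n}. s (\<epsilon> ^ j) (c j))"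
      by (rule sum.union_disjoint) auto
    moreover have "(\<Sum>j<d. s (\<epsilon> ^ j) (c j)) = 0" by (rule sum.neutral) (use less in auto)
    moreover have "(\<Sum>j\<in>{d} \<union> {d<..n}. s (\<epsilon> ^ j) (c j)) = s (\<epsilon> ^ d) (c d) + (\<Sum>j\<in>{d<..n}. s (\<epsilon> ^ j) (c j))"
      by (subst sum.union_disjoint) auto
    ultimately show ?thesis by simp
  qed
  have "bigO (Suc d) (\<lambda>\<epsilon>. (\<Sum>j\<le>n. s (\<epsilon> ^ j) (c j)) - (\<Sum>j\<in>{d<..n}. s (\<epsilon> ^ j) (c j)))"
    by (intro bigO_diff bigO_sum bigO_pow bigO_mono[OF assms(1)]) (use less.prems in auto)
  then have "bigO (Suc d) (\<lambda>\<epsilon>. s (\<epsilon> ^ d) (c d))" by (simp add: eq)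
  then obtain K r where K: "K \<ge> 0" "r > 0" "r \<le> 1"
     "\<And>\<epsilon>. norm \<epsilon> < r \<Longrightarrow> norm (s (\<epsilon> ^ d) (c d)) \<le> K * norm \<epsilon> ^ Suc d"
    by (rule bigOE) blast
  have "norm (c d) \<le> K * t" if "0 < t" "t < r" for t
    using K(4)[of "of_real t"] that by (simp add: norm_power field_simps)
  then have "\<forall>\<^sub>F t in at_right 0. norm (c d) \<le> K * t"
    using K(2) by (auto simp: eventually_at_right_field)
  moreover have "((\<lambda>t. K * t) \<longlongrightarrow> K * 0) (at_right 0)" by (intro tendsto_intros)
  ultimately have "norm (c d) \<le> K * 0"
    by (intro tendsto_lowerbound[of "\<lambda>t. K * t"]) auto
  then show "c d = 0" by simp
qed

lemma has_ps_remainder: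
  assumes "has_ps s u c"
  shows "bigO n (\<lambda>\<epsilon>. u \<epsilon> - (\<Sum>d<n. s (\<epsilon> ^ d) (c d)))"
proof -
  from assms obtain r where r: "r > 0" "summable (\<lambda>n. norm (c n) * r ^ n)"
    "\<And>\<epsilon>. norm \<epsilon> < r \<Longrightarrow> (\<lambda>n. s (\<epsilon> ^ n) (c n)) sums u \<epsilon>" by (auto simp: has_ps_def)
  define K where "K = (\<Sum>m. norm (c (m + n)) * r ^ (m + n)) / r ^ n"
  show ?thesis
  proof (rule bigOI[OF r(1)])
    fix \<epsilon> :: 'k assume e: "norm \<epsilon> < r"
    have sums: "(\<lambda>m. s (\<epsilon> ^ (m + n)) (c (m + n))) sums (u \<epsilon> - (\<Sum>d<n. s (\<epsilon> ^ d) (c d)))"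
      using r(3)[OF e] by (rule sums_split_initial_segment)
    have sm: "summable (\<lambda>m. norm (c (m + n)) * r ^ (m + n))"
      using r(2) by (rule summable_ignore_initial_segment)
    have bnd: "norm (s (\<epsilon> ^ (m + n)) (c (m + n))) \<le> norm \<epsilon> ^ n / r ^ n * (norm (c (m + n)) * r ^ (m + n))" for m
    proof -
      have "norm \<epsilon> ^ m \<le> r ^ m" using e by (intro power_mono) auto
      then have "norm \<epsilon> ^ n * norm (c (m + n)) * norm \<epsilon> ^ m \<le> norm \<epsilon> ^ n * norm (c (m + n)) * r ^ m"
        by (intro mult_left_mono) auto
      then show ?thesis using r(1) by (simp add: norm_power norm_mult power_add algebra_simps)
    qed
    have smb: "summable (\<lambda>m. norm \<epsilon> ^ n / r ^ n * (norm (c (m + n)) * r ^ (m + n)))"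
      by (rule summable_mult[OF sm])
    have "norm (u \<epsilon> - (\<Sum>d<n. s (\<epsilon> ^ d) (c d))) \<le> (\<Sum>m. norm \<epsilon> ^ n / r ^ n * (norm (c (m + n)) * r ^ (m + n)))"
      unfolding sums_unique[OF sums] by (rule norm_suminf_le[OF bnd smb])
    also have "\<dots> = norm \<epsilon> ^ n / r ^ n * (\<Sum>m. norm (c (m + n)) * r ^ (m + n))" by (rule suminf_mult[OF sm])
    also have "\<dots> = K * norm \<epsilon> ^ n" by (simp add: K_def)
    finally show "norm (u \<epsilon> - (\<Sum>d<n. s (\<epsilon> ^ d) (c d))) \<le> K * norm \<epsilon> ^ n" .
  qed
qed

lemma has_ps_at_0: "has_ps s u c \<Longrightarrow> u 0 = c 0"
  using has_ps_remainder[of u c 1] unfolding bigO_def by (auto dest: spec[of _ 0])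

lemma has_ps_bigO_iff:
  assumes "has_ps s u c"
  shows "bigO (Suc n) u \<longleftrightarrow> (\<forall>d\<le>n. c d = 0)"
proof
  assume "bigO (Suc n) u"
  from bigO_diff[OF this has_ps_remainder[OF assms, of "Suc n"]]
  have "bigO (Suc n) (\<lambda>\<epsilon>. \<Sum>d\<le>n. s (\<epsilon> ^ d) (c d))" by (simp add: lessThan_Suc_atMost)
  then show "\<forall>d\<le>n. c d = 0" using bigO_poly_zero by blast
next
  assume "\<forall>d\<le>n. c d = 0"
  then have "(\<Sum>d<Suc n. s (\<epsilon> ^ d) (c d)) = 0" for \<epsilon> by (intro sum.neutral) auto
  then show "bigO (Suc n) u" using has_ps_remainder[OF assms, of "Suc n"] by simp
qed

end

text \<open>Writes a monomial in one scalar variable as a multilinear form, so that a scalar power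
  series becomes an analytic map in the sense used above.\<close>

lemma kmultilinear_prod:
  fixes sY :: "'k::{real_normed_field,banach} \<Rightarrow> 'c::banach \<Rightarrow> 'c"
  assumes "kspace sY"
  shows "kmultilinear_on (*) sY UNIV n (\<lambda>v. sY (\<Prod>j<n. v j) b) (norm b)"
proof -
  interpret kspace sY by fact
  have upd: "(\<Prod>j<n. (v(i := z)) j) = z * (\<Prod>j\<in>{..<n}-{i}. v j)" if "i < n" for v :: "nat \<Rightarrow> 'k" and i z
    using that by (subst prod.remove[of _ i]) (auto intro!: prod.cong)
  show ?thesis
    unfolding kmultilinear_on_def
  proof (intro conjI allI impI)
    fix v w :: "nat \<Rightarrow> 'k" assume "\<forall>i<n. v i = w i"
    then have "(\<Prod>j<n. v j) = (\<Prod>j<n. w j)" by (intro prod.cong) auto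
    then show "sY (\<Prod>j<n. v j) b = sY (\<Prod>j<n. w j) b" by simp
  next
    fix v :: "nat \<Rightarrow> 'k" and i x y a
    assume "(\<forall>j<n. v j \<in> UNIV) \<and> i < n \<and> x \<in> (UNIV::'k set) \<and> y \<in> (UNIV::'k set)"
    then have i: "i < n" by simp
    show "sY (\<Prod>j<n. (v(i := a * x + y)) j) b =
       sY a (sY (\<Prod>j<n. (v(i := x)) j) b) + sY (\<Prod>j<n. (v(i := y)) j) b"
      unfolding upd[OF i] by (simp add: algebra_simps)
  next
    fix v :: "nat \<Rightarrow> 'k"
    show "norm (sY (\<Prod>j<n. v j) b) \<le> norm b * (\<Prod>j<n. norm (v j))"
      by (simp add: prod_norm mult.commute)
  qed
qed

context kspace
begin

text \<open>The quadratic remainder, specialised to the field as domain, bounds the error of the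
  difference quotient by \<open>K * norm h\<close>. Each differentiation shrinks the radius by the
  factor 4, which is harmless because only germs at 0 matter.\<close>

lemma has_ps_kderiv:
  assumes "has_ps s u c"
  shows "has_ps s (kderiv s u) (\<lambda>n. s (of_nat (Suc n)) (c (Suc n)))"
proof -
  from assms obtain r where r: "r > 0" "summable (\<lambda>n. norm (c n) * r ^ n)"
    "\<And>\<epsilon>. norm \<epsilon> < r \<Longrightarrow> (\<lambda>n. s (\<epsilon> ^ n) (c n)) sums u \<epsilon>" by (auto simp: has_ps_def)
  obtain K G' where G': "K \<ge> 0"
    "\<And>x h. norm x \<le> r / 4 \<Longrightarrow> (\<lambda>n. \<Sum>i<n. s (\<Prod>j<n. if j = i then h else x) (c n)) sums G' x h"
    "\<And>x h. norm x \<le> r / 4 \<Longrightarrow> norm (x + h) \<le> r / 4 \<Longrightarrow>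
       norm (u (x + h) - u x - G' x h) \<le> K * (norm h)\<^sup>2"
  proof (rule analytic_quadratic_remainder[OF kspace_mult kspace_axioms, where
      a = "\<lambda>n v. s (\<Prod>j<n. v j) (c n)" and C = "\<lambda>n. norm (c n)" and r = r and G = u])
    show "kmultilinear_on (*) s UNIV n (\<lambda>v. s (\<Prod>j<n. v j) (c n)) (norm (c n))" for n
      by (rule kmultilinear_prod[OF kspace_axioms])
  qed (use r in auto)
  have pr: "(\<Prod>j<n. if j = i then h else x) = h * x ^ (n - 1)" if "i < n" for i n and h x :: 'k
    using that by (subst prod.remove[of _ i]) (auto simp: card_Diff_singleton_if)
  have G'1: "(\<lambda>n. s (of_nat n * x ^ (n - 1)) (c n)) sums G' x 1" if "norm x \<le> r / 4" for x
    using G'(2)[OF that, of 1] by (simp add: pr scale_sum_left[symmetric])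
  \<comment> \<open>The general theorem yields real linearity only; homogeneity over the field is
    read off from the series.\<close>
  have G'h: "G' x h = s h (G' x 1)" if "norm x \<le> r / 4" for x h
  proof (rule sums_unique2[OF G'(2)[OF that]])
    have "(\<lambda>n. s h (s (of_nat n * x ^ (n - 1)) (c n))) sums s h (G' x 1)"
      by (rule bounded_linear.sums[OF bounded_linear_s G'1[OF that]])
    then show "(\<lambda>n. \<Sum>i<n. s (\<Prod>j<n. if j = i then h else x) (c n)) sums s h (G' x 1)"
      by (simp add: pr scale_sum_left[symmetric] mult.commute mult.left_commute)
  qed
  have kd: "kderiv s u x = G' x 1" if x: "norm x < r / 4" for x
  proof -
    define d where "d = r / 4 - norm x"
    have "d > 0" using x by (simp add: d_def)
    have "((\<lambda>h. s (inverse h) (u (x + h) - u x)) \<longlongrightarrow> G' x 1) (at 0)"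
    proof (rule metric_tendsto_imp_tendsto[where f = "\<lambda>h. K * norm h" and a=0])
      show "((\<lambda>h. K * norm h) \<longlongrightarrow> 0) (at 0)"
        by (rule tendsto_mult_right_zero, rule tendsto_norm_zero) (rule tendsto_ident_at)
      have "dist (s (inverse h) (u (x + h) - u x)) (G' x 1) \<le> dist (K * norm h) 0" if h: "h \<noteq> 0" "norm h < d" for h
      proof -
        have "norm (x + h) \<le> r / 4" using h norm_triangle_ineq[of x h] by (simp add: d_def)
        then have q: "norm (u (x + h) - u x - G' x h) \<le> K * (norm h)\<^sup>2" using G'(3) x by simp
        have "s (inverse h) (u (x + h) - u x) - G' x 1 = s (inverse h) (u (x + h) - u x - G' x h)"
          using G'h[of x h] x h by (simp add: scale_right_diff_distrib)
        then have "norm (s (inverse h) (u (x + h) - u x) - G' x 1) = norm (u (x + h) - u x - G' x h) / norm h"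
          by (simp add: norm_inverse divide_inverse mult.commute)
        also have "\<dots> \<le> K * norm h"
          using q h by (simp add: pos_divide_le_eq power2_eq_square mult.assoc)
        finally show ?thesis using G'(1) by (simp add: dist_norm)
      qed
      then show "\<forall>\<^sub>F h in at 0. dist (s (inverse h) (u (x + h) - u x)) (G' x 1) \<le> dist (K * norm h) 0"
        unfolding eventually_at using \<open>d > 0\<close> by (auto simp: dist_norm)
    qed
    then show ?thesis unfolding kderiv_def by (intro tendsto_Lim) auto
  qed
  show ?thesis
    unfolding has_ps_def
  proof (intro exI[of _ "r / 4"] conjI allI impI)
    show "0 < r / 4" using r by simp
    \<comment> \<open>The factor \<open>n + 1\<close> is absorbed by the \<open>4 ^ n\<close> that
      the smaller radius provides.\<close>
    have b: "norm (norm (s (of_nat (Suc n)) (c (Suc n))) * (r / 4) ^ n) \<le> 1 / r * (norm (c (Suc n)) * r ^ Suc n)" for n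
    proof -
      have "real (Suc n) \<le> 4 ^ n" by (induction n) auto
      then have "real (Suc n) * norm (c (Suc n)) * r ^ n \<le> 4 ^ n * norm (c (Suc n)) * r ^ n"
        using r by (intro mult_right_mono) auto
      moreover have "norm (norm (s (of_nat (Suc n)) (c (Suc n))) * (r / 4) ^ n) = real (Suc n) * norm (c (Suc n)) * r ^ n / 4 ^ n"
        using r(1) norm_of_nat[of "Suc n", where 'a='k] by (simp add: power_divide abs_mult del: of_nat_Suc)
      ultimately show ?thesis using r(1) by (simp add: pos_divide_le_eq mult.commute mult.left_commute)
    qed
    have "summable (\<lambda>n. 1 / r * (norm (c (Suc n)) * r ^ Suc n))"
      by (rule summable_mult) (use r(2) in \<open>subst summable_Suc_iff\<close>)
    then show "summable (\<lambda>n. norm (s (of_nat (Suc n)) (c (Suc n))) * (r / 4) ^ n)"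
      by (rule summable_comparison_test') (use b in blast)
    fix \<epsilon> :: 'k assume e: "norm \<epsilon> < r / 4"
    have "(\<lambda>n. s (of_nat (Suc n) * \<epsilon> ^ n) (c (Suc n))) sums G' \<epsilon> 1"
      using G'1[of \<epsilon>] e sums_Suc_iff[of "\<lambda>n. s (of_nat n * \<epsilon> ^ (n - 1)) (c n)" "G' \<epsilon> 1"] by simp
    then show "(\<lambda>n. s (\<epsilon> ^ n) (s (of_nat (Suc n)) (c (Suc n)))) sums kderiv s u \<epsilon>"
      unfolding kd[OF e] by (simp add: mult.commute)
  qed
qed

lemma has_ps_kderiv_funpow:
  assumes "has_ps s u c"
  shows "has_ps s ((kderiv s ^^ i) u) (\<lambda>n. s (fact (n + i) / fact n) (c (n + i)))"
proof (induction i)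
  case 0
  then show ?case using assms by simp
next
  case (Suc i)
  have "has_ps s ((kderiv s ^^ Suc i) u) (\<lambda>n. s (of_nat (Suc n)) (s (fact (Suc n + i) / fact (Suc n)) (c (Suc n + i))))"
    using has_ps_kderiv[OF Suc] by simp
  moreover have "of_nat (Suc n) * (fact (Suc n + i) / fact (Suc n)) = (fact (n + Suc i) / fact n :: 'k)" for n
  proof -
    have "(of_nat (Suc n) :: 'k) \<noteq> 0" by (rule of_nat_neq_0)
    then show ?thesis by (simp del: of_nat_Suc fact_Suc add: fact_Suc[of n])
  qed
  ultimately show ?case by (simp del: of_nat_Suc fact_Suc)
qed

lemma kderiv_funpow_at_0:
  "has_ps s u c \<Longrightarrow> (kderiv s ^^ i) u 0 = s (fact i) (c i)"
  using has_ps_at_0[OF has_ps_kderiv_funpow, of u c i] by simp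

end

text \<open>Applied twice to one family of words, with \<open>g\<close> the length and with
  \<open>g\<close> the total degree; equality of the two sums is the composition formula for power
  series.\<close>

lemma sums_fibres:
  fixes f :: "'i \<Rightarrow> 'a::banach"
  assumes abs: "f abs_summable_on A" and fin: "\<And>n. finite {x\<in>A. g x = n}"
  shows "(\<lambda>n::nat. \<Sum>x | x \<in> A \<and> g x = n. f x) sums infsum f A"
proof -
  let ?B = "\<lambda>n. {x\<in>A. g x = n}"
  have "(f has_sum infsum f A) A" using abs_summable_summable[OF abs] by (rule has_sum_infsum)
  moreover have "bij_betw snd (Sigma UNIV ?B) A"
    by (rule bij_betwI[where g = "\<lambda>x. (g x, x)"]) auto
  ultimately have "((\<lambda>x. f (snd x)) has_sum infsum f A) (Sigma UNIV ?B)"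
    by (simp add: has_sum_reindex_bij_betw)
  then have "((\<lambda>n. \<Sum>x\<in>?B n. f x) has_sum infsum f A) UNIV"
    by (rule has_sum_SigmaD) (use fin in auto)
  then show ?thesis by (auto dest: has_sum_imp_sums)
qed

text \<open>A finite subset meets only finitely many level sets of \<open>g\<close>, so its sum of
  norms is at most \<open>suminf b\<close>.\<close>

lemma abs_summable_on_fibres:
  fixes f :: "'i \<Rightarrow> 'a::banach" and g :: "'i \<Rightarrow> nat"
  assumes fin: "\<And>n. finite {x\<in>A. g x = n}"
    and b: "\<And>n. (\<Sum>x | x \<in> A \<and> g x = n. norm (f x)) \<le> b n" and "summable b"
  shows "f abs_summable_on A"
proof (rule nonneg_bdd_above_summable_on)
  have b0: "b n \<ge> 0" for n using b[of n] by (meson norm_ge_zero order_trans sum_nonneg)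
  show "bdd_above (sum (\<lambda>x. norm (f x)) ` {F. F \<subseteq> A \<and> finite F})"
  proof (rule bdd_aboveI2)
    fix F assume "F \<in> {F. F \<subseteq> A \<and> finite F}"
    then have F: "F \<subseteq> A" "finite F" by auto
    obtain m where m: "g ` F \<subseteq> {..<m}" using F(2) finite_nat_iff_bounded[of "g ` F"] by auto
    have "F \<subseteq> (\<Union>n<m. {x\<in>A. g x = n})" using F m by auto
    then have "sum (\<lambda>x. norm (f x)) F \<le> sum (\<lambda>x. norm (f x)) (\<Union>n<m. {x\<in>A. g x = n})"
      by (intro sum_mono2) (use fin in auto)
    also have "\<dots> = (\<Sum>n<m. \<Sum>x | x \<in> A \<and> g x = n. norm (f x))"
      by (rule sum.UNION_disjoint) (use fin in auto)
    also have "\<dots> \<le> (\<Sum>n<m. b n)" by (rule sum_mono) (rule b)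
    also have "\<dots> \<le> suminf b" by (rule sum_le_suminf[OF assms(3)]) (use b0 in auto)
    finally show "sum (\<lambda>x. norm (f x)) F \<le> suminf b" .
  qed
qed simp

text \<open>The letters are at least 1, so the length of a word is bounded by its total
  degree.\<close>

lemma finite_lists_sum_list: "finite {xs. set xs \<subseteq> {1..m} \<and> sum_list xs = (d::nat)}"
proof (rule finite_subset)
  have "length xs \<le> sum_list xs" if "set xs \<subseteq> {1..m}" for xs
    using that by (induction xs) auto
  then show "{xs. set xs \<subseteq> {1..m} \<and> sum_list xs = d} \<subseteq> {xs. set xs \<subseteq> {1..m} \<and> length xs \<le> d}"
    by auto
qed (simp add: finite_lists_length_le)

lemma prod_list_power_sum_list: "prod_list (map ((^) \<epsilon>) xs) = \<epsilon> ^ sum_list xs" for \<epsilon> :: "'a::comm_monoid_mult"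
  by (induction xs) (auto simp: power_add)

text \<open>Composition of an analytic map with a polynomial curve: expand every homogeneous term and
  regroup the resulting family, indexed by words over the exponents, by total degree.\<close>

theorem has_ps_analytic_poly:
  fixes sX :: "'k::{real_normed_field,banach} \<Rightarrow> 'x::banach \<Rightarrow> 'x"
    and sY :: "'k \<Rightarrow> 'y::banach \<Rightarrow> 'y"
  assumes kX: "kspace sX" and kY: "kspace sY"
    and ml: "\<And>n. kmultilinear_on sX sY UNIV n (a n) (C n)"
    and C: "\<And>n. C n \<ge> 0" and r: "r > 0" and sumC: "summable (\<lambda>n. C n * r ^ n)"
    and G: "\<And>h. norm h < r \<Longrightarrow> (\<lambda>n. a n (\<lambda>_. h)) sums G h"
  shows "\<exists>c. has_ps sY (\<lambda>\<epsilon>. G (\<Sum>j=1..m. sX (\<epsilon> ^ j) (x j))) c"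
proof -
  interpret X: kspace sX by (rule kX)
  interpret Y: kspace sY by (rule kY)
  define A where "A = {xs::nat list. set xs \<subseteq> {1..m}}"
  define B where "B = (\<Sum>j=1..m. norm (x j)) + 1"
  have B: "B \<ge> 1" by (simp add: B_def sum_nonneg)
  \<comment> \<open>As \<open>t \<le> 1\<close>, every \<open>t ^ j\<close> with
    \<open>j \<ge> 1\<close> is at most \<open>t\<close>; and \<open>t * B < r\<close> keeps even
    the sum of the norms of the terms inside the disc of convergence.\<close>
  define t where "t = min 1 (r / (2 * B))"
  have t: "0 < t" "t \<le> 1" "t * B < r" using B r by (auto simp: t_def min_def field_simps)
  have tB: "(\<Sum>j=1..m. t ^ j * norm (x j)) \<le> t * B"
  proof -
    have "(\<Sum>j=1..m. t ^ j * norm (x j)) \<le> (\<Sum>j=1..m. t * norm (x j))"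
    proof (intro sum_mono mult_right_mono)
      fix j assume "j \<in> {1..m}"
      then have "t ^ j \<le> t ^ 1" using t by (intro power_decreasing) auto
      then show "t ^ j \<le> t" by simp
    qed auto
    also have "\<dots> \<le> t * B" using t by (simp add: B_def sum_distrib_left[symmetric])
    finally show ?thesis .
  qed
  have nB: "norm (\<Sum>j=1..m. sX (\<epsilon> ^ j) (x j)) < r" if "norm \<epsilon> \<le> t" for \<epsilon>
  proof -
    have "norm (\<Sum>j=1..m. sX (\<epsilon> ^ j) (x j)) \<le> (\<Sum>j=1..m. t ^ j * norm (x j))"
      by (intro sum_norm_le) (use that in \<open>auto simp: norm_power intro!: mult_right_mono power_mono\<close>)
    then show ?thesis using tB t by linarith
  qed
  define q where "q xs = a (length xs) (\<lambda>i. x (xs ! i))" for xs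
  have Alen: "{xs. set xs \<subseteq> {1..m} \<and> length xs = n} = {xs \<in> A. length xs = n}" for n
    by (auto simp: A_def)
  have Asum: "{xs \<in> A. sum_list xs = n} = {xs. set xs \<subseteq> {1..m} \<and> sum_list xs = n}" for n
    by (auto simp: A_def)
  have finL: "finite {xs \<in> A. length xs = n}" for n
    unfolding Alen[symmetric] by (rule finite_lists_length_eq) simp
  have finS: "finite {xs \<in> A. sum_list xs = n}" for n
    unfolding Asum by (rule finite_lists_sum_list)
  have qb: "norm (q xs) \<le> C (length xs) * (\<Prod>i<length xs. norm (x (xs ! i)))" for xs
    unfolding q_def by (rule kmultilinear_bound[OF kX kY ml])
  \<comment> \<open>The sum of the norm bounds over all words of length \<open>n\<close> is an
    \<open>n\<close>-th power; this is the expansion lemma once more, for products of real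
    numbers.\<close>
  have real_ml: "kmultilinear_on (*) (*) UNIV n (\<lambda>v::nat \<Rightarrow> real. (\<Prod>j<n. v j) * 1) (norm (1::real))" for n
    by (rule kmultilinear_prod[OF kspace_mult])
  have fib: "(\<Sum>xs | xs \<in> A \<and> length xs = n. norm (sY (\<epsilon> ^ sum_list xs) (q xs))) \<le> C n * r ^ n"
    if e: "norm \<epsilon> \<le> t" for n \<epsilon>
  proof -
    have "(\<Sum>xs | xs \<in> A \<and> length xs = n. norm (sY (\<epsilon> ^ sum_list xs) (q xs)))
        \<le> (\<Sum>xs | xs \<in> A \<and> length xs = n. C n * (t ^ sum_list xs * (\<Prod>i<n. norm (x (xs ! i)))))"
    proof (rule sum_mono)
      fix xs assume "xs \<in> {xs \<in> A. length xs = n}"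
      then have l: "length xs = n" by simp
      have "norm (sY (\<epsilon> ^ sum_list xs) (q xs)) \<le> t ^ sum_list xs * (C n * (\<Prod>i<n. norm (x (xs ! i))))"
        using qb[of xs] e t unfolding Y.norm_s norm_power l by (intro mult_mono power_mono) auto
      then show "norm (sY (\<epsilon> ^ sum_list xs) (q xs)) \<le> C n * (t ^ sum_list xs * (\<Prod>i<n. norm (x (xs ! i))))"
        by (simp only: mult.left_commute)
    qed
    also have "\<dots> = C n * (\<Sum>xs | xs \<in> A \<and> length xs = n. t ^ sum_list xs * (\<Prod>i<n. norm (x (xs ! i))))"
      by (simp add: sum_distrib_left)
    also have "(\<Sum>xs | xs \<in> A \<and> length xs = n. t ^ sum_list xs * (\<Prod>i<n. norm (x (xs ! i)))) = (\<Sum>j=1..m. t ^ j * norm (x j)) ^ n"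
      using kmultilinear_expand[OF kspace_mult kspace_mult real_ml[of n] finite_atLeastAtMost[of 1 m], of "\<lambda>j. t ^ j" "\<lambda>j. norm (x j)"]
      unfolding Alen[symmetric] by (simp add: prod_list_power_sum_list)
    also have "\<dots> \<le> r ^ n"
      using tB t by (intro power_mono sum_nonneg) auto
    finally show ?thesis using C[of n] by (simp add: mult_left_mono)
  qed
  have abs: "(\<lambda>xs. sY (\<epsilon> ^ sum_list xs) (q xs)) abs_summable_on A" if "norm \<epsilon> \<le> t" for \<epsilon>
    by (rule abs_summable_on_fibres[where g = length, OF finL fib[OF that] sumC])
  define c where "c d = (\<Sum>xs | xs \<in> A \<and> sum_list xs = d. q xs)" for d
  show ?thesis
    unfolding has_ps_def
  proof (intro exI[of _ c] exI[of _ t] conjI allI impI)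
    show "0 < t" by fact
    have abst: "(\<lambda>xs. norm (norm (sY (of_real t ^ sum_list xs) (q xs)))) summable_on A"
      using abs[of "of_real t"] t by simp
    have "(\<lambda>d. \<Sum>xs | xs \<in> A \<and> sum_list xs = d. norm (sY (of_real t ^ sum_list xs) (q xs))) sums
        infsum (\<lambda>xs. norm (sY (of_real t ^ sum_list xs) (q xs))) A"
      by (rule sums_fibres[OF abst finS])
    then have "summable (\<lambda>d. \<Sum>xs | xs \<in> A \<and> sum_list xs = d. norm (sY (of_real t ^ sum_list xs) (q xs)))"
      by (rule sums_summable)
    then show "summable (\<lambda>d. norm (c d) * t ^ d)"
    proof (rule summable_comparison_test')
      fix d
      have "norm (c d) * t ^ d \<le> (\<Sum>xs | xs \<in> A \<and> sum_list xs = d. norm (q xs)) * t ^ d"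
        unfolding c_def using t by (intro mult_right_mono norm_sum) auto
      also have "\<dots> = (\<Sum>xs | xs \<in> A \<and> sum_list xs = d. norm (sY (of_real t ^ sum_list xs) (q xs)))"
        unfolding sum_distrib_right using t by (intro sum.cong) (auto simp: norm_power)
      finally show "norm (norm (c d) * t ^ d) \<le> (\<Sum>xs | xs \<in> A \<and> sum_list xs = d. norm (sY (of_real t ^ sum_list xs) (q xs)))"
        using t by simp
    qed
    fix \<epsilon> :: 'k assume "norm \<epsilon> < t"
    then have e: "norm \<epsilon> \<le> t" by simp
    have "(\<lambda>n. \<Sum>xs | xs \<in> A \<and> length xs = n. sY (\<epsilon> ^ sum_list xs) (q xs)) sums infsum (\<lambda>xs. sY (\<epsilon> ^ sum_list xs) (q xs)) A"
      by (rule sums_fibres[OF abs[OF e] finL])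
    moreover have "(\<Sum>xs | xs \<in> A \<and> length xs = n. sY (\<epsilon> ^ sum_list xs) (q xs)) = a n (\<lambda>_. \<Sum>j=1..m. sX (\<epsilon> ^ j) (x j))" for n
    proof -
      have "(\<Sum>xs | xs \<in> A \<and> length xs = n. sY (\<epsilon> ^ sum_list xs) (q xs)) =
          (\<Sum>xs | set xs \<subseteq> {1..m} \<and> length xs = n. sY (\<epsilon> ^ sum_list xs) (a n (\<lambda>i. x (xs ! i))))"
        unfolding Alen[symmetric] q_def by (rule sum.cong) auto
      also have "\<dots> = a n (\<lambda>_. \<Sum>j=1..m. sX (\<epsilon> ^ j) (x j))"
        using kmultilinear_expand[OF kX kY ml[of n] finite_atLeastAtMost[of 1 m], of "\<lambda>j. \<epsilon> ^ j" x]
        by (simp add: prod_list_power_sum_list)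
      finally show ?thesis .
    qed
    ultimately have "G (\<Sum>j=1..m. sX (\<epsilon> ^ j) (x j)) = infsum (\<lambda>xs. sY (\<epsilon> ^ sum_list xs) (q xs)) A"
      using G[OF nB[OF e]] sums_unique2 by fastforce
    moreover have "(\<lambda>d. \<Sum>xs | xs \<in> A \<and> sum_list xs = d. sY (\<epsilon> ^ sum_list xs) (q xs)) sums infsum (\<lambda>xs. sY (\<epsilon> ^ sum_list xs) (q xs)) A"
      by (rule sums_fibres[OF abs[OF e] finS])
    moreover have "(\<Sum>xs | xs \<in> A \<and> sum_list xs = d. sY (\<epsilon> ^ sum_list xs) (q xs)) = sY (\<epsilon> ^ d) (c d)" for d
      unfolding c_def Y.scale_sum_right by (rule sum.cong) auto
    ultimately show "(\<lambda>n. sY (\<epsilon> ^ n) (c n)) sums G (\<Sum>j=1..m. sX (\<epsilon> ^ j) (x j))" by simp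
  qed
qed

subsection \<open>The system of undetermined coefficients\<close>

text \<open>A nonzero vector ensures that the bounds \<open>C n\<close> of the expansion are
  nonnegative; in the zero space a bound with negative \<open>C n\<close> could hold. In the
  application \<open>zbar l\<close> is such a vector.\<close>

locale analytic_map =
  B: kspace sB + C: kspace sC
  for sB :: "'k::{real_normed_field,banach} \<Rightarrow> 'b::banach \<Rightarrow> 'b"
    and sC :: "'k \<Rightarrow> 'c::banach \<Rightarrow> 'c" +
  fixes G :: "'b \<Rightarrow> 'c"
  assumes analytic: "kanalytic_at sB sC G 0" and G_0 [simp]: "G 0 = 0"
    and nontrivial: "\<exists>x::'b. x \<noteq> 0"
begin

lemma expansion:
  obtains r a C where "r > 0" "\<And>n. kmultilinear_on sB sC UNIV n (a n) (C n)" "\<And>n. C n \<ge> 0"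
    "summable (\<lambda>n. C n * r ^ n)" "\<And>h. norm h < r \<Longrightarrow> (\<lambda>n. a n (\<lambda>_. h)) sums G h"
proof -
  obtain r a C where r: "r > 0" "\<And>n. kmultilinear_on sB sC UNIV n (a n) (C n)"
    "summable (\<lambda>n. C n * r ^ n)" "\<And>h. norm h < r \<Longrightarrow> (\<lambda>n. a n (\<lambda>_. h)) sums G h"
    using analytic by (auto simp: kanalytic_at_def)
  have "C n \<ge> 0" for n
  proof -
    obtain x :: 'b where x: "x \<noteq> 0" using nontrivial by blast
    have "0 \<le> norm (a n (\<lambda>_. x))" by simp
    also have "\<dots> \<le> C n * norm x ^ n"
      using kmultilinear_bound[OF B.kspace_axioms C.kspace_axioms r(2), of n "\<lambda>_. x"] by simp
    finally show ?thesis using x zero_less_power[of "norm x" n] by (simp add: zero_le_mult_iff del: zero_less_power)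
    
  qed
  then show thesis using that r by blast
qed

lemma quadratic_remainder:
  obtains \<rho> K G' where "\<rho> > 0" "K \<ge> 0"
    "\<And>x. norm x \<le> \<rho> \<Longrightarrow> bounded_linear (G' x)"
    "\<And>x h. norm x \<le> \<rho> \<Longrightarrow> norm (x + h) \<le> \<rho> \<Longrightarrow> norm (G (x + h) - G x - G' x h) \<le> K * (norm h)\<^sup>2"
    "\<And>x h. norm x \<le> \<rho> \<Longrightarrow> norm (G' x h) \<le> K * norm h"
proof -
  obtain r a C where r: "r > 0" "\<And>n. kmultilinear_on sB sC UNIV n (a n) (C n)" "\<And>n. C n \<ge> 0"
    "summable (\<lambda>n. C n * r ^ n)" "\<And>h. norm h < r \<Longrightarrow> (\<lambda>n. a n (\<lambda>_. h)) sums G h"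
    by (rule expansion) blast
  obtain K G' where "K \<ge> 0" "\<And>x. norm x \<le> r / 4 \<Longrightarrow> bounded_linear (G' x)"
    "\<And>x h. norm x \<le> r / 4 \<Longrightarrow> norm (x + h) \<le> r / 4 \<Longrightarrow>
       norm (G (x + h) - G x - G' x h) \<le> K * (norm h)\<^sup>2"
    "\<And>x h. norm x \<le> r / 4 \<Longrightarrow> norm (G' x h) \<le> K * norm h"
    by (rule analytic_quadratic_remainder[where a = a and C = C and r = r and G = G, OF B.kspace_axioms C.kspace_axioms r(2,3,1,4,5)]) (assumption, blast)
  then show thesis using that[of "r / 4" K G'] r(1) by simp
qed

lemma lipschitz_near_0:
  obtains \<rho> K where "\<rho> > 0" "K \<ge> 0"
    "\<And>x y. norm x \<le> \<rho> \<Longrightarrow> norm y \<le> \<rho> \<Longrightarrow> norm (G x - G y) \<le> K * norm (x - y)"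
proof -
  obtain \<rho> K G' where G': "\<rho> > 0" "K \<ge> 0"
    "\<And>x h. norm x \<le> \<rho> \<Longrightarrow> norm (x + h) \<le> \<rho> \<Longrightarrow> norm (G (x + h) - G x - G' x h) \<le> K * (norm h)\<^sup>2"
    "\<And>x h. norm x \<le> \<rho> \<Longrightarrow> norm (G' x h) \<le> K * norm h"
    by (rule quadratic_remainder) blast
  have "norm (G x - G y) \<le> (K * (2 * \<rho>) + K) * norm (x - y)" if "norm x \<le> \<rho>" "norm y \<le> \<rho>" for x y
  proof -
    have "norm (G (y + (x - y)) - G y - G' y (x - y)) \<le> K * (norm (x - y))\<^sup>2"
      using G'(3)[of y "x - y"] that by simp
    moreover have "norm (G' y (x - y)) \<le> K * norm (x - y)" using G'(4) that by blast
    moreover have "norm (G x - G y) \<le> norm (G x - G y - G' y (x - y)) + norm (G' y (x - y))"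
      using norm_triangle_ineq[of "G x - G y - G' y (x - y)" "G' y (x - y)"] by simp
    moreover have "K * (norm (x - y))\<^sup>2 \<le> K * (2 * \<rho> * norm (x - y))"
      unfolding power2_eq_square
      using norm_triangle_ineq4[of x y] that G'(2) by (intro mult_left_mono mult_right_mono) auto
    ultimately show ?thesis by (simp add: algebra_simps)
  qed
  then show thesis using that[of \<rho> "K * (2 * \<rho>) + K"] G'(1,2) by simp
qed

lemma has_ps_poly_curve: "\<exists>c. has_ps sC (\<lambda>\<epsilon>. G (poly_curve sB n z \<epsilon>)) c"
proof -
  obtain r a C where r: "r > 0" "\<And>n. kmultilinear_on sB sC UNIV n (a n) (C n)" "\<And>n. C n \<ge> 0"
    "summable (\<lambda>n. C n * r ^ n)" "\<And>h. norm h < r \<Longrightarrow> (\<lambda>n. a n (\<lambda>_. h)) sums G h"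
    by (rule expansion) blast
  have "poly_curve sB n z \<epsilon> = (\<Sum>j=1..n. sB (\<epsilon> ^ j) (sB (inverse (fact j)) (z j)))" for \<epsilon>
    by (simp add: poly_curve_def divide_inverse)
  then show ?thesis
    using has_ps_analytic_poly[where a = a and C = C and r = r and G = G and m = n
        and x = "\<lambda>j. sB (inverse (fact j)) (z j)", OF B.kspace_axioms C.kspace_axioms r(2,3,1,4,5)] by simp
qed

lemma bigO_poly_curve: "bigO 1 (poly_curve sB n z)"
proof -
  have "bigO 1 (\<lambda>\<epsilon>. \<Sum>j=1..n. sB (\<epsilon> ^ j) (sB (inverse (fact j)) (z j)))"
    by (intro B.bigO_sum B.bigO_pow) auto
  then show ?thesis unfolding poly_curve_def[abs_def] by (simp add: divide_inverse)
qed

lemma bigO_small: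
  fixes u :: "'k \<Rightarrow> 'b"
  assumes "bigO 1 u" "\<rho> > 0"
  obtains r where "r > 0" "\<And>\<epsilon>. norm \<epsilon> < r \<Longrightarrow> norm (u \<epsilon>) \<le> \<rho>"
proof -
  obtain K r where K: "K \<ge> 0" "r > 0" "\<And>\<epsilon>. norm \<epsilon> < r \<Longrightarrow> norm (u \<epsilon>) \<le> K * norm \<epsilon> ^ 1"
    using assms(1) by (rule bigOE) blast
  have "norm (u \<epsilon>) \<le> \<rho>" if "norm \<epsilon> < min r (\<rho> / (K + 1))" for \<epsilon>
  proof -
    have "norm \<epsilon> * (K + 1) < \<rho>" using that K(1) by (simp add: pos_less_divide_eq)
    moreover have "norm (u \<epsilon>) \<le> K * norm \<epsilon>" using K(3)[of \<epsilon>] that by simp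
    moreover have "norm \<epsilon> * (K + 1) = K * norm \<epsilon> + norm \<epsilon>" by (simp add: algebra_simps)
    ultimately show ?thesis using norm_ge_zero[of \<epsilon>] by linarith
  qed
  then show thesis using that[of "min r (\<rho> / (K + 1))"] K(1,2) assms(2) by simp
qed

text \<open>Lipschitz continuity of \<open>G\<close> near 0 passes the order of contact of two
  curves on to their images, so that coefficients beyond the order considered may be cut off or
  changed.\<close>

lemma bigO_G_diff:
  assumes "bigO 1 u" "bigO 1 v" "bigO n (\<lambda>\<epsilon>::'k. u \<epsilon> - v \<epsilon>)"
  shows "bigO n (\<lambda>\<epsilon>. G (u \<epsilon>) - G (v \<epsilon>))"
proof -
  obtain \<rho> K where \<rho>: "\<rho> > 0" "K \<ge> 0"
    "\<And>x y. norm x \<le> \<rho> \<Longrightarrow> norm y \<le> \<rho> \<Longrightarrow> norm (G x - G y) \<le> K * norm (x - y)"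
    by (rule lipschitz_near_0) blast
  obtain r1 where r1: "r1 > 0" "\<And>\<epsilon>. norm \<epsilon> < r1 \<Longrightarrow> norm (u \<epsilon>) \<le> \<rho>"
    by (rule bigO_small[OF assms(1) \<rho>(1)]) blast
  obtain r2 where r2: "r2 > 0" "\<And>\<epsilon>. norm \<epsilon> < r2 \<Longrightarrow> norm (v \<epsilon>) \<le> \<rho>"
    by (rule bigO_small[OF assms(2) \<rho>(1)]) blast
  obtain K' r3 where r3: "r3 > 0" "\<And>\<epsilon>. norm \<epsilon> < r3 \<Longrightarrow> norm (u \<epsilon> - v \<epsilon>) \<le> K' * norm \<epsilon> ^ n"
    using assms(3) by (rule bigOE) blast
  show ?thesis
  proof (rule bigOI[of "min r1 (min r2 r3)"])
    fix \<epsilon> :: 'k assume e: "norm \<epsilon> < min r1 (min r2 r3)"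
    have "norm (G (u \<epsilon>) - G (v \<epsilon>)) \<le> K * norm (u \<epsilon> - v \<epsilon>)" using \<rho>(3) r1 r2 e by simp
    also have "\<dots> \<le> K * (K' * norm \<epsilon> ^ n)" using r3 e \<rho>(2) by (intro mult_left_mono) auto
    finally show "norm (G (u \<epsilon>) - G (v \<epsilon>)) \<le> K * K' * norm \<epsilon> ^ n" by simp
  qed (use r1 r2 r3 in auto)
qed

lemma bigO_poly_curve_diff:
  assumes "i \<le> n"
  shows "bigO (Suc i) (\<lambda>\<epsilon>. poly_curve sB n z \<epsilon> - poly_curve sB i z \<epsilon>)"
proof -
  have "poly_curve sB n z \<epsilon> - poly_curve sB i z \<epsilon> = (\<Sum>j\<in>{i<..n}. sB (\<epsilon> ^ j) (sB (inverse (fact j)) (z j)))" for \<epsilon>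
  proof -
    have "{1..n} = {1..i} \<union> {i<..n}" using assms by auto
    then have "poly_curve sB n z \<epsilon> = poly_curve sB i z \<epsilon> + (\<Sum>j\<in>{i<..n}. sB (\<epsilon> ^ j / fact j) (z j))"
      unfolding poly_curve_def by (simp only:) (rule sum.union_disjoint, auto)
    then show ?thesis by (simp add: divide_inverse)
  qed
  moreover have "bigO (Suc i) (\<lambda>\<epsilon>. \<Sum>j\<in>{i<..n}. sB (\<epsilon> ^ j) (sB (inverse (fact j)) (z j)))"
    by (intro B.bigO_sum B.bigO_pow) auto
  ultimately show ?thesis by simp
qed

text \<open>A tuple solves the first \<open>n\<close> equations iff its curve solves \<open>G = 0\<close> up to order \<open>n\<close>;
  this formulation is manifestly invariant under reparametrisation.\<close>

lemma X_set_iff_bigO: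
  assumes "n \<le> m"
  shows "z \<in> X_set sB sC G n \<longleftrightarrow> bigO (Suc n) (\<lambda>\<epsilon>. G (poly_curve sB m z \<epsilon>))"
proof -
  obtain c where c: "has_ps sC (\<lambda>\<epsilon>. G (poly_curve sB m z \<epsilon>)) c" using has_ps_poly_curve by blast
  have c0: "c 0 = 0" using C.has_ps_at_0[OF c] by (simp add: poly_curve_def power_0_left)
  \<comment> \<open>\<open>T_sys\<close> uses the curve truncated at index \<open>i\<close>. The
    longer curve differs from it only from order \<open>i + 1\<close> on, so both images have the
    same \<open>i\<close>-th coefficient.\<close>
  have T: "T_sys sB sC G i z = sC (fact i) (c i)" if "i \<le> m" for i
  proof -
    obtain c' where c': "has_ps sC (\<lambda>\<epsilon>. G (poly_curve sB i z \<epsilon>)) c'" using has_ps_poly_curve by blast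
    have "bigO (Suc i) (\<lambda>\<epsilon>. G (poly_curve sB m z \<epsilon>) - G (poly_curve sB i z \<epsilon>))"
      by (intro bigO_G_diff bigO_poly_curve bigO_poly_curve_diff that)
    from bigO_diff[OF this bigO_diff[OF C.has_ps_remainder[OF c, of "Suc i"] C.has_ps_remainder[OF c', of "Suc i"]]]
    have "bigO (Suc i) (\<lambda>\<epsilon>. \<Sum>d\<le>i. sC (\<epsilon> ^ d) (c d - c' d))"
      by (simp add: lessThan_Suc_atMost C.scale_right_diff_distrib sum_subtractf)
    from C.bigO_poly_zero[OF this, of i] have "c i = c' i" by simp
    then show ?thesis using C.kderiv_funpow_at_0[OF c', of i] by (simp add: T_sys_def)
  qed
  have "z \<in> X_set sB sC G n \<longleftrightarrow> (\<forall>i\<in>{1..n}. c i = 0)"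
    using T assms by (auto simp: X_set_def)
  also have "\<dots> \<longleftrightarrow> (\<forall>d\<le>n. c d = 0)" using c0 by (metis One_nat_def Suc_leI atLeastAtMost_iff not_gr_zero)
  finally show ?thesis using C.has_ps_bigO_iff[OF c] by simp
qed

end

subsection \<open>Open mapping and closed direct sums\<close>

text \<open>Successive correction: each step halves the residual, and the corrections form a
  geometric series whose sum stays in the closed set \<open>E\<close>.\<close>

lemma exact_preimage_of_approximate:
  fixes T :: "'x::banach \<Rightarrow> 'y::banach"
  assumes E: "closed E" "real_vector.subspace E"
    and add: "\<And>x y. x \<in> E \<Longrightarrow> y \<in> E \<Longrightarrow> T (x + y) = T x + T y"
    and bd: "\<And>x. x \<in> E \<Longrightarrow> norm (T x) \<le> C * norm x"
    and V: "\<And>x y. x \<in> V \<Longrightarrow> y \<in> V \<Longrightarrow> x - y \<in> V" "T ` E \<subseteq> V"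
    and M: "M \<ge> 0"
    and approx: "\<And>y. y \<in> V \<Longrightarrow> \<exists>x\<in>E. norm x \<le> M * norm y \<and> norm (y - T x) \<le> norm y / 2"
    and y: "y \<in> V"
  shows "\<exists>x\<in>E. T x = y \<and> norm x \<le> 2 * M * norm y"
proof -
  obtain f where f: "\<And>y. y \<in> V \<Longrightarrow> f y \<in> E \<and> norm (f y) \<le> M * norm y \<and> norm (y - T (f y)) \<le> norm y / 2"
    using approx by metis
  define w where "w = rec_nat y (\<lambda>_ z. z - T (f z))"
  have w0: "w 0 = y" and wS: "w (Suc n) = w n - T (f (w n))" for n by (auto simp: w_def)
  have wV: "w n \<in> V" for n
  proof (induction n)
    case (Suc n)
    then have "T (f (w n)) \<in> V" using f V(2) by blast
    then show ?case unfolding wS by (rule V(1)[OF Suc])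
  qed (use y w0 in simp)
  have wn: "norm (w n) \<le> norm y * (1 / 2) ^ n" for n
  proof (induction n)
    case (Suc n)
    have "norm (w (Suc n)) \<le> norm (w n) / 2" unfolding wS using f[OF wV] by blast
    then show ?case using Suc by simp
  qed (simp add: w0)
  have fb: "norm (f (w n)) \<le> M * norm y * (1 / 2) ^ n" for n
    using f[OF wV, of n] mult_left_mono[OF wn M, of n] by simp
  have geo: "summable (\<lambda>n. M * norm y * (1 / 2) ^ n)"
    by (intro summable_mult summable_geometric) simp
  have sm: "summable (\<lambda>n. f (w n))"
    by (rule summable_comparison_test'[OF geo]) (use fb in auto)
  have sE: "(\<Sum>i<n. f (w i)) \<in> E" for n
    by (rule real_vector.subspace_sum[OF E(2)]) (use f wV in auto)
  have Ts: "T (\<Sum>i<n. f (w i)) = y - w n" for n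
  proof (induction n)
    case 0
    have "0 \<in> E" using E(2) by (rule real_vector.subspace_0)
    then have "T 0 = 0" using add[of 0 0] by simp
    then show ?case by (simp add: w0)
  next
    case (Suc n)
    then show ?case using add[OF sE] f[OF wV] by (simp add: wS)
  qed
  define x where "x = (\<Sum>n. f (w n))"
  have lim: "(\<lambda>n. \<Sum>i<n. f (w i)) \<longlonglongrightarrow> x"
    unfolding x_def by (rule summable_LIMSEQ[OF sm])
  then have xE: "x \<in> E" using closed_sequentially[OF E(1), of "\<lambda>n. \<Sum>i<n. f (w i)"] sE by blast
  have "(\<lambda>n. T (\<Sum>i<n. f (w i))) \<longlonglongrightarrow> T x"
  proof (rule metric_tendsto_imp_tendsto[where f = "\<lambda>n. C * norm ((\<Sum>i<n. f (w i)) - x)" and a = 0])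
    show "(\<lambda>n. C * norm ((\<Sum>i<n. f (w i)) - x)) \<longlonglongrightarrow> 0"
      by (intro tendsto_mult_right_zero tendsto_norm_zero LIM_zero lim)
    have "dist (T (\<Sum>i<n. f (w i))) (T x) \<le> dist (C * norm ((\<Sum>i<n. f (w i)) - x)) 0" for n
    proof -
      have d: "(\<Sum>i<n. f (w i)) - x \<in> E" by (rule real_vector.subspace_diff[OF E(2) sE xE])
      then have "T (\<Sum>i<n. f (w i)) = T ((\<Sum>i<n. f (w i)) - x) + T x" using add[OF d xE] by simp
      then show ?thesis using bd[OF d] by (simp add: dist_norm)
    qed
    then show "\<forall>\<^sub>F n in sequentially. dist (T (\<Sum>i<n. f (w i))) (T x) \<le> dist (C * norm ((\<Sum>i<n. f (w i)) - x)) 0"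
      by simp
  qed
  moreover have "w \<longlonglongrightarrow> 0"
  proof (rule Lim_null_comparison)
    show "(\<lambda>n. norm y * (1 / 2) ^ n) \<longlonglongrightarrow> 0"
      by (intro tendsto_mult_right_zero LIMSEQ_realpow_zero) auto
  qed (use wn in auto)
  then have "(\<lambda>n. T (\<Sum>i<n. f (w i))) \<longlonglongrightarrow> y - 0" unfolding Ts by (intro tendsto_intros)
  ultimately have "T x = y" using LIMSEQ_unique by fastforce
  moreover have "norm x \<le> (\<Sum>n. M * norm y * (1 / 2) ^ n)"
    unfolding x_def by (rule norm_suminf_le[OF fb geo])
  then have "norm x \<le> 2 * M * norm y" by (simp add: suminf_mult suminf_geometric)
  ultimately show ?thesis using xE by blast
qed

text \<open>Formulated for a map that is linear on a closed subspace and has closed image, because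
  the spaces of the splittings are sets rather than types. Baire's theorem is applied to the image
  with its subspace topology; an interior point of the closure of the image of some ball gives
  approximate preimages, which the preceding lemma makes exact.\<close>

theorem open_mapping_closed_subspace:
  fixes T :: "'x::banach \<Rightarrow> 'y::banach"
  assumes E: "closed E" "real_vector.subspace E"
    and add: "\<And>x y. x \<in> E \<Longrightarrow> y \<in> E \<Longrightarrow> T (x + y) = T x + T y"
    and scl: "\<And>r x. x \<in> E \<Longrightarrow> T (r *\<^sub>R x) = r *\<^sub>R T x"
    and bd: "\<And>x. x \<in> E \<Longrightarrow> norm (T x) \<le> C * norm x"
    and closedV: "closed (T ` E)"
  obtains K where "K > 0" "\<And>y. y \<in> T ` E \<Longrightarrow> \<exists>x\<in>E. T x = y \<and> norm x \<le> K * norm y"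
proof -
  define V where "V = T ` E"
  have E0: "0 \<in> E" using E(2) by (rule real_vector.subspace_0)
  have diff: "T (x - y) = T x - T y" if "x \<in> E" "y \<in> E" for x y
    using add[of x "(-1) *\<^sub>R y"] scl[of y "-1"] real_vector.subspace_scale[OF E(2) that(2), of "-1"] that by simp
  have Vd: "x - y \<in> V" if "x \<in> V" "y \<in> V" for x y
    using that diff real_vector.subspace_diff[OF E(2)] by (auto simp: V_def) (metis imageI)
  have Va: "x + y \<in> V" if "x \<in> V" "y \<in> V" for x y
    using that add real_vector.subspace_add[OF E(2)] by (auto simp: V_def) (metis imageI)
  have Vs: "r *\<^sub>R x \<in> V" if "x \<in> V" for x r
    using that scl real_vector.subspace_scale[OF E(2)] by (auto simp: V_def) (metis imageI)
  have T0: "T 0 = 0" using diff[OF E0 E0] by simp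
  define B where "B n = closure (T ` (E \<inter> cball 0 (real n)))" for n
  have BV: "B n \<subseteq> V" for n
    unfolding B_def V_def by (rule closure_minimal[OF _ closedV]) auto
  have "\<exists>n. top_of_set V interior_of B n \<noteq> {}"
  proof (rule ccontr)
    assume "\<not> ?thesis"
    then have none: "top_of_set V interior_of B n = {}" for n by blast
    have "top_of_set V interior_of (\<Union> (range B)) = {}"
    proof (rule Baire_category_alt)
      show "completely_metrizable_space (top_of_set V) \<or> locally_compact_space (top_of_set V) \<and> regular_space (top_of_set V)"
        using closedV completely_metrizable_space_closedin[OF completely_metrizable_space_euclidean, of V]
        by (simp add: V_def)
      show "closedin (top_of_set V) S \<and> top_of_set V interior_of S = {}" if "S \<in> range B" for S
        using that none BV by (auto simp: B_def intro!: closed_subset)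
    qed auto
    moreover have "\<Union> (range B) = V"
    proof
      show "V \<subseteq> \<Union> (range B)"
      proof
        fix y assume "y \<in> V"
        then obtain x where x: "x \<in> E" "y = T x" by (auto simp: V_def)
        obtain n where "norm x \<le> real n" using real_arch_simple by blast
        then have "y \<in> T ` (E \<inter> cball 0 (real n))" using x by auto
        then have "y \<in> B n" unfolding B_def by (rule subsetD[OF closure_subset])
        then show "y \<in> \<Union> (range B)" by blast
      qed
    qed (use BV in auto)
    ultimately have "top_of_set V interior_of V = {}" by simp
    then have "V = {}" using interior_of_topspace[of "top_of_set V"] by simp
    then show False using E0 by (simp add: V_def)
  qed
  then obtain n y0 where "y0 \<in> top_of_set V interior_of B n" by blast
  then obtain U where U: "open U" "y0 \<in> U \<inter> V" "U \<inter> V \<subseteq> B n"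
    unfolding interior_of_def openin_open by blast
  then obtain e where e: "e > 0" "ball y0 e \<subseteq> U" by (meson IntD1 openE)
  \<comment> \<open>Below, \<open>y0 + t y\<close> and \<open>y0\<close> are approximated within
    \<open>e / 8\<close> by images of vectors of norm at most \<open>n\<close>. Dividing the
    difference by \<open>t = e / (2 norm y)\<close> leaves an error of at most
    \<open>norm y / 2\<close> and a preimage of norm at most
    \<open>4 n / e * norm y\<close>.\<close>
  define M where "M = 4 * real n / e"
  have M: "M \<ge> 0" using e by (simp add: M_def)
  have approx: "\<exists>x\<in>E. norm x \<le> M * norm y \<and> norm (y - T x) \<le> norm y / 2" if y: "y \<in> V" for y
  proof (cases "y = 0")
    case True
    then show ?thesis using E0 T0 by (intro bexI[of _ 0]) auto
  next
    case False
    define t where "t = e / (2 * norm y)"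
    have t: "t > 0" "t * norm y = e / 2" using False e by (auto simp: t_def)
    have "y0 + t *\<^sub>R y \<in> U \<inter> V"
      using e t U(2) Va Vs y by (auto intro!: subsetD[OF e(2)] simp: dist_norm)
    then have mem1: "y0 + t *\<^sub>R y \<in> B n" by (rule subsetD[OF U(3)])
    have mem2: "y0 \<in> B n" by (rule subsetD[OF U(3) U(2)])
    have e8: "e / 8 > 0" using e by simp
    have near: "\<exists>x\<in>E. norm x \<le> real n \<and> dist (T x) b < e / 8" if "b \<in> B n" for b
    proof -
      have "\<exists>z\<in>T ` (E \<inter> cball 0 (real n)). dist z b < e / 8"
        by (rule closure_approachable[THEN iffD1, rule_format, OF _ e8]) (use that in \<open>simp only: B_def\<close>)
      then obtain x where x: "x \<in> E \<inter> cball 0 (real n)" "dist (T x) b < e / 8"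
        by (elim bexE imageE) (simp only:)
      show ?thesis
        by (rule bexI[of _ x]) (use x in simp_all)
    qed
    obtain x1 where x1: "x1 \<in> E" "norm x1 \<le> real n" "dist (T x1) (y0 + t *\<^sub>R y) < e / 8"
      using near[OF mem1] by (elim bexE conjE)
    obtain x2 where x2: "x2 \<in> E" "norm x2 \<le> real n" "dist (T x2) y0 < e / 8"
      using near[OF mem2] by (elim bexE conjE)
    note x = x1 x2
    define x where "x = (1 / t) *\<^sub>R (x1 - x2)"
    have d: "x1 - x2 \<in> E" using x real_vector.subspace_diff[OF E(2)] by blast
    then have xE: "x \<in> E" unfolding x_def by (rule real_vector.subspace_scale[OF E(2)])
    have "norm (x1 - x2) \<le> 2 * real n" using x norm_triangle_ineq4[of x1 x2] by simp
    then have xM: "norm x \<le> M * norm y"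
      using t e False by (simp add: x_def M_def t_def divide_simps)
    have "norm (t *\<^sub>R (y - T x)) \<le> e / 4"
    proof -
      have "t *\<^sub>R (y - T x) = t *\<^sub>R y - (T x1 - T x2)"
        using t scl[OF d, of "1 / t"] diff[of x1 x2] x by (simp add: x_def scaleR_right_diff_distrib)
      also have "\<dots> = (T x2 - y0) - (T x1 - (y0 + t *\<^sub>R y))" by simp
      finally show ?thesis using x norm_triangle_ineq4[of "T x2 - y0" "T x1 - (y0 + t *\<^sub>R y)"]
        by (simp add: dist_norm)
    qed
    then have "t * norm (y - T x) \<le> e / 4" using t(1) by simp
    also have "e / 4 = t * (norm y / 2)" using t(2) by simp
    finally have "t * norm (y - T x) \<le> t * (norm y / 2)" .
    then have "norm (y - T x) \<le> norm y / 2" using t(1) by (rule mult_left_le_imp_le)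
    then show ?thesis using xE xM by blast
  qed
  show thesis
  proof (rule that[of "2 * M + 1"])
    show "2 * M + 1 > 0" using M by simp
    fix y assume "y \<in> T ` E"
    then obtain x where "x \<in> E" "T x = y" "norm x \<le> 2 * M * norm y"
      using exact_preimage_of_approximate[OF E add bd Vd _ M approx, of y] by (auto simp: V_def)
    then show "\<exists>x\<in>E. T x = y \<and> norm x \<le> (2 * M + 1) * norm y"
      by (intro bexI[of _ x] conjI) (auto simp: distrib_right intro: add_increasing2)
  qed
qed

lemma (in kspace) subspace_imp_real_subspace: "subspace E \<Longrightarrow> real_vector.subspace E"
  unfolding real_vector.subspace_def using subspace_0 subspace_add subspace_scale[of E _ "of_real r" for r]
  by auto

lemma closed_direct_sumD:
  assumes "closed_direct_sum s V X Y"
  shows "module.subspace s X" "closed X" "module.subspace s Y" "closed Y" "X \<inter> Y = {0}"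
    "V = {x + y | x y. x \<in> X \<and> y \<in> Y}"
  using assms unfolding closed_direct_sum_def by iprover+

lemma (in kspace) closed_direct_sum_unique:
  assumes "closed_direct_sum s V X Y" "x + y = x' + y'" "x \<in> X" "x' \<in> X" "y \<in> Y" "y' \<in> Y"
  shows "x = x' \<and> y = y'"
proof -
  have ds: "subspace X" "subspace Y" "X \<inter> Y = {0}"
    by (rule closed_direct_sumD[OF assms(1)])+
  have "x - x' = y' - y" using assms(2) by (simp add: algebra_simps)
  moreover have "x - x' \<in> X" "y' - y \<in> Y" using assms(3-6) ds(1,2) subspace_diff by blast+
  ultimately have "x - x' \<in> X \<inter> Y" by simp
  then have "x - x' = 0" unfolding ds(3) by simp
  then show ?thesis using assms(2) by simp
qed

text \<open>Boundedness is the open mapping theorem for the addition map from \<open>X\<close> times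
  \<open>Y\<close> onto \<open>V\<close>.\<close>

theorem (in kspace) closed_direct_sum_projection:
  assumes ds: "closed_direct_sum s V X Y" and V: "closed V"
  obtains q where "klinear_on s s V q" "\<And>v. v \<in> V \<Longrightarrow> q v \<in> Y" "\<And>v. v \<in> V \<Longrightarrow> v - q v \<in> X"
    "\<And>y. y \<in> Y \<Longrightarrow> q y = y" "\<And>x. x \<in> X \<Longrightarrow> q x = 0"
proof -
  have X: "subspace X" "closed X" and Y: "subspace Y" "closed Y"
    and Veq: "V = {x + y | x y. x \<in> X \<and> y \<in> Y}"
    by (rule closed_direct_sumD[OF ds])+
  note uniq = closed_direct_sum_unique[OF ds]
  define T :: "'b \<times> 'b \<Rightarrow> 'b" where "T = (\<lambda>(x, y). x + y)"
  have img: "T ` (X \<times> Y) = V" by (auto simp: T_def Veq image_iff)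
  obtain K where K: "K > 0" "\<And>y. y \<in> T ` (X \<times> Y) \<Longrightarrow> \<exists>x\<in>X \<times> Y. T x = y \<and> norm x \<le> K * norm y"
  proof (rule open_mapping_closed_subspace[of "X \<times> Y" T 2])
    show "closed (X \<times> Y)" using X Y by (intro closed_Times)
    show "real_vector.subspace (X \<times> Y)"
      using subspace_imp_real_subspace[OF X(1)] subspace_imp_real_subspace[OF Y(1)]
      by (rule subspace_Times)
    show "closed (T ` (X \<times> Y))" unfolding img by (rule V)
    fix z :: "'b \<times> 'b"
    have "norm (T z) \<le> norm (fst z) + norm (snd z)" by (simp add: T_def case_prod_beta norm_triangle_ineq)
    also have "\<dots> \<le> 2 * norm z"
      using norm_fst_le[of "fst z" "snd z"] norm_snd_le[of "snd z" "fst z"] by simp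
    finally show "norm (T z) \<le> 2 * norm z" .
  qed (auto simp: T_def scaleR_right_distrib)
  define q where "q v = (SOME y. y \<in> Y \<and> v - y \<in> X)" for v
  have q: "q v \<in> Y \<and> v - q v \<in> X" if "v \<in> V" for v
  proof -
    obtain x y where "x \<in> X" "y \<in> Y" "v = x + y" using \<open>v \<in> V\<close> Veq by blast
    then have "y \<in> Y \<and> v - y \<in> X" by simp
    then show ?thesis unfolding q_def by (rule someI)
  qed
  have qeq: "q (x + y) = y" if "x \<in> X" "y \<in> Y" for x y
  proof -
    have "x + y \<in> V" using that Veq by blast
    from q[OF this] uniq[of x y "x + y - q (x + y)" "q (x + y)"] that show ?thesis by simp
  qed
  have q': "\<exists>x y. v = x + y \<and> x \<in> X \<and> y \<in> Y \<and> q v = y" if "v \<in> V" for v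
    using that q qeq unfolding Veq by blast
  show thesis
  proof (rule that[of q])
    show "klinear_on s s V q"
      unfolding klinear_on_def
    proof (intro conjI ballI allI)
      fix v w assume "v \<in> V" "w \<in> V"
      obtain x y where v: "v = x + y" "x \<in> X" "y \<in> Y" "q v = y" using q'[OF \<open>v \<in> V\<close>] by blast
      obtain x' y' where w: "w = x' + y'" "x' \<in> X" "y' \<in> Y" "q w = y'" using q'[OF \<open>w \<in> V\<close>] by blast
      note vw = v w
      have "q (v + w) = q ((x + x') + (y + y'))" using vw by (simp add: algebra_simps)
      also have "\<dots> = y + y'" by (rule qeq) (use vw X Y subspace_add in auto)
      finally show "q (v + w) = q v + q w" using vw by simp
    next
      fix a v assume "v \<in> V"
      then obtain x y where vw: "v = x + y" "x \<in> X" "y \<in> Y" "q v = y" using q' by blast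
      have "q (s a v) = q (s a x + s a y)" using vw by (simp add: scale_right_distrib)
      also have "\<dots> = s a y" by (rule qeq) (use vw X Y subspace_scale in auto)
      finally show "q (s a v) = s a (q v)" using vw by simp
    next
      show "\<exists>C. \<forall>x\<in>V. norm (q x) \<le> C * norm x"
      proof (intro exI ballI)
        fix v assume "v \<in> V"
        then obtain z where z: "z \<in> X \<times> Y" "T z = v" "norm z \<le> K * norm v" using K(2) img by blast
        then have "q v = snd z" using qeq by (auto simp: T_def)
        then show "norm (q v) \<le> K * norm v" using z(3) norm_snd_le[of "snd z" "fst z"] by simp
      qed
    qed
    show "q y = y" if "y \<in> Y" for y using qeq[of 0 y] that X(1) subspace_0 by simp
    show "q x = 0" if "x \<in> X" for x using qeq[of x 0] that Y(1) subspace_0 by simp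
  qed (use q in auto)
qed

subsection \<open>Smooth maps\<close>

text \<open>The part of \<open>ksmooth_on\<close> that does not mention the function; closure
  properties then amount to writing down a new tower of derivatives.\<close>

definition smooth_tower ::
  "('k \<Rightarrow> 'x::real_normed_vector \<Rightarrow> 'x) \<Rightarrow> ('k \<Rightarrow> 'y::real_normed_vector \<Rightarrow> 'y) \<Rightarrow> 'x set \<Rightarrow> 'x set \<Rightarrow>
   (nat \<Rightarrow> 'x \<Rightarrow> (nat \<Rightarrow> 'x) \<Rightarrow> 'y) \<Rightarrow> bool" where
  "smooth_tower sX sY E U D \<longleftrightarrow> (\<forall>m. \<forall>x\<in>U. (\<exists>C. kmultilinear_on sX sY E m (D m x) C) \<and>
           (\<forall>e>0. \<exists>d>0. \<forall>y\<in>U. norm (y - x) < d \<longrightarrow>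
              (\<forall>v. (\<forall>i<m. v i \<in> E) \<longrightarrow>
                 norm (D m y v - D m x v - D (Suc m) x (v(m := y - x)))
                   \<le> e * norm (y - x) * (\<Prod>i<m. norm (v i)))))"

lemma ksmooth_on_tower:
  "ksmooth_on sX sY E U f \<longleftrightarrow> (\<exists>D. (\<forall>x\<in>U. \<forall>v. D 0 x v = f x) \<and> smooth_tower sX sY E U D)"
  unfolding ksmooth_on_def smooth_tower_def ..

lemma kmultilinear_onI:
  assumes "\<And>v w. (\<And>i. i < n \<Longrightarrow> v i = w i) \<Longrightarrow> f v = f w"
    and "\<And>v i x y a. (\<And>j. j < n \<Longrightarrow> v j \<in> E) \<Longrightarrow> i < n \<Longrightarrow> x \<in> E \<Longrightarrow> y \<in> E \<Longrightarrow>
        f (v(i := sX a x + y)) = sY a (f (v(i := x))) + f (v(i := y))"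
    and "\<And>v. (\<And>j. j < n \<Longrightarrow> v j \<in> E) \<Longrightarrow> norm (f v) \<le> C * (\<Prod>j<n. norm (v j))"
  shows "kmultilinear_on sX sY E n f C"
  using assms unfolding kmultilinear_on_def by (intro conjI allI impI) (blast | metis)+

lemma kmultilinear_onD:
  assumes "kmultilinear_on sX sY E n f C"
  shows "(\<And>i. i < n \<Longrightarrow> v i = w i) \<Longrightarrow> f v = f w"
    and "(\<And>j. j < n \<Longrightarrow> v j \<in> E) \<Longrightarrow> i < n \<Longrightarrow> x \<in> E \<Longrightarrow> y \<in> E \<Longrightarrow>
        f (v(i := sX a x + y)) = sY a (f (v(i := x))) + f (v(i := y))"
    and "(\<And>j. j < n \<Longrightarrow> v j \<in> E) \<Longrightarrow> norm (f v) \<le> C * (\<Prod>j<n. norm (v j))"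
proof -
  show "(\<And>i. i < n \<Longrightarrow> v i = w i) \<Longrightarrow> f v = f w"
    using assms[unfolded kmultilinear_on_def, THEN conjunct1, rule_format, of v w] by blast
  show "(\<And>j. j < n \<Longrightarrow> v j \<in> E) \<Longrightarrow> i < n \<Longrightarrow> x \<in> E \<Longrightarrow> y \<in> E \<Longrightarrow>
        f (v(i := sX a x + y)) = sY a (f (v(i := x))) + f (v(i := y))"
    using assms[unfolded kmultilinear_on_def, THEN conjunct2, THEN conjunct1, rule_format, of v i x y a] by blast
  show "(\<And>j. j < n \<Longrightarrow> v j \<in> E) \<Longrightarrow> norm (f v) \<le> C * (\<Prod>j<n. norm (v j))"
    using assms[unfolded kmultilinear_on_def, THEN conjunct2, THEN conjunct2, rule_format, of v] by blast
qed

lemma kmultilinear_on_nonneg: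
  assumes "kmultilinear_on sX sY E m f C"
  shows "kmultilinear_on sX sY E m f \<bar>C\<bar>"
  using assms unfolding kmultilinear_on_def
  by (auto intro: order_trans[OF _ mult_right_mono[OF abs_ge_self]] simp: prod_nonneg)

lemma smooth_towerE1:
  assumes "smooth_tower sX sY E U D" "x \<in> U"
  obtains C where "C \<ge> 0" "kmultilinear_on sX sY E m (D m x) C"
  using assms unfolding smooth_tower_def by (meson abs_ge_zero kmultilinear_on_nonneg)

lemma smooth_towerE2:
  assumes "smooth_tower sX sY E U D" "x \<in> U" "e > 0"
  obtains d where "d > 0" "\<And>y v. y \<in> U \<Longrightarrow> norm (y - x) < d \<Longrightarrow> (\<And>i. i < m \<Longrightarrow> v i \<in> E) \<Longrightarrow>
    norm (D m y v - D m x v - D (Suc m) x (v(m := y - x))) \<le> e * norm (y - x) * (\<Prod>i<m. norm (v i))"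
proof -
  obtain d where "d > 0" and d: "\<forall>y\<in>U. norm (y - x) < d \<longrightarrow> (\<forall>v. (\<forall>i<m. v i \<in> E) \<longrightarrow>
      norm (D m y v - D m x v - D (Suc m) x (v(m := y - x))) \<le> e * norm (y - x) * (\<Prod>i<m. norm (v i)))"
    using assms(1)[unfolded smooth_tower_def, rule_format, of x m] assms(2,3) by iprover
  show thesis
  proof (rule that[OF \<open>d > 0\<close>])
    fix y v assume y: "y \<in> U" "norm (y - x) < d" and v: "\<And>i. i < m \<Longrightarrow> v i \<in> E"
    have "\<forall>i<m. v i \<in> E" using v by blast
    then show "norm (D m y v - D m x v - D (Suc m) x (v(m := y - x))) \<le> e * norm (y - x) * (\<Prod>i<m. norm (v i))"
      by (rule d[THEN bspec, OF y(1), THEN mp, OF y(2), THEN spec, THEN mp])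
  qed
qed

lemma ksmooth_on_cong:
  "ksmooth_on sX sY E U f \<Longrightarrow> (\<And>x. x \<in> U \<Longrightarrow> f x = g x) \<Longrightarrow> ksmooth_on sX sY E U g"
  unfolding ksmooth_on_def by auto

lemma ksmooth_on_subset:
  assumes "ksmooth_on sX sY E U f" and U': "U' \<subseteq> U"
  shows "ksmooth_on sX sY E U' f"
proof -
  obtain D where D: "\<forall>x\<in>U. \<forall>v. D 0 x v = f x" "smooth_tower sX sY E U D"
    using assms(1) ksmooth_on_tower by blast
  have "smooth_tower sX sY E U' D"
    unfolding smooth_tower_def
  proof (intro allI ballI conjI impI)
    fix m x assume "x \<in> U'"
    then have x: "x \<in> U" using U' by blast
    show "\<exists>C. kmultilinear_on sX sY E m (D m x) C"
      by (rule smooth_towerE1[OF D(2) x]) blast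
    fix e :: real assume e: "e > 0"
    obtain d where d: "d > 0" "\<And>y v. y \<in> U \<Longrightarrow> norm (y - x) < d \<Longrightarrow> (\<And>i. i < m \<Longrightarrow> v i \<in> E) \<Longrightarrow>
       norm (D m y v - D m x v - D (Suc m) x (v(m := y - x))) \<le> e * norm (y - x) * (\<Prod>i<m. norm (v i))"
      by (rule smooth_towerE2[OF D(2) x e, of m]) blast
    show "\<exists>d>0. \<forall>y\<in>U'. norm (y - x) < d \<longrightarrow> (\<forall>v. (\<forall>i<m. v i \<in> E) \<longrightarrow>
        norm (D m y v - D m x v - D (Suc m) x (v(m := y - x))) \<le> e * norm (y - x) * (\<Prod>i<m. norm (v i)))"
      using d U' by (intro exI[of _ d] conjI ballI impI allI) auto
  qed
  moreover have "\<forall>x\<in>U'. \<forall>v. D 0 x v = f x" using D U' by blast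
  ultimately show ?thesis using ksmooth_on_tower by blast
qed

lemma ksmooth_on_add:
  assumes kY: "kspace sY" and f: "ksmooth_on sX sY E U f" and g: "ksmooth_on sX sY E U g"
  shows "ksmooth_on sX sY E U (\<lambda>x. f x + g x)"
proof -
  interpret Y: kspace sY by fact
  obtain D1 where D1: "\<forall>x\<in>U. \<forall>v. D1 0 x v = f x" "smooth_tower sX sY E U D1" using f ksmooth_on_tower by blast
  obtain D2 where D2: "\<forall>x\<in>U. \<forall>v. D2 0 x v = g x" "smooth_tower sX sY E U D2" using g ksmooth_on_tower by blast
  define D where "D = (\<lambda>m x v. D1 m x v + D2 m x v)"
  have "smooth_tower sX sY E U D"
    unfolding smooth_tower_def
  proof (intro allI ballI conjI impI)
    fix m x assume x: "x \<in> U"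
    obtain C1 where C1: "kmultilinear_on sX sY E m (D1 m x) C1" by (rule smooth_towerE1[OF D1(2) x])
    obtain C2 where C2: "kmultilinear_on sX sY E m (D2 m x) C2" by (rule smooth_towerE1[OF D2(2) x])
    have "kmultilinear_on sX sY E m (D m x) (C1 + C2)"
    proof (rule kmultilinear_onI)
      show "D m x v = D m x w" if "\<And>i. i < m \<Longrightarrow> v i = w i" for v w
        unfolding D_def using kmultilinear_onD(1)[OF C1] kmultilinear_onD(1)[OF C2] that by metis
      show "D m x (v(i := sX c a + b)) = sY c (D m x (v(i := a))) + D m x (v(i := b))"
        if "\<And>j. j < m \<Longrightarrow> v j \<in> E" "i < m" "a \<in> E" "b \<in> E" for v i a b c
      proof -
        have "D1 m x (v(i := sX c a + b)) = sY c (D1 m x (v(i := a))) + D1 m x (v(i := b))"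
          by (rule kmultilinear_onD(2)[OF C1]) (use that in auto)
        moreover have "D2 m x (v(i := sX c a + b)) = sY c (D2 m x (v(i := a))) + D2 m x (v(i := b))"
          by (rule kmultilinear_onD(2)[OF C2]) (use that in auto)
        ultimately show ?thesis unfolding D_def by (simp add: Y.scale_right_distrib)
      qed
      show "norm (D m x v) \<le> (C1 + C2) * (\<Prod>j<m. norm (v j))" if "\<And>j. j < m \<Longrightarrow> v j \<in> E" for v
        unfolding D_def distrib_right
        by (intro norm_triangle_mono kmultilinear_onD(3)[OF C1] kmultilinear_onD(3)[OF C2] that)
    qed
    then show "\<exists>C. kmultilinear_on sX sY E m (D m x) C" by blast
    fix e :: real assume "e > 0"
    then have e: "e / 2 > 0" by simp
    obtain d1 where d1: "d1 > 0" "\<And>y v. y \<in> U \<Longrightarrow> norm (y - x) < d1 \<Longrightarrow> (\<And>i. i < m \<Longrightarrow> v i \<in> E) \<Longrightarrow>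
       norm (D1 m y v - D1 m x v - D1 (Suc m) x (v(m := y - x))) \<le> e / 2 * norm (y - x) * (\<Prod>i<m. norm (v i))"
      by (rule smooth_towerE2[OF D1(2) x e, of m]) blast
    obtain d2 where d2: "d2 > 0" "\<And>y v. y \<in> U \<Longrightarrow> norm (y - x) < d2 \<Longrightarrow> (\<And>i. i < m \<Longrightarrow> v i \<in> E) \<Longrightarrow>
       norm (D2 m y v - D2 m x v - D2 (Suc m) x (v(m := y - x))) \<le> e / 2 * norm (y - x) * (\<Prod>i<m. norm (v i))"
      by (rule smooth_towerE2[OF D2(2) x e, of m]) blast
    show "\<exists>d>0. \<forall>y\<in>U. norm (y - x) < d \<longrightarrow> (\<forall>v. (\<forall>i<m. v i \<in> E) \<longrightarrow>
        norm (D m y v - D m x v - D (Suc m) x (v(m := y - x))) \<le> e * norm (y - x) * (\<Prod>i<m. norm (v i)))"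
    proof (intro exI[of _ "min d1 d2"] conjI ballI impI allI)
      fix y v assume y: "y \<in> U" "norm (y - x) < min d1 d2" and v: "\<forall>i<m. v i \<in> E"
      have "D m y v - D m x v - D (Suc m) x (v(m := y - x)) =
        (D1 m y v - D1 m x v - D1 (Suc m) x (v(m := y - x))) + (D2 m y v - D2 m x v - D2 (Suc m) x (v(m := y - x)))"
        by (simp add: D_def)
      also have "norm \<dots> \<le> e / 2 * norm (y - x) * (\<Prod>i<m. norm (v i)) + e / 2 * norm (y - x) * (\<Prod>i<m. norm (v i))"
        by (intro norm_triangle_mono d1 d2) (use y v in auto)
      finally show "norm (D m y v - D m x v - D (Suc m) x (v(m := y - x))) \<le> e * norm (y - x) * (\<Prod>i<m. norm (v i))"
        by simp
    qed (use d1 d2 in auto)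
  qed
  moreover have "\<forall>x\<in>U. \<forall>v. D 0 x v = f x + g x" using D1 D2 by (simp add: D_def)
  ultimately show ?thesis using ksmooth_on_tower by blast
qed

lemma ksmooth_on_compose_klinear:
  assumes T: "klinear_on sY sZ UNIV T" and f: "ksmooth_on sX sY E U f"
  shows "ksmooth_on sX sZ E U (\<lambda>x. T (f x))"
proof -
  have add: "T (a + b) = T a + T b" and scl: "T (sY c a) = sZ c (T a)" for a b c
    using T by (auto simp: klinear_on_def)
  have diff: "T (a - b) = T a - T b" for a b using add[of "a - b" b] by simp
  obtain C0 where "\<And>a. norm (T a) \<le> C0 * norm a" using T by (auto simp: klinear_on_def)
  then have C: "norm (T a) \<le> \<bar>C0\<bar> * norm a" for a
    by (meson abs_ge_self mult_right_mono norm_ge_zero order_trans)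
  obtain D1 where D1: "\<forall>x\<in>U. \<forall>v. D1 0 x v = f x" "smooth_tower sX sY E U D1" using f ksmooth_on_tower by blast
  define D where "D = (\<lambda>m x v. T (D1 m x v))"
  have "smooth_tower sX sZ E U D"
    unfolding smooth_tower_def
  proof (intro allI ballI conjI impI)
    fix m x assume x: "x \<in> U"
    obtain C1 where C1: "C1 \<ge> 0" "kmultilinear_on sX sY E m (D1 m x) C1" by (rule smooth_towerE1[OF D1(2) x])
    have "kmultilinear_on sX sZ E m (D m x) (\<bar>C0\<bar> * C1)"
    proof (rule kmultilinear_onI)
      show "D m x v = D m x w" if "\<And>i. i < m \<Longrightarrow> v i = w i" for v w
        unfolding D_def using kmultilinear_onD(1)[OF C1(2)] that by metis
      show "D m x (v(i := sX c a + b)) = sZ c (D m x (v(i := a))) + D m x (v(i := b))"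
        if "\<And>j. j < m \<Longrightarrow> v j \<in> E" "i < m" "a \<in> E" "b \<in> E" for v i a b c
      proof -
        have "D1 m x (v(i := sX c a + b)) = sY c (D1 m x (v(i := a))) + D1 m x (v(i := b))"
          by (rule kmultilinear_onD(2)[OF C1(2)]) (use that in auto)
        then show ?thesis unfolding D_def by (simp add: add scl)
      qed
      show "norm (D m x v) \<le> \<bar>C0\<bar> * C1 * (\<Prod>j<m. norm (v j))" if "\<And>j. j < m \<Longrightarrow> v j \<in> E" for v
      proof -
        have "\<bar>C0\<bar> * norm (D1 m x v) \<le> \<bar>C0\<bar> * (C1 * (\<Prod>j<m. norm (v j)))"
          by (intro mult_left_mono kmultilinear_onD(3)[OF C1(2)] that) auto
        then show ?thesis using C[of "D1 m x v"] unfolding D_def by (simp add: mult.assoc)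
      qed
    qed
    then show "\<exists>C. kmultilinear_on sX sZ E m (D m x) C" by blast
    fix e :: real assume "e > 0"
    then have e: "e / (\<bar>C0\<bar> + 1) > 0" by (simp add: add_nonneg_pos)
    obtain d1 where d1: "d1 > 0" "\<And>y v. y \<in> U \<Longrightarrow> norm (y - x) < d1 \<Longrightarrow> (\<And>i. i < m \<Longrightarrow> v i \<in> E) \<Longrightarrow>
       norm (D1 m y v - D1 m x v - D1 (Suc m) x (v(m := y - x))) \<le> e / (\<bar>C0\<bar> + 1) * norm (y - x) * (\<Prod>i<m. norm (v i))"
      by (rule smooth_towerE2[OF D1(2) x e, of m]) blast
    show "\<exists>d>0. \<forall>y\<in>U. norm (y - x) < d \<longrightarrow> (\<forall>v. (\<forall>i<m. v i \<in> E) \<longrightarrow>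
        norm (D m y v - D m x v - D (Suc m) x (v(m := y - x))) \<le> e * norm (y - x) * (\<Prod>i<m. norm (v i)))"
    proof (intro exI[of _ d1] conjI ballI impI allI)
      fix y v assume y: "y \<in> U" "norm (y - x) < d1" and v: "\<forall>i<m. v i \<in> E"
      let ?r = "D1 m y v - D1 m x v - D1 (Suc m) x (v(m := y - x))"
      have "D m y v - D m x v - D (Suc m) x (v(m := y - x)) = T ?r" by (simp add: D_def diff)
      also have "norm \<dots> \<le> (\<bar>C0\<bar> + 1) * norm ?r" using C[of ?r] norm_ge_zero[of ?r] unfolding distrib_right mult_1 by linarith
      also have "\<dots> \<le> (\<bar>C0\<bar> + 1) * (e / (\<bar>C0\<bar> + 1) * norm (y - x) * (\<Prod>i<m. norm (v i)))"
        by (intro mult_left_mono d1) (use y v in auto)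
      also have "\<dots> = e * norm (y - x) * (\<Prod>i<m. norm (v i))"
        using abs_ge_zero[of C0] by (simp add: field_simps)
      finally show "norm (D m y v - D m x v - D (Suc m) x (v(m := y - x))) \<le> e * norm (y - x) * (\<Prod>i<m. norm (v i))" .
    qed (use d1 in auto)
  qed
  moreover have "\<forall>x\<in>U. \<forall>v. D 0 x v = T (f x)" using D1 by (simp add: D_def)
  ultimately show ?thesis using ksmooth_on_tower by blast
qed

text \<open>Because \<open>J\<close> is linear and preserves norms, increments and their bounds
  transfer verbatim and the same radius serves. In the application \<open>J\<close> places the
  parameter \<open>p\<close> in the last entry of a bounded sequence.\<close>

lemma ksmooth_on_precompose:
  assumes J: "\<And>x y. J (x + y) = J x + J y" "\<And>a x. J (sZ a x) = sX a (J x)" "\<And>x. norm (J x) = norm x"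
    and JE: "\<And>x. x \<in> E' \<Longrightarrow> J x \<in> E" and JU: "\<And>x. x \<in> U' \<Longrightarrow> J x \<in> U"
    and f: "ksmooth_on sX sY E U f"
  shows "ksmooth_on sZ sY E' U' (\<lambda>x. f (J x))"
proof -
  have Jd: "J (x - y) = J x - J y" for x y using J(1)[of "x - y" y] by simp
  obtain D1 where D1: "\<forall>x\<in>U. \<forall>v. D1 0 x v = f x" "smooth_tower sX sY E U D1" using f ksmooth_on_tower by blast
  define D where "D = (\<lambda>m x v. D1 m (J x) (\<lambda>i. J (v i)))"
  have upd: "(\<lambda>j. J ((v(i := a)) j)) = (\<lambda>j. J (v j))(i := J a)" for v a and i :: nat
    by (rule ext) simp
  have "smooth_tower sZ sY E' U' D"
    unfolding smooth_tower_def
  proof (intro allI ballI conjI impI)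
    fix m x assume x: "x \<in> U'"
    obtain C1 where C1: "kmultilinear_on sX sY E m (D1 m (J x)) C1" by (rule smooth_towerE1[OF D1(2) JU[OF x]])
    have "kmultilinear_on sZ sY E' m (D m x) C1"
    proof (rule kmultilinear_onI)
      show "D m x v = D m x w" if "\<And>i. i < m \<Longrightarrow> v i = w i" for v w
        unfolding D_def by (rule kmultilinear_onD(1)[OF C1]) (simp add: that)
      show "D m x (v(i := sZ c a + b)) = sY c (D m x (v(i := a))) + D m x (v(i := b))"
        if "\<And>j. j < m \<Longrightarrow> v j \<in> E'" "i < m" "a \<in> E'" "b \<in> E'" for v i a b c
        unfolding D_def upd J(1,2) by (rule kmultilinear_onD(2)[OF C1]) (use that JE in auto)
      show "norm (D m x v) \<le> C1 * (\<Prod>j<m. norm (v j))" if "\<And>j. j < m \<Longrightarrow> v j \<in> E'" for v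
        using kmultilinear_onD(3)[OF C1, of "\<lambda>j. J (v j)"] that JE by (simp add: D_def J)
    qed
    then show "\<exists>C. kmultilinear_on sZ sY E' m (D m x) C" by blast
    fix e :: real assume e: "e > 0"
    obtain d1 where d1: "d1 > 0" "\<And>y v. y \<in> U \<Longrightarrow> norm (y - J x) < d1 \<Longrightarrow> (\<And>i. i < m \<Longrightarrow> v i \<in> E) \<Longrightarrow>
       norm (D1 m y v - D1 m (J x) v - D1 (Suc m) (J x) (v(m := y - J x))) \<le> e * norm (y - J x) * (\<Prod>i<m. norm (v i))"
      by (rule smooth_towerE2[OF D1(2) JU[OF x] e, of m]) blast
    show "\<exists>d>0. \<forall>y\<in>U'. norm (y - x) < d \<longrightarrow> (\<forall>v. (\<forall>i<m. v i \<in> E') \<longrightarrow>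
        norm (D m y v - D m x v - D (Suc m) x (v(m := y - x))) \<le> e * norm (y - x) * (\<Prod>i<m. norm (v i)))"
    proof (intro exI[of _ d1] conjI ballI impI allI)
      fix y v assume y: "y \<in> U'" "norm (y - x) < d1" and v: "\<forall>i<m. v i \<in> E'"
      have "norm (J y - J x) < d1" using y J(3)[of "y - x"] by (simp add: Jd)
      then show "norm (D m y v - D m x v - D (Suc m) x (v(m := y - x))) \<le> e * norm (y - x) * (\<Prod>i<m. norm (v i))"
        using d1(2)[of "J y" "\<lambda>j. J (v j)"] v JE JU[OF y(1)] J(3)[of "y - x"]
        unfolding D_def upd Jd J(3) by simp
    qed (use d1 in auto)
  qed
  moreover have "\<forall>x\<in>U'. \<forall>v. D 0 x v = f (J x)" using D1 JU by (simp add: D_def)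
  ultimately show ?thesis using ksmooth_on_tower by blast
qed

lemma ksmooth_on_klinear:
  assumes kY: "kspace sY" and T: "klinear_on sX sY UNIV T"
  shows "ksmooth_on sX sY E U T"
proof -
  interpret Y: kspace sY by fact
  have add: "T (a + b) = T a + T b" and scl: "T (sX c a) = sY c (T a)" for a b c
    using T by (auto simp: klinear_on_def)
  have diff: "T (a - b) = T a - T b" for a b using add[of "a - b" b] by simp
  obtain C where C: "\<And>a. norm (T a) \<le> C * norm a" using T by (auto simp: klinear_on_def)
  define D where "D = (\<lambda>m x (v::nat \<Rightarrow> 'c). if m = (0::nat) then T x else if m = 1 then T (v 0) else 0)"
  have "smooth_tower sX sY E U D"
    unfolding smooth_tower_def
  proof (intro allI ballI conjI impI)
    fix m x
    have "kmultilinear_on sX sY E m (D m x) (if m = 0 then norm (T x) else if m = 1 then C else 0)"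
    proof (rule kmultilinear_onI)
      show "D m x v = D m x w" if "\<And>i. i < m \<Longrightarrow> v i = w i" for v w
        using that by (auto simp: D_def)
      show "D m x (v(i := sX c a + b)) = sY c (D m x (v(i := a))) + D m x (v(i := b))"
        if "\<And>j. j < m \<Longrightarrow> v j \<in> E" "i < m" "a \<in> E" "b \<in> E" for v i a b c
        using that(2) by (auto simp: D_def add scl)
    qed (use C in \<open>auto simp: D_def\<close>)
    then show "\<exists>C. kmultilinear_on sX sY E m (D m x) C" by blast
    fix e :: real assume e: "e > 0"
    have "D m y v - D m x v - D (Suc m) x (v(m := y - x)) = 0" for y v
      by (auto simp: D_def diff)
    moreover have "e * norm (y - x) * (\<Prod>i<m. norm (v i)) \<ge> 0" for y and v :: "nat \<Rightarrow> 'c"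
      using e by (intro mult_nonneg_nonneg prod_nonneg) auto
    ultimately show "\<exists>d>0. \<forall>y\<in>U. norm (y - x) < d \<longrightarrow> (\<forall>v. (\<forall>i<m. v i \<in> E) \<longrightarrow>
        norm (D m y v - D m x v - D (Suc m) x (v(m := y - x))) \<le> e * norm (y - x) * (\<Prod>i<m. norm (v i)))"
      by (intro exI[of _ 1]) simp
  qed
  moreover have "\<forall>x\<in>U. \<forall>v. D 0 x v = T x" by (simp add: D_def)
  ultimately show ?thesis using ksmooth_on_tower by blast
qed

lemma ksmooth_on_const:
  assumes kY: "kspace sY"
  shows "ksmooth_on sX sY E U (\<lambda>_. b)"
proof -
  interpret Y: kspace sY by fact
  define D where "D = (\<lambda>(m::nat) (x::'c) (v::nat \<Rightarrow> 'c). if m = 0 then b else 0)"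
  have "smooth_tower sX sY E U D"
    unfolding smooth_tower_def
  proof (intro allI ballI conjI impI)
    fix m x
    have "kmultilinear_on sX sY E m (D m x) (norm b)"
      by (rule kmultilinear_onI) (auto simp: D_def prod_nonneg)
    then show "\<exists>C. kmultilinear_on sX sY E m (D m x) C" by blast
    fix e :: real assume e: "e > 0"
    have "e * norm (y - x) * (\<Prod>i<m. norm (v i)) \<ge> 0" for y and v :: "nat \<Rightarrow> 'c"
      using e by (intro mult_nonneg_nonneg prod_nonneg) auto
    then show "\<exists>d>0. \<forall>y\<in>U. norm (y - x) < d \<longrightarrow> (\<forall>v. (\<forall>i<m. v i \<in> E) \<longrightarrow>
        norm (D m y v - D m x v - D (Suc m) x (v(m := y - x))) \<le> e * norm (y - x) * (\<Prod>i<m. norm (v i)))"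
      by (intro exI[of _ 1]) (simp add: D_def)
  qed
  moreover have "\<forall>x\<in>U. \<forall>v. D 0 x v = b" by (simp add: D_def)
  ultimately show ?thesis using ksmooth_on_tower by blast
qed

lemma ksmooth_on_sum:
  assumes "kspace sY" "finite J" "\<And>j. j \<in> J \<Longrightarrow> ksmooth_on sX sY E U (f j)"
  shows "ksmooth_on sX sY E U (\<lambda>x. \<Sum>j\<in>J. f j x)"
  using assms(2,3)
  by (induction J rule: finite_induct) (auto intro: ksmooth_on_const ksmooth_on_add assms(1))

lemma ksmooth_on_has_kderivative:
  assumes f: "ksmooth_on sX sY E U f" and x: "x \<in> U" and E: "\<And>y. y \<in> U \<Longrightarrow> y - x \<in> E"
    and sY1: "\<And>y. sY 1 y = y" and sX: "0 \<in> E" "\<And>x. sX 1 x = x" "\<And>a. sX a 0 = 0" "\<And>a. sY a 0 = 0"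
  shows "\<exists>D. has_kderivative_on sX sY E U f x D"
proof -
  obtain D where D: "\<forall>x\<in>U. \<forall>v. D 0 x v = f x" "smooth_tower sX sY E U D" using f ksmooth_on_tower by blast
  define L where "L h = D (Suc 0) x (\<lambda>_. h)" for h
  obtain C where C: "kmultilinear_on sX sY E (Suc 0) (D (Suc 0) x) C" by (rule smooth_towerE1[OF D(2) x])
  have L0: "D (Suc 0) x v = L (v 0)" for v unfolding L_def by (rule kmultilinear_onD(1)[OF C]) simp
  have lin: "L (sX a y + z) = sY a (L y) + L z" if "y \<in> E" "z \<in> E" for a y z
    using kmultilinear_onD(2)[OF C, of "\<lambda>_. 0" 0 y z a] that sX by (simp add: L0)
  have "L 0 = 0" using lin[of 0 0 1] sX sY1 by simp
  have "klinear_on sX sY E L"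
    unfolding klinear_on_def
  proof (intro conjI ballI allI exI)
    show "L (y + z) = L y + L z" if "y \<in> E" "z \<in> E" for y z using lin[OF that, of 1] sX sY1 by simp
    show "L (sX a y) = sY a (L y)" if "y \<in> E" for a y using lin[OF that sX(1), of a] \<open>L 0 = 0\<close> by simp
    show "norm (L y) \<le> C * norm y" if "y \<in> E" for y
      unfolding L_def using kmultilinear_onD(3)[OF C, of "\<lambda>_. y"] that by simp
  qed
  moreover have "((\<lambda>y. norm (f y - f x - L (y - x)) / norm (y - x)) \<longlongrightarrow> 0) (at x within U)"
  proof (rule tendstoI)
    fix e :: real assume "e > 0"
    then have e: "e / 2 > 0" by simp
    obtain d where d: "d > 0" "\<And>y v. y \<in> U \<Longrightarrow> norm (y - x) < d \<Longrightarrow> (\<And>i. i < 0 \<Longrightarrow> v i \<in> E) \<Longrightarrow>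
       norm (D 0 y v - D 0 x v - D (Suc 0) x (v(0 := y - x))) \<le> e / 2 * norm (y - x) * (\<Prod>i<0. norm (v i))"
      by (rule smooth_towerE2[OF D(2) x e, of 0]) blast
    have "dist (norm (f y - f x - L (y - x)) / norm (y - x)) 0 < e" if "y \<in> U" "y \<noteq> x" "dist y x < d" for y
    proof -
      have "norm (f y - f x - L (y - x)) \<le> e / 2 * norm (y - x)"
        using d(2)[of y "\<lambda>_. 0"] that D(1) x L0 by (simp add: dist_norm)
      also have "\<dots> < e * norm (y - x)" using that \<open>e > 0\<close> by simp
      finally show ?thesis using that by (simp add: pos_divide_less_eq)
    qed
    then show "\<forall>\<^sub>F y in at x within U. dist (norm (f y - f x - L (y - x)) / norm (y - x)) 0 < e"
      unfolding eventually_at using d(1) by blast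
  qed
  ultimately show ?thesis unfolding has_kderivative_on_def by blast
qed

text \<open>Leibniz' rule: the \<open>m\<close>-th derivative of \<open>\<epsilon> f\<close> is \<open>\<epsilon>\<close> times that of \<open>f\<close> plus the
  terms in which one of the \<open>m\<close> increments hits the factor \<open>\<epsilon>\<close>; \<open>del i\<close> drops the \<open>i\<close>-th increment.\<close>

definition del :: "nat \<Rightarrow> (nat \<Rightarrow> 'a) \<Rightarrow> nat \<Rightarrow> 'a" where
  "del i v j = (if j < i then v j else v (Suc j))"

lemma prod_del: "i < m \<Longrightarrow> f (v i) * (\<Prod>j<m - 1. f (del i v j)) = (\<Prod>j<m. f (v j) :: real)"
proof (induction m)
  case (Suc m)
  show ?case
  proof (cases "i = m")
    case True
    then show ?thesis by (simp add: del_def)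
  next
    case False
    then have i: "i < m" using Suc.prems by simp
    then obtain m' where m': "m = Suc m'" by (cases m) auto
    have "(\<Prod>j<m. f (del i v j)) = (\<Prod>j<m - 1. f (del i v j)) * f (v m)"
      using i by (simp add: m' del_def)
    then have "f (v i) * (\<Prod>j<m. f (del i v j)) = (f (v i) * (\<Prod>j<m - 1. f (del i v j))) * f (v m)"
      by simp
    then show ?thesis unfolding Suc.IH[OF i] by simp
  qed
qed simp

lemma del_upd_same: "del i (v(i := a)) = del i v"
  by (auto simp: del_def fun_eq_iff)

lemma del_upd_less: "i < k \<Longrightarrow> del k (v(i := a)) = (del k v)(i := a)"
  by (auto simp: del_def fun_eq_iff)

lemma del_upd_greater: "k < i \<Longrightarrow> del k (v(i := a)) = (del k v)(i - 1 := a)"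
  by (auto simp: del_def fun_eq_iff)

lemma ksmooth_on_scale_fst:
  fixes sX :: "'k::{real_normed_field,banach} \<Rightarrow> 'x::banach \<Rightarrow> 'x" and sY :: "'k \<Rightarrow> 'y::banach \<Rightarrow> 'y"
  assumes kY: "kspace sY" and f: "ksmooth_on (scale_prod sX) sY E U f"
    and UE: "\<And>x y. x \<in> U \<Longrightarrow> y \<in> U \<Longrightarrow> y - x \<in> E"
  shows "ksmooth_on (scale_prod sX) sY E U (\<lambda>x. sY (fst x) (f x))"
proof -
  interpret Y: kspace sY by fact
  obtain D1 where D1: "\<forall>x\<in>U. \<forall>v. D1 0 x v = f x" "smooth_tower (scale_prod sX) sY E U D1"
    using f ksmooth_on_tower by blast
  define D where "D = (\<lambda>m x v. sY (fst x) (D1 m x v) + (\<Sum>i<m. sY (fst (v i)) (D1 (m - 1) x (del i v))))"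
  have fst_lin: "fst (scale_prod sX c a + b) = c * fst a + fst b" "fst (scale_prod sX c a) = c * fst a" for c a b
    by (simp_all add: scale_prod_def case_prod_beta)
  have "smooth_tower (scale_prod sX) sY E U D"
    unfolding smooth_tower_def
  proof (intro allI ballI conjI impI)
    fix m x assume x: "x \<in> U"
    obtain C1 where C1: "C1 \<ge> 0" "kmultilinear_on (scale_prod sX) sY E m (D1 m x) C1" by (rule smooth_towerE1[OF D1(2) x])
    obtain C0 where C0: "C0 \<ge> 0" "kmultilinear_on (scale_prod sX) sY E (m - 1) (D1 (m - 1) x) C0" by (rule smooth_towerE1[OF D1(2) x])
    obtain C2 where C2: "C2 \<ge> 0" "kmultilinear_on (scale_prod sX) sY E (Suc m) (D1 (Suc m) x) C2" by (rule smooth_towerE1[OF D1(2) x])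
    have delE: "del i v j \<in> E" if "\<And>j. j < m \<Longrightarrow> v j \<in> E" "j < m - 1" for i j v
      using that by (auto simp: del_def)
    have fst_prod: "norm (fst (v i)) * (\<Prod>j<m - 1. norm (del i v j)) \<le> (\<Prod>j<m. norm (v j))" if "i < m" for v :: "nat \<Rightarrow> 'k \<times> 'x" and i
    proof -
      have "norm (fst (v i)) * (\<Prod>j<m - 1. norm (del i v j)) \<le> norm (v i) * (\<Prod>j<m - 1. norm (del i v j))"
        using norm_fst_le[of "fst (v i)" "snd (v i)"] by (intro mult_right_mono prod_nonneg) auto
      then show ?thesis using prod_del[OF that, of norm v] by simp
    qed
    have "kmultilinear_on (scale_prod sX) sY E m (D m x) (norm (fst x) * C1 + real m * C0)"
    proof (rule kmultilinear_onI)
      show "D m x v = D m x w" if eq: "\<And>i. i < m \<Longrightarrow> v i = w i" for v w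
      proof -
        have "D1 m x v = D1 m x w" by (rule kmultilinear_onD(1)[OF C1(2) eq])
        moreover have "D1 (m - 1) x (del i v) = D1 (m - 1) x (del i w)" if "i < m" for i
          by (rule kmultilinear_onD(1)[OF C0(2)]) (use eq in \<open>auto simp: del_def\<close>)
        ultimately show ?thesis unfolding D_def using eq by (auto intro!: sum.cong)
      qed
      show "D m x (v(i := scale_prod sX c a + b)) = sY c (D m x (v(i := a))) + D m x (v(i := b))"
        if v: "\<And>j. j < m \<Longrightarrow> v j \<in> E" and i: "i < m" and ab: "a \<in> E" "b \<in> E" for v i a b c
      proof -
        have 1: "D1 m x (v(i := scale_prod sX c a + b)) = sY c (D1 m x (v(i := a))) + D1 m x (v(i := b))"
          by (rule kmultilinear_onD(2)[OF C1(2)]) (use v i ab in auto)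
        have 2: "sY (fst ((v(i := scale_prod sX c a + b)) j)) (D1 (m - 1) x (del j (v(i := scale_prod sX c a + b)))) =
            sY c (sY (fst ((v(i := a)) j)) (D1 (m - 1) x (del j (v(i := a))))) + sY (fst ((v(i := b)) j)) (D1 (m - 1) x (del j (v(i := b))))"
          if j: "j < m" for j
        proof -
          consider "j = i" | "i < j" | "j < i" by linarith
          then show ?thesis
          proof cases
            case 1
            then show ?thesis by (simp add: del_upd_same fst_lin Y.scale_left_distrib)
          next
            case 2
            have "D1 (m - 1) x ((del j v)(i := scale_prod sX c a + b)) = sY c (D1 (m - 1) x ((del j v)(i := a))) + D1 (m - 1) x ((del j v)(i := b))"
              by (rule kmultilinear_onD(2)[OF C0(2)]) (use v ab 2 j delE in auto)
            then show ?thesis using 2 by (simp add: del_upd_less Y.scale_right_distrib mult.commute)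
          next
            case 3
            have "D1 (m - 1) x ((del j v)(i - 1 := scale_prod sX c a + b)) = sY c (D1 (m - 1) x ((del j v)(i - 1 := a))) + D1 (m - 1) x ((del j v)(i - 1 := b))"
              by (rule kmultilinear_onD(2)[OF C0(2)]) (use v ab 3 i delE in auto)
            then show ?thesis using 3 by (simp add: del_upd_greater Y.scale_right_distrib mult.commute)
          qed
        qed
        show ?thesis
          unfolding D_def 1 using 2 by (simp add: Y.scale_right_distrib Y.scale_sum_right sum.distrib mult.commute del: fun_upd_apply)
      qed
      show "norm (D m x v) \<le> (norm (fst x) * C1 + real m * C0) * (\<Prod>j<m. norm (v j))" if v: "\<And>j. j < m \<Longrightarrow> v j \<in> E" for v
      proof -
        have "norm (sY (fst x) (D1 m x v)) \<le> norm (fst x) * (C1 * (\<Prod>j<m. norm (v j)))"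
          unfolding Y.norm_s by (intro mult_left_mono kmultilinear_onD(3)[OF C1(2)] v) auto
        moreover have "norm (\<Sum>i<m. sY (fst (v i)) (D1 (m - 1) x (del i v))) \<le> (\<Sum>i<m. C0 * (\<Prod>j<m. norm (v j)))"
        proof (rule sum_norm_le)
          fix i assume "i \<in> {..<m}"
          then have i: "i < m" by simp
          have "norm (sY (fst (v i)) (D1 (m - 1) x (del i v))) \<le> norm (fst (v i)) * (C0 * (\<Prod>j<m - 1. norm (del i v j)))"
            unfolding Y.norm_s by (intro mult_left_mono kmultilinear_onD(3)[OF C0(2)] delE v) auto
          also have "\<dots> = C0 * (norm (fst (v i)) * (\<Prod>j<m - 1. norm (del i v j)))" by simp
          also have "\<dots> \<le> C0 * (\<Prod>j<m. norm (v j))" by (rule mult_left_mono[OF fst_prod[OF i] C0(1)])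
          finally show "norm (sY (fst (v i)) (D1 (m - 1) x (del i v))) \<le> C0 * (\<Prod>j<m. norm (v j))" .
        qed
        ultimately show ?thesis
          unfolding D_def distrib_right by (intro norm_triangle_mono) (auto simp: mult.assoc)
      qed
    qed
    then show "\<exists>C. kmultilinear_on (scale_prod sX) sY E m (D m x) C" by blast
    fix e :: real assume e: "e > 0"
    \<comment> \<open>\<open>B\<close> dominates the total factor of \<open>e'\<close> in the three
      estimates below, and the radius \<open>e' / (1 + C2)\<close> turns the second-order term into
      one with a factor \<open>e'\<close>.\<close>
    define B where "B = norm (fst x) + 1 + C2 + real m + 1"
    have B: "B > 0" using C2(1) norm_ge_zero[of "fst x"] of_nat_0_le_iff[of m, where 'a=real] unfolding B_def by linarith
    define e' where "e' = min 1 (e / (2 * B))"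
    have e': "e' > 0" "e' \<le> 1" "e' * B \<le> e / 2" using e B by (auto simp: e'_def min_def field_simps)
    obtain d1 where d1: "d1 > 0" "\<And>y v. y \<in> U \<Longrightarrow> norm (y - x) < d1 \<Longrightarrow> (\<And>i. i < m \<Longrightarrow> v i \<in> E) \<Longrightarrow>
       norm (D1 m y v - D1 m x v - D1 (Suc m) x (v(m := y - x))) \<le> e' * norm (y - x) * (\<Prod>i<m. norm (v i))"
      by (rule smooth_towerE2[OF D1(2) x e'(1), of m]) blast
    obtain d2 where d2: "d2 > 0" "\<And>y v. y \<in> U \<Longrightarrow> norm (y - x) < d2 \<Longrightarrow> (\<And>i. i < m - 1 \<Longrightarrow> v i \<in> E) \<Longrightarrow>
       norm (D1 (m - 1) y v - D1 (m - 1) x v - D1 (Suc (m - 1)) x (v(m - 1 := y - x))) \<le> e' * norm (y - x) * (\<Prod>i<m - 1. norm (v i))"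
      by (rule smooth_towerE2[OF D1(2) x e'(1), of "m - 1"]) blast
    show "\<exists>d>0. \<forall>y\<in>U. norm (y - x) < d \<longrightarrow> (\<forall>v. (\<forall>i<m. v i \<in> E) \<longrightarrow>
        norm (D m y v - D m x v - D (Suc m) x (v(m := y - x))) \<le> e * norm (y - x) * (\<Prod>i<m. norm (v i)))"
    proof (intro exI[of _ "min d1 (min d2 (e' / (1 + C2)))"] conjI ballI impI allI)
      show "0 < min d1 (min d2 (e' / (1 + C2)))" using d1 d2 e' C2 by simp
      fix y v assume y: "y \<in> U" "norm (y - x) < min d1 (min d2 (e' / (1 + C2)))" and v': "\<forall>i<m. v i \<in> E"
      then have v: "\<And>i. i < m \<Longrightarrow> v i \<in> E" by blast
      define h where "h = y - x"
      have hE: "h \<in> E" unfolding h_def by (rule UE[OF x y(1)])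
      define pv where "pv = (\<Prod>i<m. norm (v i))"
      have pv: "pv \<ge> 0" by (simp add: pv_def prod_nonneg)
      define \<rho> where "\<rho> = D1 m y v - D1 m x v - D1 (Suc m) x (v(m := h))"
      have \<rho>: "norm \<rho> \<le> e' * norm h * pv" unfolding \<rho>_def h_def pv_def by (rule d1(2)) (use y v in auto)
      have fh: "norm (fst h) \<le> norm h" using norm_fst_le[of "fst h" "snd h"] by simp
      have upd_m: "norm (D1 (Suc m) x (v(m := h))) \<le> C2 * norm h * pv"
      proof -
        have "norm (D1 (Suc m) x (v(m := h))) \<le> C2 * (\<Prod>j<Suc m. norm ((v(m := h)) j))"
          by (rule kmultilinear_onD(3)[OF C2(2)]) (use v hE in auto)
        then show ?thesis by (simp add: pv_def mult.commute mult.left_commute)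
      qed
      have del_m: "D1 m x (del m (v(m := h))) = D1 m x v"
        by (rule kmultilinear_onD(1)[OF C1(2)]) (auto simp: del_def)
      have sumS: "(\<Sum>i<Suc m. sY (fst ((v(m := h)) i)) (D1 (Suc m - 1) x (del i (v(m := h))))) =
          (\<Sum>i<m. sY (fst (v i)) (D1 (Suc (m - 1)) x ((del i v)(m - 1 := h)))) + sY (fst h) (D1 m x v)"
        by (simp add: del_m del_upd_greater)
      \<comment> \<open>With \<open>fst y = fst x + fst h\<close> the remainder has three parts: the
        remainder of \<open>f\<close> scaled by \<open>fst x\<close>, the product of
        \<open>fst h\<close> with an increment of the derivative, which is of second order in
        \<open>h\<close>, and the remainders of the derivative of order
        \<open>m - 1\<close>.\<close>
      have split: "D m y v - D m x v - D (Suc m) x (v(m := h)) =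
          sY (fst x) \<rho> + sY (fst h) (\<rho> + D1 (Suc m) x (v(m := h))) +
          (\<Sum>i<m. sY (fst (v i)) (D1 (m - 1) y (del i v) - D1 (m - 1) x (del i v) - D1 (Suc (m - 1)) x ((del i v)(m - 1 := h))))"
      proof -
        have "fst y = fst x + fst h" by (simp add: h_def)
        then show ?thesis
          unfolding D_def sumS \<rho>_def
          by (simp add: algebra_simps sum_subtractf sum.distrib)
      qed
      have t1: "norm (sY (fst x) \<rho>) \<le> norm (fst x) * (e' * norm h * pv)"
        unfolding Y.norm_s by (rule mult_left_mono[OF \<rho>]) simp
      have t2: "norm (sY (fst h) (\<rho> + D1 (Suc m) x (v(m := h)))) \<le> e' * norm h * pv"
      proof -
        have "norm (\<rho> + D1 (Suc m) x (v(m := h))) \<le> e' * norm h * pv + C2 * norm h * pv"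
          by (rule norm_triangle_mono[OF \<rho> upd_m])
        also have "\<dots> \<le> 1 * norm h * pv + C2 * norm h * pv"
          using e' pv by (intro add_mono mult_right_mono) auto
        finally have "norm (sY (fst h) (\<rho> + D1 (Suc m) x (v(m := h)))) \<le> norm h * ((1 + C2) * norm h * pv)"
          unfolding Y.norm_s using fh C2 pv by (intro mult_mono) (auto simp: distrib_right)
        also have "\<dots> = ((1 + C2) * norm h) * (norm h * pv)" by simp
        also have "\<dots> \<le> e' * (norm h * pv)"
        proof (rule mult_right_mono)
          have "norm h < e' / (1 + C2)" using y(2) by (simp add: h_def)
          then show "(1 + C2) * norm h \<le> e'" using C2(1) by (simp add: pos_less_divide_eq mult.commute)
        qed (use pv in simp)
        finally show ?thesis by (simp add: mult.assoc)
      qed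
      have t3: "norm (\<Sum>i<m. sY (fst (v i)) (D1 (m - 1) y (del i v) - D1 (m - 1) x (del i v) - D1 (Suc (m - 1)) x ((del i v)(m - 1 := h))))
          \<le> (\<Sum>i<m. e' * norm h * pv)"
      proof (rule sum_norm_le)
        fix i assume "i \<in> {..<m}"
        then have i: "i < m" by simp
        have "norm (D1 (m - 1) y (del i v) - D1 (m - 1) x (del i v) - D1 (Suc (m - 1)) x ((del i v)(m - 1 := h)))
          \<le> e' * norm h * (\<Prod>j<m - 1. norm (del i v j))"
          unfolding h_def by (rule d2(2)) (use y v delE in auto)
        then have "norm (sY (fst (v i)) (D1 (m - 1) y (del i v) - D1 (m - 1) x (del i v) - D1 (Suc (m - 1)) x ((del i v)(m - 1 := h))))
          \<le> norm (fst (v i)) * (e' * norm h * (\<Prod>j<m - 1. norm (del i v j)))"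
          unfolding Y.norm_s by (rule mult_left_mono) simp
        also have "\<dots> = e' * norm h * (norm (fst (v i)) * (\<Prod>j<m - 1. norm (del i v j)))" by simp
        also have "\<dots> \<le> e' * norm h * pv"
          unfolding pv_def by (rule mult_left_mono[OF fst_prod[OF i]]) (use e' in simp)
        finally show "norm (sY (fst (v i)) (D1 (m - 1) y (del i v) - D1 (m - 1) x (del i v) - D1 (Suc (m - 1)) x ((del i v)(m - 1 := h))))
          \<le> e' * norm h * pv" .
      qed
      have "norm (D m y v - D m x v - D (Suc m) x (v(m := h))) \<le>
          norm (fst x) * (e' * norm h * pv) + e' * norm h * pv + (\<Sum>i<m. e' * norm h * pv)"
        unfolding split by (intro norm_triangle_mono t1 t2 t3)
      also have "\<dots> = e' * (norm (fst x) + 1 + real m) * (norm h * pv)" by (simp add: algebra_simps)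
      also have "\<dots> \<le> e' * B * (norm h * pv)"
        using e' C2(1) pv by (intro mult_right_mono mult_left_mono) (auto simp: B_def)
      also have "\<dots> \<le> e * (norm h * pv)"
        using e' e pv by (intro mult_right_mono) auto
      finally show "norm (D m y v - D m x v - D (Suc m) x (v(m := y - x))) \<le> e * norm (y - x) * (\<Prod>i<m. norm (v i))"
        by (simp add: h_def pv_def mult.assoc)
    qed
  qed
  moreover have "\<forall>x\<in>U. \<forall>v. D 0 x v = sY (fst x) (f x)" using D1 by (simp add: D_def)
  ultimately show ?thesis using ksmooth_on_tower by blast
qed

lemma ksmooth_on_scale_fst_power:
  fixes sX :: "'k::{real_normed_field,banach} \<Rightarrow> 'x::banach \<Rightarrow> 'x" and sY :: "'k \<Rightarrow> 'y::banach \<Rightarrow> 'y"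
  assumes kY: "kspace sY" and f: "ksmooth_on (scale_prod sX) sY E U f"
    and UE: "\<And>x y. x \<in> U \<Longrightarrow> y \<in> U \<Longrightarrow> y - x \<in> E"
  shows "ksmooth_on (scale_prod sX) sY E U (\<lambda>x. sY (fst x ^ n) (f x))"
proof -
  interpret Y: kspace sY by fact
  show ?thesis
  proof (induction n)
    case (Suc n)
    then show ?case using ksmooth_on_scale_fst[OF kY Suc UE] by simp
  qed (use f in simp)
qed

subsection \<open>Bounded linear maps on finite tuples\<close>

text \<open>Tuples are functions of which only the entries \<open>1, \<dots>, k+1\<close> count, so \<open>tnorm\<close> is a seminorm.\<close>

definition tnorm :: "nat \<Rightarrow> (nat \<Rightarrow> 'b::real_normed_vector) \<Rightarrow> real" where
  "tnorm k x = (\<Sum>i=1..k+1. norm (x i))"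

lemma tnorm_nonneg [simp]: "tnorm k x \<ge> 0"
  by (simp add: tnorm_def sum_nonneg)

lemma norm_le_tnorm: "i \<in> {1..k+1} \<Longrightarrow> norm (x i) \<le> tnorm k x"
  unfolding tnorm_def by (rule member_le_sum) auto

lemma tnorm_add: "tnorm k (\<lambda>i. x i + y i) \<le> tnorm k x + tnorm k y"
  unfolding tnorm_def sum.distrib[symmetric] by (intro sum_mono norm_triangle_ineq)

lemma tnorm_le: "(\<And>i. i \<in> {1..k+1} \<Longrightarrow> norm (x i) \<le> b) \<Longrightarrow> tnorm k x \<le> real (k + 1) * b"
  unfolding tnorm_def using sum_bounded_above[of "{1..k+1}" "\<lambda>i. norm (x i)" b] by simp

definition tlinear ::
  "('k \<Rightarrow> 'b::real_normed_vector \<Rightarrow> 'b) \<Rightarrow> ('k \<Rightarrow> 'y::real_normed_vector \<Rightarrow> 'y) \<Rightarrow> nat \<Rightarrow> ((nat \<Rightarrow> 'b) \<Rightarrow> 'y) \<Rightarrow> bool" where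
  "tlinear sB sY k f \<longleftrightarrow> (\<forall>x y. f (\<lambda>i. x i + y i) = f x + f y) \<and>
     (\<forall>a x. f (\<lambda>i. sB a (x i)) = sY a (f x)) \<and> (\<exists>C. \<forall>x. norm (f x) \<le> C * tnorm k x)"

lemma tlinear_add: "tlinear sB sY k f \<Longrightarrow> f (\<lambda>i. x i + y i) = f x + f y"
  by (simp add: tlinear_def)

lemma tlinear_scale: "tlinear sB sY k f \<Longrightarrow> f (\<lambda>i. sB a (x i)) = sY a (f x)"
  by (simp add: tlinear_def)

lemma tlinear_bound:
  assumes "tlinear sB sY k f"
  obtains C where "C > 0" "\<And>x. norm (f x) \<le> C * tnorm k x"
proof -
  obtain C where C: "\<And>x. norm (f x) \<le> C * tnorm k x" using assms by (auto simp: tlinear_def)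
  have "norm (f x) \<le> (\<bar>C\<bar> + 1) * tnorm k x" for x
    using C[of x] by (rule order_trans) (intro mult_right_mono, auto)
  then show thesis using that[of "\<bar>C\<bar> + 1"] by simp
qed

lemma tlinear_diff: "tlinear sB sY k f \<Longrightarrow> f (\<lambda>i. x i - y i) = f x - f y"
  using tlinear_add[of sB sY k f "\<lambda>i. x i - y i" y] by simp

lemma tlinear_0: "tlinear sB sY k f \<Longrightarrow> f (\<lambda>i. 0) = 0"
  using tlinear_diff[of sB sY k f "\<lambda>_. 0" "\<lambda>_. 0"] by simp

text \<open>The bound by the seminorm \<open>tnorm\<close> forces the map to ignore entries outside
  \<open>1, ..., k+1\<close>.\<close>

lemma tlinear_cong:
  assumes "tlinear sB sY k f" "\<And>i. i \<in> {1..k+1} \<Longrightarrow> x i = y i"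
  shows "f x = f y"
proof -
  obtain C where "\<And>x. norm (f x) \<le> C * tnorm k x" by (rule tlinear_bound[OF assms(1)]) blast
  moreover have "tnorm k (\<lambda>i. x i - y i) = 0" unfolding tnorm_def by (rule sum.neutral) (use assms(2) in auto)
  ultimately have "norm (f (\<lambda>i. x i - y i)) \<le> 0" by (metis mult_zero_right)
  then show ?thesis using tlinear_diff[OF assms(1), of x y] by simp
qed

lemma tlinear_coord: "i \<in> {1..k+1} \<Longrightarrow> tlinear sB sB k (\<lambda>x. x i)"
  unfolding tlinear_def using norm_le_tnorm[of i k] by (auto intro!: exI[of _ 1])

lemma tlinear_compose:
  assumes T: "\<And>i. i \<in> {1..k+1} \<Longrightarrow> tlinear sB sB k (\<lambda>x. T x i)" and f: "tlinear sB sY k f"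
  shows "tlinear sB sY k (\<lambda>x. f (T x))"
proof -
  have "\<exists>C. \<forall>x. norm (T x i) \<le> C * tnorm k x" if "i \<in> {1..k+1}" for i
    using T[OF that] by (auto simp: tlinear_def)
  then obtain C where C: "\<And>i x. i \<in> {1..k+1} \<Longrightarrow> norm (T x i) \<le> C i * tnorm k x" by metis
  obtain D where D: "D > 0" "\<And>x. norm (f x) \<le> D * tnorm k x" by (rule tlinear_bound[OF f]) blast
  have TC: "tnorm k (T x) \<le> (\<Sum>i=1..k+1. C i) * tnorm k x" for x
    unfolding tnorm_def[of k "T x"] sum_distrib_right by (rule sum_mono) (rule C)
  show ?thesis
    unfolding tlinear_def
  proof (intro conjI allI exI)
    fix x y
    have "f (T (\<lambda>i. x i + y i)) = f (\<lambda>i. T x i + T y i)"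
      by (rule tlinear_cong[OF f]) (rule tlinear_add[OF T])
    then show "f (T (\<lambda>i. x i + y i)) = f (T x) + f (T y)" by (simp add: tlinear_add[OF f])
  next
    fix a x
    have "f (T (\<lambda>i. sB a (x i))) = f (\<lambda>i. sB a (T x i))"
      by (rule tlinear_cong[OF f]) (rule tlinear_scale[OF T])
    then show "f (T (\<lambda>i. sB a (x i))) = sY a (f (T x))" by (simp add: tlinear_scale[OF f])
  next
    fix x
    have "norm (f (T x)) \<le> D * tnorm k (T x)" by (rule D(2))
    also have "\<dots> \<le> D * ((\<Sum>i=1..k+1. C i) * tnorm k x)" using D(1) by (intro mult_left_mono TC) auto
    finally show "norm (f (T x)) \<le> D * (\<Sum>i=1..k+1. C i) * tnorm k x" by (simp add: mult.assoc)
  qed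
qed

lemma tlinear_tuple_bound:
  assumes T: "\<And>i. i \<in> {1..k+1} \<Longrightarrow> tlinear sB sB k (\<lambda>x. T x i)"
  obtains C where "C > 0" "\<And>x. tnorm k (T x) \<le> C * tnorm k x"
proof -
  have "\<exists>C. \<forall>x. norm (T x i) \<le> C * tnorm k x" if "i \<in> {1..k+1}" for i
    using T[OF that] by (auto simp: tlinear_def)
  then obtain C where C: "\<And>i x. i \<in> {1..k+1} \<Longrightarrow> norm (T x i) \<le> C i * tnorm k x" by metis
  have "tnorm k (T x) \<le> (\<Sum>i=1..k+1. C i) * tnorm k x" for x
    unfolding tnorm_def[of k "T x"] sum_distrib_right by (rule sum_mono) (rule C)
  also have "(\<Sum>i=1..k+1. C i) * tnorm k x \<le> (\<bar>\<Sum>i=1..k+1. C i\<bar> + 1) * tnorm k x" for x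
    by (intro mult_right_mono) auto
  finally show thesis by (intro that[of "\<bar>\<Sum>i=1..k+1. C i\<bar> + 1"]) auto
qed

lemma tlinear_compose_klinear:
  assumes T: "klinear_on sB sY UNIV T" and f: "tlinear sB sB k f"
  shows "tlinear sB sY k (\<lambda>x. T (f x))"
proof -
  obtain D where D: "D > 0" "\<And>x. norm (f x) \<le> D * tnorm k x" by (rule tlinear_bound[OF f]) blast
  obtain C where "\<And>x. norm (T x) \<le> C * norm x" using T by (auto simp: klinear_on_def)
  then have C: "norm (T x) \<le> \<bar>C\<bar> * norm x" for x
    by (meson abs_ge_self mult_right_mono norm_ge_zero order_trans)
  have "norm (T (f x)) \<le> \<bar>C\<bar> * D * tnorm k x" for x
    using C[of "f x"] mult_left_mono[OF D(2)[of x], of "\<bar>C\<bar>"] by simp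
  then show ?thesis
    unfolding tlinear_def using T by (auto simp: klinear_on_def tlinear_add[OF f] tlinear_scale[OF f])
qed

lemma tlinear_plus:
  assumes "kspace sY" "tlinear sB sY k f" "tlinear sB sY k g"
  shows "tlinear sB sY k (\<lambda>x. f x + g x)"
proof -
  interpret Y: kspace sY by fact
  obtain C where C: "\<And>x. norm (f x) \<le> C * tnorm k x" by (rule tlinear_bound[OF assms(2)]) blast
  obtain D where D: "\<And>x. norm (g x) \<le> D * tnorm k x" by (rule tlinear_bound[OF assms(3)]) blast
  have "norm (f x + g x) \<le> (C + D) * tnorm k x" for x
    unfolding distrib_right by (rule norm_triangle_mono[OF C D])
  then show ?thesis
    unfolding tlinear_def
    using tlinear_add[OF assms(2)] tlinear_add[OF assms(3)] tlinear_scale[OF assms(2)] tlinear_scale[OF assms(3)]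
    by (auto simp: Y.scale_right_distrib)
qed

lemma tlinear_zero: "kspace sY \<Longrightarrow> tlinear sB sY k (\<lambda>x. 0)"
proof -
  assume "kspace sY"
  then interpret Y: kspace sY .
  show ?thesis by (auto simp: tlinear_def intro!: exI[of _ 0])
qed

lemma tlinear_sum:
  assumes "kspace sY" "finite J" "\<And>j. j \<in> J \<Longrightarrow> tlinear sB sY k (f j)"
  shows "tlinear sB sY k (\<lambda>x. \<Sum>j\<in>J. f j x)"
  using assms(2,3) by (induction J rule: finite_induct) (auto intro: tlinear_zero tlinear_plus assms(1))

lemma tlinear_scaled:
  assumes "kspace sY" "tlinear sB sY k f"
  shows "tlinear sB sY k (\<lambda>x. sY a (f x))"
proof -
  interpret Y: kspace sY by fact
  obtain C where C: "\<And>x. norm (f x) \<le> C * tnorm k x" by (rule tlinear_bound[OF assms(2)]) blast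
  show ?thesis
    unfolding tlinear_def
  proof (intro conjI allI exI)
    show "norm (sY a (f x)) \<le> norm a * C * tnorm k x" for x
      using mult_left_mono[OF C[of x], of "norm a"] by (simp add: mult.assoc)
  qed (simp_all add: tlinear_add[OF assms(2)] tlinear_scale[OF assms(2)] Y.scale_right_distrib mult.commute)
qed

lemma tlinear_minus:
  assumes "kspace sY" "tlinear sB sY k f" "tlinear sB sY k g"
  shows "tlinear sB sY k (\<lambda>x. f x - g x)"
proof -
  interpret Y: kspace sY by fact
  show ?thesis using tlinear_plus[OF assms(1,2) tlinear_scaled[OF assms(1,3), of "-1"]] by simp
qed

lemma tlinear_mat_app:
  assumes "kspace s" "unit_upper_matrix s k M" "i \<in> {1..k+1}"
  shows "tlinear s s k (\<lambda>x. mat_app k M x i)"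
  unfolding mat_app_def
proof (rule tlinear_sum[OF assms(1)])
  show "tlinear s s k (\<lambda>x. M i j (x j))" if "j \<in> {1..k+1}" for j
    by (rule tlinear_compose_klinear[OF _ tlinear_coord[OF that]]) (use assms that in \<open>auto simp: unit_upper_matrix_def\<close>)
qed simp

lemma mat_app_unit_upper:
  assumes "unit_upper_matrix s k M" "i \<in> {1..k+1}"
  shows "mat_app k M x i = x i + (\<Sum>j\<in>{i<..k+1}. M i j (x j))"
proof -
  have "{1..k+1} = {1..<i} \<union> ({i} \<union> {i<..k+1})" using assms(2) by auto
  then have "mat_app k M x i = (\<Sum>j\<in>{1..<i} \<union> ({i} \<union> {i<..k+1}). M i j (x j))"
    by (simp only: mat_app_def)
  also have "\<dots> = (\<Sum>j\<in>{1..<i}. M i j (x j)) + ((\<Sum>j\<in>{i}. M i j (x j)) + (\<Sum>j\<in>{i<..k+1}. M i j (x j)))"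
    by (subst sum.union_disjoint, (auto)[3], subst sum.union_disjoint) auto
  also have "(\<Sum>j\<in>{1..<i}. M i j (x j)) = 0"
    by (rule sum.neutral) (use assms in \<open>auto simp: unit_upper_matrix_def\<close>)
  also have "(\<Sum>j\<in>{i}. M i j (x j)) = x i" using assms by (auto simp: unit_upper_matrix_def)
  finally show ?thesis by simp
qed

text \<open>Back substitution; with \<open>q i = id\<close> it inverts the unit upper triangular matrix \<open>M\<close>.\<close>

declare sum.cong [fundef_cong]

function bsub :: "nat \<Rightarrow> (nat \<Rightarrow> 'b \<Rightarrow> 'b) \<Rightarrow> (nat \<Rightarrow> nat \<Rightarrow> 'b \<Rightarrow> 'b) \<Rightarrow> (nat \<Rightarrow> 'b) \<Rightarrow> nat \<Rightarrow> 'b::real_normed_vector" where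
  "bsub k q M x i = q i (x i - (\<Sum>j\<in>{i<..k+1}. M i j (bsub k q M x j)))"
  by pat_completeness auto
termination
  by (relation "Wellfounded.measure (\<lambda>(k, q, M, x, i). k + 1 - i)") auto

declare bsub.simps [simp del]
declare sum.cong [fundef_cong del]

lemma tlinear_bsub:
  assumes s: "kspace s" and q: "\<And>i. i \<in> {1..k+1} \<Longrightarrow> klinear_on s s UNIV (q i)" and M: "unit_upper_matrix s k M"
    and i: "i \<in> {1..k+1}"
  shows "tlinear s s k (\<lambda>x. bsub k q M x i)"
  using i
proof (induction "k + 1 - i" arbitrary: i rule: less_induct)
  case less
  have "tlinear s s k (\<lambda>x. q i (x i - (\<Sum>j\<in>{i<..k+1}. M i j (bsub k q M x j))))"
  proof (intro tlinear_compose_klinear[OF q] tlinear_minus[OF s] tlinear_coord tlinear_sum[OF s])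
    fix j assume j: "j \<in> {i<..k+1}"
    then have "tlinear s s k (\<lambda>x. bsub k q M x j)" using less.hyps[of j] less.prems by auto
    moreover have "klinear_on s s UNIV (M i j)" using M less.prems j by (auto simp: unit_upper_matrix_def)
    ultimately show "tlinear s s k (\<lambda>x. M i j (bsub k q M x j))" by (rule tlinear_compose_klinear[rotated])
  qed (use less.prems in auto)
  then show ?case unfolding bsub.simps[of k q M _ i] .
qed

lemma bsub_id_inverse:
  assumes M: "unit_upper_matrix s k M" and i: "i \<in> {1..k+1}"
  shows "mat_app k M (bsub k (\<lambda>_ v. v) M x) i = x i"
    and "bsub k (\<lambda>_ v. v) M (mat_app k M x) i = x i"
proof -
  show "mat_app k M (bsub k (\<lambda>_ v. v) M x) i = x i"
    unfolding mat_app_unit_upper[OF M i] by (subst bsub.simps) simp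
  show "bsub k (\<lambda>_ v. v) M (mat_app k M x) i = x i"
    using i
  proof (induction "k + 1 - i" arbitrary: i rule: less_induct)
    case less
    have "bsub k (\<lambda>_ v. v) M (mat_app k M x) i =
       mat_app k M x i - (\<Sum>j\<in>{i<..k+1}. M i j (bsub k (\<lambda>_ v. v) M (mat_app k M x) j))"
      by (rule bsub.simps)
    also have "(\<Sum>j\<in>{i<..k+1}. M i j (bsub k (\<lambda>_ v. v) M (mat_app k M x) j)) = (\<Sum>j\<in>{i<..k+1}. M i j (x j))"
      by (rule sum.cong[OF refl], rule arg_cong[of _ _ "M i _"], rule less.hyps) (use less.prems in auto)
    finally show ?case unfolding mat_app_unit_upper[OF M less.prems] by simp
  qed
qed

lemma klinear_onD:
  assumes "klinear_on sX sY UNIV f"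
  shows "f (x + y) = f x + f y" "f (sX a x) = sY a (f x)"
  using assms by (auto simp: klinear_on_def)

lemma klinear_on_diff: "klinear_on sX sY UNIV f \<Longrightarrow> f (x - y) = f x - f y"
  using klinear_onD(1)[of sX sY f "x - y" y] by simp

lemma klinear_on_0: "klinear_on sX sY UNIV f \<Longrightarrow> f 0 = 0"
  using klinear_on_diff[of sX sY f 0 0] by simp

lemma klinear_on_sum: "klinear_on sX sY UNIV f \<Longrightarrow> f (\<Sum>j\<in>J. g j) = (\<Sum>j\<in>J. f (g j))"
  by (induction J rule: infinite_finite_induct) (auto simp: klinear_on_0 klinear_onD)

lemma klinear_on_bound:
  assumes "klinear_on sX sY UNIV f"
  obtains C where "C > 0" "\<And>x. norm (f x) \<le> C * norm x"
proof -
  obtain C where C: "\<And>x. norm (f x) \<le> C * norm x" using assms by (auto simp: klinear_on_def)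
  have "norm (f x) \<le> (\<bar>C\<bar> + 1) * norm x" for x
    using C[of x] by (rule order_trans) (intro mult_right_mono, auto)
  then show thesis using that[of "\<bar>C\<bar> + 1"] by simp
qed

lemma klinear_on_bounded_linear:
  assumes "kspace sX" "kspace sY" "klinear_on sX sY UNIV f"
  shows "bounded_linear f"
proof -
  interpret X: kspace sX by fact
  interpret Y: kspace sY by fact
  obtain C where C: "\<And>x. norm (f x) \<le> C * norm x" by (rule klinear_on_bound[OF assms(3)]) blast
  show ?thesis
    by (rule bounded_linear_intro[of _ C])
       (use C klinear_onD[OF assms(3)] klinear_onD(2)[OF assms(3), of "of_real r" for r] in \<open>auto simp: mult.commute\<close>)
qed

subsection \<open>The splitting of the domain\<close>

locale branch = analytic_map sB sC G
  for sB :: "'k::{real_normed_field,banach} \<Rightarrow> 'b::banach \<Rightarrow> 'b"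
    and sC :: "'k \<Rightarrow> 'c::banach \<Rightarrow> 'c" and G +
  fixes k l :: nat
    and zbar :: "nat \<Rightarrow> 'b"
    and A S :: "nat \<Rightarrow> 'b \<Rightarrow> 'c"
    and N Nc :: "nat \<Rightarrow> 'b set" and R Rc :: "nat \<Rightarrow> 'c set"
    and I :: "nat \<Rightarrow> 'b" and M L :: "nat \<Rightarrow> nat \<Rightarrow> 'b \<Rightarrow> 'b"
    and P :: "'b set"
  assumes dexp: "deriv_expansion sB sC G k zbar A"
    and chain: "operator_chain sB sC A k N Nc R Rc S"
    and surj: "sum_operator_surj k N S"
    and smat: "solution_matrices sB sC G k zbar N I M L"
    and l: "l \<in> {1..k}" and zl: "zbar l \<noteq> 0" and zbelow: "\<forall>j\<in>{1..<l}. zbar j = 0"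
    and Psum: "closed_direct_sum sB (N (k+1)) P (range (\<lambda>a. sB a (zbar l)))"
begin

lemma N_0: "N 0 = UNIV"
  using chain by (simp add: operator_chain_def)

lemma nsplit:
  assumes "i \<in> {1..k+1}"
  shows "closed_direct_sum sB (N (i - 1)) (Nc i) (N i)" "closed_direct_sum sC (Rc (i - 1)) (R i) (Rc i)"
    "klinear_on sB sC (N (i - 1)) (S i)" "R i = S i ` N (i - 1)" "bij_betw (S i) (Nc i) (R i)"
    "N i = {v \<in> N (i - 1). S i v = 0}"
  using chain assms unfolding operator_chain_def by blast+

lemma subspace_N: "i \<le> k + 1 \<Longrightarrow> B.subspace (N i)" and closed_N: "i \<le> k + 1 \<Longrightarrow> closed (N i)"
  using closed_direct_sumD(3,4)[OF nsplit(1)[of i]] N_0 B.subspace_UNIV by (cases "i = 0"; simp)+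

lemma subspace_Nc: "i \<in> {1..k+1} \<Longrightarrow> B.subspace (Nc i)" and closed_Nc: "i \<in> {1..k+1} \<Longrightarrow> closed (Nc i)"
  using closed_direct_sumD(1,2)[OF nsplit(1)[of i]] by simp_all

lemma N_step: "i \<in> {1..k+1} \<Longrightarrow> N i \<subseteq> N (i - 1)"
  using nsplit(6)[of i] by blast

lemma Nc_subset: "i \<in> {1..k+1} \<Longrightarrow> Nc i \<subseteq> N (i - 1)"
proof
  fix v assume i: "i \<in> {1..k+1}" and v: "v \<in> Nc i"
  have "0 \<in> N i" by (rule B.subspace_0[OF subspace_N]) (use i in simp)
  then have "\<exists>x y. v = x + y \<and> x \<in> Nc i \<and> y \<in> N i" using v by (intro exI[of _ v] exI[of _ 0]) simp
  then show "v \<in> N (i - 1)" unfolding closed_direct_sumD(6)[OF nsplit(1)[OF i]] by blast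
qed

lemma N_antimono: "i \<le> j \<Longrightarrow> j \<le> k + 1 \<Longrightarrow> N j \<subseteq> N i"
proof (induction j rule: dec_induct)
  case (step n)
  then show ?case using N_step[of "Suc n"] by auto
qed simp

lemma ex_local_projection:
  assumes "i \<in> {1..k+1}"
  shows "\<exists>q. klinear_on sB sB (N (i - 1)) q \<and> (\<forall>v\<in>N (i - 1). q v \<in> N i \<and> v - q v \<in> Nc i) \<and>
     (\<forall>v\<in>N i. q v = v) \<and> (\<forall>v\<in>Nc i. q v = 0)"
  by (rule B.closed_direct_sum_projection[OF nsplit(1)[OF assms] closed_N]) (use assms in auto)

definition lproj :: "nat \<Rightarrow> 'b \<Rightarrow> 'b" where
  "lproj i = (SOME q. klinear_on sB sB (N (i - 1)) q \<and> (\<forall>v\<in>N (i - 1). q v \<in> N i \<and> v - q v \<in> Nc i) \<and>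
     (\<forall>v\<in>N i. q v = v) \<and> (\<forall>v\<in>Nc i. q v = 0))"

lemma lproj:
  assumes "i \<in> {1..k+1}"
  shows "klinear_on sB sB (N (i - 1)) (lproj i)" "\<And>v. v \<in> N (i - 1) \<Longrightarrow> lproj i v \<in> N i"
    "\<And>v. v \<in> N (i - 1) \<Longrightarrow> v - lproj i v \<in> Nc i" "\<And>v. v \<in> N i \<Longrightarrow> lproj i v = v" "\<And>v. v \<in> Nc i \<Longrightarrow> lproj i v = 0"
  using someI_ex[OF ex_local_projection[OF assms]] unfolding lproj_def by blast+

text \<open>A composition of local projections, hence for \<open>i \<le> k + 1\<close> a bounded
  projection of the whole space onto \<open>N i\<close>; its kernel is the sum of
  \<open>Nc 1, ..., Nc i\<close>.\<close>

primrec proj :: "nat \<Rightarrow> 'b \<Rightarrow> 'b" where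
  "proj 0 v = v"
| "proj (Suc i) v = lproj (Suc i) (proj i v)"

lemma proj_mem: "i \<le> k + 1 \<Longrightarrow> proj i v \<in> N i"
  by (induction i) (use N_0 lproj(2) in auto)

lemma klinear_proj: "i \<le> k + 1 \<Longrightarrow> klinear_on sB sB UNIV (proj i)"
proof (induction i)
  case 0
  show ?case by (auto simp: klinear_on_def intro!: exI[of _ 1])
next
  case (Suc i)
  then have IH: "klinear_on sB sB UNIV (proj i)" and q: "klinear_on sB sB (N i) (lproj (Suc i))"
    using lproj(1)[of "Suc i"] by auto
  have m: "proj i v \<in> N i" for v using proj_mem Suc.prems by simp
  obtain C where C: "C > 0" "\<And>v. norm (proj i v) \<le> C * norm v" by (rule klinear_on_bound[OF IH]) blast
  obtain D where D: "\<And>v. v \<in> N i \<Longrightarrow> norm (lproj (Suc i) v) \<le> D * norm v" using q unfolding klinear_on_def by blast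
  have "norm (proj (Suc i) v) \<le> \<bar>D\<bar> * C * norm v" for v
  proof -
    have "norm (proj (Suc i) v) \<le> D * norm (proj i v)" using D[OF m] by simp
    also have "\<dots> \<le> \<bar>D\<bar> * norm (proj i v)" by (intro mult_right_mono) auto
    also have "\<dots> \<le> \<bar>D\<bar> * (C * norm v)" by (intro mult_left_mono C) auto
    finally show ?thesis by (simp add: mult.assoc)
  qed
  then show ?case using q m unfolding klinear_on_def by (auto simp: klinear_onD[OF IH])
qed

lemma proj_id: "i \<le> k + 1 \<Longrightarrow> v \<in> N i \<Longrightarrow> proj i v = v"
proof (induction i)
  case (Suc i)
  then have "v \<in> N i" using N_step[of "Suc i"] by auto
  then show ?case using Suc lproj(4)[of "Suc i"] by simp
qed simp

lemma proj_Nc: "j \<in> {1..k+1} \<Longrightarrow> j \<le> i \<Longrightarrow> i \<le> k + 1 \<Longrightarrow> v \<in> Nc j \<Longrightarrow> proj i v = 0"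
proof (induction i)
  case (Suc i)
  show ?case
  proof (cases "j = Suc i")
    case True
    then have "v \<in> N i" using Nc_subset[of "Suc i"] Suc.prems by auto
    then have "proj i v = v" using proj_id[of i] Suc.prems by simp
    then show ?thesis using lproj(5)[of "Suc i"] Suc.prems True by simp
  next
    case False
    then have "proj i v = 0" using Suc by simp
    then show ?thesis using klinear_on_0[OF klinear_proj, of "Suc i"] lproj(4)[of "Suc i" 0] B.subspace_0[OF subspace_N, of "Suc i"] Suc.prems by simp
  qed
qed simp

declare proj.simps(2) [simp del]

text \<open>The component in \<open>Nc i\<close> for the splitting of the whole space into
  \<open>Nc 1, ..., Nc (k+1)\<close> and \<open>N (k+1)\<close>.\<close>

definition W :: "nat \<Rightarrow> 'b \<Rightarrow> 'b" where "W i v = proj (i - 1) v - proj i v"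

lemma klinear_minus:
  assumes "klinear_on sB sB UNIV f" "klinear_on sB sB UNIV g"
  shows "klinear_on sB sB UNIV (\<lambda>v. f v - g v)"
proof -
  obtain C where C: "\<And>v. norm (f v) \<le> C * norm v" by (rule klinear_on_bound[OF assms(1)]) blast
  obtain D where D: "\<And>v. norm (g v) \<le> D * norm v" by (rule klinear_on_bound[OF assms(2)]) blast
  have "norm (f v - g v) \<le> (C + D) * norm v" for v
    using norm_triangle_ineq4[of "f v" "g v"] C[of v] D[of v] by (simp add: distrib_right)
  then show ?thesis
    unfolding klinear_on_def by (auto simp: klinear_onD[OF assms(1)] klinear_onD[OF assms(2)] B.scale_right_diff_distrib)
qed

lemma klinear_W: "i \<in> {1..k+1} \<Longrightarrow> klinear_on sB sB UNIV (W i)"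
  unfolding W_def[abs_def] by (intro klinear_minus klinear_proj) auto

lemma W_mem: "i \<in> {1..k+1} \<Longrightarrow> W i v \<in> Nc i"
  using lproj(3)[of i "proj (i - 1) v"] proj_mem[of "i - 1" v] by (cases i) (auto simp: W_def proj.simps(2))

lemma W_sum: "v = (\<Sum>i=1..k+1. W i v) + proj (k + 1) v"
proof -
  have "(\<Sum>i=1..j. W i v) = v - proj j v" for j by (induction j) (auto simp: W_def)
  then show ?thesis by (simp only: diff_add_cancel)
qed

lemma W_Nc: "i \<in> {1..k+1} \<Longrightarrow> j \<in> {1..k+1} \<Longrightarrow> v \<in> Nc j \<Longrightarrow> W i v = (if i = j then v else 0)"
proof -
  assume i: "i \<in> {1..k+1}" and j: "j \<in> {1..k+1}" and v: "v \<in> Nc j"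
  have vN: "v \<in> N (j - 1)" using Nc_subset[OF j] v by blast
  consider "i < j" | "i = j" | "j < i" by linarith
  then show ?thesis
  proof cases
    case 1
    then have "i \<le> j - 1" "i - 1 \<le> j - 1" "j - 1 \<le> k + 1" using j by auto
    then have "v \<in> N i" "v \<in> N (i - 1)" using N_antimono[of _ "j - 1"] vN by blast+
    moreover have "i \<le> k + 1" "i - 1 \<le> k + 1" using i by auto
    ultimately show ?thesis using 1 proj_id by (simp add: W_def)
  next
    case 2
    moreover have "j - 1 \<le> k + 1" using j by auto
    ultimately show ?thesis using i v vN proj_id[of "j - 1" v] proj_Nc[of j j v] by (simp add: W_def)
  next
    case 3
    then show ?thesis using i j v proj_Nc[of j i v] proj_Nc[of j "i - 1" v] by (simp add: W_def)
  qed
qed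

lemma W_N:
  assumes i: "i \<in> {1..k+1}" and v: "v \<in> N (k + 1)"
  shows "W i v = 0"
proof -
  have le: "i \<le> k + 1" "i - 1 \<le> k + 1" using i by auto
  then have "v \<in> N i" "v \<in> N (i - 1)" using N_antimono[of _ "k + 1"] v by blast+
  then show ?thesis using proj_id le by (simp add: W_def)
qed

lemma zbar_l_mem: "zbar l \<in> N (k + 1)"
proof -
  have "0 \<in> P" by (rule B.subspace_0[OF closed_direct_sumD(1)[OF Psum]])
  then have "\<exists>x y. zbar l = x + y \<and> x \<in> P \<and> y \<in> range (\<lambda>a. sB a (zbar l))"
    by (intro exI[of _ 0] exI[of _ "zbar l"]) (auto intro: range_eqI[of _ _ 1])
  then show ?thesis unfolding closed_direct_sumD(6)[OF Psum] by blast
qed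

lemma P_subset: "P \<subseteq> N (k + 1)"
proof
  fix p assume "p \<in> P"
  then have "\<exists>x y. p = x + y \<and> x \<in> P \<and> y \<in> range (\<lambda>a. sB a (zbar l))"
    by (intro exI[of _ p] exI[of _ 0]) (auto intro: range_eqI[of _ _ 0])
  then show "p \<in> N (k + 1)" unfolding closed_direct_sumD(6)[OF Psum] by blast
qed

lemma subspace_P: "B.subspace P" and closed_P: "closed P"
  using closed_direct_sumD[OF Psum] by auto

text \<open>The projection of \<open>N (k+1)\<close> onto the line along \<open>P\<close> takes
  multiples of \<open>zbar l\<close> as values. As \<open>zbar l\<close> is nonzero, the factor is
  unique, and composing with \<open>proj (k + 1)\<close> gives a bounded functional on the whole
  space.\<close>

lemma ex_line_coordinate:
  "\<exists>\<sigma>. klinear_on sB (*) UNIV \<sigma> \<and> (\<forall>v. proj (k + 1) v - sB (\<sigma> v) (zbar l) \<in> P) \<and>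
     (\<forall>p\<in>P. \<forall>a. \<sigma> (p + sB a (zbar l)) = a) \<and> (\<forall>i\<in>{1..k+1}. \<forall>v\<in>Nc i. \<sigma> v = 0)"
proof -
  obtain q where q: "klinear_on sB sB (N (k + 1)) q" "\<And>v. v \<in> N (k + 1) \<Longrightarrow> q v \<in> range (\<lambda>a. sB a (zbar l))"
    "\<And>v. v \<in> N (k + 1) \<Longrightarrow> v - q v \<in> P" "\<And>y. y \<in> range (\<lambda>a. sB a (zbar l)) \<Longrightarrow> q y = y" "\<And>x. x \<in> P \<Longrightarrow> q x = 0"
    by (rule B.closed_direct_sum_projection[OF Psum closed_N]) auto
  have pm: "proj (k + 1) v \<in> N (k + 1)" for v by (rule proj_mem) simp
  have lin: "klinear_on sB sB UNIV (proj (k + 1))" by (rule klinear_proj) simp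
  have "\<forall>v. \<exists>a. q (proj (k + 1) v) = sB a (zbar l)" using q(2)[OF pm] by blast
  then obtain \<sigma> where \<sigma>: "\<And>v. q (proj (k + 1) v) = sB (\<sigma> v) (zbar l)" by metis
  have eq: "a = b" if "sB a (zbar l) = sB b (zbar l)" for a b
    using that zl B.scale_cancel_right by blast
  have q_add: "q (v + w) = q v + q w" if "v \<in> N (k + 1)" "w \<in> N (k + 1)" for v w
    using q(1) that by (auto simp: klinear_on_def)
  have q_scl: "q (sB a v) = sB a (q v)" if "v \<in> N (k + 1)" for v a
    using q(1) that by (auto simp: klinear_on_def)
  have "klinear_on sB (*) UNIV \<sigma>"
    unfolding klinear_on_def
  proof (intro conjI ballI allI)
    fix v w
    have "sB (\<sigma> (v + w)) (zbar l) = sB (\<sigma> v + \<sigma> w) (zbar l)"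
      unfolding \<sigma>[symmetric] klinear_onD[OF lin] B.scale_left_distrib q_add[OF pm pm] ..
    then show "\<sigma> (v + w) = \<sigma> v + \<sigma> w" by (rule eq)
  next
    fix a v
    have "sB (\<sigma> (sB a v)) (zbar l) = sB a (sB (\<sigma> v) (zbar l))"
      unfolding \<sigma>[symmetric] klinear_onD[OF lin] q_scl[OF pm] ..
    then show "\<sigma> (sB a v) = a * \<sigma> v" by (intro eq) simp
  next
    obtain C where C: "C > 0" "\<And>v. norm (proj (k + 1) v) \<le> C * norm v" by (rule klinear_on_bound[OF lin]) blast
    obtain D where D: "\<And>v. v \<in> N (k + 1) \<Longrightarrow> norm (q v) \<le> D * norm v" using q(1) unfolding klinear_on_def by blast
    have "norm (\<sigma> v) \<le> \<bar>D\<bar> * C / norm (zbar l) * norm v" for v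
    proof -
      have "norm (\<sigma> v) * norm (zbar l) \<le> D * norm (proj (k + 1) v)" using D[OF pm, of v] unfolding \<sigma> by simp
      also have "\<dots> \<le> \<bar>D\<bar> * norm (proj (k + 1) v)" by (intro mult_right_mono) auto
      also have "\<dots> \<le> \<bar>D\<bar> * (C * norm v)" by (intro mult_left_mono C) auto
      finally show ?thesis using zl by (simp add: pos_le_divide_eq mult.assoc)
    qed
    then show "\<exists>C. \<forall>v\<in>UNIV. norm (\<sigma> v) \<le> C * norm v" by blast
  qed
  moreover have "proj (k + 1) v - sB (\<sigma> v) (zbar l) \<in> P" for v
    unfolding \<sigma>[symmetric] by (rule q(3)[OF pm])
  moreover have "\<sigma> (p + sB a (zbar l)) = a" if "p \<in> P" for p a
  proof (rule eq)
    have m: "p \<in> N (k + 1)" "sB a (zbar l) \<in> N (k + 1)"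
      using P_subset that B.subspace_scale[OF subspace_N zbar_l_mem] by auto
    then have "proj (k + 1) (p + sB a (zbar l)) = p + sB a (zbar l)"
      by (intro proj_id B.subspace_add[OF subspace_N]) auto
    then show "sB (\<sigma> (p + sB a (zbar l))) (zbar l) = sB a (zbar l)"
      unfolding \<sigma>[symmetric] using q_add[OF m] q(4)[OF rangeI[of _ a]] q(5) that by simp
  qed
  moreover have "\<sigma> v = 0" if "i \<in> {1..k+1}" "v \<in> Nc i" for i v
  proof -
    have "proj (k + 1) v = 0" by (rule proj_Nc[of i]) (use that in auto)
    then have "sB (\<sigma> v) (zbar l) = sB 0 (zbar l)" unfolding \<sigma>[symmetric] using q(5)[of 0] B.subspace_0[OF subspace_P] by simp
    then show ?thesis by (rule eq)
  qed
  ultimately show ?thesis by blast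
qed

definition lcoord :: "'b \<Rightarrow> 'k" where
  "lcoord = (SOME \<sigma>. klinear_on sB (*) UNIV \<sigma> \<and> (\<forall>v. proj (k + 1) v - sB (\<sigma> v) (zbar l) \<in> P) \<and>
     (\<forall>p\<in>P. \<forall>a. \<sigma> (p + sB a (zbar l)) = a) \<and> (\<forall>i\<in>{1..k+1}. \<forall>v\<in>Nc i. \<sigma> v = 0))"

definition pproj :: "'b \<Rightarrow> 'b" where
  "pproj v = proj (k + 1) v - sB (lcoord v) (zbar l)"

lemma klinear_lcoord: "klinear_on sB (*) UNIV lcoord"
  and pproj_mem: "pproj v \<in> P"
  and lcoord_line: "p \<in> P \<Longrightarrow> lcoord (p + sB a (zbar l)) = a"
  and lcoord_Nc: "i \<in> {1..k+1} \<Longrightarrow> w \<in> Nc i \<Longrightarrow> lcoord w = 0"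
  using someI_ex[OF ex_line_coordinate] unfolding lcoord_def[symmetric] pproj_def by blast+

lemma klinear_pproj: "klinear_on sB sB UNIV pproj"
proof -
  have "klinear_on sB sB UNIV (\<lambda>v. sB (lcoord v) (zbar l))"
  proof -
    obtain C where C: "C > 0" "\<And>v. norm (lcoord v) \<le> C * norm v" by (rule klinear_on_bound[OF klinear_lcoord]) blast
    have "norm (sB (lcoord v) (zbar l)) \<le> C * norm (zbar l) * norm v" for v
      using mult_right_mono[OF C(2)[of v], of "norm (zbar l)"] by (simp add: mult.commute mult.left_commute)
    then show ?thesis unfolding klinear_on_def
      by (auto simp: klinear_onD[OF klinear_lcoord] B.scale_left_distrib)
  qed
  then show ?thesis unfolding pproj_def[abs_def] by (intro klinear_minus klinear_proj) auto
qed

lemma coordinates: "v = (\<Sum>i=1..k+1. W i v) + (pproj v + sB (lcoord v) (zbar l))"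
  using W_sum[of v] by (simp add: pproj_def)

lemma
  assumes "\<And>i. i \<in> {1..k+1} \<Longrightarrow> w i \<in> Nc i" "p \<in> P"
  shows W_of_coordinates: "i \<in> {1..k+1} \<Longrightarrow> W i ((\<Sum>i=1..k+1. w i) + (p + sB a (zbar l))) = w i"
    and pproj_of_coordinates: "pproj ((\<Sum>i=1..k+1. w i) + (p + sB a (zbar l))) = p"
    and lcoord_of_coordinates: "lcoord ((\<Sum>i=1..k+1. w i) + (p + sB a (zbar l))) = a"
proof -
  have n: "p + sB a (zbar l) \<in> N (k + 1)"
    by (intro B.subspace_add[OF subspace_N] subsetD[OF P_subset] B.subspace_scale[OF subspace_N] zbar_l_mem assms) auto
  show "W i ((\<Sum>i=1..k+1. w i) + (p + sB a (zbar l))) = w i" if i: "i \<in> {1..k+1}" for i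
  proof -
    have "W i ((\<Sum>i=1..k+1. w i) + (p + sB a (zbar l))) = (\<Sum>j=1..k+1. W i (w j)) + W i (p + sB a (zbar l))"
      by (simp only: klinear_onD[OF klinear_W[OF i]] klinear_on_sum[OF klinear_W[OF i]])
    also have "W i (p + sB a (zbar l)) = 0" by (rule W_N[OF i n])
    also have "(\<Sum>j=1..k+1. W i (w j)) = (\<Sum>j=1..k+1. if i = j then w j else 0)"
      by (rule sum.cong[OF refl]) (use W_Nc i assms in auto)
    also have "\<dots> = w i" using i by simp
    finally show ?thesis by simp
  qed
  have l: "lcoord ((\<Sum>i=1..k+1. w i) + (p + sB a (zbar l))) = (\<Sum>j=1..k+1. lcoord (w j)) + lcoord (p + sB a (zbar l))"
    by (simp only: klinear_onD[OF klinear_lcoord] klinear_on_sum[OF klinear_lcoord])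
  also have "\<dots> = 0 + a"
    by (intro arg_cong2[of _ _ _ _ "(+)"] sum.neutral) (use lcoord_Nc assms lcoord_line in auto)
  finally show la: "lcoord ((\<Sum>i=1..k+1. w i) + (p + sB a (zbar l))) = a" by simp
  have lin: "klinear_on sB sB UNIV (proj (k + 1))" by (rule klinear_proj) simp
  have "proj (k + 1) ((\<Sum>i=1..k+1. w i) + (p + sB a (zbar l))) = (\<Sum>j=1..k+1. proj (k + 1) (w j)) + proj (k + 1) (p + sB a (zbar l))"
    by (simp only: klinear_onD[OF lin] klinear_on_sum[OF lin])
  also have "\<dots> = 0 + (p + sB a (zbar l))"
    by (intro arg_cong2[of _ _ _ _ "(+)"] sum.neutral ballI proj_id n)
       (use proj_Nc[of _ "k + 1"] assms in auto)
  finally show "pproj ((\<Sum>i=1..k+1. w i) + (p + sB a (zbar l))) = p"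
    unfolding pproj_def la by simp
qed

subsection \<open>Expansion of the equation along the approximate solution\<close>

definition base :: "'k \<Rightarrow> 'b" where "base \<epsilon> = poly_curve sB k zbar \<epsilon>"

text \<open>\<open>Dl \<epsilon> \<delta>\<close> is the change of the curve when the coefficients \<open>z\<^sub>2\<^sub>k\<^sub>+\<^sub>1, \<dots>, z\<^sub>k\<^sub>+\<^sub>1\<close> change by
  \<open>\<delta>\<close>, and \<open>Lam d \<delta>\<close> is the coefficient of \<open>\<epsilon>\<close> to the power \<open>k+1+d\<close> in \<open>G'(base \<epsilon>) (Dl \<epsilon> \<delta>)\<close>.\<close>

definition hat :: "nat \<Rightarrow> (nat \<Rightarrow> 'b) \<Rightarrow> 'b" where
  "hat s \<delta> = sB (inverse (fact (k + 1 + s))) (\<delta> (k + 1 - s))"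

definition Dl :: "'k \<Rightarrow> (nat \<Rightarrow> 'b) \<Rightarrow> 'b" where
  "Dl \<epsilon> \<delta> = (\<Sum>s\<le>k. sB (\<epsilon> ^ (k + 1 + s)) (hat s \<delta>))"

definition Lam :: "nat \<Rightarrow> (nat \<Rightarrow> 'b) \<Rightarrow> 'c" where
  "Lam d \<delta> = (\<Sum>s\<le>d. A (d - s) (hat s \<delta>))"

lemma klinear_A: "klinear_on sB sC UNIV (A i)"
  using dexp by (simp add: deriv_expansion_def)

lemma tlinear_hat: "s \<le> k \<Longrightarrow> tlinear sB sB k (hat s)"
  unfolding hat_def[abs_def] by (intro tlinear_scaled tlinear_coord B.kspace_axioms) auto

lemma tlinear_Dl: "tlinear sB sB k (Dl \<epsilon>)"
  unfolding Dl_def[abs_def]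
  by (intro tlinear_sum tlinear_scaled tlinear_hat B.kspace_axioms) auto

lemma tlinear_Lam: "d \<le> k \<Longrightarrow> tlinear sB sC k (Lam d)"
  unfolding Lam_def[abs_def]
  by (intro tlinear_sum tlinear_compose_klinear[OF klinear_A] tlinear_hat C.kspace_axioms) auto

lemma norm_hat: "s \<le> k \<Longrightarrow> norm (hat s \<delta>) \<le> tnorm k \<delta>"
proof -
  assume s: "s \<le> k"
  have "norm (hat s \<delta>) = inverse (fact (k + 1 + s)) * norm (\<delta> (k + 1 - s))"
    by (simp only: hat_def B.norm_s norm_inverse norm_fact)
  also have "\<dots> \<le> 1 * norm (\<delta> (k + 1 - s))"
    by (intro mult_right_mono) (simp_all only: inverse_le_1_iff fact_ge_1 norm_ge_zero simp_thms)
  also have "\<dots> \<le> tnorm k \<delta>" using norm_le_tnorm[of "k + 1 - s" k \<delta>] s by simp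
  finally show ?thesis .
qed

lemma norm_Dl:
  assumes "norm \<epsilon> \<le> 1"
  shows "norm (Dl \<epsilon> \<delta>) \<le> real (k + 1) * (norm \<epsilon> ^ (k + 1) * tnorm k \<delta>)"
proof -
  have "norm (Dl \<epsilon> \<delta>) \<le> (\<Sum>s\<le>k. norm \<epsilon> ^ (k + 1) * tnorm k \<delta>)"
    unfolding Dl_def
  proof (rule sum_norm_le)
    fix s assume "s \<in> {..k}"
    then show "norm (sB (\<epsilon> ^ (k + 1 + s)) (hat s \<delta>)) \<le> norm \<epsilon> ^ (k + 1) * tnorm k \<delta>"
      unfolding B.norm_s norm_power
      by (intro mult_mono norm_hat power_decreasing assms) auto
  qed
  then show ?thesis by simp
qed

lemma poly_curve_completion: "poly_curve sB (2*k+1) (completion k zbar y) \<epsilon> = base \<epsilon> + Dl \<epsilon> y"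
proof -
  have "{1..2*k+1} = {1..k} \<union> {k+1..2*k+1}" by auto
  then have "poly_curve sB (2*k+1) (completion k zbar y) \<epsilon> =
      (\<Sum>j=1..k. sB (\<epsilon> ^ j / fact j) (completion k zbar y j)) + (\<Sum>j=k+1..2*k+1. sB (\<epsilon> ^ j / fact j) (completion k zbar y j))"
    unfolding poly_curve_def by (simp only:) (rule sum.union_disjoint, auto)
  also have "(\<Sum>j=1..k. sB (\<epsilon> ^ j / fact j) (completion k zbar y j)) = base \<epsilon>"
    unfolding base_def poly_curve_def by (rule sum.cong) (auto simp: completion_def)
  also have "(\<Sum>j=k+1..2*k+1. sB (\<epsilon> ^ j / fact j) (completion k zbar y j)) = Dl \<epsilon> y"
    unfolding Dl_def
    by (rule sum.reindex_bij_witness[of _ "\<lambda>s. k + 1 + s" "\<lambda>j. j - (k + 1)"])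
       (auto simp: completion_def hat_def divide_inverse Suc_diff_le mult_2 intro!: arg_cong[of _ _ y])
  finally show ?thesis .
qed

lemma bigO_base: "bigO 1 base"
  unfolding base_def[abs_def] by (rule bigO_poly_curve)

lemma bigO_Dl: "bigO (k + 1) (\<lambda>\<epsilon>. Dl \<epsilon> \<delta>)"
  by (rule bigOI[of 1 _ "real (k + 1) * tnorm k \<delta>"]) (use norm_Dl[of _ \<delta>] in \<open>auto simp: mult.commute mult.left_commute\<close>)

lemma bigO_curve: "bigO 1 (\<lambda>\<epsilon>. base \<epsilon> + Dl \<epsilon> \<delta>)"
  by (intro bigO_add bigO_base bigO_mono[OF bigO_Dl]) auto

lemma X_bar_completion_iff:
  assumes "n \<le> 2 * k + 1"
  shows "completion k zbar y \<in> X_bar sB sC G k zbar n \<longleftrightarrow> bigO (Suc n) (\<lambda>\<epsilon>. G (base \<epsilon> + Dl \<epsilon> y))"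
  using X_set_iff_bigO[OF assms, of "completion k zbar y"]
  unfolding poly_curve_completion by (simp add: X_bar_def completion_def)

lemma bigO_G_zeta: "bigO (2 * k + 2) (\<lambda>\<epsilon>. G (base \<epsilon> + Dl \<epsilon> I))"
  using X_bar_completion_iff[of "2 * k + 1" I] smat by (simp add: solution_matrices_def)

definition Gd :: "'k \<Rightarrow> 'b \<Rightarrow> 'c" where "Gd \<epsilon> = frechet_derivative G (at (base \<epsilon>))"

text \<open>A Frechet derivative is a priori only real linear; its homogeneity over the scalar field
  is read off from the expansion.\<close>

lemma Gd_remainder:
  obtains r K where "r > 0" "r \<le> 1" "\<And>n. K n \<ge> 0"
    "\<And>\<epsilon> v n. norm \<epsilon> < r \<Longrightarrow> norm (Gd \<epsilon> v - (\<Sum>i<n. sC (\<epsilon> ^ i) (A i v))) \<le> K n * norm \<epsilon> ^ n * norm v"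
    "\<And>\<epsilon> v a. norm \<epsilon> < r \<Longrightarrow> Gd \<epsilon> (sB a v) = sC a (Gd \<epsilon> v)"
proof -
  obtain r C where r: "r > 0" and C: "\<And>i v. norm (A i v) \<le> C i * norm v" and sm: "summable (\<lambda>i. C i * r ^ i)"
    and sums: "\<And>\<epsilon> v. norm \<epsilon> < r \<Longrightarrow> (\<lambda>i. sC (\<epsilon> ^ i) (A i v)) sums Gd \<epsilon> v"
    using dexp unfolding deriv_expansion_def Gd_def base_def by blast
  have C0: "C i \<ge> 0" for i
  proof -
    obtain x :: 'b where x: "x \<noteq> 0" using nontrivial by blast
    have "0 \<le> C i * norm x" using C[of i x] norm_ge_zero order_trans by blast
    then show ?thesis using x by (simp add: zero_le_mult_iff)
  qed
  define K where "K n = (\<Sum>i. C (i + n) * r ^ (i + n)) / r ^ n" for n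
  have smn: "summable (\<lambda>i. C (i + n) * r ^ (i + n))" for n
    using sm by (rule summable_ignore_initial_segment)
  have K0: "K n \<ge> 0" for n
    unfolding K_def by (intro divide_nonneg_nonneg suminf_nonneg smn mult_nonneg_nonneg C0) (use r in auto)
  show thesis
  proof (rule that[of "min r 1" K])
    fix \<epsilon> :: 'k and v n assume "norm \<epsilon> < min r 1"
    then have e: "norm \<epsilon> < r" by simp
    have s: "(\<lambda>i. sC (\<epsilon> ^ (i + n)) (A (i + n) v)) sums (Gd \<epsilon> v - (\<Sum>i<n. sC (\<epsilon> ^ i) (A i v)))"
      using sums[OF e] by (rule sums_split_initial_segment)
    have bnd: "norm (sC (\<epsilon> ^ (i + n)) (A (i + n) v)) \<le> norm \<epsilon> ^ n / r ^ n * norm v * (C (i + n) * r ^ (i + n))" for i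
    proof -
      have "norm \<epsilon> ^ i \<le> r ^ i" using e by (intro power_mono) auto
      then have "norm \<epsilon> ^ n * norm \<epsilon> ^ i * norm (A (i + n) v) \<le> norm \<epsilon> ^ n * r ^ i * (C (i + n) * norm v)"
        using C[of "i + n" v] r by (intro mult_mono) auto
      then show ?thesis using r by (simp add: norm_power power_add norm_mult mult.commute mult.left_commute)
    qed
    have smb: "summable (\<lambda>i. norm \<epsilon> ^ n / r ^ n * norm v * (C (i + n) * r ^ (i + n)))"
      by (rule summable_mult[OF smn])
    have "norm (Gd \<epsilon> v - (\<Sum>i<n. sC (\<epsilon> ^ i) (A i v))) \<le> (\<Sum>i. norm \<epsilon> ^ n / r ^ n * norm v * (C (i + n) * r ^ (i + n)))"
      unfolding sums_unique[OF s] by (rule norm_suminf_le[OF bnd smb])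
    also have "\<dots> = norm \<epsilon> ^ n / r ^ n * norm v * (\<Sum>i. C (i + n) * r ^ (i + n))" by (rule suminf_mult[OF smn])
    also have "\<dots> = K n * norm \<epsilon> ^ n * norm v" by (simp add: K_def)
    finally show "norm (Gd \<epsilon> v - (\<Sum>i<n. sC (\<epsilon> ^ i) (A i v))) \<le> K n * norm \<epsilon> ^ n * norm v" .
  next
    fix \<epsilon> :: 'k and v a assume "norm \<epsilon> < min r 1"
    then have e: "norm \<epsilon> < r" by simp
    have "(\<lambda>i. sC a (sC (\<epsilon> ^ i) (A i v))) sums sC a (Gd \<epsilon> v)"
      by (rule bounded_linear.sums[OF C.bounded_linear_s sums[OF e]])
    moreover have "sC a (sC (\<epsilon> ^ i) (A i v)) = sC (\<epsilon> ^ i) (A i (sB a v))" for i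
      by (simp add: klinear_onD[OF klinear_A] mult.commute)
    ultimately show "Gd \<epsilon> (sB a v) = sC a (Gd \<epsilon> v)"
      using sums[OF e, of "sB a v"] sums_unique2 by fastforce
  qed (use r K0 in auto)
qed

text \<open>The Cauchy product of the expansion of \<open>G'\<close> with the perturbation, cut off
  after total degree \<open>2k+1\<close>.\<close>

lemma Lam_triangle:
  "(\<Sum>d\<le>k. sC (\<epsilon> ^ (k + 1 + d)) (Lam d \<delta>)) =
   (\<Sum>s\<le>k. sC (\<epsilon> ^ (k + 1 + s)) (\<Sum>i<Suc (k - s). sC (\<epsilon> ^ i) (A i (hat s \<delta>))))"
proof -
  let ?f = "\<lambda>s i. sC (\<epsilon> ^ (k + 1 + s + i)) (A i (hat s \<delta>))"
  have "(\<Sum>d\<le>k. sC (\<epsilon> ^ (k + 1 + d)) (Lam d \<delta>)) = (\<Sum>d\<le>k. \<Sum>s\<le>d. ?f s (d - s))"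
    unfolding Lam_def C.scale_sum_right by (intro sum.cong refl) (auto simp: add.assoc)
  also have "\<dots> = (\<Sum>(s, i)\<in>{(s, i). s + i \<le> k}. ?f s i)"
    by (rule sum.triangle_reindex_eq[symmetric])
  also have "{(s, i). s + i \<le> k} = Sigma {..k} (\<lambda>s. {..<Suc (k - s)})" by auto
  also have "(\<Sum>(s, i)\<in>Sigma {..k} (\<lambda>s. {..<Suc (k - s)}). ?f s i) = (\<Sum>s\<le>k. \<Sum>i<Suc (k - s). ?f s i)"
    by (rule sum.Sigma[symmetric]) auto
  also have "\<dots> = (\<Sum>s\<le>k. sC (\<epsilon> ^ (k + 1 + s)) (\<Sum>i<Suc (k - s). sC (\<epsilon> ^ i) (A i (hat s \<delta>))))"
    by (simp only: C.scale_sum_right power_add mult.assoc C.scale_scale)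
  finally show ?thesis .
qed

text \<open>All perturbations have order \<open>k+1\<close>, so quadratic remainders have order
  \<open>2k+2\<close>. The residual at \<open>I\<close> has that order too, because \<open>I\<close>
  completes \<open>zbar\<close> to an element of \<open>X_bar\<close> at level \<open>2k+1\<close>.
  Below this order the equation is therefore linear in \<delta>, uniformly for bounded
  \<delta>.\<close>

theorem G_expansion:
  assumes "R0 \<ge> 0"
  obtains r K where "r > 0" "K \<ge> 0"
    "\<And>\<epsilon> \<delta>. norm \<epsilon> < r \<Longrightarrow> tnorm k \<delta> \<le> R0 \<Longrightarrow>
      norm (G (base \<epsilon> + Dl \<epsilon> I + Dl \<epsilon> \<delta>) - (\<Sum>d\<le>k. sC (\<epsilon> ^ (k + 1 + d)) (Lam d \<delta>))) \<le> K * norm \<epsilon> ^ (2 * k + 2)"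
proof -
  obtain \<rho> Kq G' where \<rho>: "\<rho> > 0" "Kq \<ge> 0"
    and G'lin: "\<And>x. norm x \<le> \<rho> \<Longrightarrow> bounded_linear (G' x)"
    and G'q: "\<And>x h. norm x \<le> \<rho> \<Longrightarrow> norm (x + h) \<le> \<rho> \<Longrightarrow> norm (G (x + h) - G x - G' x h) \<le> Kq * (norm h)\<^sup>2"
    by (rule quadratic_remainder) blast
  \<comment> \<open>Identifies the derivative used in \<open>deriv_expansion\<close> with the one
    for which the quadratic remainder is known.\<close>
  have G'fr: "frechet_derivative G (at x) = G' x" if x: "norm x < \<rho>" for x
  proof -
    have "(G has_derivative G' x) (at x)"
      unfolding has_derivative_at
    proof (intro conjI G'lin)
      show "norm x \<le> \<rho>" using x by simp
      show "(\<lambda>h. norm (G (x + h) - G x - G' x h) / norm h) \<midarrow>0\<rightarrow> 0"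
      proof (rule metric_tendsto_imp_tendsto[where f = "\<lambda>h. Kq * norm h" and a = 0])
        show "(\<lambda>h. Kq * norm h) \<midarrow>0\<rightarrow> 0" by (rule tendsto_mult_right_zero, rule tendsto_norm_zero, rule tendsto_ident_at)
        have "dist (norm (G (x + h) - G x - G' x h) / norm h) 0 \<le> dist (Kq * norm h) 0" if "h \<noteq> 0" "norm h < \<rho> - norm x" for h
        proof -
          have "norm (x + h) \<le> \<rho>" using that norm_triangle_ineq[of x h] by linarith
          then have "norm (G (x + h) - G x - G' x h) \<le> Kq * (norm h)\<^sup>2" using G'q x by simp
          then show ?thesis using that \<rho> by (simp add: pos_divide_le_eq power2_eq_square mult.assoc)
        qed
        then show "\<forall>\<^sub>F h in at 0. dist (norm (G (x + h) - G x - G' x h) / norm h) 0 \<le> dist (Kq * norm h) 0"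
          unfolding eventually_at using x by (intro exI[of _ "\<rho> - norm x"]) auto
      qed
    qed
    then show ?thesis by (metis frechet_derivative_at)
  qed
  obtain r1 K1 where r1: "r1 > 0" "r1 \<le> 1" "\<And>n. K1 n \<ge> 0"
    "\<And>\<epsilon> v n. norm \<epsilon> < r1 \<Longrightarrow> norm (Gd \<epsilon> v - (\<Sum>i<n. sC (\<epsilon> ^ i) (A i v))) \<le> K1 n * norm \<epsilon> ^ n * norm v"
    "\<And>\<epsilon> v a. norm \<epsilon> < r1 \<Longrightarrow> Gd \<epsilon> (sB a v) = sC a (Gd \<epsilon> v)"
    by (rule Gd_remainder) blast
  obtain K2 r2 where r2: "K2 \<ge> 0" "r2 > 0" "\<And>\<epsilon>. norm \<epsilon> < r2 \<Longrightarrow> norm (G (base \<epsilon> + Dl \<epsilon> I)) \<le> K2 * norm \<epsilon> ^ (2 * k + 2)"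
    by (rule bigOE[OF bigO_G_zeta]) blast
  have \<rho>2: "\<rho> / 2 > 0" using \<rho> by simp
  obtain r3 where r3: "r3 > 0" "\<And>\<epsilon>. norm \<epsilon> < r3 \<Longrightarrow> norm (base \<epsilon>) \<le> \<rho> / 2"
    by (rule bigO_small[OF bigO_base \<rho>2]) blast
  \<comment> \<open>A common bound for \<open>Dl \<epsilon> I\<close> and
    \<open>Dl \<epsilon> I + Dl \<epsilon> \<delta>\<close> after the factor
    \<open>norm \<epsilon> ^ (k + 1)\<close> has been taken out.\<close>
  define T where "T = real (k + 1) * (tnorm k I + R0)"
  have T: "T \<ge> 0" "real (k + 1) * tnorm k I \<le> T" using assms by (auto simp: T_def intro: mult_nonneg_nonneg add_nonneg_nonneg)
  define r where "r = min (min r1 r2) (min r3 (\<rho> / (2 * (T + 1))))"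
  have r: "r > 0" using r1 r2 r3 \<rho> T by (simp add: r_def)
  define K where "K = 2 * (Kq * T\<^sup>2) + K2 + (\<Sum>s\<le>k. K1 (Suc (k - s)) * R0)"
  show thesis
  proof (rule that[OF r, of K])
    show "K \<ge> 0" unfolding K_def using \<rho> r1 r2 assms by (intro add_nonneg_nonneg sum_nonneg mult_nonneg_nonneg) auto
    fix \<epsilon> :: 'k and \<delta> :: "nat \<Rightarrow> 'b" assume e: "norm \<epsilon> < r" and \<delta>: "tnorm k \<delta> \<le> R0"
    have e1: "norm \<epsilon> < r1" "norm \<epsilon> < r2" "norm \<epsilon> < r3" "norm \<epsilon> \<le> 1" using e r1 by (auto simp: r_def)
    have eT: "norm \<epsilon> * T \<le> \<rho> / 2"
    proof -
      have "norm \<epsilon> * (2 * (T + 1)) < \<rho>" using e T by (simp add: r_def pos_less_divide_eq)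
      moreover have "norm \<epsilon> * (2 * (T + 1)) = 2 * (norm \<epsilon> * T) + 2 * norm \<epsilon>" by (simp add: algebra_simps)
      ultimately show ?thesis using norm_ge_zero[of \<epsilon>] by linarith
    qed
    define h1 h where "h1 = Dl \<epsilon> I" and "h = Dl \<epsilon> \<delta>"
    have h1: "norm h1 \<le> norm \<epsilon> ^ (k + 1) * T"
    proof -
      have "norm h1 \<le> norm \<epsilon> ^ (k + 1) * (real (k + 1) * tnorm k I)"
        unfolding h1_def using norm_Dl[OF e1(4), of I] by (simp only: mult.left_commute)
      also have "\<dots> \<le> norm \<epsilon> ^ (k + 1) * T" by (intro mult_left_mono T) auto
      finally show ?thesis .
    qed
    have h: "norm (h1 + h) \<le> norm \<epsilon> ^ (k + 1) * T"
    proof -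
      have "h1 + h = Dl \<epsilon> (\<lambda>i. I i + \<delta> i)" by (simp add: h1_def h_def tlinear_add[OF tlinear_Dl])
      then have "norm (h1 + h) \<le> norm \<epsilon> ^ (k + 1) * (real (k + 1) * tnorm k (\<lambda>i. I i + \<delta> i))"
        using norm_Dl[OF e1(4), of "\<lambda>i. I i + \<delta> i"] by (simp only: mult.left_commute)
      also have "\<dots> \<le> norm \<epsilon> ^ (k + 1) * T"
        unfolding T_def using tnorm_add[of k I \<delta>] \<delta> by (intro mult_left_mono) auto
      finally show ?thesis .
    qed
    have small: "norm \<epsilon> ^ (k + 1) * T \<le> \<rho> / 2"
    proof -
      have "norm \<epsilon> ^ (k + 1) \<le> norm \<epsilon> ^ 1" by (rule power_decreasing) (use e1 in auto)
      then have "norm \<epsilon> ^ (k + 1) * T \<le> norm \<epsilon> * T" using T by (intro mult_right_mono) auto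
      then show ?thesis using eT by simp
    qed
    have sq: "Kq * (norm x)\<^sup>2 \<le> Kq * T\<^sup>2 * norm \<epsilon> ^ (2 * k + 2)" if "norm x \<le> norm \<epsilon> ^ (k + 1) * T" for x :: 'b
    proof -
      have "(norm x)\<^sup>2 \<le> (norm \<epsilon> ^ (k + 1) * T)\<^sup>2" using that by (intro power_mono) auto
      also have "\<dots> = T\<^sup>2 * norm \<epsilon> ^ (2 * k + 2)"
      proof -
        have ex: "2 * k + 2 = (k + 1) * 2" by simp
        show ?thesis unfolding ex power_mult power_mult_distrib by (rule mult.commute)
      qed
      finally show ?thesis using \<rho> by (simp add: mult_left_mono mult.assoc)
    qed
    have b: "norm (base \<epsilon>) \<le> \<rho> / 2" using r3 e1 by simp
    then have b\<rho>: "norm (base \<epsilon>) \<le> \<rho>" "norm (base \<epsilon>) < \<rho>" using \<rho> by auto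
    have in1: "norm (base \<epsilon> + h1) \<le> \<rho>" using norm_triangle_ineq[of "base \<epsilon>" h1] b h1 small by linarith
    have in2: "norm (base \<epsilon> + (h1 + h)) \<le> \<rho>" using norm_triangle_ineq[of "base \<epsilon>" "h1 + h"] b h small by linarith
    have Gd: "Gd \<epsilon> = G' (base \<epsilon>)" unfolding Gd_def by (rule G'fr[OF b\<rho>(2)])
    interpret G': bounded_linear "G' (base \<epsilon>)" by (rule G'lin[OF b\<rho>(1)])
    have q1: "norm (G (base \<epsilon> + h1) - G (base \<epsilon>) - Gd \<epsilon> h1) \<le> Kq * T\<^sup>2 * norm \<epsilon> ^ (2 * k + 2)"
      using G'q[OF b\<rho>(1) in1] sq[OF h1] unfolding Gd by linarith
    have q2: "norm (G (base \<epsilon> + (h1 + h)) - G (base \<epsilon>) - Gd \<epsilon> (h1 + h)) \<le> Kq * T\<^sup>2 * norm \<epsilon> ^ (2 * k + 2)"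
      using G'q[OF b\<rho>(1) in2] sq[OF h] unfolding Gd by linarith
    define r4 where "r4 s = Gd \<epsilon> (hat s \<delta>) - (\<Sum>i<Suc (k - s). sC (\<epsilon> ^ i) (A i (hat s \<delta>)))" for s
    have "Gd \<epsilon> h = (\<Sum>s\<le>k. sC (\<epsilon> ^ (k + 1 + s)) (Gd \<epsilon> (hat s \<delta>)))"
      unfolding h_def Dl_def r1(5)[OF e1(1), symmetric] unfolding Gd by (rule G'.sum)
    then have rem: "Gd \<epsilon> h - (\<Sum>d\<le>k. sC (\<epsilon> ^ (k + 1 + d)) (Lam d \<delta>)) = (\<Sum>s\<le>k. sC (\<epsilon> ^ (k + 1 + s)) (r4 s))"
      unfolding Lam_triangle r4_def by (simp only: C.scale_right_diff_distrib sum_subtractf)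
    have q3: "norm (\<Sum>s\<le>k. sC (\<epsilon> ^ (k + 1 + s)) (r4 s)) \<le> (\<Sum>s\<le>k. K1 (Suc (k - s)) * R0 * norm \<epsilon> ^ (2 * k + 2))"
    proof (rule sum_norm_le)
      fix s assume "s \<in> {..k}"
      then have s: "s \<le> k" by simp
      have "norm (sC (\<epsilon> ^ (k + 1 + s)) (r4 s)) \<le> norm \<epsilon> ^ (k + 1 + s) * (K1 (Suc (k - s)) * norm \<epsilon> ^ Suc (k - s) * norm (hat s \<delta>))"
        unfolding C.norm_s norm_power r4_def by (intro mult_left_mono r1(4) e1) auto
      also have "\<dots> \<le> norm \<epsilon> ^ (k + 1 + s) * (K1 (Suc (k - s)) * norm \<epsilon> ^ Suc (k - s) * R0)"
        using norm_hat[OF s, of \<delta>] \<delta> r1(3) by (intro mult_left_mono mult_nonneg_nonneg) auto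
      also have "\<dots> = K1 (Suc (k - s)) * R0 * (norm \<epsilon> ^ (k + 1 + s) * norm \<epsilon> ^ Suc (k - s))" by (simp only: ac_simps)
      also have "norm \<epsilon> ^ (k + 1 + s) * norm \<epsilon> ^ Suc (k - s) = norm \<epsilon> ^ (2 * k + 2)"
        using s by (simp only: power_add[symmetric]) (rule arg_cong[of _ _ "(^) (norm \<epsilon>)"], simp)
      finally show "norm (sC (\<epsilon> ^ (k + 1 + s)) (r4 s)) \<le> K1 (Suc (k - s)) * R0 * norm \<epsilon> ^ (2 * k + 2)" .
    qed
    have "Gd \<epsilon> (h1 + h) = Gd \<epsilon> h1 + Gd \<epsilon> h" unfolding Gd by (rule G'.add)
    then have "G (base \<epsilon> + h1 + h) - (\<Sum>d\<le>k. sC (\<epsilon> ^ (k + 1 + d)) (Lam d \<delta>)) =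
       (G (base \<epsilon> + (h1 + h)) - G (base \<epsilon>) - Gd \<epsilon> (h1 + h)) - (G (base \<epsilon> + h1) - G (base \<epsilon>) - Gd \<epsilon> h1)
       + G (base \<epsilon> + h1) + (\<Sum>s\<le>k. sC (\<epsilon> ^ (k + 1 + s)) (r4 s))"
      unfolding rem[symmetric] by (simp add: add.assoc)
    note arg_cong[of _ _ norm, OF this]
    also have "norm \<dots> \<le> (Kq * T\<^sup>2 * norm \<epsilon> ^ (2 * k + 2) + Kq * T\<^sup>2 * norm \<epsilon> ^ (2 * k + 2)) +
        K2 * norm \<epsilon> ^ (2 * k + 2) + (\<Sum>s\<le>k. K1 (Suc (k - s)) * R0 * norm \<epsilon> ^ (2 * k + 2))"
      by (intro norm_triangle_mono q3 order_trans[OF norm_triangle_ineq4 add_mono[OF q2 q1]] r2(3)[OF e1(2), folded h1_def])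
    also have "\<dots> = K * norm \<epsilon> ^ (2 * k + 2)"
      by (simp add: K_def distrib_right sum_distrib_right)
    finally show "norm (G (base \<epsilon> + Dl \<epsilon> I + Dl \<epsilon> \<delta>) - (\<Sum>d\<le>k. sC (\<epsilon> ^ (k + 1 + d)) (Lam d \<delta>))) \<le> K * norm \<epsilon> ^ (2 * k + 2)"
      by (simp only: h1_def h_def)
  qed
qed

lemma bigO_Lam_iff:
  assumes n: "n \<le> k + 1"
  shows "bigO (k + 1 + n) (\<lambda>\<epsilon>. \<Sum>d\<le>k. sC (\<epsilon> ^ (k + 1 + d)) (Lam d \<delta>)) \<longleftrightarrow> (\<forall>d<n. Lam d \<delta> = 0)"
proof -
  have split: "(\<Sum>d\<le>k. sC (\<epsilon> ^ (k + 1 + d)) (Lam d \<delta>)) =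
      (\<Sum>d<n. sC (\<epsilon> ^ (k + 1 + d)) (Lam d \<delta>)) + (\<Sum>d\<in>{n..k}. sC (\<epsilon> ^ (k + 1 + d)) (Lam d \<delta>))" for \<epsilon>
  proof -
    have "{..k} = {..<n} \<union> {n..k}" using n by auto
    then show ?thesis by (simp only:) (rule sum.union_disjoint, auto)
  qed
  have high: "bigO (k + 1 + n) (\<lambda>\<epsilon>. \<Sum>d\<in>{n..k}. sC (\<epsilon> ^ (k + 1 + d)) (Lam d \<delta>))"
    by (intro C.bigO_sum C.bigO_pow) auto
  show ?thesis
  proof
    assume L: "bigO (k + 1 + n) (\<lambda>\<epsilon>. \<Sum>d\<le>k. sC (\<epsilon> ^ (k + 1 + d)) (Lam d \<delta>))"
    define c where "c e = (if e \<ge> k + 1 then Lam (e - (k + 1)) \<delta> else 0)" for e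
    have "(\<Sum>d<n. sC (\<epsilon> ^ (k + 1 + d)) (Lam d \<delta>)) = (\<Sum>e\<le>k + n. sC (\<epsilon> ^ e) (c e))" for \<epsilon>
    proof -
      have "(\<Sum>e\<le>k + n. sC (\<epsilon> ^ e) (c e)) = (\<Sum>e\<in>{k+1..k+n}. sC (\<epsilon> ^ e) (c e))"
        by (rule sum.mono_neutral_right) (auto simp: c_def)
      also have "\<dots> = (\<Sum>d<n. sC (\<epsilon> ^ (k + 1 + d)) (Lam d \<delta>))"
        by (rule sum.reindex_bij_witness[of _ "\<lambda>d. k + 1 + d" "\<lambda>e. e - (k + 1)"]) (auto simp: c_def)
      finally show ?thesis ..
    qed
    moreover have "bigO (k + 1 + n) (\<lambda>\<epsilon>. \<Sum>d<n. sC (\<epsilon> ^ (k + 1 + d)) (Lam d \<delta>))"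
      using bigO_diff[OF L high] unfolding split add_diff_cancel_right' .
    ultimately have "bigO (Suc (k + n)) (\<lambda>\<epsilon>. \<Sum>e\<le>k + n. sC (\<epsilon> ^ e) (c e))" by simp
    then have "c e = 0" if "e \<le> k + n" for e using C.bigO_poly_zero that by blast
    from this[of "k + 1 + d" for d] show "\<forall>d<n. Lam d \<delta> = 0" by (simp add: c_def)
  next
    assume "\<forall>d<n. Lam d \<delta> = 0"
    then have "(\<Sum>d<n. sC (\<epsilon> ^ (k + 1 + d)) (Lam d \<delta>)) = 0" for \<epsilon> by (intro sum.neutral) auto
    then show "bigO (k + 1 + n) (\<lambda>\<epsilon>. \<Sum>d\<le>k. sC (\<epsilon> ^ (k + 1 + d)) (Lam d \<delta>))"
      unfolding split by (simp only: add_0_left high)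
  qed
qed

text \<open>Quadratic terms start at order \<open>2k+2\<close>, so the coefficient equations of the
  orders \<open>k+1, ..., k+n\<close> become linear in the deviation \<delta> from
  \<open>I\<close>.\<close>

lemma X_bar_Lam_iff:
  assumes n: "n \<le> k + 1" "1 \<le> n"
  shows "completion k zbar (\<lambda>i. I i + \<delta> i) \<in> X_bar sB sC G k zbar (k + n) \<longleftrightarrow> (\<forall>d<n. Lam d \<delta> = 0)"
proof -
  obtain r K where r: "r > 0" "\<And>\<epsilon>. norm \<epsilon> < r \<Longrightarrow>
      norm (G (base \<epsilon> + Dl \<epsilon> I + Dl \<epsilon> \<delta>) - (\<Sum>d\<le>k. sC (\<epsilon> ^ (k + 1 + d)) (Lam d \<delta>))) \<le> K * norm \<epsilon> ^ (2 * k + 2)"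
    by (rule G_expansion[of "tnorm k \<delta>"]) (simp, blast)
  have "bigO (2 * k + 2) (\<lambda>\<epsilon>. G (base \<epsilon> + Dl \<epsilon> I + Dl \<epsilon> \<delta>) - (\<Sum>d\<le>k. sC (\<epsilon> ^ (k + 1 + d)) (Lam d \<delta>)))"
    by (rule bigOI[OF r])
  then have rem: "bigO (k + 1 + n) (\<lambda>\<epsilon>. G (base \<epsilon> + Dl \<epsilon> I + Dl \<epsilon> \<delta>) - (\<Sum>d\<le>k. sC (\<epsilon> ^ (k + 1 + d)) (Lam d \<delta>)))"
    by (rule bigO_mono) (use n in simp)
  have "completion k zbar (\<lambda>i. I i + \<delta> i) \<in> X_bar sB sC G k zbar (k + n) \<longleftrightarrow>
      bigO (k + 1 + n) (\<lambda>\<epsilon>. G (base \<epsilon> + Dl \<epsilon> I + Dl \<epsilon> \<delta>))"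
    using X_bar_completion_iff[of "k + n" "\<lambda>i. I i + \<delta> i"] n by (simp add: tlinear_add[OF tlinear_Dl] add.assoc)
  also have "\<dots> \<longleftrightarrow> bigO (k + 1 + n) (\<lambda>\<epsilon>. \<Sum>d\<le>k. sC (\<epsilon> ^ (k + 1 + d)) (Lam d \<delta>))"
    using bigO_diff[OF _ rem] bigO_add[OF rem] by fastforce
  finally show ?thesis using bigO_Lam_iff[OF n(1)] by simp
qed

subsection \<open>Solutions of the linearised system\<close>

text \<open>The product \<open>N_0 x ... x N_k\<close>. Its image under \<open>M\<close> is the
  space of deviations from \<open>I\<close> that keep the first \<open>2k\<close> equations
  solved.\<close>

definition Yset :: "(nat \<Rightarrow> 'b) set" where
  "Yset = {x. \<forall>i\<in>{1..k+1}. x i \<in> N (i - 1)}"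

definition Minv :: "(nat \<Rightarrow> 'b) \<Rightarrow> nat \<Rightarrow> 'b" where
  "Minv = bsub k (\<lambda>_ v. v) M"

lemma unit_M: "unit_upper_matrix sB k M" and unit_L: "unit_upper_matrix sB k L"
  using smat by (auto simp: solution_matrices_def)

lemma tlinear_M: "i \<in> {1..k+1} \<Longrightarrow> tlinear sB sB k (\<lambda>x. mat_app k M x i)"
  and tlinear_L: "i \<in> {1..k+1} \<Longrightarrow> tlinear sB sB k (\<lambda>x. mat_app k L x i)"
  using tlinear_mat_app[OF B.kspace_axioms unit_M] tlinear_mat_app[OF B.kspace_axioms unit_L] by auto

lemma tlinear_Minv: "i \<in> {1..k+1} \<Longrightarrow> tlinear sB sB k (\<lambda>x. Minv x i)"
  unfolding Minv_def
  by (rule tlinear_bsub[OF B.kspace_axioms _ unit_M]) (auto simp: klinear_on_def intro!: exI[of _ 1])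

lemma M_Minv: "i \<in> {1..k+1} \<Longrightarrow> mat_app k M (Minv x) i = x i"
  and Minv_M: "i \<in> {1..k+1} \<Longrightarrow> Minv (mat_app k M x) i = x i"
  unfolding Minv_def by (rule bsub_id_inverse[OF unit_M]; simp)+

lemma Minv_cong: "(\<And>i. i \<in> {1..k+1} \<Longrightarrow> x i = y i) \<Longrightarrow> i \<in> {1..k+1} \<Longrightarrow> Minv x i = Minv y i"
  by (rule tlinear_cong[OF tlinear_Minv]) auto

lemma L_cong: "(\<And>i. i \<in> {1..k+1} \<Longrightarrow> x i = y i) \<Longrightarrow> i \<in> {1..k+1} \<Longrightarrow> mat_app k L x i = mat_app k L y i"
  by (rule tlinear_cong[OF tlinear_L]) auto

lemma Dl_cong: "(\<And>i. i \<in> {1..k+1} \<Longrightarrow> x i = y i) \<Longrightarrow> Dl \<epsilon> x = Dl \<epsilon> y"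
  by (rule tlinear_cong[OF tlinear_Dl]) auto

lemma k_pos: "k \<ge> 1"
  using l by simp

lemma Yset_iff: "x \<in> Yset \<longleftrightarrow> (\<forall>i\<in>{1..k+1}. x i \<in> N (i - 1))"
  by (simp add: Yset_def)

lemma Yset_cong: "x \<in> Yset \<Longrightarrow> (\<And>i. i \<in> {1..k+1} \<Longrightarrow> x i = y i) \<Longrightarrow> y \<in> Yset"
  by (simp add: Yset_iff)

lemma Yset_add: "x \<in> Yset \<Longrightarrow> y \<in> Yset \<Longrightarrow> (\<lambda>i. x i + y i) \<in> Yset"
  unfolding Yset_iff by (auto intro!: B.subspace_add subspace_N)

lemma X_bar_2k: "completion k zbar y \<in> X_bar sB sC G k zbar (2*k) \<longleftrightarrow>
     (\<exists>v. (\<forall>i\<in>{1..k+1}. v i \<in> N (i-1)) \<and> (\<forall>i\<in>{1..k+1}. y i = I i + mat_app k M v i))"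
  and X_bar_2k1: "completion k zbar y \<in> X_bar sB sC G k zbar (2*k+1) \<longleftrightarrow>
     (\<exists>n. (\<forall>i\<in>{1..k+1}. n i \<in> N i) \<and> (\<forall>i\<in>{1..k+1}. y i = I i + mat_app k M (mat_app k L n) i))"
proof -
  have "(\<forall>y. completion k zbar y \<in> X_bar sB sC G k zbar (2*k) \<longleftrightarrow>
     (\<exists>v. (\<forall>i\<in>{1..k+1}. v i \<in> N (i-1)) \<and> (\<forall>i\<in>{1..k+1}. y i = I i + mat_app k M v i)))"
    "(\<forall>y. completion k zbar y \<in> X_bar sB sC G k zbar (2*k+1) \<longleftrightarrow>
     (\<exists>n. (\<forall>i\<in>{1..k+1}. n i \<in> N i) \<and> (\<forall>i\<in>{1..k+1}. y i = I i + mat_app k M (mat_app k L n) i)))"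
    using smat unfolding solution_matrices_def by iprover+
  then show "completion k zbar y \<in> X_bar sB sC G k zbar (2*k) \<longleftrightarrow>
     (\<exists>v. (\<forall>i\<in>{1..k+1}. v i \<in> N (i-1)) \<and> (\<forall>i\<in>{1..k+1}. y i = I i + mat_app k M v i))"
    "completion k zbar y \<in> X_bar sB sC G k zbar (2*k+1) \<longleftrightarrow>
     (\<exists>n. (\<forall>i\<in>{1..k+1}. n i \<in> N i) \<and> (\<forall>i\<in>{1..k+1}. y i = I i + mat_app k M (mat_app k L n) i))"
    by blast+
qed

lemma Lam_solutions:
  "(\<forall>d<k. Lam d \<delta> = 0) \<longleftrightarrow> (\<exists>x\<in>Yset. \<forall>i\<in>{1..k+1}. \<delta> i = mat_app k M x i)"
proof -
  have "completion k zbar (\<lambda>i. I i + \<delta> i) \<in> X_bar sB sC G k zbar (2 * k) \<longleftrightarrow> (\<forall>d<k. Lam d \<delta> = 0)"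
    using X_bar_Lam_iff[of k \<delta>] k_pos by (simp add: mult_2)
  then show ?thesis unfolding X_bar_2k by (simp add: Yset_def Bex_def)
qed

lemma Lam_solutions':
  "(\<forall>d\<le>k. Lam d \<delta> = 0) \<longleftrightarrow>
     (\<exists>n. (\<forall>i\<in>{1..k+1}. n i \<in> N i) \<and> (\<forall>i\<in>{1..k+1}. \<delta> i = mat_app k M (mat_app k L n) i))"
proof -
  have "completion k zbar (\<lambda>i. I i + \<delta> i) \<in> X_bar sB sC G k zbar (2 * k + 1) \<longleftrightarrow> (\<forall>d\<le>k. Lam d \<delta> = 0)"
    using X_bar_Lam_iff[of "k + 1" \<delta>] by (simp add: mult_2 less_Suc_eq_le)
  then show ?thesis unfolding X_bar_2k1 by simp
qed

lemma Lam_M_Yset: "x \<in> Yset \<Longrightarrow> d < k \<Longrightarrow> Lam d (mat_app k M x) = 0"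
  using Lam_solutions[of "mat_app k M x"] by blast

lemma Minv_Yset: "(\<And>d. d < k \<Longrightarrow> Lam d \<delta> = 0) \<Longrightarrow> Minv \<delta> \<in> Yset"
proof -
  assume "\<And>d. d < k \<Longrightarrow> Lam d \<delta> = 0"
  then obtain x where x: "x \<in> Yset" "\<And>i. i \<in> {1..k+1} \<Longrightarrow> \<delta> i = mat_app k M x i" using Lam_solutions by blast
  show ?thesis
    by (rule Yset_cong[OF x(1)]) (simp only: Minv_cong[OF x(2)] Minv_M)
qed

text \<open>For \<open>x\<close> in \<open>Yset\<close> this is the only coefficient left, that of
  \<open>\<epsilon>^(2k+1)\<close>. Its restriction to the complements \<open>Nc i\<close> is the
  linear isomorphism behind the implicit function theorem.\<close>

definition Q :: "(nat \<Rightarrow> 'b) \<Rightarrow> 'c" where "Q x = Lam k (mat_app k M x)"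

lemma tlinear_Q: "tlinear sB sC k Q"
  unfolding Q_def[abs_def] by (rule tlinear_compose[OF tlinear_M tlinear_Lam]) auto

lemma L_Yset: "(\<And>i. i \<in> {1..k+1} \<Longrightarrow> n i \<in> N i) \<Longrightarrow> mat_app k L n \<in> Yset"
  using smat unfolding solution_matrices_def Yset_iff by blast

lemma Lam_ML: "(\<And>i. i \<in> {1..k+1} \<Longrightarrow> n i \<in> N i) \<Longrightarrow> d \<le> k \<Longrightarrow> Lam d (mat_app k M (mat_app k L n)) = 0"
  using Lam_solutions'[of "mat_app k M (mat_app k L n)"] by blast

lemma Q_L: "(\<And>i. i \<in> {1..k+1} \<Longrightarrow> n i \<in> N i) \<Longrightarrow> Q (mat_app k L n) = 0"
  unfolding Q_def using Lam_ML by blast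

lemma Q_eq_0:
  assumes "x \<in> Yset" "Q x = 0"
  obtains n where "\<And>i. i \<in> {1..k+1} \<Longrightarrow> n i \<in> N i" "\<And>i. i \<in> {1..k+1} \<Longrightarrow> x i = mat_app k L n i"
proof -
  have "\<forall>d\<le>k. Lam d (mat_app k M x) = 0"
    using assms Lam_M_Yset unfolding Q_def by (metis le_neq_implies_less)
  then obtain n where n: "\<And>i. i \<in> {1..k+1} \<Longrightarrow> n i \<in> N i"
     "\<And>i. i \<in> {1..k+1} \<Longrightarrow> mat_app k M x i = mat_app k M (mat_app k L n) i"
    using Lam_solutions' by blast
  have "x i = mat_app k L n i" if i: "i \<in> {1..k+1}" for i
  proof -
    have "Minv (mat_app k M x) i = Minv (mat_app k M (mat_app k L n)) i" by (rule Minv_cong[OF n(2) i])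
    then show ?thesis unfolding Minv_M[OF i] .
  qed
  then show thesis using that n(1) by blast
qed

text \<open>The unique decomposition \<open>x = w + L n\<close> with \<open>w\<^sub>i \<in> N\<^sub>i\<^sup>c\<close> and \<open>n\<^sub>i \<in> N\<^sub>i\<close>.\<close>

definition npart :: "(nat \<Rightarrow> 'b) \<Rightarrow> nat \<Rightarrow> 'b" where "npart = bsub k proj L"

definition wpart :: "(nat \<Rightarrow> 'b) \<Rightarrow> nat \<Rightarrow> 'b" where "wpart x i = x i - mat_app k L (npart x) i"

lemma tlinear_npart: "i \<in> {1..k+1} \<Longrightarrow> tlinear sB sB k (\<lambda>x. npart x i)"
  unfolding npart_def by (rule tlinear_bsub[OF B.kspace_axioms klinear_proj unit_L]) auto

lemma tlinear_wpart: "i \<in> {1..k+1} \<Longrightarrow> tlinear sB sB k (\<lambda>x. wpart x i)"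
  unfolding wpart_def
  by (intro tlinear_minus[OF B.kspace_axioms] tlinear_coord tlinear_compose[OF tlinear_npart tlinear_L]) auto

lemma npart_mem: "i \<in> {1..k+1} \<Longrightarrow> npart x i \<in> N i"
  unfolding npart_def by (subst bsub.simps) (rule proj_mem, simp)

lemma w_plus_L: "x i = wpart x i + mat_app k L (npart x) i"
  by (simp add: wpart_def)

text \<open>What is known about \<open>L\<close> concerns complete rows; replacing
  \<open>n j\<close> by 0 for \<open>j \<le> i\<close> isolates the strictly upper part of row
  \<open>i\<close>.\<close>

lemma L_tail_mem:
  assumes n: "\<And>i. i \<in> {1..k+1} \<Longrightarrow> n i \<in> N i" and i: "i \<in> {1..k+1}"
  shows "(\<Sum>j\<in>{i<..k+1}. L i j (n j)) \<in> N (i - 1)"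
proof -
  define n' where "n' j = (if j > i then n j else 0)" for j
  have "n' j \<in> N j" if "j \<in> {1..k+1}" for j
    using that n B.subspace_0[OF subspace_N, of j] by (auto simp: n'_def)
  then have "mat_app k L n' i \<in> N (i - 1)" using L_Yset[of n'] i by (simp add: Yset_iff)
  moreover have "mat_app k L n' i = (\<Sum>j\<in>{i<..k+1}. L i j (n j))"
    unfolding mat_app_unit_upper[OF unit_L i] by (simp add: n'_def)
  ultimately show ?thesis by simp
qed

lemma wpart_mem:
  assumes x: "x \<in> Yset" and i: "i \<in> {1..k+1}"
  shows "wpart x i \<in> Nc i"
proof -
  define v where "v = x i - (\<Sum>j\<in>{i<..k+1}. L i j (npart x j))"
  have i1: "i - 1 \<le> k + 1" using i by auto
  have "v \<in> N (i - 1)"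
    unfolding v_def
    by (intro B.subspace_diff[OF subspace_N[OF i1]] L_tail_mem npart_mem i) (use x i in \<open>simp_all add: Yset_iff\<close>)
  then have "proj (i - 1) v = v" by (rule proj_id[OF i1])
  moreover have "npart x i = proj i v" unfolding npart_def v_def by (rule bsub.simps)
  then have "wpart x i = v - proj i v"
    unfolding wpart_def mat_app_unit_upper[OF unit_L i] v_def by simp
  ultimately have "wpart x i = W i v" by (simp add: W_def)
  then show ?thesis using W_mem[OF i] by simp
qed

lemma npart_unique:
  assumes w: "\<And>i. i \<in> {1..k+1} \<Longrightarrow> w i \<in> Nc i" and n: "\<And>i. i \<in> {1..k+1} \<Longrightarrow> n i \<in> N i"
    and x: "\<And>i. i \<in> {1..k+1} \<Longrightarrow> x i = w i + mat_app k L n i" and i: "i \<in> {1..k+1}"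
  shows "npart x i = n i" "wpart x i = w i"
proof -
  have np: "npart x i = n i" if "i \<in> {1..k+1}" for i
    using that
  proof (induction "k + 1 - i" arbitrary: i rule: less_induct)
    case less
    have ik: "i \<le> k + 1" using less.prems by simp
    have "npart x i = proj i (x i - (\<Sum>j\<in>{i<..k+1}. L i j (npart x j)))"
      unfolding npart_def by (rule bsub.simps)
    also have "(\<Sum>j\<in>{i<..k+1}. L i j (npart x j)) = (\<Sum>j\<in>{i<..k+1}. L i j (n j))"
      by (rule sum.cong[OF refl], rule arg_cong[of _ _ "L i _"], rule less.hyps) (use less.prems in auto)
    also have "x i - (\<Sum>j\<in>{i<..k+1}. L i j (n j)) = w i + n i"
      unfolding x[OF less.prems] mat_app_unit_upper[OF unit_L less.prems] by simp
    also have "proj i (w i + n i) = proj i (w i) + proj i (n i)" by (rule klinear_onD(1)[OF klinear_proj[OF ik]])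
    also have "\<dots> = n i" using proj_Nc[of i i "w i"] proj_id[OF ik n[OF less.prems]] w less.prems by simp
    finally show ?case .
  qed
  show "npart x i = n i" by (rule np[OF i])
  have "mat_app k L (npart x) i = mat_app k L n i" by (rule L_cong[OF np i])
  then show "wpart x i = w i" unfolding wpart_def x[OF i] by simp
qed

lemma W_of_sum:
  assumes w: "\<And>i. i \<in> {1..k+1} \<Longrightarrow> w i \<in> Nc i" and n: "n \<in> N (k + 1)"
  shows "i \<in> {1..k+1} \<Longrightarrow> W i ((\<Sum>i=1..k+1. w i) + n) = w i"
    and "proj (k + 1) ((\<Sum>i=1..k+1. w i) + n) = n"
proof -
  have "(\<Sum>i=1..k+1. W i n) = 0" by (rule sum.neutral) (use W_N n in auto)
  then have eq: "n = pproj n + sB (lcoord n) (zbar l)" using coordinates[of n] by simp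
  have p: "proj (k + 1) v = pproj v + sB (lcoord v) (zbar l)" for v by (simp add: pproj_def)
  show "i \<in> {1..k+1} \<Longrightarrow> W i ((\<Sum>i=1..k+1. w i) + n) = w i"
    by (subst eq) (rule W_of_coordinates[OF w pproj_mem])
  have "pproj ((\<Sum>i=1..k+1. w i) + n) = pproj n" "lcoord ((\<Sum>i=1..k+1. w i) + n) = lcoord n"
    by (subst eq, rule pproj_of_coordinates[OF w pproj_mem], assumption)
       (subst eq, rule lcoord_of_coordinates[OF w pproj_mem], assumption)
  then show "proj (k + 1) ((\<Sum>i=1..k+1. w i) + n) = n" unfolding p using eq by simp
qed

subsection \<open>Reduction to the splitting coordinates\<close>

definition last_entry :: "'b \<Rightarrow> nat \<Rightarrow> 'b" where "last_entry v = (\<lambda>_. 0)(k + 1 := v)"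

lemma last_entry_mem: "v \<in> N (k + 1) \<Longrightarrow> i \<in> {1..k+1} \<Longrightarrow> last_entry v i \<in> N i"
  using B.subspace_0[OF subspace_N, of i] by (auto simp: last_entry_def)

text \<open>The tuples with \<open>n_1 = ... = n_k = 0\<close>, each coded by a single vector
  through its coordinates.\<close>

definition emb :: "'b \<Rightarrow> nat \<Rightarrow> 'b" where "emb u i = W i u + mat_app k L (last_entry (proj (k + 1) u)) i"

text \<open>A left inverse of \<open>emb\<close>, defined on all tuples by dropping the parameters
  \<open>n_1, ..., n_k\<close>.\<close>

definition red :: "(nat \<Rightarrow> 'b) \<Rightarrow> 'b" where "red x = (\<Sum>i=1..k+1. wpart x i) + npart x (k + 1)"

definition Dx :: "'k \<Rightarrow> (nat \<Rightarrow> 'b) \<Rightarrow> 'b" where "Dx \<epsilon> x = Dl \<epsilon> (mat_app k M x)"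

text \<open>The tuple of \<open>1/\<epsilon>\<close> times the contribution of
  \<open>n_1, ..., n_k\<close>. Division lowers each index by one, so row \<open>i - 1\<close> moves
  to row \<open>i\<close>; the factor \<open>1 / (2k+3-i)\<close> converts \<open>1/(j+1)!\<close>
  into \<open>1/j!\<close>. No coefficient moves into the top index \<open>2k+1\<close>, hence the 0
  in row 1.\<close>

definition shift :: "(nat \<Rightarrow> 'b) \<Rightarrow> nat \<Rightarrow> 'b" where
  "shift x = (let y = mat_app k M (mat_app k L (\<lambda>i. if i \<le> k then npart x i else 0)) in
     Minv (\<lambda>i. if i = 1 then 0 else sB (inverse (of_nat (2 * k + 3 - i))) (y (i - 1))))"

lemma tlinear_red: "tlinear sB sB k red"
  unfolding red_def[abs_def]
  by (intro tlinear_plus tlinear_sum tlinear_wpart tlinear_npart B.kspace_axioms) auto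

lemma tlinear_Dx: "tlinear sB sB k (Dx \<epsilon>)"
  unfolding Dx_def[abs_def] by (rule tlinear_compose[OF tlinear_M tlinear_Dl])

lemma tlinear_shift: "i \<in> {1..k+1} \<Longrightarrow> tlinear sB sB k (\<lambda>x. shift x i)"
proof -
  assume i: "i \<in> {1..k+1}"
  have n: "tlinear sB sB k (\<lambda>x. if j \<le> k then npart x j else 0)" if "j \<in> {1..k+1}" for j
    using tlinear_npart[OF that] tlinear_zero[OF B.kspace_axioms] by (cases "j \<le> k") auto
  have y: "tlinear sB sB k (\<lambda>x. mat_app k M (mat_app k L (\<lambda>i. if i \<le> k then npart x i else 0)) j)" if "j \<in> {1..k+1}" for j
    by (rule tlinear_compose[OF tlinear_compose[OF n tlinear_L] tlinear_M[OF that]])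
  show ?thesis
    unfolding shift_def Let_def
  proof (rule tlinear_compose[OF _ tlinear_Minv[OF i]])
    fix j assume j: "j \<in> {1..k+1}"
    show "tlinear sB sB k (\<lambda>x. if j = 1 then 0 else sB (inverse (of_nat (2 * k + 3 - j)))
        (mat_app k M (mat_app k L (\<lambda>i. if i \<le> k then npart x i else 0)) (j - 1)))"
    proof (cases "j = 1")
      case False
      then have "j - 1 \<in> {1..k+1}" using j by auto
      then show ?thesis using False tlinear_scaled[OF B.kspace_axioms y] by simp
    qed (simp add: tlinear_zero[OF B.kspace_axioms])
  qed
qed

lemma emb_red:
  assumes x: "x \<in> Yset" and i: "i \<in> {1..k+1}"
  shows "emb (red x) i = wpart x i + mat_app k L (last_entry (npart x (k + 1))) i"
  unfolding emb_def red_def using W_of_sum[OF wpart_mem[OF x] npart_mem] i by simp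

lemma hat_Suc_shift:
  assumes s: "s < k" and y: "yt = (\<lambda>i. if i = 1 then 0 else sB (inverse (of_nat (2 * k + 3 - i))) (y (i - 1)))"
  shows "hat s yt = hat (Suc s) y"
proof -
  have "2 * k + 3 - (k + 1 - s) = Suc (k + 1 + s)" using s by simp
  moreover have "k + 1 - s - 1 = k + 1 - Suc s" by simp
  moreover have "k + 1 - s \<noteq> 1" using s by simp
  ultimately have "hat s yt = sB (inverse (fact (k + 1 + s)) * inverse (of_nat (Suc (k + 1 + s)))) (y (k + 1 - Suc s))"
    unfolding hat_def y by simp
  also have "inverse (fact (k + 1 + s)) * inverse (of_nat (Suc (k + 1 + s))) = (inverse (fact (k + 1 + Suc s)) :: 'k)"
    by (simp only: add_Suc_right fact_Suc of_nat_mult of_nat_fact inverse_mult_distrib mult.commute)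
  finally show ?thesis by (simp add: hat_def)
qed

text \<open>The linearised system is invariant under multiplying a solution curve by \<open>1/\<epsilon>\<close>. Hence the
  parameters \<open>n\<^sub>1, \<dots>, n\<^sub>k\<close> can be traded for one power of \<open>\<epsilon>\<close>.\<close>

lemma shift_properties:
  assumes x: "x \<in> Yset"
  shows "shift x \<in> Yset"
    and "Dx \<epsilon> (mat_app k L (\<lambda>i. if i \<le> k then npart x i else 0)) = sB \<epsilon> (Dx \<epsilon> (shift x))"
proof -
  define n where "n = (\<lambda>i. if i \<le> k then npart x i else 0)"
  define y where "y = mat_app k M (mat_app k L n)"
  define yt where "yt = (\<lambda>i. if i = 1 then 0 else sB (inverse (of_nat (2 * k + 3 - i))) (y (i - 1)))"
  have sh: "shift x = Minv yt" unfolding shift_def Let_def n_def y_def yt_def ..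
  have n: "n i \<in> N i" if "i \<in> {1..k+1}" for i
    using that npart_mem B.subspace_0[OF subspace_N, of i] by (auto simp: n_def)
  \<comment> \<open>The last rows of \<open>M\<close> and \<open>L\<close> are trivial and
    \<open>n (k+1)\<close> is 0, so the curve of \<open>y\<close> has no term of order
    \<open>k+1\<close>; this is what allows the division by \<epsilon>.\<close>
  have "k + 1 \<in> {1..k+1}" by simp
  from mat_app_unit_upper[OF unit_M this] mat_app_unit_upper[OF unit_L this]
  have "y (k + 1) = 0" by (simp add: y_def n_def)
  then have h0: "hat 0 y = 0" by (simp add: hat_def)
  have hS: "hat s yt = hat (Suc s) y" if "s < k" for s by (rule hat_Suc_shift[OF that yt_def])
  have hk: "hat k yt = 0" by (simp add: hat_def yt_def)
  \<comment> \<open>The division shifts the degree: \<open>Lam d\<close> of the new tuple is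
    \<open>Lam (d+1)\<close> of the old one, which vanishes up to \<open>d + 1 = k\<close>. One
    equation is lost, so the result lies in \<open>Yset\<close>, and its own parameters
    \<open>n_1, ..., n_k\<close> may again be nonzero.\<close>
  have "Lam d yt = 0" if d: "d < k" for d
  proof -
    have "Lam d yt = (\<Sum>s\<le>d. A (Suc d - Suc s) (hat (Suc s) y))"
      unfolding Lam_def by (intro sum.cong refl) (use d in \<open>auto simp: hS\<close>)
    also have "\<dots> = (\<Sum>s\<le>Suc d. A (Suc d - s) (hat s y))"
      unfolding sum.atMost_Suc_shift by (simp add: h0 klinear_on_0[OF klinear_A])
    also have "\<dots> = Lam (Suc d) y" by (simp add: Lam_def)
    also have "\<dots> = 0" unfolding y_def by (rule Lam_ML) (use n d in auto)
    finally show ?thesis .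
  qed
  then show "shift x \<in> Yset" unfolding sh by (rule Minv_Yset)
  have first: "(\<Sum>s\<le>k. f s) = f 0 + (\<Sum>s<k. f (Suc s))" for f :: "nat \<Rightarrow> 'b"
    unfolding lessThan_Suc_atMost[symmetric] by (rule sum.lessThan_Suc_shift)
  have last_entry: "(\<Sum>s\<le>k. f s) = (\<Sum>s<k. f s) + f k" for f :: "nat \<Rightarrow> 'b"
    unfolding lessThan_Suc_atMost[symmetric] by (rule sum.lessThan_Suc)
  have "Dl \<epsilon> y = (\<Sum>s<k. sB (\<epsilon> ^ (k + 1 + Suc s)) (hat (Suc s) y))"
    unfolding Dl_def first by (simp add: h0)
  also have "\<dots> = (\<Sum>s<k. sB \<epsilon> (sB (\<epsilon> ^ (k + 1 + s)) (hat s yt)))"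
    by (intro sum.cong refl) (auto simp: hS)
  also have "\<dots> = sB \<epsilon> (Dl \<epsilon> yt)"
    unfolding Dl_def last_entry by (simp add: B.scale_sum_right hk)
  also have "Dl \<epsilon> yt = Dx \<epsilon> (shift x)"
    unfolding Dx_def sh by (rule Dl_cong) (rule M_Minv[symmetric])
  finally show "Dx \<epsilon> (mat_app k L (\<lambda>i. if i \<le> k then npart x i else 0)) = sB \<epsilon> (Dx \<epsilon> (shift x))"
    by (simp add: Dx_def y_def n_def)
qed

definition E :: "'k \<Rightarrow> 'b \<Rightarrow> 'b" where "E \<epsilon> u = Dx \<epsilon> (emb u)"

text \<open>The removal of \<open>n_1, ..., n_k\<close> costs \<epsilon> times another element of
  \<open>Yset\<close>, so the step can be repeated.\<close>

lemma Dx_step: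
  assumes x: "x \<in> Yset"
  shows "Dx \<epsilon> x = E \<epsilon> (red x) + sB \<epsilon> (Dx \<epsilon> (shift x))"
proof -
  have "Dx \<epsilon> x = Dx \<epsilon> (\<lambda>i. emb (red x) i + mat_app k L (\<lambda>i. if i \<le> k then npart x i else 0) i)"
  proof (rule tlinear_cong[OF tlinear_Dx])
    fix i assume i: "i \<in> {1..k+1}"
    have "mat_app k L (npart x) i = mat_app k L (\<lambda>j. last_entry (npart x (k + 1)) j + (if j \<le> k then npart x j else 0)) i"
      by (rule L_cong[OF _ i]) (auto simp: last_entry_def le_Suc_eq)
    then show "x i = emb (red x) i + mat_app k L (\<lambda>i. if i \<le> k then npart x i else 0) i"
      unfolding emb_red[OF x i] using w_plus_L[of x i] by (simp add: tlinear_add[OF tlinear_L[OF i]])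
  qed
  then show ?thesis by (simp add: tlinear_add[OF tlinear_Dx] E_def shift_properties[OF x])
qed

lemma klinear_emb: "i \<in> {1..k+1} \<Longrightarrow> klinear_on sB sB UNIV (\<lambda>u. emb u i)"
proof -
  assume i: "i \<in> {1..k+1}"
  have lin: "klinear_on sB sB UNIV (proj (k + 1))" by (rule klinear_proj) simp
  obtain C1 where C1: "C1 > 0" "\<And>u. norm (W i u) \<le> C1 * norm u" by (rule klinear_on_bound[OF klinear_W[OF i]]) blast
  obtain C2 where C2: "C2 > 0" "\<And>u. norm (proj (k + 1) u) \<le> C2 * norm u" by (rule klinear_on_bound[OF lin]) blast
  obtain C3 where C3: "C3 > 0" "\<And>x. norm (mat_app k L x i) \<le> C3 * tnorm k x" by (rule tlinear_bound[OF tlinear_L[OF i]]) blast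
  have tl: "tnorm k (last_entry v) = norm v" for v by (simp add: tnorm_def last_entry_def)
  have add: "last_entry (v + w) = (\<lambda>i. last_entry v i + last_entry w i)" and scl: "last_entry (sB a v) = (\<lambda>i. sB a (last_entry v i))" for v w a
    by (auto simp: last_entry_def fun_eq_iff)
  show ?thesis
    unfolding klinear_on_def
  proof (intro conjI ballI allI)
    show "emb (u + v) i = emb u i + emb v i" for u v
      unfolding emb_def klinear_onD[OF klinear_W[OF i]] klinear_onD[OF lin] add tlinear_add[OF tlinear_L[OF i]]
      by simp
    show "emb (sB a u) i = sB a (emb u i)" for a u
      unfolding emb_def klinear_onD[OF klinear_W[OF i]] klinear_onD[OF lin] scl tlinear_scale[OF tlinear_L[OF i]] B.scale_right_distrib ..
    have "norm (emb u i) \<le> (C1 + C3 * C2) * norm u" for u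
    proof -
      have "norm (mat_app k L (last_entry (proj (k + 1) u)) i) \<le> C3 * (C2 * norm u)"
        using order_trans[OF C3(2)[of "last_entry (proj (k + 1) u)", unfolded tl] mult_left_mono[OF C2(2)[of u]]] C3(1) by simp
      then show ?thesis unfolding emb_def using C1(2)[of u] norm_triangle_ineq[of "W i u" "mat_app k L (last_entry (proj (k + 1) u)) i"]
        by (simp add: distrib_right mult.assoc)
    qed
    then show "\<exists>C. \<forall>u\<in>UNIV. norm (emb u i) \<le> C * norm u" by blast
  qed
qed

lemma tnorm_emb: obtains C where "C > 0" "\<And>u. tnorm k (emb u) \<le> C * norm u"
proof -
  have "\<exists>C>0. \<forall>u. norm (emb u i) \<le> C * norm u" if "i \<in> {1..k+1}" for i
    by (rule klinear_on_bound[OF klinear_emb[OF that]]) blast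
  then obtain C where C: "\<And>i. i \<in> {1..k+1} \<Longrightarrow> C i > 0" "\<And>i u. i \<in> {1..k+1} \<Longrightarrow> norm (emb u i) \<le> C i * norm u" by metis
  show thesis
  proof (rule that)
    show "(\<Sum>i=1..k+1. C i) > 0" by (rule sum_pos) (use C in auto)
    show "tnorm k (emb u) \<le> (\<Sum>i=1..k+1. C i) * norm u" for u
      unfolding tnorm_def sum_distrib_right by (rule sum_mono) (rule C)
  qed
qed

lemma klinear_E: "klinear_on sB sB UNIV (E \<epsilon>)"
proof -
  obtain C1 where C1: "C1 > 0" "\<And>u. tnorm k (emb u) \<le> C1 * norm u" by (rule tnorm_emb) blast
  obtain C2 where C2: "C2 > 0" "\<And>x. norm (Dx \<epsilon> x) \<le> C2 * tnorm k x" by (rule tlinear_bound[OF tlinear_Dx]) blast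
  show ?thesis
    unfolding klinear_on_def
  proof (intro conjI ballI allI)
    fix u v
    have "E \<epsilon> (u + v) = Dx \<epsilon> (\<lambda>i. emb u i + emb v i)"
      unfolding E_def by (rule tlinear_cong[OF tlinear_Dx]) (rule klinear_onD(1)[OF klinear_emb])
    then show "E \<epsilon> (u + v) = E \<epsilon> u + E \<epsilon> v" by (simp add: E_def tlinear_add[OF tlinear_Dx])
  next
    fix a u
    have "E \<epsilon> (sB a u) = Dx \<epsilon> (\<lambda>i. sB a (emb u i))"
      unfolding E_def by (rule tlinear_cong[OF tlinear_Dx]) (rule klinear_onD(2)[OF klinear_emb])
    then show "E \<epsilon> (sB a u) = sB a (E \<epsilon> u)" by (simp add: E_def tlinear_scale[OF tlinear_Dx])
  next
    have "norm (E \<epsilon> u) \<le> C2 * C1 * norm u" for u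
    proof -
      have "C2 * tnorm k (emb u) \<le> C2 * (C1 * norm u)" using C2(1) by (intro mult_left_mono C1) auto
      with C2(2)[of "emb u"] show ?thesis unfolding E_def mult.assoc by (rule order_trans)
    qed
    then show "\<exists>C. \<forall>u\<in>UNIV. norm (E \<epsilon> u) \<le> C * norm u" by blast
  qed
qed

text \<open>The sum that results from iterating \<open>Dx_step\<close>.\<close>

definition H :: "'k \<Rightarrow> (nat \<Rightarrow> 'b) \<Rightarrow> 'b" where
  "H \<epsilon> x = (\<Sum>j. sB (\<epsilon> ^ j) (red ((shift ^^ j) x)))"

lemma tlinear_shift_funpow: "i \<in> {1..k+1} \<Longrightarrow> tlinear sB sB k (\<lambda>x. (shift ^^ j) x i)"
proof (induction j arbitrary: i)
  case 0
  then show ?case by (simp add: tlinear_coord)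
next
  case (Suc j)
  show ?case using tlinear_compose[OF Suc.IH tlinear_shift[OF Suc.prems]] by simp
qed

text \<open>With \<open>C2\<close> a bound for \<open>shift\<close>, the series is dominated by a
  geometric one of ratio \<open>norm \<epsilon> * C2 \<le> 1/2\<close>. Its first term is
  \<open>red x\<close>, so \<open>H\<close> and \<open>red\<close> differ by a factor \<epsilon>.
  The remainder after \<open>n\<close> reductions carries \<open>\<epsilon>^n\<close>, which beats
  the growth of \<open>shift\<close>, and tends to 0.\<close>

theorem H_properties:
  obtains r K where "r > 0" "K > 0"
    "\<And>\<epsilon> x y. norm \<epsilon> < r \<Longrightarrow> H \<epsilon> (\<lambda>i. x i - y i) = H \<epsilon> x - H \<epsilon> y"
    "\<And>\<epsilon> x y. norm \<epsilon> < r \<Longrightarrow> H \<epsilon> (\<lambda>i. x i + y i) = H \<epsilon> x + H \<epsilon> y"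
    "\<And>\<epsilon> x. norm \<epsilon> < r \<Longrightarrow> norm (H \<epsilon> x) \<le> K * tnorm k x"
    "\<And>\<epsilon> x. norm \<epsilon> < r \<Longrightarrow> norm (H \<epsilon> x - red x) \<le> K * norm \<epsilon> * tnorm k x"
    "\<And>\<epsilon> x. norm \<epsilon> < r \<Longrightarrow> x \<in> Yset \<Longrightarrow> Dx \<epsilon> x = E \<epsilon> (H \<epsilon> x)"
proof -
  obtain C1 where C1: "C1 > 0" "\<And>x. norm (red x) \<le> C1 * tnorm k x" by (rule tlinear_bound[OF tlinear_red]) blast
  have "\<exists>C>0. \<forall>x. tnorm k (shift x) \<le> C * tnorm k x"
    by (rule tlinear_tuple_bound[OF tlinear_shift]) blast+
  then obtain C2 where C2: "C2 > 0" "\<And>x. tnorm k (shift x) \<le> C2 * tnorm k x" by blast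
  have C2j: "tnorm k ((shift ^^ j) x) \<le> C2 ^ j * tnorm k x" for j x
  proof (induction j)
    case (Suc j)
    have "tnorm k ((shift ^^ Suc j) x) \<le> C2 * tnorm k ((shift ^^ j) x)" using C2(2) by simp
    also have "\<dots> \<le> C2 * (C2 ^ j * tnorm k x)" using C2(1) by (intro mult_left_mono Suc) auto
    finally show ?case by simp
  qed simp
  define r where "r = 1 / (2 * C2)"
  have r: "r > 0" using C2 by (simp add: r_def)
  have e2: "norm \<epsilon> * C2 \<le> 1 / 2" if "norm \<epsilon> < r" for \<epsilon> :: 'k
    using that C2(1) by (simp add: r_def pos_less_divide_eq)
  have term_bound: "norm (sB (\<epsilon> ^ j) (red ((shift ^^ j) x))) \<le> C1 * tnorm k x * (norm \<epsilon> * C2) ^ j" for \<epsilon> j x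
  proof -
    have "norm (red ((shift ^^ j) x)) \<le> C1 * (C2 ^ j * tnorm k x)"
      using order_trans[OF C1(2)[of "(shift ^^ j) x"] mult_left_mono[OF C2j[of j x], of C1]] C1(1) by simp
    then have "norm \<epsilon> ^ j * norm (red ((shift ^^ j) x)) \<le> norm \<epsilon> ^ j * (C1 * (C2 ^ j * tnorm k x))"
      by (rule mult_left_mono) simp
    then show ?thesis by (simp add: norm_power power_mult_distrib mult.commute mult.left_commute)
  qed
  have tb: "norm (sB (\<epsilon> ^ j) (red ((shift ^^ j) x))) \<le> C1 * tnorm k x * (1 / 2) ^ j" if "norm \<epsilon> < r" for \<epsilon> j x
  proof -
    have "(norm \<epsilon> * C2) ^ j \<le> (1 / 2) ^ j" using e2[OF that] C2(1) by (intro power_mono) auto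
    then have "C1 * tnorm k x * (norm \<epsilon> * C2) ^ j \<le> C1 * tnorm k x * (1 / 2) ^ j"
      using C1(1) by (intro mult_left_mono mult_nonneg_nonneg) auto
    with term_bound[of \<epsilon> j x] show ?thesis by (rule order_trans)
  qed
  have geo: "summable (\<lambda>j. c * (1 / 2 :: real) ^ j)" for c
    by (intro summable_mult summable_geometric) simp
  have sm: "summable (\<lambda>j. sB (\<epsilon> ^ j) (red ((shift ^^ j) x)))" if "norm \<epsilon> < r" for \<epsilon> x
    by (rule summable_comparison_test'[OF geo]) (use tb[OF that] in blast)
  have comp: "tlinear sB sB k (\<lambda>x. red ((shift ^^ j) x))" for j
    by (rule tlinear_compose[OF _ tlinear_red]) (rule tlinear_shift_funpow)
  define K where "K = 2 * C1 + 2 * C1 * C2"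
  show thesis
  proof (rule that[OF r, of K])
    show "K > 0" unfolding K_def using C1 C2 by (simp add: add_pos_pos)
    fix \<epsilon> :: 'k and x y :: "nat \<Rightarrow> 'b" assume e: "norm \<epsilon> < r"
    have "red ((shift ^^ j) (\<lambda>i. x i - y i)) = red ((shift ^^ j) x) - red ((shift ^^ j) y)" for j
      by (rule tlinear_diff[OF comp])
    then show "H \<epsilon> (\<lambda>i. x i - y i) = H \<epsilon> x - H \<epsilon> y"
      unfolding H_def suminf_diff[OF sm[OF e] sm[OF e]] by (simp add: B.scale_right_diff_distrib)
    have "red ((shift ^^ j) (\<lambda>i. x i + y i)) = red ((shift ^^ j) x) + red ((shift ^^ j) y)" for j
      by (rule tlinear_add[OF comp])
    then show "H \<epsilon> (\<lambda>i. x i + y i) = H \<epsilon> x + H \<epsilon> y"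
      unfolding H_def suminf_add[OF sm[OF e] sm[OF e]] by (simp add: B.scale_right_distrib)
  next
    fix \<epsilon> :: 'k and x assume e: "norm \<epsilon> < r"
    have "norm (H \<epsilon> x) \<le> (\<Sum>j. C1 * tnorm k x * (1 / 2) ^ j)"
      unfolding H_def by (rule norm_suminf_le[OF tb[OF e] geo])
    also have "\<dots> = 2 * C1 * tnorm k x" by (simp add: suminf_mult suminf_geometric)
    also have "\<dots> \<le> K * tnorm k x" unfolding K_def using C1 C2 by (intro mult_right_mono) auto
    finally show "norm (H \<epsilon> x) \<le> K * tnorm k x" .
    have "(\<lambda>j. sB (\<epsilon> ^ Suc j) (red ((shift ^^ Suc j) x))) sums (H \<epsilon> x - red x)"
      using summable_sums[OF sm[OF e, of x]] sums_Suc_iff[of "\<lambda>j. sB (\<epsilon> ^ j) (red ((shift ^^ j) x))" "H \<epsilon> x - red x"]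
      by (simp add: H_def)
    then have "H \<epsilon> x - red x = (\<Sum>j. sB (\<epsilon> ^ Suc j) (red ((shift ^^ Suc j) x)))" by (rule sums_unique)
    note arg_cong[of _ _ norm, OF this]
    also have "norm \<dots> \<le> (\<Sum>j. C1 * tnorm k x * (norm \<epsilon> * C2) * (1 / 2) ^ j)"
    proof (rule norm_suminf_le[OF _ geo])
      fix j
      have "(norm \<epsilon> * C2) ^ j \<le> (1 / 2) ^ j" using e2[OF e] C2(1) by (intro power_mono) auto
      then have "C1 * tnorm k x * (norm \<epsilon> * C2) * (norm \<epsilon> * C2) ^ j \<le> C1 * tnorm k x * (norm \<epsilon> * C2) * (1 / 2) ^ j"
        using C1(1) C2(1) by (intro mult_left_mono mult_nonneg_nonneg) auto
      then show "norm (sB (\<epsilon> ^ Suc j) (red ((shift ^^ Suc j) x))) \<le> C1 * tnorm k x * (norm \<epsilon> * C2) * (1 / 2) ^ j"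
        using term_bound[of \<epsilon> "Suc j" x] by (simp only: power_Suc mult.assoc)
    qed
    also have "\<dots> = 2 * C1 * C2 * norm \<epsilon> * tnorm k x" by (simp add: suminf_mult suminf_geometric)
    also have "\<dots> \<le> K * norm \<epsilon> * tnorm k x" unfolding K_def using C1 C2 by (intro mult_right_mono) auto
    finally show "norm (H \<epsilon> x - red x) \<le> K * norm \<epsilon> * tnorm k x" .
  next
    fix \<epsilon> :: 'k and x assume e: "norm \<epsilon> < r" and x: "x \<in> Yset"
    have xj: "(shift ^^ j) x \<in> Yset" for j by (induction j) (use x shift_properties(1) in auto)
    have fin: "Dx \<epsilon> x = E \<epsilon> (\<Sum>j<n. sB (\<epsilon> ^ j) (red ((shift ^^ j) x))) + sB (\<epsilon> ^ n) (Dx \<epsilon> ((shift ^^ n) x))" for n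
    proof (induction n)
      case 0
      then show ?case by (simp add: klinear_on_0[OF klinear_E])
    next
      case (Suc n)
      then show ?case
        using Dx_step[OF xj, of \<epsilon> n]
        by (simp add: klinear_onD[OF klinear_E] B.scale_right_distrib add.assoc mult.commute)
    qed
    obtain C3 where C3: "C3 > 0" "\<And>x. norm (Dx \<epsilon> x) \<le> C3 * tnorm k x" by (rule tlinear_bound[OF tlinear_Dx]) blast
    have "(\<lambda>n. sB (\<epsilon> ^ n) (Dx \<epsilon> ((shift ^^ n) x))) \<longlonglongrightarrow> 0"
    proof (rule Lim_null_comparison)
      show "(\<lambda>n. C3 * tnorm k x * (1 / 2) ^ n) \<longlonglongrightarrow> 0"
        by (intro tendsto_mult_right_zero LIMSEQ_realpow_zero) auto
      have "norm (sB (\<epsilon> ^ n) (Dx \<epsilon> ((shift ^^ n) x))) \<le> C3 * tnorm k x * (1 / 2) ^ n" for n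
      proof -
        have "norm (Dx \<epsilon> ((shift ^^ n) x)) \<le> C3 * (C2 ^ n * tnorm k x)"
          using order_trans[OF C3(2)[of "(shift ^^ n) x"] mult_left_mono[OF C2j[of n x], of C3]] C3(1) by simp
        then have "norm \<epsilon> ^ n * norm (Dx \<epsilon> ((shift ^^ n) x)) \<le> norm \<epsilon> ^ n * (C3 * (C2 ^ n * tnorm k x))"
          by (rule mult_left_mono) simp
        also have "\<dots> = C3 * tnorm k x * (norm \<epsilon> * C2) ^ n" by (simp add: power_mult_distrib mult.commute mult.left_commute)
        also have "\<dots> \<le> C3 * tnorm k x * (1 / 2) ^ n"
          using e2[OF e] C2(1) C3(1) by (intro mult_left_mono power_mono) auto
        finally show ?thesis by (simp add: norm_power)
      qed
      then show "\<forall>\<^sub>F n in sequentially. norm (sB (\<epsilon> ^ n) (Dx \<epsilon> ((shift ^^ n) x))) \<le> C3 * tnorm k x * (1 / 2) ^ n"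
        by simp
    qed
    moreover have "(\<lambda>n. E \<epsilon> (\<Sum>j<n. sB (\<epsilon> ^ j) (red ((shift ^^ j) x)))) \<longlonglongrightarrow> E \<epsilon> (H \<epsilon> x)"
      unfolding H_def
      by (rule bounded_linear.tendsto[OF klinear_on_bounded_linear[OF B.kspace_axioms B.kspace_axioms klinear_E]])
         (rule summable_LIMSEQ[OF sm[OF e]])
    ultimately have "(\<lambda>n. E \<epsilon> (\<Sum>j<n. sB (\<epsilon> ^ j) (red ((shift ^^ j) x))) + sB (\<epsilon> ^ n) (Dx \<epsilon> ((shift ^^ n) x)))
        \<longlonglongrightarrow> E \<epsilon> (H \<epsilon> x) + 0"
      by (intro tendsto_add)
    then show "Dx \<epsilon> x = E \<epsilon> (H \<epsilon> x)" unfolding fin[symmetric] by (simp add: LIMSEQ_const_iff)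
  qed
qed

subsection \<open>The leading operator is an isomorphism\<close>

lemma
  assumes "i \<in> {1..k+1}"
  shows subspace_R: "C.subspace (R i)" and subspace_Rc: "C.subspace (Rc i)"
    and R_Int_Rc: "R i \<inter> Rc i = {0}"
    and Rc_eq: "Rc (i - 1) = {x + y | x y. x \<in> R i \<and> y \<in> Rc i}"
  by (rule closed_direct_sumD[OF nsplit(2)[OF assms]])+

lemma Rc_0: "Rc 0 = UNIV"
  using chain by (simp add: operator_chain_def)

lemma subspace_Rc': "i \<le> k + 1 \<Longrightarrow> C.subspace (Rc i)"
  using subspace_Rc[of i] Rc_0 C.subspace_UNIV by (cases "i = 0") auto

lemma Rc_decomposition: "i \<le> k + 1 \<Longrightarrow> \<exists>w\<in>Rc i. \<exists>r. (\<forall>j\<in>{1..i}. r j \<in> R j) \<and> y = w + (\<Sum>j=1..i. r j)"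
proof (induction i)
  case 0
  then show ?case using Rc_0 by auto
next
  case (Suc i)
  then obtain w r where w: "w \<in> Rc i" and r: "\<forall>j\<in>{1..i}. r j \<in> R j" "y = w + (\<Sum>j=1..i. r j)" by auto
  obtain x v where xv: "w = x + v" "x \<in> R (Suc i)" "v \<in> Rc (Suc i)"
    using w Rc_eq[of "Suc i"] Suc.prems by auto
  define r' where "r' = r(Suc i := x)"
  have "(\<Sum>j=1..i. r' j) = (\<Sum>j=1..i. r j)" by (rule sum.cong) (auto simp: r'_def)
  then have "y = v + (\<Sum>j=1..Suc i. r' j)" using r(2) xv(1) by (simp add: r'_def)
  moreover have "\<forall>j\<in>{1..Suc i}. r' j \<in> R j" using r(1) xv(2) by (auto simp: r'_def)
  ultimately show ?case using xv(3) by blast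
qed

text \<open>Directness of the sum of \<open>Rc i\<close> and \<open>R 1, ..., R i\<close>; it makes
  the definite description in \<open>proj_Rc\<close> meaningful.\<close>

lemma Rc_decomposition_zero:
  "i \<le> k + 1 \<Longrightarrow> w \<in> Rc i \<Longrightarrow> \<forall>j\<in>{1..i}. r j \<in> R j \<Longrightarrow> w + (\<Sum>j=1..i. r j) = 0 \<Longrightarrow> w = 0"
proof (induction i arbitrary: w)
  case (Suc i)
  have R: "r (Suc i) \<in> R (Suc i)" using Suc.prems by simp
  have i: "Suc i \<in> {1..k+1}" using Suc.prems by simp
  have "\<exists>x y. w + r (Suc i) = x + y \<and> x \<in> R (Suc i) \<and> y \<in> Rc (Suc i)"
    by (intro exI[of _ "r (Suc i)"] exI[of _ w]) (simp add: R Suc.prems(2) add.commute)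
  then have "w + r (Suc i) \<in> Rc i" using Rc_eq[OF i] by simp
  then have "w + r (Suc i) = 0"
    using Suc.IH[of "w + r (Suc i)"] Suc.prems by (simp add: add.assoc add.commute)
  then have "r (Suc i) = - w" by (simp add: add_eq_0_iff)
  then have "w \<in> R (Suc i)" using C.subspace_neg[OF subspace_R[OF i] R] by simp
  then show ?case using R_Int_Rc[OF i] Suc.prems(2) by blast
qed simp

lemma proj_Rc_decomposition:
  assumes i: "i \<le> k + 1"
  obtains r where "\<And>j. j \<in> {1..i} \<Longrightarrow> r j \<in> R j" "y = proj_Rc R Rc i y + (\<Sum>j=1..i. r j)"
proof -
  obtain w r where w: "w \<in> Rc i" "\<forall>j\<in>{1..i}. r j \<in> R j" "y = w + (\<Sum>j=1..i. r j)"
    using Rc_decomposition[OF i, of y] by blast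
  have "proj_Rc R Rc i y = w"
    unfolding proj_Rc_def
  proof (rule the_equality)
    show "w \<in> Rc i \<and> (\<exists>r. (\<forall>j\<in>{1..i}. r j \<in> R j) \<and> y = w + (\<Sum>j=1..i. r j))" using w by blast
    fix w' assume "w' \<in> Rc i \<and> (\<exists>r. (\<forall>j\<in>{1..i}. r j \<in> R j) \<and> y = w' + (\<Sum>j=1..i. r j))"
    then obtain r' where w': "w' \<in> Rc i" "\<forall>j\<in>{1..i}. r' j \<in> R j" "y = w' + (\<Sum>j=1..i. r' j)" by blast
    have "w' - w = 0"
    proof (rule Rc_decomposition_zero[OF i, of _ "\<lambda>j. r' j - r j"])
      show "w' - w \<in> Rc i" by (rule C.subspace_diff[OF subspace_Rc'[OF i] w'(1) w(1)])
      show "\<forall>j\<in>{1..i}. r' j - r j \<in> R j"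
      proof
        fix j assume j: "j \<in> {1..i}"
        then have "j \<in> {1..k+1}" using i by auto
        from C.subspace_diff[OF subspace_R[OF this]] show "r' j - r j \<in> R j" using j w(2) w'(2) by blast
      qed
      show "w' - w + (\<Sum>j=1..i. r' j - r j) = 0" using w(3) w'(3) by (simp add: sum_subtractf algebra_simps)
    qed
    then show "w' = w" by simp
  qed
  then show thesis using that w by blast
qed

definition single :: "nat \<Rightarrow> 'b \<Rightarrow> nat \<Rightarrow> 'b" where "single i v = (\<lambda>_. 0)(i := v)"

lemma single_Yset: "i \<in> {1..k+1} \<Longrightarrow> v \<in> N (i - 1) \<Longrightarrow> single i v \<in> Yset"
  by (auto simp: Yset_iff single_def intro!: B.subspace_0[OF subspace_N])

lemma M_single: "i \<in> {1..k+1} \<Longrightarrow> j \<in> {1..k+1} \<Longrightarrow> i \<le> j \<Longrightarrow> mat_app k M (single i v) j = (if j = i then v else 0)"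
  unfolding mat_app_unit_upper[OF unit_M]
  using unit_M klinear_on_0[of sB sB "M j _"]
  by (auto simp: single_def unit_upper_matrix_def intro!: sum.neutral)

text \<open>The first factor is the \<open>1/j!\<close> in front of the coefficient of index
  \<open>j = 2k+2-i\<close>; the second undoes the normalisation \<open>(2(i-1))! / (i-1)!\<close>
  in the definition of \<open>S i\<close>.\<close>

definition lead :: "nat \<Rightarrow> 'k" where
  "lead i = inverse (fact (2 * k + 2 - i)) * inverse (fact (2 * (i - 1)) / fact (i - 1))"

text \<open>Modulo the ranges \<open>R\<^sub>1, \<dots>, R\<^sub>i\<^sub>-\<^sub>1\<close>, the operator \<open>Q\<close> acts on the \<open>i\<close>-th entry as a multiple of \<open>S\<^sub>i\<close>.\<close>

lemma Q_single:
  assumes i: "i \<in> {1..k+1}" and w: "w \<in> N (i - 1)"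
  obtains r where "\<And>j. j \<in> {1..i-1} \<Longrightarrow> r j \<in> R j" "Q (single i w) = sC (lead i) (S i w) + (\<Sum>j=1..i-1. r j)"
proof -
  define y where "y = mat_app k M (single i w)"
  \<comment> \<open>By upper triangularity of \<open>M\<close> the coefficients
    \<open>hat s y\<close> vanish for \<open>s < s0\<close>. Hence \<open>Lam (s0 + s)\<close> is
    the \<open>s\<close>-th sum of a chain that starts with a multiple of \<open>w\<close>, as in
    \<open>null_chain\<close>.\<close>
  define s0 where "s0 = k + 1 - i"
  define v where "v t = hat (s0 + t) y" for t
  have is0: "i + s0 = k + 1" using i by (simp add: s0_def)
  have yi: "y i = w" unfolding y_def using M_single[OF i i] by simp
  have hat0: "hat s y = 0" if "s < s0" for s
  proof -
    have "y (k + 1 - s) = 0" unfolding y_def using M_single[OF i, of "k + 1 - s" w] that is0 by auto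
    then show ?thesis by (simp add: hat_def)
  qed
  have Lam_chain: "Lam (s0 + s) y = (\<Sum>j=0..s. A j (v (s - j)))" for s
  proof -
    have "{..s0 + s} = {..<s0} \<union> {s0..s0 + s}" by auto
    then have "Lam (s0 + s) y = (\<Sum>t<s0. A (s0 + s - t) (hat t y)) + (\<Sum>t\<in>{s0..s0+s}. A (s0 + s - t) (hat t y))"
      unfolding Lam_def by (simp only:) (rule sum.union_disjoint, auto)
    also have "(\<Sum>t<s0. A (s0 + s - t) (hat t y)) = 0"
      by (rule sum.neutral) (auto simp: hat0 klinear_on_0[OF klinear_A])
    also have "(\<Sum>t\<in>{s0..s0+s}. A (s0 + s - t) (hat t y)) = (\<Sum>j=0..s. A j (v (s - j)))"
      by (rule sum.reindex_bij_witness[of _ "\<lambda>j. s0 + (s - j)" "\<lambda>t. s0 + s - t"]) (auto simp: v_def)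
    finally show ?thesis by simp
  qed
  have v0: "v 0 = sB (inverse (fact (2 * k + 2 - i))) w"
  proof -
    have "k + 1 + s0 = 2 * k + 2 - i" "k + 1 - s0 = i" using is0 by auto
    then show ?thesis unfolding v_def hat_def by (simp only: add_0_right yi)
  qed
  have i1: "i - 1 \<le> k + 1" using i by auto
  have v0N: "v 0 \<in> N (i - 1)" unfolding v0 by (rule B.subspace_scale[OF subspace_N[OF i1] w])
  have S_lin: "S i (v 0) = sC (inverse (fact (2 * k + 2 - i))) (S i w)"
    unfolding v0 using nsplit(3)[OF i] w by (auto simp: klinear_on_def)
  have "s0 + (i - 1) = k" using is0 i by auto
  then have Qs: "Q (single i w) = (\<Sum>j=0..i-1. A j (v (i - 1 - j)))"
    using Lam_chain[of "i - 1"] by (simp add: Q_def y_def)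
  have S1: "S 1 u = A 0 u" for u using chain by (simp add: operator_chain_def)
  show thesis
  proof (cases "i = 1")
    case True
    have "Q (single i w) = sC (lead i) (S i w)"
      using Qs S_lin S1 True by (simp add: lead_def)
    then show thesis using that[of "\<lambda>_. 0"] True by simp
  next
    case False
    then have ik: "i - 1 \<in> {1..k}" using i by auto
    have nch: "null_chain A (i - 1) (v 0) v"
      unfolding null_chain_def
    proof (intro conjI allI impI refl)
      fix s assume "s < i - 1"
      then have "s0 + s < k" using is0 by linarith
      then have "Lam (s0 + s) y = 0" unfolding y_def by (rule Lam_M_Yset[OF single_Yset[OF i w]])
      then show "(\<Sum>j=0..s. A j (v (s - j))) = 0" unfolding Lam_chain .
    qed
    have all: "\<forall>i\<in>{1..k}. \<forall>v0\<in>N i. (\<exists>v. null_chain A i v0 v) \<and>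
        (\<forall>v. null_chain A i v0 v \<longrightarrow> S (i+1) v0 =
             sC (fact (2*i) / fact i) (proj_Rc R Rc i (\<Sum>j=1..i. A j (v (i - j)))))"
      using chain unfolding operator_chain_def by iprover
    have "S (i - 1 + 1) (v 0) = sC (fact (2*(i-1)) / fact (i-1)) (proj_Rc R Rc (i-1) (\<Sum>j=1..i-1. A j (v (i - 1 - j))))"
      using all[rule_format, OF ik v0N] nch by blast
    then have SP: "S i (v 0) = sC (fact (2*(i-1)) / fact (i-1)) (proj_Rc R Rc (i-1) (\<Sum>j=1..i-1. A j (v (i - 1 - j))))"
      using i by simp
    have ne: "(fact (2*(i-1)) / fact (i-1) :: 'k) \<noteq> 0" by (simp only: divide_eq_0_iff fact_nonzero simp_thms not_False_eq_True)
    have P: "proj_Rc R Rc (i-1) (\<Sum>j=1..i-1. A j (v (i - 1 - j))) = sC (lead i) (S i w)"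
    proof -
      have "sC (lead i) (S i w) = sC (inverse (fact (2*(i-1)) / fact (i-1))) (S i (v 0))"
        unfolding S_lin lead_def by (simp only: C.scale_scale mult.commute)
      also have "\<dots> = proj_Rc R Rc (i-1) (\<Sum>j=1..i-1. A j (v (i - 1 - j)))"
        unfolding SP using ne by (rule C.s_inverse_cancel)
      finally show ?thesis ..
    qed
    obtain r where r: "\<And>j. j \<in> {1..i-1} \<Longrightarrow> r j \<in> R j"
      "(\<Sum>j=1..i-1. A j (v (i - 1 - j))) = proj_Rc R Rc (i-1) (\<Sum>j=1..i-1. A j (v (i - 1 - j))) + (\<Sum>j=1..i-1. r j)"
      by (rule proj_Rc_decomposition[OF i1]) blast
    \<comment> \<open>The sum in \<open>Q\<close> begins with \<open>j = 0\<close>, the one in the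
      definition of \<open>S i\<close> with \<open>j = 1\<close>; the extra term is a value of
      \<open>A 0 = S 1\<close> and so belongs to \<open>R 1\<close>.\<close>
    define r' where "r' = r(1 := r 1 + A 0 (v (i - 1)))"
    have one: "1 \<in> {1..i-1}" using ik by simp
    have "A 0 (v (i - 1)) \<in> R 1" using nsplit(4)[of 1] S1 N_0 by auto
    then have "r' j \<in> R j" if "j \<in> {1..i-1}" for j
      using r(1)[OF that] C.subspace_add[OF subspace_R[of 1]] by (auto simp: r'_def)
    moreover have "(\<Sum>j=1..i-1. r' j) = A 0 (v (i - 1)) + (\<Sum>j=1..i-1. r j)"
      using sum.remove[OF _ one, of r'] sum.remove[OF _ one, of r] by (simp add: r'_def add.commute add.left_commute)
    moreover have "Q (single i w) = A 0 (v (i - 1)) + (\<Sum>j=1..i-1. A j (v (i - 1 - j)))"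
      unfolding Qs by (simp add: sum.atLeast_Suc_atMost)
    ultimately show thesis using that[of r'] r(2) P by (simp add: add.left_commute)
  qed
qed

lemma lead_nonzero: "lead i \<noteq> 0"
  by (simp only: lead_def mult_eq_0_iff inverse_nonzero_iff_nonzero divide_eq_0_iff fact_nonzero inverse_eq_iff_eq simp_thms inverse_zero_imp_zero)

text \<open>A triangular solve: \<open>S i\<close> on \<open>Nc i\<close> hits the component in
  \<open>R i\<close>, and the error lies in the ranges of smaller index, where it is corrected by
  induction.\<close>

lemma Q_onto_ranges:
  "i \<le> k + 1 \<Longrightarrow> (\<And>j. j \<in> {1..i} \<Longrightarrow> r j \<in> R j) \<Longrightarrow> \<exists>w. (\<forall>j\<in>{1..k+1}. w j \<in> Nc j) \<and> Q w = (\<Sum>j=1..i. r j)"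
proof (induction i arbitrary: r)
  case 0
  then show ?case
    by (intro exI[of _ "\<lambda>_. 0"]) (auto simp: tlinear_0[OF tlinear_Q] intro!: B.subspace_0[OF subspace_Nc])
next
  case (Suc i)
  have i: "Suc i \<in> {1..k+1}" using Suc.prems by simp
  have "sC (inverse (lead (Suc i))) (r (Suc i)) \<in> R (Suc i)"
    using Suc.prems by (intro C.subspace_scale[OF subspace_R[OF i]]) auto
  then obtain w0 where w0: "w0 \<in> Nc (Suc i)" "S (Suc i) w0 = sC (inverse (lead (Suc i))) (r (Suc i))"
    using nsplit(5)[OF i] unfolding bij_betw_def by (metis imageE)
  have w0N: "w0 \<in> N (Suc i - 1)" using Nc_subset[OF i] w0 by blast
  obtain r0 where r0: "\<And>j. j \<in> {1..i} \<Longrightarrow> r0 j \<in> R j"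
    "Q (single (Suc i) w0) = sC (lead (Suc i)) (S (Suc i) w0) + (\<Sum>j=1..i. r0 j)"
    using Q_single[OF i w0N] unfolding diff_Suc_1 by blast
  have Q0: "Q (single (Suc i) w0) = r (Suc i) + (\<Sum>j=1..i. r0 j)"
    unfolding r0(2) w0(2) using lead_nonzero by simp
  have "r j - r0 j \<in> R j" if j: "j \<in> {1..i}" for j
  proof -
    have "j \<in> {1..k+1}" using j i by auto
    from C.subspace_diff[OF subspace_R[OF this]] show ?thesis using r0(1)[OF j] Suc.prems(2)[of j] j by simp
  qed
  then obtain w where w: "\<forall>j\<in>{1..k+1}. w j \<in> Nc j" "Q w = (\<Sum>j=1..i. r j - r0 j)"
    using Suc.IH[of "\<lambda>j. r j - r0 j"] Suc.prems by auto
  have "\<forall>j\<in>{1..k+1}. w j + single (Suc i) w0 j \<in> Nc j"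
    using w(1) w0(1) by (auto simp: single_def intro!: B.subspace_add[OF subspace_Nc])
  moreover have "Q (\<lambda>j. w j + single (Suc i) w0 j) = (\<Sum>j=1..Suc i. r j)"
    by (simp add: tlinear_add[OF tlinear_Q] w(2) Q0 sum_subtractf)
  ultimately show ?case by (intro exI[of _ "\<lambda>j. w j + single (Suc i) w0 j"]) simp
qed

text \<open>Surjectivity of the sum operator means that every \<open>y\<close> is a sum of elements
  of the ranges \<open>R j\<close>.\<close>

lemma Q_surj: "\<exists>w. (\<forall>j\<in>{1..k+1}. w j \<in> Nc j) \<and> Q w = y"
proof -
  obtain n where n: "\<forall>i\<in>{0..k}. n i \<in> N i" "y = (\<Sum>i=0..k. S (i+1) (n i))"
    using surj unfolding sum_operator_surj_def by blast
  have "y = (\<Sum>j=1..k+1. S j (n (j - 1)))"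
    unfolding n(2) by (rule sum.reindex_bij_witness[of _ "\<lambda>j. j - 1" "\<lambda>i. i + 1"]) auto
  moreover have "S j (n (j - 1)) \<in> R j" if "j \<in> {1..k+1}" for j
  proof -
    have "n (j - 1) \<in> N (j - 1)" using n(1) that by auto
    then show ?thesis unfolding nsplit(4)[OF that] by (rule imageI)
  qed
  ultimately show ?thesis using Q_onto_ranges[of "k + 1" "\<lambda>j. S j (n (j - 1))"] by simp
qed

lemma Nc_Yset: "(\<And>i. i \<in> {1..k+1} \<Longrightarrow> w i \<in> Nc i) \<Longrightarrow> w \<in> Yset"
  unfolding Yset_iff using Nc_subset by blast

text \<open>A tuple of \<open>Yset\<close> annihilated by \<open>Q\<close> has the form
  \<open>L n\<close>. Comparison of the decompositions \<open>w + L 0\<close> and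
  \<open>0 + L n\<close> of the same tuple gives \<open>w = 0\<close>.\<close>

lemma Q_inj:
  assumes w: "\<And>i. i \<in> {1..k+1} \<Longrightarrow> w i \<in> Nc i" and "Q w = 0" and i: "i \<in> {1..k+1}"
  shows "w i = 0"
proof -
  obtain n where n: "\<And>i. i \<in> {1..k+1} \<Longrightarrow> n i \<in> N i" "\<And>i. i \<in> {1..k+1} \<Longrightarrow> w i = mat_app k L n i"
    by (rule Q_eq_0[OF Nc_Yset[OF w] assms(2)]) blast+
  have "wpart w i = 0"
    by (rule npart_unique(2)[where n = n and w = "\<lambda>_. 0"]) (use n i B.subspace_0[OF subspace_Nc] in auto)
  moreover have "wpart w i = w i"
    by (rule npart_unique(2)[where n = "\<lambda>_. 0"])
       (use w i B.subspace_0[OF subspace_N] tlinear_0[OF tlinear_L] in auto)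
  ultimately show ?thesis by simp
qed

text \<open>Tuples with \<open>w i\<close> in \<open>Nc i\<close> are the coordinates of the vectors
  in the kernel \<open>V\<close> of \<open>proj (k + 1)\<close>. This turns \<open>Q\<close> into a
  map \<open>T\<close> from a closed subspace onto the whole target, and the open mapping theorem
  together with injectivity bounds the inverse.\<close>

theorem Q_lower_bound:
  obtains K where "K > 0" "\<And>w. (\<And>i. i \<in> {1..k+1} \<Longrightarrow> w i \<in> Nc i) \<Longrightarrow> tnorm k w \<le> K * norm (Q w)"
proof -
  define V where "V = {u. proj (k + 1) u = 0}"
  define T where "T u = Q (\<lambda>i. W i u)" for u
  have lin: "klinear_on sB sB UNIV (proj (k + 1))" by (rule klinear_proj) simp
  have bl: "bounded_linear (proj (k + 1))" by (rule klinear_on_bounded_linear[OF B.kspace_axioms B.kspace_axioms lin])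
  have Wb: "\<exists>C>0. \<forall>u. norm (W i u) \<le> C * norm u" if "i \<in> {1..k+1}" for i
    by (rule klinear_on_bound[OF klinear_W[OF that]]) blast
  then obtain CW where CW: "\<And>i. i \<in> {1..k+1} \<Longrightarrow> CW i > 0" "\<And>i u. i \<in> {1..k+1} \<Longrightarrow> norm (W i u) \<le> CW i * norm u" by metis
  define CS where "CS = (\<Sum>i=1..k+1. CW i)"
  have CS: "CS > 0" unfolding CS_def by (rule sum_pos) (use CW in auto)
  have Wt: "tnorm k (\<lambda>i. W i u) \<le> CS * norm u" for u
    unfolding tnorm_def CS_def sum_distrib_right by (rule sum_mono) (rule CW)
  obtain CQ where CQ: "CQ > 0" "\<And>x. norm (Q x) \<le> CQ * tnorm k x" by (rule tlinear_bound[OF tlinear_Q]) blast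
  have img: "T ` V = UNIV"
  proof -
    have "y \<in> T ` V" for y
    proof -
      obtain w where w: "\<forall>j\<in>{1..k+1}. w j \<in> Nc j" "Q w = y" using Q_surj by blast
      define u where "u = (\<Sum>j=1..k+1. w j) + 0"
      have 0: "0 \<in> N (k + 1)" by (rule B.subspace_0[OF subspace_N]) simp
      have "u \<in> V" unfolding u_def V_def mem_Collect_eq by (rule W_of_sum(2)) (use w 0 in auto)
      moreover have "T u = Q w"
        unfolding T_def by (rule tlinear_cong[OF tlinear_Q], unfold u_def, rule W_of_sum(1)) (use w 0 in auto)
      ultimately show ?thesis using w(2) by (intro image_eqI[of _ _ u]) simp_all
    qed
    then show ?thesis by blast
  qed
  obtain K where K: "K > 0" "\<And>y. y \<in> T ` V \<Longrightarrow> \<exists>u\<in>V. T u = y \<and> norm u \<le> K * norm y"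
  proof (rule open_mapping_closed_subspace[of V T "CQ * CS"])
    show "closed V" unfolding V_def
      by (intro closed_Collect_eq bounded_linear.continuous_on[OF bl] continuous_on_id continuous_on_const)
    show "real_vector.subspace V"
      unfolding V_def real_vector.subspace_def using bl
      by (auto simp: linear_simps)
    show "T (x + y) = T x + T y" for x y
    proof -
      have "T (x + y) = Q (\<lambda>i. W i x + W i y)"
        unfolding T_def by (rule tlinear_cong[OF tlinear_Q]) (rule klinear_onD(1)[OF klinear_W])
      then show ?thesis by (simp add: T_def tlinear_add[OF tlinear_Q])
    qed
    show "T (r *\<^sub>R x) = r *\<^sub>R T x" for r x
    proof -
      have "T (r *\<^sub>R x) = Q (\<lambda>i. sB (of_real r) (W i x))"
        unfolding T_def B.s_of_real[symmetric] by (rule tlinear_cong[OF tlinear_Q]) (rule klinear_onD(2)[OF klinear_W])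
      then show ?thesis unfolding tlinear_scale[OF tlinear_Q] by (simp add: T_def)
    qed
    show "norm (T x) \<le> CQ * CS * norm x" for x
      unfolding T_def mult.assoc using CQ(2)[of "\<lambda>i. W i x"] mult_left_mono[OF Wt[of x], of CQ] CQ(1) by linarith
    show "closed (T ` V)" unfolding img by simp
  qed blast
  show thesis
  proof (rule that[of "CS * K"])
    show "CS * K > 0" using CS K by simp
    fix w assume w: "\<And>i. i \<in> {1..k+1} \<Longrightarrow> w i \<in> Nc i"
    obtain u where u: "T u = Q w" "norm u \<le> K * norm (Q w)" using K(2)[of "Q w"] img by auto
    have "W i u - w i = 0" if "i \<in> {1..k+1}" for i
    proof (rule Q_inj[OF _ _ that])
      show "W i u - w i \<in> Nc i" if "i \<in> {1..k+1}" for i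
        by (rule B.subspace_diff[OF subspace_Nc[OF that] W_mem[OF that] w[OF that]])
      show "Q (\<lambda>i. W i u - w i) = 0" using u(1) by (simp add: tlinear_diff[OF tlinear_Q] T_def)
    qed
    then have "tnorm k w = tnorm k (\<lambda>i. W i u)" unfolding tnorm_def by (intro sum.cong) auto
    also have "\<dots> \<le> CS * norm u" by (rule Wt)
    also have "\<dots> \<le> CS * (K * norm (Q w))" using CS u(2) by (intro mult_left_mono) auto
    finally show "tnorm k w \<le> CS * K * norm (Q w)" by (simp add: mult.assoc)
  qed
qed

text \<open>Row 1 belongs to the highest power, and upper triangularity of \<open>M\<close> adds
  nothing in other rows. Since \<open>N 0\<close> is the whole space, \<open>v\<close> is arbitrary:
  this makes \<open>E \<epsilon>\<close> onto for \<epsilon> \<noteq> 0 and lets tails of order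
  \<open>2k+2\<close> be absorbed.\<close>

lemma Dx_first: "Dx \<epsilon> (single 1 v) = sB (\<epsilon> ^ (2 * k + 1) / fact (2 * k + 1)) v"
proof -
  have y: "mat_app k M (single 1 v) j = (if j = 1 then v else 0)" if "j \<in> {1..k+1}" for j
    using M_single[of 1 j v] that by simp
  have h: "hat s (mat_app k M (single 1 v)) = (if s = k then sB (inverse (fact (2 * k + 1))) v else 0)" if "s \<le> k" for s
  proof -
    have j: "k + 1 - s \<in> {1..k+1}" using that by auto
    have kk: "k + 1 + k = 2 * k + 1" by simp
    show ?thesis unfolding hat_def y[OF j] using that by (auto simp only: kk diff_add_inverse2 if_True B.scale_zero_right split: if_splits)
  qed
  have "Dx \<epsilon> (single 1 v) = (\<Sum>s\<le>k. if s = k then sB (\<epsilon> ^ (k + 1 + s)) (sB (inverse (fact (2 * k + 1))) v) else 0)"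
    unfolding Dx_def Dl_def
  proof (rule sum.cong[OF refl])
    fix s assume "s \<in> {..k}"
    then have s: "s \<le> k" by simp
    show "sB (\<epsilon> ^ (k + 1 + s)) (hat s (mat_app k M (single 1 v))) =
      (if s = k then sB (\<epsilon> ^ (k + 1 + s)) (sB (inverse (fact (2 * k + 1))) v) else 0)"
      unfolding h[OF s] by (cases "s = k") (simp_all del: fact_Suc)
  qed
  also have "\<dots> = sB (\<epsilon> ^ (k + 1 + k)) (sB (inverse (fact (2 * k + 1))) v)" by simp
  also have "k + 1 + k = 2 * k + 1" by simp
  finally show ?thesis by (simp only: B.scale_scale divide_inverse)
qed

lemma single_1_Yset: "single 1 v \<in> Yset"
  by (rule single_Yset) (auto simp: N_0)

lemma entry_bound:
  assumes "unit_upper_matrix sB k T"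
  obtains c where "c \<ge> 1" "\<And>i j v. i \<in> {1..k+1} \<Longrightarrow> j \<in> {1..k+1} \<Longrightarrow> norm (T i j v) \<le> c * norm v"
proof -
  have "\<exists>C>0. \<forall>v. norm (T i j v) \<le> C * norm v" if "i \<in> {1..k+1}" "j \<in> {1..k+1}" for i j
    by (rule klinear_on_bound[of sB sB "T i j"]) (use assms that in \<open>auto simp: unit_upper_matrix_def\<close>)
  then obtain C where C: "\<And>i j. i \<in> {1..k+1} \<Longrightarrow> j \<in> {1..k+1} \<Longrightarrow> C i j > 0"
    "\<And>i j v. i \<in> {1..k+1} \<Longrightarrow> j \<in> {1..k+1} \<Longrightarrow> norm (T i j v) \<le> C i j * norm v" by metis
  define c where "c = 1 + (\<Sum>i=1..k+1. \<Sum>j=1..k+1. C i j)"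
  have nn: "0 \<le> (\<Sum>j=1..k+1. C i j)" if "i \<in> {1..k+1}" for i
    by (rule sum_nonneg) (rule less_imp_le[OF C(1)[OF that]])
  have le: "C i j \<le> c" if "i \<in> {1..k+1}" "j \<in> {1..k+1}" for i j
  proof -
    have "C i j \<le> (\<Sum>j=1..k+1. C i j)" by (rule member_le_sum) (use C(1) that in \<open>auto intro: less_imp_le\<close>)
    also have "\<dots> \<le> (\<Sum>i=1..k+1. \<Sum>j=1..k+1. C i j)"
      by (rule member_le_sum[where f = "\<lambda>i. \<Sum>j=1..k+1. C i j"]) (use nn that in blast)+
    finally show ?thesis by (simp add: c_def)
  qed
  show thesis
  proof (rule that[of c])
    show "c \<ge> 1" unfolding c_def using sum_nonneg[of "{1..k+1}" "\<lambda>i. \<Sum>j=1..k+1. C i j"] nn by simp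
    show "norm (T i j v) \<le> c * norm v" if "i \<in> {1..k+1}" "j \<in> {1..k+1}" for i j v
      using C(2)[OF that, of v] mult_right_mono[OF le[OF that], of "norm v"] by simp
  qed
qed

lemma Dl_alt: "Dl \<epsilon> y = (\<Sum>i=1..k+1. sB (\<epsilon> ^ (2*k+2-i) / fact (2*k+2-i)) (y i))"
  unfolding Dl_def
  by (rule sum.reindex_bij_witness[of _ "\<lambda>i. k + 1 - i" "\<lambda>s. k + 1 - s"])
     (auto simp: hat_def divide_inverse Suc_diff_le mult_2 simp del: fact_Suc)

text \<open>After rescaling the coordinates by their powers of \<open>\<epsilon>\<close>, \<open>E \<epsilon>\<close> is a small perturbation of the identity.\<close>

theorem E_lower_bound:
  obtains r where "r > 0" "\<And>\<epsilon>. \<epsilon> \<noteq> 0 \<Longrightarrow> norm \<epsilon> < r \<Longrightarrow> \<exists>\<kappa>>0. \<forall>u. norm (E \<epsilon> u) \<ge> \<kappa> * norm u"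
proof -
  obtain cM where cM: "cM \<ge> 1" "\<And>i j v. i \<in> {1..k+1} \<Longrightarrow> j \<in> {1..k+1} \<Longrightarrow> norm (M i j v) \<le> cM * norm v"
    by (rule entry_bound[OF unit_M]) blast
  obtain cL where cL: "cL \<ge> 1" "\<And>i j v. i \<in> {1..k+1} \<Longrightarrow> j \<in> {1..k+1} \<Longrightarrow> norm (L i j v) \<le> cL * norm v"
    by (rule entry_bound[OF unit_L]) blast
  have "\<exists>C>0. \<forall>u. norm (W i u) \<le> C * norm u" if "i \<in> {1..k+1}" for i
    by (rule klinear_on_bound[OF klinear_W[OF that]]) blast
  then obtain CW where CW: "\<And>i. i \<in> {1..k+1} \<Longrightarrow> CW i > 0" "\<And>i u. i \<in> {1..k+1} \<Longrightarrow> norm (W i u) \<le> CW i * norm u" by metis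
  have lin: "klinear_on sB sB UNIV (proj (k + 1))" by (rule klinear_proj) simp
  obtain CP where CP: "CP > 0" "\<And>u. norm (proj (k + 1) u) \<le> CP * norm u" by (rule klinear_on_bound[OF lin]) blast
  define m where "m i = 2 * k + 2 - i" for i
  \<comment> \<open>\<open>F\<close> bounds the weighted coordinate sum \<open>\<beta>\<close> by
    \<open>norm uh\<close>, and \<open>D\<close> bounds the off-diagonal part by
    \<open>a * D * \<beta>\<close>; the radius makes that part at most half of
    \<open>uh\<close>.\<close>
  define F where "F = (\<Sum>i=1..k+1. fact (m i) * CW i) + fact (k + 1) * CP"
  have F: "F > 0" unfolding F_def using CW(1) CP(1) by (intro add_nonneg_pos sum_nonneg mult_pos_pos) (auto intro!: mult_nonneg_nonneg less_imp_le)
  define D where "D = real (k + 1) * (cL + real (k + 1) * (cM * (1 + cL)))"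
  have D: "D \<ge> 0" unfolding D_def using cM cL by (intro mult_nonneg_nonneg add_nonneg_nonneg) auto
  define r where "r = min 1 (1 / (2 * (D * F + 1)))"
  have DF: "D * F \<ge> 0" using D F by simp
  have r: "r > 0" using DF by (simp add: r_def)
  show thesis
  proof (rule that[OF r])
    fix \<epsilon> :: 'k assume e0: "\<epsilon> \<noteq> 0" and e: "norm \<epsilon> < r"
    define a where "a = norm \<epsilon>"
    have a: "0 < a" "a \<le> 1" using e0 e by (auto simp: a_def r_def)
    have aDF: "a * (D * F) \<le> 1 / 2"
    proof -
      have "a * (2 * (D * F + 1)) < 1" using e DF by (simp add: r_def a_def pos_less_divide_eq)
      then show ?thesis using a by (simp add: algebra_simps)
    qed
    \<comment> \<open>The constant degenerates like \<open>a ^ (2k+2)\<close>. This is harmless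
      because the lower bound is only used at a fixed \<epsilon>.\<close>
    define \<kappa> where "\<kappa> = inverse (2 * F * inverse (a ^ (2 * k + 2)))"
    have \<kappa>: "\<kappa> > 0" using F a by (simp add: \<kappa>_def)
    have "norm (E \<epsilon> u) \<ge> \<kappa> * norm u" for u
    proof -
      define n where "n = proj (k + 1) u"
      have nN: "n \<in> N (k + 1)" unfolding n_def by (rule proj_mem) simp
      define ws where "ws i = sB (\<epsilon> ^ m i / fact (m i)) (W i u)" for i
      define ns where "ns = sB (\<epsilon> ^ (k + 1) / fact (k + 1)) n"
      \<comment> \<open>The diagonal part of \<open>E \<epsilon> u\<close>: the coordinates of
        \<open>u\<close>, each multiplied by its own power of \<epsilon> and divided by the
        factorial.\<close>
      define uh where "uh = (\<Sum>i=1..k+1. ws i) + ns"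
      have wsN: "ws i \<in> Nc i" if "i \<in> {1..k+1}" for i
        unfolding ws_def by (rule B.subspace_scale[OF subspace_Nc[OF that] W_mem[OF that]])
      have nsN: "ns \<in> N (k + 1)" unfolding ns_def by (rule B.subspace_scale[OF subspace_N nN]) simp
      have Wuh: "W i uh = ws i" if "i \<in> {1..k+1}" for i unfolding uh_def by (rule W_of_sum(1)[OF wsN nsN that])
      have Puh: "proj (k + 1) uh = ns" unfolding uh_def by (rule W_of_sum(2)[OF wsN nsN])
      have sc: "norm (sB (\<epsilon> ^ j / fact j) v) = a ^ j / fact j * norm v" for j v
        by (simp only: B.norm_s norm_divide norm_power norm_fact a_def)
      have aW: "a ^ m i * norm (W i u) \<le> fact (m i) * CW i * norm uh" if "i \<in> {1..k+1}" for i
      proof -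
        have "a ^ m i / fact (m i) * norm (W i u) \<le> CW i * norm uh"
          using CW(2)[OF that, of uh] unfolding Wuh[OF that] ws_def sc .
        then show ?thesis by (simp add: pos_divide_le_eq mult.commute mult.left_commute)
      qed
      have an: "a ^ (k + 1) * norm n \<le> fact (k + 1) * CP * norm uh"
      proof -
        have "a ^ (k + 1) / fact (k + 1) * norm n \<le> CP * norm uh"
          using CP(2)[of uh] unfolding Puh ns_def sc .
        then show ?thesis by (simp add: pos_divide_le_eq mult.commute mult.left_commute del: fact_Suc power_Suc)
      qed
      define \<beta> where "\<beta> = (\<Sum>i=1..k+1. a ^ m i * norm (W i u)) + a ^ (k + 1) * norm n"
      have \<beta>F: "\<beta> \<le> F * norm uh"
        unfolding \<beta>_def F_def distrib_right sum_distrib_right by (intro add_mono sum_mono aW an)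
      have \<beta>W: "a ^ m i * norm (W i u) \<le> \<beta>" if "i \<in> {1..k+1}" for i
      proof -
        have "a ^ m i * norm (W i u) \<le> (\<Sum>i=1..k+1. a ^ m i * norm (W i u))"
          using that a by (intro member_le_sum[where f = "\<lambda>i. a ^ m i * norm (W i u)"]) auto
        then show ?thesis using a unfolding \<beta>_def by (simp add: add_increasing2)
      qed
      have \<beta>n: "a ^ (k + 1) * norm n \<le> \<beta>"
        unfolding \<beta>_def using a by (intro add_increasing sum_nonneg) auto
      have \<beta>0: "\<beta> \<ge> 0" unfolding \<beta>_def using a by (intro add_nonneg_nonneg sum_nonneg) auto
      define x where "x = emb u"
      have kk: "k + 1 \<in> {1..k+1}" by simp
      \<comment> \<open>What the strictly upper parts of \<open>L\<close> and \<open>M\<close>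
        contribute to row \<open>i\<close>. Only coordinates of rows \<open>j > i\<close> occur, and
        their own power \<open>m j\<close> is smaller than \<open>m i\<close>; so one factor
        \<open>a\<close> is gained against \<open>\<beta>\<close>.\<close>
      define z where "z i = (if i = k + 1 then 0 else L i (k + 1) n) + (\<Sum>j\<in>{i<..k+1}. M i j (x j))" for i
      have Llast: "mat_app k L (last_entry n) i = (if i = k + 1 then n else L i (k + 1) n)" if "i \<in> {1..k+1}" for i
      proof -
        have "(\<Sum>j\<in>{i<..k+1}. L i j (last_entry n j)) = (\<Sum>j\<in>{i<..k+1}. if j = k + 1 then L i (k + 1) n else 0)"
        proof (rule sum.cong[OF refl])
          fix j assume "j \<in> {i<..k+1}"
          then have "klinear_on sB sB UNIV (L i j)" using unit_L that by (auto simp: unit_upper_matrix_def)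
          then show "L i j (last_entry n j) = (if j = k + 1 then L i (k + 1) n else 0)"
            using klinear_on_0 by (auto simp: last_entry_def)
        qed
        then show ?thesis unfolding mat_app_unit_upper[OF unit_L that] using that by (auto simp: last_entry_def)
      qed
      have xi: "x i = W i u + (if i = k + 1 then n else L i (k + 1) n)" if "i \<in> {1..k+1}" for i
        unfolding x_def emb_def n_def[symmetric] Llast[OF that] ..
      have xb: "norm (x j) \<le> norm (W j u) + cL * norm n" if "j \<in> {1..k+1}" for j
      proof -
        have "norm (if j = k + 1 then n else L j (k + 1) n) \<le> cL * norm n"
          using cL(2)[OF that kk, of n] mult_right_mono[OF cL(1), of "norm n"] by auto
        then show ?thesis unfolding xi[OF that] using norm_triangle_ineq[of "W j u" "if j = k + 1 then n else L j (k + 1) n"] by linarith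
      qed
      have Mx: "mat_app k M x i = W i u + (if i = k + 1 then n else 0) + z i" if "i \<in> {1..k+1}" for i
        unfolding mat_app_unit_upper[OF unit_M that] xi[OF that] z_def by simp
      have Eu: "E \<epsilon> u = uh + (\<Sum>i=1..k+1. sB (\<epsilon> ^ m i / fact (m i)) (z i))"
      proof -
        have "E \<epsilon> u = (\<Sum>i=1..k+1. sB (\<epsilon> ^ m i / fact (m i)) (W i u + (if i = k + 1 then n else 0) + z i))"
          unfolding E_def Dx_def x_def[symmetric] Dl_alt m_def[symmetric] by (rule sum.cong[OF refl]) (simp only: Mx)
        also have "\<dots> = (\<Sum>i=1..k+1. ws i) + (\<Sum>i=1..k+1. if i = k + 1 then sB (\<epsilon> ^ m i / fact (m i)) n else 0)
            + (\<Sum>i=1..k+1. sB (\<epsilon> ^ m i / fact (m i)) (z i))"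
          unfolding ws_def sum.distrib[symmetric] by (rule sum.cong) (auto simp: B.scale_right_distrib)
        also have "(\<Sum>i=1..k+1. if i = k + 1 then sB (\<epsilon> ^ m i / fact (m i)) n else 0) = ns"
        proof -
          have "m (k + 1) = k + 1" by (simp add: m_def)
          then show ?thesis unfolding ns_def by (subst sum.delta) (simp_all del: fact_Suc power_Suc)
        qed
        finally show ?thesis by (simp add: uh_def)
      qed
      have zb: "norm (sB (\<epsilon> ^ m i / fact (m i)) (z i)) \<le> a * (cL + real (k + 1) * (cM * (1 + cL))) * \<beta>" if i: "i \<in> {1..k+1}" for i
      proof (cases "i = k + 1")
        case True
        then have "z i = 0" by (simp add: z_def)
        then show ?thesis using a \<beta>0 cM cL by simp
      next
        case False
        then have ik: "i \<le> k" using i by simp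
        have pw: "a ^ m i * t \<le> a * b" if "a ^ j * t \<le> b" "Suc j \<le> m i" "t \<ge> 0" for j t b
        proof -
          have "a ^ m i \<le> a ^ Suc j" using a that(2) by (intro power_decreasing) auto
          then have "a ^ m i * t \<le> a ^ Suc j * t" using that(3) by (rule mult_right_mono)
          also have "\<dots> = a * (a ^ j * t)" by simp
          also have "\<dots> \<le> a * b" using a that(1) by (intro mult_left_mono) auto
          finally show ?thesis .
        qed
        have pn: "a ^ m i * norm n \<le> a * \<beta>" by (rule pw[OF \<beta>n]) (use ik in \<open>auto simp: m_def\<close>)
        have pW: "a ^ m i * norm (W j u) \<le> a * \<beta>" if "j \<in> {i<..k+1}" for j
          by (rule pw[OF \<beta>W]) (use that in \<open>auto simp: m_def\<close>)
        have px: "a ^ m i * norm (M i j (x j)) \<le> cM * (1 + cL) * (a * \<beta>)" if j: "j \<in> {i<..k+1}" for j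
        proof -
          have jj: "j \<in> {1..k+1}" using j by auto
          have "norm (M i j (x j)) \<le> cM * (norm (W j u) + cL * norm n)"
            using cM(2)[OF i jj, of "x j"] mult_left_mono[OF xb[OF jj], of cM] cM(1) by linarith
          then have "a ^ m i * norm (M i j (x j)) \<le> a ^ m i * (cM * (norm (W j u) + cL * norm n))"
            using a by (intro mult_left_mono) auto
          also have "\<dots> = cM * (a ^ m i * norm (W j u) + cL * (a ^ m i * norm n))" by (simp add: algebra_simps)
          also have "\<dots> \<le> cM * (a * \<beta> + cL * (a * \<beta>))"
            using cM(1) cL(1) by (intro mult_left_mono add_mono pW[OF j] pn) auto
          finally show ?thesis by (simp add: algebra_simps)
        qed
        have "norm (z i) \<le> norm (L i (k + 1) n) + (\<Sum>j\<in>{i<..k+1}. norm (M i j (x j)))"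
          unfolding z_def using False by (simp add: norm_triangle_mono norm_sum)
        also have "\<dots> \<le> cL * norm n + (\<Sum>j\<in>{i<..k+1}. norm (M i j (x j)))" using cL(2)[OF i kk, of n] by simp
        finally have "a ^ m i * norm (z i) \<le> a ^ m i * (cL * norm n + (\<Sum>j\<in>{i<..k+1}. norm (M i j (x j))))"
          using a by (intro mult_left_mono) auto
        also have "\<dots> = cL * (a ^ m i * norm n) + (\<Sum>j\<in>{i<..k+1}. a ^ m i * norm (M i j (x j)))"
          by (simp add: distrib_left sum_distrib_left mult.left_commute)
        also have "\<dots> \<le> cL * (a * \<beta>) + (\<Sum>j\<in>{i<..k+1}. cM * (1 + cL) * (a * \<beta>))"
          using cL(1) by (intro add_mono mult_left_mono pn sum_mono px) auto
        also have "(\<Sum>j\<in>{i<..k+1}. cM * (1 + cL) * (a * \<beta>)) \<le> real (k + 1) * (cM * (1 + cL) * (a * \<beta>))"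
          using cM(1) cL(1) a \<beta>0 by (simp add: mult_right_mono)
        finally have "a ^ m i * norm (z i) \<le> a * (cL + real (k + 1) * (cM * (1 + cL))) * \<beta>" by (simp add: algebra_simps)
        moreover have "norm (sB (\<epsilon> ^ m i / fact (m i)) (z i)) \<le> a ^ m i * norm (z i)"
        proof -
          have "a ^ m i / fact (m i) \<le> a ^ m i / 1" using a fact_ge_1[of "m i", where 'a=real] by (intro divide_left_mono) auto
          then show ?thesis unfolding sc by (intro mult_right_mono) auto
        qed
        ultimately show ?thesis by linarith
      qed
      have "norm (\<Sum>i=1..k+1. sB (\<epsilon> ^ m i / fact (m i)) (z i)) \<le> (\<Sum>i=1..k+1. a * (cL + real (k + 1) * (cM * (1 + cL))) * \<beta>)"
        by (rule sum_norm_le) (rule zb)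
      also have "\<dots> = a * D * \<beta>" by (simp add: D_def)
      also have "\<dots> \<le> a * D * (F * norm uh)" using a D \<beta>F by (intro mult_left_mono) auto
      also have "\<dots> = a * (D * F) * norm uh" by simp
      also have "\<dots> \<le> 1 / 2 * norm uh" by (rule mult_right_mono[OF aDF]) simp
      finally have "norm (E \<epsilon> u) \<ge> norm uh / 2"
        unfolding Eu using norm_diff_ineq[of uh "\<Sum>i=1..k+1. sB (\<epsilon> ^ m i / fact (m i)) (z i)"] by linarith
      moreover have "norm u \<le> inverse (a ^ (2 * k + 2)) * \<beta>"
      proof -
        have big: "t \<le> inverse (a ^ (2 * k + 2)) * (a ^ j * t)" if "j \<le> 2 * k + 2" "t \<ge> 0" for j t
        proof -
          have "a ^ (2 * k + 2) * t \<le> a ^ j * t" using a that by (intro mult_right_mono power_decreasing) auto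
          then show ?thesis using a by (simp add: field_simps del: power_Suc)
        qed
        have "norm u \<le> (\<Sum>i=1..k+1. norm (W i u)) + norm n"
          by (subst W_sum[of u]) (unfold n_def[symmetric], intro norm_triangle_mono norm_sum order_refl)
        also have "\<dots> \<le> (\<Sum>i=1..k+1. inverse (a ^ (2 * k + 2)) * (a ^ m i * norm (W i u))) + inverse (a ^ (2 * k + 2)) * (a ^ (k + 1) * norm n)"
          by (intro add_mono sum_mono big) (auto simp: m_def)
        finally show ?thesis unfolding \<beta>_def by (simp add: distrib_left sum_distrib_left)
      qed
      moreover have "inverse (a ^ (2 * k + 2)) * \<beta> \<le> inverse (a ^ (2 * k + 2)) * (F * norm uh)"
        using a \<beta>F by (intro mult_left_mono) auto
      ultimately have "norm u \<le> 2 * F * inverse (a ^ (2 * k + 2)) * norm (E \<epsilon> u)"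
      proof -
        assume 1: "norm uh / 2 \<le> norm (E \<epsilon> u)" and 2: "norm u \<le> inverse (a ^ (2 * k + 2)) * \<beta>"
          and 3: "inverse (a ^ (2 * k + 2)) * \<beta> \<le> inverse (a ^ (2 * k + 2)) * (F * norm uh)"
        have "inverse (a ^ (2 * k + 2)) * (F * norm uh) \<le> inverse (a ^ (2 * k + 2)) * (F * (2 * norm (E \<epsilon> u)))"
          using 1 a F by (intro mult_left_mono) auto
        then show ?thesis using 2 3 by (simp add: mult.assoc mult.left_commute)
      qed
      then have "\<kappa> * norm u \<le> \<kappa> * (2 * F * inverse (a ^ (2 * k + 2)) * norm (E \<epsilon> u))"
        using \<kappa> by (intro mult_left_mono) auto
      also have "\<dots> = (\<kappa> * (2 * F * inverse (a ^ (2 * k + 2)))) * norm (E \<epsilon> u)" by (simp only: mult.assoc)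
      also have "\<kappa> * (2 * F * inverse (a ^ (2 * k + 2))) = 1"
        unfolding \<kappa>_def by (rule left_inverse) (use F a in simp)
      finally show ?thesis by simp
    qed
    then show "\<exists>\<kappa>>0. \<forall>u. norm (E \<epsilon> u) \<ge> \<kappa> * norm u" using \<kappa> by blast
  qed
qed

end

section \<open>Maps that are Lipschitz on bounded sets\<close>

definition lip_bounded :: "('x::real_normed_vector \<Rightarrow> 'y::real_normed_vector) \<Rightarrow> bool" where
  "lip_bounded f \<longleftrightarrow> (\<forall>r. \<exists>K\<ge>0. \<forall>u v. norm u \<le> r \<longrightarrow> norm v \<le> r \<longrightarrow> norm (f u - f v) \<le> K * norm (u - v))"

lemma lip_boundedE:
  assumes "lip_bounded f"
  obtains K where "K \<ge> 0" "\<And>u v. norm u \<le> r \<Longrightarrow> norm v \<le> r \<Longrightarrow> norm (f u - f v) \<le> K * norm (u - v)"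
  using assms unfolding lip_bounded_def by blast

lemma lip_bounded_bound:
  assumes "lip_bounded f"
  obtains K where "K \<ge> 0" "\<And>u. norm u \<le> r \<Longrightarrow> norm (f u) \<le> K"
proof -
  obtain K where K: "K \<ge> 0" "\<And>u v. norm u \<le> \<bar>r\<bar> \<Longrightarrow> norm v \<le> \<bar>r\<bar> \<Longrightarrow> norm (f u - f v) \<le> K * norm (u - v)"
    by (rule lip_boundedE[OF assms]) blast
  show thesis
  proof (rule that[of "norm (f 0) + K * \<bar>r\<bar>"])
    show "norm (f u) \<le> norm (f 0) + K * \<bar>r\<bar>" if "norm u \<le> r" for u
    proof -
      have "norm (f u) \<le> norm (f 0) + norm (f u - f 0)" using norm_triangle_ineq[of "f 0" "f u - f 0"] by simp
      also have "norm (f u - f 0) \<le> K * norm u" using K(2)[of u 0] that by simp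
      also have "\<dots> \<le> K * \<bar>r\<bar>" using that K(1) by (intro mult_left_mono) auto
      finally show ?thesis by simp
    qed
  qed (use K(1) in simp)
qed

lemma lip_bounded_const: "lip_bounded (\<lambda>_. b)"
  unfolding lip_bounded_def by auto

lemma lip_bounded_klinear: "klinear_on sX sY UNIV f \<Longrightarrow> lip_bounded f"
  unfolding lip_bounded_def
  by (metis klinear_on_bound klinear_on_diff less_imp_le)

lemma lip_bounded_add:
  assumes "lip_bounded f" "lip_bounded g"
  shows "lip_bounded (\<lambda>u. f u + g u)"
  unfolding lip_bounded_def
proof
  fix r
  obtain K where K: "K \<ge> 0" "\<And>u v. norm u \<le> r \<Longrightarrow> norm v \<le> r \<Longrightarrow> norm (f u - f v) \<le> K * norm (u - v)"
    by (rule lip_boundedE[OF assms(1)]) blast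
  obtain K' where K': "K' \<ge> 0" "\<And>u v. norm u \<le> r \<Longrightarrow> norm v \<le> r \<Longrightarrow> norm (g u - g v) \<le> K' * norm (u - v)"
    by (rule lip_boundedE[OF assms(2)]) blast
  have "norm (f u + g u - (f v + g v)) \<le> (K + K') * norm (u - v)" if "norm u \<le> r" "norm v \<le> r" for u v
    using norm_triangle_mono[OF K(2)[OF that] K'(2)[OF that]] by (simp add: distrib_right algebra_simps)
  then show "\<exists>K\<ge>0. \<forall>u v. norm u \<le> r \<longrightarrow> norm v \<le> r \<longrightarrow> norm (f u + g u - (f v + g v)) \<le> K * norm (u - v)"
    using K(1) K'(1) by (intro exI[of _ "K + K'"]) auto
qed

lemma lip_bounded_sum: "finite J \<Longrightarrow> (\<And>j. j \<in> J \<Longrightarrow> lip_bounded (f j)) \<Longrightarrow> lip_bounded (\<lambda>u. \<Sum>j\<in>J. f j u)"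
  by (induction J rule: finite_induct) (auto intro: lip_bounded_const lip_bounded_add)

lemma lip_bounded_scale:
  assumes s: "kspace s" and a: "lip_bounded a" and f: "lip_bounded f"
  shows "lip_bounded (\<lambda>u. s (a u) (f u))"
  unfolding lip_bounded_def
proof
  interpret kspace s by fact
  fix r
  obtain K where K: "K \<ge> 0" "\<And>u v. norm u \<le> r \<Longrightarrow> norm v \<le> r \<Longrightarrow> norm (a u - a v) \<le> K * norm (u - v)"
    by (rule lip_boundedE[OF a]) blast
  obtain K' where K': "K' \<ge> 0" "\<And>u v. norm u \<le> r \<Longrightarrow> norm v \<le> r \<Longrightarrow> norm (f u - f v) \<le> K' * norm (u - v)"
    by (rule lip_boundedE[OF f]) blast
  obtain B where B: "B \<ge> 0" "\<And>u. norm u \<le> r \<Longrightarrow> norm (a u) \<le> B" by (rule lip_bounded_bound[OF a]) blast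
  obtain B' where B': "B' \<ge> 0" "\<And>u. norm u \<le> r \<Longrightarrow> norm (f u) \<le> B'" by (rule lip_bounded_bound[OF f]) blast
  have "norm (s (a u) (f u) - s (a v) (f v)) \<le> (B * K' + K * B') * norm (u - v)" if uv: "norm u \<le> r" "norm v \<le> r" for u v
  proof -
    have "s (a u) (f u) - s (a v) (f v) = s (a u) (f u - f v) + s (a u - a v) (f v)"
      by (simp add: scale_left_diff_distrib scale_right_diff_distrib)
    also have "norm \<dots> \<le> B * (K' * norm (u - v)) + (K * norm (u - v)) * B'"
      by (intro norm_triangle_mono) (use uv B B' K K' in \<open>auto intro!: mult_mono\<close>)
    finally show ?thesis by (simp add: algebra_simps)
  qed
  then show "\<exists>K\<ge>0. \<forall>u v. norm u \<le> r \<longrightarrow> norm v \<le> r \<longrightarrow> norm (s (a u) (f u) - s (a v) (f v)) \<le> K * norm (u - v)"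
    using K K' B B' by (intro exI[of _ "B * K' + K * B'"]) auto
qed

lemma lip_bounded_power:
  fixes a :: "'x::real_normed_vector \<Rightarrow> 'k::{real_normed_field,banach}"
  shows "lip_bounded a \<Longrightarrow> lip_bounded (\<lambda>u. a u ^ t)"
  by (induction t) (auto intro: lip_bounded_const lip_bounded_scale[OF kspace_mult])

lemma norm_power_diff_le:
  fixes a b :: "'k::real_normed_field"
  assumes "norm a \<le> 1" "norm b \<le> 1"
  shows "norm (a ^ t - b ^ t) \<le> real t * norm (a - b)"
proof (induction t)
  case (Suc t)
  have "a ^ Suc t - b ^ Suc t = a * (a ^ t - b ^ t) + (a - b) * b ^ t" by (simp add: algebra_simps)
  also have "norm \<dots> \<le> 1 * (real t * norm (a - b)) + norm (a - b) * 1"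
    unfolding norm_mult norm_power
    by (intro order_trans[OF norm_triangle_ineq add_mono], unfold norm_mult norm_power)
       (intro mult_mono Suc assms norm_ge_zero power_le_one zero_le_one mult_nonneg_nonneg; use assms in simp)+
  finally show ?case by (simp add: algebra_simps)
qed simp

lemma power_split: "m \<le> n \<Longrightarrow> a ^ n = a ^ m * a ^ (n - m)" for a :: "'a::monoid_mult"
  by (metis le_add_diff_inverse power_add)

context branch
begin

lemma klinear_tlinear_compose:
  assumes T: "\<And>i. i \<in> {1..k+1} \<Longrightarrow> klinear_on sB sB UNIV (\<lambda>u. T u i)" and f: "tlinear sB sY k f"
  shows "klinear_on sB sY UNIV (\<lambda>u. f (T u))"
proof -
  have "\<exists>C>0. \<forall>u. norm (T u i) \<le> C * norm u" if "i \<in> {1..k+1}" for i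
    by (rule klinear_on_bound[OF T[OF that]]) blast
  then obtain C where C: "\<And>i. i \<in> {1..k+1} \<Longrightarrow> C i > 0" "\<And>i u. i \<in> {1..k+1} \<Longrightarrow> norm (T u i) \<le> C i * norm u" by metis
  have Tb: "tnorm k (T u) \<le> (\<Sum>i=1..k+1. C i) * norm u" for u
    unfolding tnorm_def sum_distrib_right by (rule sum_mono) (rule C)
  obtain D where D: "D > 0" "\<And>x. norm (f x) \<le> D * tnorm k x" by (rule tlinear_bound[OF f]) blast
  show ?thesis
    unfolding klinear_on_def
  proof (intro conjI ballI allI)
    fix u v
    have "f (T (u + v)) = f (\<lambda>i. T u i + T v i)"
      by (rule tlinear_cong[OF f]) (rule klinear_onD(1)[OF T])
    then show "f (T (u + v)) = f (T u) + f (T v)" by (simp add: tlinear_add[OF f])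
  next
    fix a u
    have "f (T (sB a u)) = f (\<lambda>i. sB a (T u i))"
      by (rule tlinear_cong[OF f]) (rule klinear_onD(2)[OF T])
    then show "f (T (sB a u)) = sY a (f (T u))" by (simp add: tlinear_scale[OF f])
  next
    have "norm (f (T u)) \<le> D * (\<Sum>i=1..k+1. C i) * norm u" for u
      unfolding mult.assoc using order_trans[OF D(2)[of "T u"] mult_left_mono[OF Tb[of u]]] D(1) by simp
    then show "\<exists>C. \<forall>u\<in>UNIV. norm (f (T u)) \<le> C * norm u" by blast
  qed
qed

lemma klinear_last: "klinear_on sB sB UNIV f \<Longrightarrow> klinear_on sB sB UNIV (\<lambda>u. last_entry (f u) i)"
  by (cases "i = k + 1") (auto simp: last_entry_def klinear_on_def intro!: exI[of _ 0])

lemma klinear_plus: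
  assumes "klinear_on sB sB UNIV f" "klinear_on sB sB UNIV g"
  shows "klinear_on sB sB UNIV (\<lambda>v. f v + g v)"
proof -
  have neg: "klinear_on sB sB UNIV (\<lambda>v. 0 - g v)"
    by (rule klinear_minus[OF _ assms(2)]) (auto simp: klinear_on_def intro!: exI[of _ 0])
  show ?thesis using klinear_minus[OF assms(1) neg] by simp
qed

subsection \<open>Reparametrisation of the solution curves\<close>

definition q :: nat where "q = k + 1 - l"

text \<open>The time change adds \<open>l \<sigma> / l!\<close> times \<open>zbar l\<close> at order
  \<open>k+1\<close>, hence \<open>(k+1)! / (l-1)!\<close> times \<open>\<sigma> zbar l\<close> to
  the normalised coefficient. Taking \<open>\<sigma> = s / kap\<close> makes the displacement
  exactly \<open>s zbar l\<close>.\<close>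

definition kap :: 'k where "kap = fact (k + 1) / fact (l - 1)"

text \<open>\<open>Co d \<sigma> y\<close> is the coefficient of \<open>\<epsilon>\<^sup>d\<close> of the curve with coefficients \<open>y\<close> after the
  reparametrisation \<open>\<epsilon> (1 + \<epsilon>\<^sup>q \<sigma>)\<close>.\<close>

definition Co :: "nat \<Rightarrow> 'k \<Rightarrow> (nat \<Rightarrow> 'b) \<Rightarrow> 'b" where
  "Co d \<sigma> y = (\<Sum>j=1..2*k+1. \<Sum>t\<le>j. if j + q * t = d then sB (of_nat (j choose t) * \<sigma> ^ t / fact j) (y j) else 0)"

definition Cv :: "(nat \<Rightarrow> 'b) \<Rightarrow> 'k \<Rightarrow> 'b" where "Cv x \<epsilon> = base \<epsilon> + Dl \<epsilon> I + Dx \<epsilon> x"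

definition cf :: "(nat \<Rightarrow> 'b) \<Rightarrow> nat \<Rightarrow> 'b" where "cf x = completion k zbar (\<lambda>i. I i + mat_app k M x i)"

text \<open>The coefficients of orders \<open>k+1, ..., 2k+1\<close> after the time change, in
  factorial normalisation and relative to \<open>I\<close>. The orders from \<open>2k+2\<close> up
  to the degree bound \<open>Dg\<close> are collected in \<open>rho\<close>.\<close>

definition dl :: "'k \<Rightarrow> (nat \<Rightarrow> 'b) \<Rightarrow> nat \<Rightarrow> 'b" where
  "dl \<sigma> x i = sB (fact (2*k+2-i)) (Co (2*k+2-i) \<sigma> (cf x)) - I i"

definition Dg :: nat where "Dg = (2 * k + 1) * (q + 1)"

definition rho :: "'k \<Rightarrow> 'k \<Rightarrow> (nat \<Rightarrow> 'b) \<Rightarrow> 'b" where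
  "rho \<epsilon> \<sigma> x = (\<Sum>d\<in>{2*k+2..Dg}. sB (\<epsilon> ^ (d - (2*k+2))) (Co d \<sigma> (cf x)))"

lemma q: "q \<ge> 1" "l + q = k + 1"
  using l by (auto simp: q_def)

lemma kap_nonzero: "kap \<noteq> 0"
  by (simp only: kap_def divide_eq_0_iff fact_nonzero simp_thms)

lemma Cv_poly_curve: "Cv x \<epsilon> = poly_curve sB (2*k+1) (cf x) \<epsilon>"
  unfolding cf_def poly_curve_completion Cv_def Dx_def by (simp add: tlinear_add[OF tlinear_Dl] add.assoc)

lemma poly_curve_reparam:
  "poly_curve sB (2*k+1) y (\<epsilon> * (1 + \<epsilon> ^ q * \<sigma>)) = (\<Sum>d\<le>Dg. sB (\<epsilon> ^ d) (Co d \<sigma> y))"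
proof -
  have pw: "(\<epsilon> * (1 + \<epsilon> ^ q * \<sigma>)) ^ j = (\<Sum>t\<le>j. \<epsilon> ^ (j + q * t) * (of_nat (j choose t) * \<sigma> ^ t))" for j
  proof -
    have "(\<epsilon> * (1 + \<epsilon> ^ q * \<sigma>)) ^ j = \<epsilon> ^ j * (\<epsilon> ^ q * \<sigma> + 1) ^ j" by (simp add: power_mult_distrib add.commute)
    also have "(\<epsilon> ^ q * \<sigma> + 1) ^ j = (\<Sum>t\<le>j. of_nat (j choose t) * (\<epsilon> ^ (q * t) * \<sigma> ^ t))"
      by (subst binomial_ring) (simp add: power_mult_distrib power_mult)
    finally show ?thesis
      unfolding sum_distrib_left by (simp only: power_add mult_ac)
  qed
  have Dg: "j + q * t \<le> Dg" if "j \<in> {1..2*k+1}" "t \<le> j" for j t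
  proof -
    have "j + q * t \<le> (2 * k + 1) + q * (2 * k + 1)" using that by (intro add_mono mult_left_mono) auto
    then show ?thesis by (simp add: Dg_def algebra_simps)
  qed
  let ?z = "\<lambda>j t. sB (of_nat (j choose t) * \<sigma> ^ t / fact j) (y j)"
  have "poly_curve sB (2*k+1) y (\<epsilon> * (1 + \<epsilon> ^ q * \<sigma>)) = (\<Sum>j=1..2*k+1. \<Sum>t\<le>j. sB (\<epsilon> ^ (j + q * t)) (?z j t))"
    unfolding poly_curve_def pw by (simp add: sum_divide_distrib B.scale_sum_left)
  also have "\<dots> = (\<Sum>j=1..2*k+1. \<Sum>t\<le>j. \<Sum>d\<le>Dg. if j + q * t = d then sB (\<epsilon> ^ d) (?z j t) else 0)"
    by (intro sum.cong refl) (use Dg in auto)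
  also have "\<dots> = (\<Sum>j=1..2*k+1. \<Sum>d\<le>Dg. \<Sum>t\<le>j. if j + q * t = d then sB (\<epsilon> ^ d) (?z j t) else 0)"
    by (intro sum.cong refl sum.swap)
  also have "\<dots> = (\<Sum>d\<le>Dg. \<Sum>j=1..2*k+1. \<Sum>t\<le>j. if j + q * t = d then sB (\<epsilon> ^ d) (?z j t) else 0)"
    by (rule sum.swap)
  also have "\<dots> = (\<Sum>d\<le>Dg. sB (\<epsilon> ^ d) (Co d \<sigma> y))"
    unfolding Co_def B.scale_sum_right by (intro sum.cong refl) auto
  finally show ?thesis .
qed

lemma cf_below: "1 \<le> j \<Longrightarrow> j < l \<Longrightarrow> cf x j = 0"
  and cf_le: "j \<le> k \<Longrightarrow> cf x j = zbar j"
  and cf_gt: "j > k \<Longrightarrow> cf x j = I (2*k+2-j) + mat_app k M x (2*k+2-j)"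
  using l zbelow by (auto simp: cf_def completion_def)

lemma Co_0: "Co 0 \<sigma> y = 0"
  unfolding Co_def by (intro sum.neutral ballI) auto

text \<open>A term with \<open>t \<ge> 1\<close> and \<open>j + q * t \<le> k\<close> has
  \<open>j \<le> k - q < l\<close>, where the coefficients vanish. So the time change leaves the
  prescribed \<open>zbar\<close> as they are.\<close>

lemma Co_low:
  assumes "1 \<le> d" "d \<le> k"
  shows "Co d \<sigma> (cf x) = sB (inverse (fact d)) (zbar d)"
proof -
  have "(if j + q * t = d then sB (of_nat (j choose t) * \<sigma> ^ t / fact j) (cf x j) else 0) =
      (if j = d then if t = 0 then sB (inverse (fact d)) (zbar d) else 0 else 0)"
    if "j \<in> {1..2*k+1}" "t \<in> {..j}" for j t
  proof (cases "t = 0")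
    case True
    then show ?thesis using assms by (simp add: cf_le divide_inverse)
  next
    case False
    then have qt: "q \<le> q * t" by simp
    have "cf x j = 0" if "j + q * t = d"
    proof (rule cf_below)
      show "j < l" using that assms q(2) qt by linarith
    qed (use \<open>j \<in> {1..2*k+1}\<close> in simp)
    then show ?thesis using False by auto
  qed
  then have "Co d \<sigma> (cf x) = (\<Sum>j=1..2*k+1. \<Sum>t\<le>j. if j = d then if t = 0 then sB (inverse (fact d)) (zbar d) else 0 else 0)"
    unfolding Co_def by (intro sum.cong refl) auto
  also have "\<dots> = (\<Sum>j=1..2*k+1. if j = d then sB (inverse (fact d)) (zbar d) else 0)"
    by (intro sum.cong refl) auto
  also have "\<dots> = sB (inverse (fact d)) (zbar d)" using assms by (subst sum.delta) auto
  finally show ?thesis .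
qed

text \<open>Since \<open>l + q = k + 1\<close>, a contribution with \<open>t = 1\<close> has
  \<open>j = l\<close>, one with \<open>t \<ge> 2\<close> has \<open>j < l\<close> and vanishes, and
  \<open>t = 0\<close> gives the old coefficient.\<close>

lemma Co_top: "Co (k + 1) \<sigma> (cf x) = sB (inverse (fact (k + 1))) (cf x (k + 1)) + sB (\<sigma> / fact (l - 1)) (zbar l)"
proof -
  let ?v = "sB (inverse (fact (k + 1))) (cf x (k + 1))" and ?w = "sB (\<sigma> / fact (l - 1)) (zbar l)"
  have l1: "l \<ge> 1" "l \<le> k" using l by auto
  have lf: "of_nat l / fact l = (1 / fact (l - 1) :: 'k)"
  proof -
    obtain l' where l': "l = Suc l'" using l1 by (cases l) auto
    have "(of_nat (Suc l') :: 'k) \<noteq> 0" by (rule of_nat_neq_0)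
    then show ?thesis unfolding l' fact_Suc of_nat_mult of_nat_fact by (simp del: of_nat_Suc)
  qed
  have "(if j + q * t = k + 1 then sB (of_nat (j choose t) * \<sigma> ^ t / fact j) (cf x j) else 0) =
      (if j = k + 1 then if t = 0 then ?v else 0 else 0) + (if j = l then if t = 1 then ?w else 0 else 0)"
    if j: "j \<in> {1..2*k+1}" "t \<in> {..j}" for j t
  proof -
    consider "t = 0" | "t = 1" | "t \<ge> 2" by linarith
    then show ?thesis
    proof cases
      case 1
      then show ?thesis by (auto simp: divide_inverse simp del: fact_Suc)
    next
      case 2
      have "of_nat l * \<sigma> / fact l = \<sigma> / fact (l - 1)" using lf by (metis mult.commute times_divide_eq_right mult.right_neutral)
      moreover have "j + q * t = k + 1 \<longleftrightarrow> j = l" using 2 q(2) by auto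
      ultimately show ?thesis using 2 l1 by (auto simp: cf_le)
    next
      case 3
      then have qt: "2 * q \<le> q * t" by simp
      have "cf x j = 0" if "j + q * t = k + 1"
      proof (rule cf_below)
        show "j < l" using that q qt by linarith
      qed (use j in simp)
      then show ?thesis using 3 by auto
    qed
  qed
  then have "Co (k + 1) \<sigma> (cf x) = (\<Sum>j=1..2*k+1. \<Sum>t\<le>j. (if j = k + 1 then if t = 0 then ?v else 0 else 0) + (if j = l then if t = 1 then ?w else 0 else 0))"
    unfolding Co_def by (intro sum.cong refl) blast
  also have "\<dots> = (\<Sum>j=1..2*k+1. (if j = k + 1 then ?v else 0) + (if j = l then ?w else 0))"
    by (intro sum.cong refl) (auto simp: sum.distrib l1)
  also have "\<dots> = (\<Sum>j=1..2*k+1. if j = k + 1 then ?v else 0) + (\<Sum>j=1..2*k+1. if j = l then ?w else 0)"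
    by (rule sum.distrib)
  also have "(\<Sum>j=1..2*k+1. if j = k + 1 then ?v else 0) = ?v" by (subst sum.delta) auto
  also have "(\<Sum>j=1..2*k+1. if j = l then ?w else 0) = ?w" using l1 by (subst sum.delta) auto
  finally show ?thesis .
qed

theorem Cv_reparam:
  "Cv x (\<epsilon> * (1 + \<epsilon> ^ q * \<sigma>)) = base \<epsilon> + Dl \<epsilon> I + Dl \<epsilon> (dl \<sigma> x) + sB (\<epsilon> ^ (2*k+2)) (rho \<epsilon> \<sigma> x)"
proof -
  have "2 * k + 1 \<le> Dg" by (simp add: Dg_def)
  then have "{..Dg} = insert 0 {1..2*k+1} \<union> {2*k+2..Dg}" by auto
  then have "Cv x (\<epsilon> * (1 + \<epsilon> ^ q * \<sigma>)) =
      (\<Sum>d\<in>insert 0 {1..2*k+1}. sB (\<epsilon> ^ d) (Co d \<sigma> (cf x))) + (\<Sum>d\<in>{2*k+2..Dg}. sB (\<epsilon> ^ d) (Co d \<sigma> (cf x)))"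
    unfolding Cv_poly_curve poly_curve_reparam by (simp only:) (rule sum.union_disjoint, auto)
  also have "(\<Sum>d\<in>insert 0 {1..2*k+1}. sB (\<epsilon> ^ d) (Co d \<sigma> (cf x))) = (\<Sum>d=1..2*k+1. sB (\<epsilon> ^ d) (Co d \<sigma> (cf x)))"
    by (subst sum.insert) (auto simp: Co_0)
  also have "\<dots> = poly_curve sB (2*k+1) (completion k zbar (\<lambda>i. I i + dl \<sigma> x i)) \<epsilon>"
    unfolding poly_curve_def
  proof (rule sum.cong[OF refl])
    fix d assume d: "d \<in> {1..2*k+1}"
    show "sB (\<epsilon> ^ d) (Co d \<sigma> (cf x)) = sB (\<epsilon> ^ d / fact d) (completion k zbar (\<lambda>i. I i + dl \<sigma> x i) d)"
    proof (cases "d \<le> k")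
      case True
      then show ?thesis using d by (simp add: Co_low completion_def divide_inverse)
    next
      case False
      then have "2 * k + 2 - (2 * k + 2 - d) = d" using d by auto
      then show ?thesis using False by (simp add: completion_def dl_def)
    qed
  qed
  also have "\<dots> = base \<epsilon> + Dl \<epsilon> I + Dl \<epsilon> (dl \<sigma> x)"
    unfolding poly_curve_completion by (simp add: tlinear_add[OF tlinear_Dl] add.assoc)
  also have "(\<Sum>d\<in>{2*k+2..Dg}. sB (\<epsilon> ^ d) (Co d \<sigma> (cf x))) = sB (\<epsilon> ^ (2*k+2)) (rho \<epsilon> \<sigma> x)"
    unfolding rho_def B.scale_sum_right
  proof (rule sum.cong[OF refl])
    fix d assume "d \<in> {2*k+2..Dg}"
    then have "\<epsilon> ^ d = \<epsilon> ^ (2*k+2) * \<epsilon> ^ (d - (2*k+2))" by (intro power_split) simp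
    then show "sB (\<epsilon> ^ d) (Co d \<sigma> (cf x)) = sB (\<epsilon> ^ (2*k+2)) (sB (\<epsilon> ^ (d - (2*k+2))) (Co d \<sigma> (cf x)))" by (simp only: B.scale_scale)
  qed
  finally show ?thesis .
qed

lemma bigO_reparam:
  fixes u :: "'k \<Rightarrow> 'z::real_normed_vector"
  assumes "bigO n u"
  shows "bigO n (\<lambda>\<epsilon>. u (\<epsilon> * (1 + \<epsilon> ^ q * \<sigma>)))"
proof -
  obtain K r where K: "K \<ge> 0" "r > 0" "r \<le> 1" "\<And>\<epsilon>. norm \<epsilon> < r \<Longrightarrow> norm (u \<epsilon>) \<le> K * norm \<epsilon> ^ n"
    using assms by (rule bigOE) blast
  define B where "B = 1 + norm \<sigma>"
  have B: "B \<ge> 1" by (simp add: B_def)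
  show ?thesis
  proof (rule bigOI[of "r / B"])
    show "r / B > 0" using K B by simp
    fix \<epsilon> :: 'k assume e: "norm \<epsilon> < r / B"
    then have eB: "norm \<epsilon> * B < r" using B by (simp add: pos_less_divide_eq)
    have "r / B \<le> 1" using K(3) B by (simp add: pos_divide_le_eq)
    then have e1: "norm \<epsilon> \<le> 1" using e by simp
    have "norm (1 + \<epsilon> ^ q * \<sigma>) \<le> 1 + norm \<epsilon> ^ q * norm \<sigma>"
      using norm_triangle_ineq[of 1 "\<epsilon> ^ q * \<sigma>"] by (simp add: norm_mult norm_power)
    also have "norm \<epsilon> ^ q * norm \<sigma> \<le> 1 * norm \<sigma>" using e1 by (intro mult_right_mono power_le_one) auto
    finally have "norm (\<epsilon> * (1 + \<epsilon> ^ q * \<sigma>)) \<le> norm \<epsilon> * B"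
      unfolding norm_mult B_def by (intro mult_left_mono) auto
    then have "norm (u (\<epsilon> * (1 + \<epsilon> ^ q * \<sigma>))) \<le> K * norm (\<epsilon> * (1 + \<epsilon> ^ q * \<sigma>)) ^ n"
      and "norm (\<epsilon> * (1 + \<epsilon> ^ q * \<sigma>)) ^ n \<le> (norm \<epsilon> * B) ^ n"
      using K(4) eB by (auto intro: power_mono)
    then have "norm (u (\<epsilon> * (1 + \<epsilon> ^ q * \<sigma>))) \<le> K * (norm \<epsilon> * B) ^ n"
      using K(1) by (meson mult_left_mono order_trans)
    then show "norm (u (\<epsilon> * (1 + \<epsilon> ^ q * \<sigma>))) \<le> K * B ^ n * norm \<epsilon> ^ n" by (simp add: power_mult_distrib mult_ac)
  qed
qed

text \<open>Solving \<open>G = 0\<close> up to a given order is invariant under reparametrisation.\<close>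

lemma Lam_dl:
  assumes n: "n \<le> k + 1" "1 \<le> n" and x: "\<And>d. d < n \<Longrightarrow> Lam d (mat_app k M x) = 0" and d: "d < n"
  shows "Lam d (dl \<sigma> x) = 0"
proof -
  have "completion k zbar (\<lambda>i. I i + mat_app k M x i) \<in> X_bar sB sC G k zbar (k + n)"
    using X_bar_Lam_iff[OF n] x by blast
  then have "bigO (Suc (k + n)) (\<lambda>\<epsilon>. G (Cv x \<epsilon>))"
    using X_bar_completion_iff[of "k + n"] n by (simp add: Cv_def Dx_def tlinear_add[OF tlinear_Dl] add.assoc)
  then have 1: "bigO (Suc (k + n)) (\<lambda>\<epsilon>. G (Cv x (\<epsilon> * (1 + \<epsilon> ^ q * \<sigma>))))" by (rule bigO_reparam)
  have c1: "bigO 1 (Cv x)" unfolding Cv_poly_curve[abs_def] by (rule bigO_poly_curve)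
  have c2: "bigO 1 (\<lambda>\<epsilon>. base \<epsilon> + Dl \<epsilon> (\<lambda>i. I i + dl \<sigma> x i))" by (rule bigO_curve)
  \<comment> \<open>The terms in \<open>rho\<close> start at order \<open>2k+2\<close>, beyond the
    orders considered, so they may be dropped from the curve.\<close>
  have "bigO (Suc (k + n)) (\<lambda>\<epsilon>. Cv x (\<epsilon> * (1 + \<epsilon> ^ q * \<sigma>)) - (base \<epsilon> + Dl \<epsilon> (\<lambda>i. I i + dl \<sigma> x i)))"
  proof -
    have "Cv x (\<epsilon> * (1 + \<epsilon> ^ q * \<sigma>)) - (base \<epsilon> + Dl \<epsilon> (\<lambda>i. I i + dl \<sigma> x i)) =
        (\<Sum>d\<in>{2*k+2..Dg}. sB (\<epsilon> ^ d) (Co d \<sigma> (cf x)))" for \<epsilon>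
    proof -
      have "Cv x (\<epsilon> * (1 + \<epsilon> ^ q * \<sigma>)) - (base \<epsilon> + Dl \<epsilon> (\<lambda>i. I i + dl \<sigma> x i)) = sB (\<epsilon> ^ (2*k+2)) (rho \<epsilon> \<sigma> x)"
        unfolding Cv_reparam by (simp add: tlinear_add[OF tlinear_Dl] add.assoc)
      also have "\<dots> = (\<Sum>d\<in>{2*k+2..Dg}. sB (\<epsilon> ^ d) (Co d \<sigma> (cf x)))"
        unfolding rho_def B.scale_sum_right
      proof (rule sum.cong[OF refl])
        fix d assume "d \<in> {2*k+2..Dg}"
        then have "\<epsilon> ^ d = \<epsilon> ^ (2*k+2) * \<epsilon> ^ (d - (2*k+2))" by (intro power_split) simp
        then show "sB (\<epsilon> ^ (2*k+2)) (sB (\<epsilon> ^ (d - (2*k+2))) (Co d \<sigma> (cf x))) = sB (\<epsilon> ^ d) (Co d \<sigma> (cf x))"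
          by (simp only: B.scale_scale)
      qed
      finally show ?thesis .
    qed
    moreover have "bigO (Suc (k + n)) (\<lambda>\<epsilon>. \<Sum>d\<in>{2*k+2..Dg}. sB (\<epsilon> ^ d) (Co d \<sigma> (cf x)))"
      by (intro B.bigO_sum B.bigO_pow) (use n in auto)
    ultimately show ?thesis by simp
  qed
  then have 2: "bigO (Suc (k + n)) (\<lambda>\<epsilon>. G (Cv x (\<epsilon> * (1 + \<epsilon> ^ q * \<sigma>))) - G (base \<epsilon> + Dl \<epsilon> (\<lambda>i. I i + dl \<sigma> x i)))"
    by (rule bigO_G_diff[OF bigO_reparam[OF c1] c2])
  have "bigO (Suc (k + n)) (\<lambda>\<epsilon>. G (base \<epsilon> + Dl \<epsilon> (\<lambda>i. I i + dl \<sigma> x i)))"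
    using bigO_diff[OF 1 2] by simp
  then have "completion k zbar (\<lambda>i. I i + dl \<sigma> x i) \<in> X_bar sB sC G k zbar (k + n)"
    using X_bar_completion_iff[of "k + n" "\<lambda>i. I i + dl \<sigma> x i"] n by simp
  then show ?thesis using X_bar_Lam_iff[OF n] d by blast
qed

text \<open>The effect of the time change in the coordinates of \<open>Yset\<close>, up to terms of
  order \<open>2k+2\<close>.\<close>

definition Theta :: "'k \<Rightarrow> (nat \<Rightarrow> 'b) \<Rightarrow> nat \<Rightarrow> 'b" where "Theta \<sigma> x = Minv (dl \<sigma> x)"

lemma Theta_Yset: "x \<in> Yset \<Longrightarrow> Theta \<sigma> x \<in> Yset"
  unfolding Theta_def by (rule Minv_Yset) (rule Lam_dl[of k], use k_pos Lam_M_Yset in auto)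

lemma top_Minv: "Minv y (k + 1) = y (k + 1)"
  unfolding Minv_def by (subst bsub.simps) simp

lemma top_mat: "mat_app k M x (k + 1) = x (k + 1)" "mat_app k L x (k + 1) = x (k + 1)"
  using mat_app_unit_upper[OF unit_M, of "k + 1"] mat_app_unit_upper[OF unit_L, of "k + 1"] by simp_all

lemma dl_top: "dl (s / kap) x (k + 1) = x (k + 1) + sB s (zbar l)"
proof -
  have e: "2 * k + 2 - (k + 1) = k + 1" by simp
  have f: "fact (k + 1) * (s / kap / fact (l - 1)) = s"
    unfolding kap_def by (simp del: fact_Suc)
  have "sB (fact (k + 1)) (Co (k + 1) (s / kap) (cf x)) = cf x (k + 1) + sB s (zbar l)"
    unfolding Co_top B.scale_right_distrib B.scale_scale f by (simp del: fact_Suc)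
  moreover have "cf x (k + 1) = I (k + 1) + x (k + 1)"
    using cf_gt[of "k + 1" x] unfolding e top_mat by simp
  ultimately show ?thesis unfolding dl_def e by simp
qed

lemma red_L: "(\<And>i. i \<in> {1..k+1} \<Longrightarrow> n i \<in> N i) \<Longrightarrow> (\<And>i. i \<in> {1..k+1} \<Longrightarrow> x i = mat_app k L n i) \<Longrightarrow> red x = n (k + 1)"
proof -
  assume n: "\<And>i. i \<in> {1..k+1} \<Longrightarrow> n i \<in> N i" and x: "\<And>i. i \<in> {1..k+1} \<Longrightarrow> x i = mat_app k L n i"
  note u = npart_unique[where w = "\<lambda>_. 0" and n = n and x = x, OF _ n]
  have "npart x (k + 1) = n (k + 1)" by (rule u) (use x B.subspace_0[OF subspace_Nc] in auto)
  moreover have "wpart x i = 0" if "i \<in> {1..k+1}" for i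
    by (rule u) (use x B.subspace_0[OF subspace_Nc] that in auto)
  ultimately show ?thesis by (simp add: red_def)
qed

lemma red_Nc: "(\<And>i. i \<in> {1..k+1} \<Longrightarrow> w i \<in> Nc i) \<Longrightarrow> red w = (\<Sum>i=1..k+1. w i)"
proof -
  assume w: "\<And>i. i \<in> {1..k+1} \<Longrightarrow> w i \<in> Nc i"
  have z: "w i = w i + mat_app k L (\<lambda>_. 0) i" if "i \<in> {1..k+1}" for i
    by (simp add: tlinear_0[OF tlinear_L[OF that]])
  note u = npart_unique[where w = w and n = "\<lambda>_. 0" and x = w, OF w _ z]
  have "npart w (k + 1) = 0" by (rule u) (use B.subspace_0[OF subspace_N] in auto)
  moreover have "wpart w i = w i" if "i \<in> {1..k+1}" for i
    by (rule u) (use B.subspace_0[OF subspace_N] that in auto)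
  ultimately show ?thesis by (simp add: red_def)
qed

text \<open>A curve with last parameter \<open>p\<close> and zero complement part solves the first
  \<open>2k+1\<close> equations, and so does the reparametrised one. The new tuple is thus some
  \<open>L n\<close>, again without complement part. Its \<open>n (k+1)\<close> is read off in the
  last row, where \<open>M\<close>, \<open>L\<close> and \<open>Minv\<close> are trivial, and
  \<open>red\<close> discards the other parameters. The identity is exact for \<open>p\<close> and
  \<open>s\<close> of any size.\<close>

lemma red_Theta_last:
  assumes p: "p \<in> N (k + 1)"
  shows "red (Theta (s / kap) (mat_app k L (last_entry p))) = p + sB s (zbar l)"
proof -
  have lp: "last_entry p i \<in> N i" if "i \<in> {1..k+1}" for i by (rule last_entry_mem[OF p that])
  have "Lam d (dl (s / kap) (mat_app k L (last_entry p))) = 0" if "d \<le> k" for d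
    by (rule Lam_dl[of "k + 1"]) (use that Lam_ML[OF lp] in auto)
  then obtain n where n: "\<And>i. i \<in> {1..k+1} \<Longrightarrow> n i \<in> N i"
    "\<And>i. i \<in> {1..k+1} \<Longrightarrow> dl (s / kap) (mat_app k L (last_entry p)) i = mat_app k M (mat_app k L n) i"
    using Lam_solutions' by blast
  have T: "Theta (s / kap) (mat_app k L (last_entry p)) i = mat_app k L n i" if "i \<in> {1..k+1}" for i
  proof -
    have "Minv (dl (s / kap) (mat_app k L (last_entry p))) i = Minv (mat_app k M (mat_app k L n)) i"
      by (rule Minv_cong[OF n(2) that])
    then show ?thesis unfolding Theta_def Minv_M[OF that] .
  qed
  have "red (Theta (s / kap) (mat_app k L (last_entry p))) = n (k + 1)" by (rule red_L[OF n(1) T])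
  also have "n (k + 1) = Theta (s / kap) (mat_app k L (last_entry p)) (k + 1)" using T[of "k + 1"] top_mat(2)[of n] by (simp only: atLeastAtMost_iff) simp
  also have "\<dots> = p + sB s (zbar l)" unfolding Theta_def top_Minv dl_top top_mat by (simp add: last_entry_def)
  finally show ?thesis .
qed

subsection \<open>The chart\<close>

text \<open>Like \<open>emb\<close>, but without the coordinate along \<open>zbar l\<close>, which
  enters through the time change \<open>sig u\<close> instead.\<close>

definition emb0 :: "'b \<Rightarrow> nat \<Rightarrow> 'b" where "emb0 u i = W i u + mat_app k L (last_entry (pproj u)) i"

definition sig :: "'b \<Rightarrow> 'k" where "sig u = lcoord u / kap"

text \<open>The tail of order \<open>2k+2\<close> is moved into the first entry, which belongs to
  \<open>\<epsilon>^(2k+1)\<close> and is unrestricted; an explicit factor \<epsilon> remains in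
  front of \<open>rho\<close>.\<close>

definition X :: "'k \<Rightarrow> 'b \<Rightarrow> nat \<Rightarrow> 'b" where
  "X \<epsilon> u i = Theta (sig u) (emb0 u) i + single 1 (sB (\<epsilon> * fact (2*k+1)) (rho \<epsilon> (sig u) (emb0 u))) i"

definition F :: "'k \<Rightarrow> 'b \<Rightarrow> 'b" where "F \<epsilon> u = H \<epsilon> (X \<epsilon> u)"

lemma emb0_Yset: "emb0 u \<in> Yset"
proof -
  have "mat_app k L (last_entry (pproj u)) \<in> Yset"
    by (rule L_Yset) (rule last_entry_mem[OF subsetD[OF P_subset pproj_mem]])
  moreover have "(\<lambda>i. W i u) \<in> Yset" by (rule Nc_Yset) (rule W_mem)
  ultimately show ?thesis unfolding emb0_def[abs_def] by (intro Yset_add)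
qed

lemma X_Yset: "X \<epsilon> u \<in> Yset"
  unfolding X_def[abs_def] by (intro Yset_add Theta_Yset emb0_Yset single_1_Yset)

lemma Dl_Theta: "x \<in> Yset \<Longrightarrow> Dl \<epsilon> (dl \<sigma> x) = Dx \<epsilon> (Theta \<sigma> x)"
  unfolding Dx_def Theta_def by (rule Dl_cong) (rule M_Minv[symmetric])

lemma Cv_Dx: "Cv (emb0 u) (\<epsilon> * (1 + \<epsilon> ^ q * sig u)) = base \<epsilon> + Dl \<epsilon> I + Dx \<epsilon> (X \<epsilon> u)"
proof -
  have "sB (\<epsilon> ^ (2*k+2)) v = Dx \<epsilon> (single 1 (sB (\<epsilon> * fact (2*k+1)) v))" for v
  proof -
    have e: "\<epsilon> ^ (2*k+2) = \<epsilon> ^ (2*k+1) / fact (2*k+1) * (\<epsilon> * fact (2*k+1))"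
      by (simp add: power_add del: fact_Suc)
    show ?thesis unfolding Dx_first e by (simp only: B.scale_scale)
  qed
  then show ?thesis
    unfolding Cv_reparam Dl_Theta[OF emb0_Yset] X_def[abs_def] tlinear_add[OF tlinear_Dx] by (simp add: add.assoc)
qed

lemma klinear_emb0: "i \<in> {1..k+1} \<Longrightarrow> klinear_on sB sB UNIV (\<lambda>u. emb0 u i)"
  unfolding emb0_def
  by (intro klinear_plus klinear_W klinear_tlinear_compose[OF klinear_last[OF klinear_pproj] tlinear_L])

lemma lip_sig: "lip_bounded sig"
proof -
  have "lip_bounded (\<lambda>u. inverse kap * lcoord u)"
    by (intro lip_bounded_scale[OF kspace_mult] lip_bounded_const lip_bounded_klinear[OF klinear_lcoord])
  then show ?thesis unfolding sig_def[abs_def] by (simp add: divide_inverse mult.commute)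
qed

lemma lip_Co: "lip_bounded (\<lambda>u. Co d (sig u) (cf (emb0 u)))"
proof -
  have c: "lip_bounded (\<lambda>u. cf (emb0 u) j)" if "j \<in> {1..2*k+1}" for j
  proof (cases "j \<le> k")
    case True
    then show ?thesis by (simp add: cf_le lip_bounded_const)
  next
    case False
    then have "2 * k + 2 - j \<in> {1..k+1}" using that by auto
    then have "klinear_on sB sB UNIV (\<lambda>u. mat_app k M (emb0 u) (2 * k + 2 - j))"
      by (intro klinear_tlinear_compose[OF klinear_emb0 tlinear_M])
    then show ?thesis using False by (simp add: cf_gt lip_bounded_add lip_bounded_const lip_bounded_klinear)
  qed
  have "lip_bounded (\<lambda>u. if j + q * t = d then sB (of_nat (j choose t) * sig u ^ t / fact j) (cf (emb0 u) j) else 0)"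
    if "j \<in> {1..2*k+1}" for j t
  proof -
    have "lip_bounded (\<lambda>u. sB (of_nat (j choose t) / fact j * sig u ^ t) (cf (emb0 u) j))"
      by (intro lip_bounded_scale[OF B.kspace_axioms] lip_bounded_scale[OF kspace_mult] lip_bounded_const
          lip_bounded_power lip_sig c that)
    then show ?thesis by (cases "j + q * t = d") (simp_all add: lip_bounded_const)
  qed
  then show ?thesis unfolding Co_def by (intro lip_bounded_sum) auto
qed

lemma rho_bounds:
  obtains K where "K \<ge> 0"
    "\<And>\<epsilon> u v. norm \<epsilon> \<le> 1 \<Longrightarrow> norm u \<le> r \<Longrightarrow> norm v \<le> r \<Longrightarrow>
       norm (rho \<epsilon> (sig u) (emb0 u) - rho \<epsilon> (sig v) (emb0 v)) \<le> K * norm (u - v)"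
    "\<And>\<epsilon> u. norm \<epsilon> \<le> 1 \<Longrightarrow> norm u \<le> r \<Longrightarrow> norm (rho \<epsilon> (sig u) (emb0 u)) \<le> K"
proof -
  have "\<exists>K\<ge>0. (\<forall>u v. norm u \<le> r \<longrightarrow> norm v \<le> r \<longrightarrow> norm (Co d (sig u) (cf (emb0 u)) - Co d (sig v) (cf (emb0 v))) \<le> K * norm (u - v))
     \<and> (\<forall>u. norm u \<le> r \<longrightarrow> norm (Co d (sig u) (cf (emb0 u))) \<le> K)" for d
  proof -
    obtain K where K: "K \<ge> 0" "\<And>u v. norm u \<le> r \<Longrightarrow> norm v \<le> r \<Longrightarrow> norm (Co d (sig u) (cf (emb0 u)) - Co d (sig v) (cf (emb0 v))) \<le> K * norm (u - v)"
      by (rule lip_boundedE[OF lip_Co]) blast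
    obtain K' where K': "K' \<ge> 0" "\<And>u. norm u \<le> r \<Longrightarrow> norm (Co d (sig u) (cf (emb0 u))) \<le> K'"
      by (rule lip_bounded_bound[OF lip_Co]) blast
    have "norm (Co d (sig u) (cf (emb0 u)) - Co d (sig v) (cf (emb0 v))) \<le> (K + K') * norm (u - v)" if "norm u \<le> r" "norm v \<le> r" for u v
      using K(2)[OF that] K'(1) by (simp add: distrib_right add_increasing2)
    moreover have "norm (Co d (sig u) (cf (emb0 u))) \<le> K + K'" if "norm u \<le> r" for u
      using K'(2)[OF that] K(1) by simp
    ultimately show ?thesis using K(1) K'(1) by (intro exI[of _ "K + K'"]) auto
  qed
  then obtain K where K: "\<And>d. K d \<ge> 0"
    "\<And>d u v. norm u \<le> r \<Longrightarrow> norm v \<le> r \<Longrightarrow> norm (Co d (sig u) (cf (emb0 u)) - Co d (sig v) (cf (emb0 v))) \<le> K d * norm (u - v)"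
    "\<And>d u. norm u \<le> r \<Longrightarrow> norm (Co d (sig u) (cf (emb0 u))) \<le> K d" by metis
  have pw: "norm \<epsilon> ^ n * t \<le> t" if "norm \<epsilon> \<le> 1" "t \<ge> 0" for \<epsilon> :: 'k and n t
    using mult_right_mono[OF power_le_one[OF norm_ge_zero that(1), of n] that(2)] by simp
  show thesis
  proof (rule that)
    show "(\<Sum>d\<in>{2*k+2..Dg}. K d) \<ge> 0" by (rule sum_nonneg) (rule K)
    show "norm (rho \<epsilon> (sig u) (emb0 u) - rho \<epsilon> (sig v) (emb0 v)) \<le> (\<Sum>d\<in>{2*k+2..Dg}. K d) * norm (u - v)"
      if "norm \<epsilon> \<le> 1" "norm u \<le> r" "norm v \<le> r" for \<epsilon> u v
      unfolding rho_def sum_subtractf[symmetric] B.scale_right_diff_distrib[symmetric] sum_distrib_right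
      by (rule sum_norm_le, unfold B.norm_s norm_power) (rule order_trans[OF pw K(2)], use that in auto)
    show "norm (rho \<epsilon> (sig u) (emb0 u)) \<le> (\<Sum>d\<in>{2*k+2..Dg}. K d)"
      if "norm \<epsilon> \<le> 1" "norm u \<le> r" for \<epsilon> u
      unfolding rho_def
      by (rule sum_norm_le, unfold B.norm_s norm_power) (rule order_trans[OF pw K(3)], use that in auto)
  qed
qed

lemma tlinear_red_Minv: "tlinear sB sB k (\<lambda>y. red (Minv y))"
  by (rule tlinear_compose[OF tlinear_Minv tlinear_red])

text \<open>The terms of positive degree in the reparametrisation parameter which involve the
  coordinates \<open>W\<close>; they are small in Lipschitz norm when both are small.\<close>

definition cross :: "'b \<Rightarrow> nat \<Rightarrow> 'b" where
  "cross u i = (\<Sum>j=1..2*k+1. \<Sum>t\<le>j. if j + q * t = 2*k+2-i \<and> t \<noteq> 0 \<and> j > k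
     then sB (fact (2*k+2-i) * (of_nat (j choose t) * sig u ^ t / fact j)) (mat_app k M (\<lambda>i. W i u) (2*k+2-j)) else 0)"

text \<open>For a fixed time change the new coefficients are affine in the old ones, so the
  \<open>W\<close> coordinates contribute linearly. The term \<open>t = 0\<close> of this
  contribution is \<open>M W\<close>; the terms with \<open>t \<noteq> 0\<close> make up
  \<open>cross\<close>.\<close>

lemma dl_emb0:
  assumes i: "i \<in> {1..k+1}"
  shows "dl (sig u) (emb0 u) i = dl (sig u) (mat_app k L (last_entry (pproj u))) i + (mat_app k M (\<lambda>i. W i u) i + cross u i)"
proof -
  define x0 where "x0 = mat_app k L (last_entry (pproj u))"
  define w where "w = (\<lambda>i. W i u)"
  define d where "d = 2 * k + 2 - i"
  have d: "k < d" "d \<le> 2 * k + 1" "2 * k + 2 - d = i" using i by (auto simp: d_def)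
  have x: "emb0 u = (\<lambda>i. w i + x0 i)" by (auto simp: emb0_def w_def x0_def)
  have cfd: "cf (emb0 u) j - cf x0 j = (if j \<le> k then 0 else mat_app k M w (2*k+2-j))" if "j \<in> {1..2*k+1}" for j
  proof (cases "j \<le> k")
    case False
    then have "2 * k + 2 - j \<in> {1..k+1}" using that by auto
    then show ?thesis using False unfolding x by (simp add: cf_gt tlinear_add[OF tlinear_M])
  qed (simp add: cf_le)
  have term_eq: "(if j + q * t = d then sB (of_nat (j choose t) * sig u ^ t / fact j) (cf (emb0 u) j) else 0) -
        (if j + q * t = d then sB (of_nat (j choose t) * sig u ^ t / fact j) (cf x0 j) else 0) =
      (if j = d then if t = 0 then sB (inverse (fact d)) (mat_app k M w i) else 0 else 0) +
      (if j + q * t = d \<and> t \<noteq> 0 \<and> j > k then sB (of_nat (j choose t) * sig u ^ t / fact j) (mat_app k M w (2*k+2-j)) else 0)"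
    if "j \<in> {1..2*k+1}" "t \<le> j" for j t
  proof (cases "j + q * t = d")
    case True
    show ?thesis
    proof (cases "t = 0")
      case t: True
      then have "j = d" using True by simp
      then show ?thesis using t d cfd[OF that(1)] by (simp add: B.scale_right_diff_distrib[symmetric] divide_inverse del: fact_Suc)
    next
      case False
      then have "q * t \<ge> 1" using q(1) by simp
      then have "j \<noteq> d" using True by linarith
      then show ?thesis using True False cfd[OF that(1)] by (simp add: B.scale_right_diff_distrib[symmetric])
    qed
  next
    case False
    then show ?thesis by auto
  qed
  have "Co d (sig u) (cf (emb0 u)) - Co d (sig u) (cf x0) =
    (\<Sum>j=1..2*k+1. \<Sum>t\<le>j. (if j = d then if t = 0 then sB (inverse (fact d)) (mat_app k M w i) else 0 else 0) +
      (if j + q * t = d \<and> t \<noteq> 0 \<and> j > k then sB (of_nat (j choose t) * sig u ^ t / fact j) (mat_app k M w (2*k+2-j)) else 0))"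
    unfolding Co_def sum_subtractf[symmetric] by (intro sum.cong refl term_eq) auto
  also have "\<dots> = (\<Sum>j=1..2*k+1. \<Sum>t\<le>j. if j = d then if t = 0 then sB (inverse (fact d)) (mat_app k M w i) else 0 else 0) +
     (\<Sum>j=1..2*k+1. \<Sum>t\<le>j. if j + q * t = d \<and> t \<noteq> 0 \<and> j > k then sB (of_nat (j choose t) * sig u ^ t / fact j) (mat_app k M w (2*k+2-j)) else 0)"
    unfolding sum.distrib ..
  also have "(\<Sum>j=1..2*k+1. \<Sum>t\<le>j. if j = d then if t = 0 then sB (inverse (fact d)) (mat_app k M w i) else 0 else 0) =
     (\<Sum>j=1..2*k+1. if j = d then sB (inverse (fact d)) (mat_app k M w i) else 0)"
    by (intro sum.cong refl) auto
  also have "\<dots> = sB (inverse (fact d)) (mat_app k M w i)" using d by (subst sum.delta) auto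
  finally have diff: "Co d (sig u) (cf (emb0 u)) - Co d (sig u) (cf x0) = sB (inverse (fact d)) (mat_app k M w i) +
     (\<Sum>j=1..2*k+1. \<Sum>t\<le>j. if j + q * t = d \<and> t \<noteq> 0 \<and> j > k then sB (of_nat (j choose t) * sig u ^ t / fact j) (mat_app k M w (2*k+2-j)) else 0)" .
  have "dl (sig u) (emb0 u) i - dl (sig u) x0 i = sB (fact d) (Co d (sig u) (cf (emb0 u)) - Co d (sig u) (cf x0))"
    unfolding dl_def d_def by (simp add: B.scale_right_diff_distrib del: fact_Suc)
  also have "\<dots> = mat_app k M w i + cross u i"
  proof -
    have "sB (fact d) (sB (inverse (fact d)) (mat_app k M w i)) = mat_app k M w i" by (simp del: fact_Suc)
    moreover have "sB (fact d) (\<Sum>j=1..2*k+1. \<Sum>t\<le>j. if j + q * t = d \<and> t \<noteq> 0 \<and> j > k then sB (of_nat (j choose t) * sig u ^ t / fact j) (mat_app k M w (2*k+2-j)) else 0) = cross u i"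
      unfolding cross_def B.scale_sum_right d_def[symmetric] w_def by (intro sum.cong refl) auto
    ultimately show ?thesis unfolding diff B.scale_right_distrib by simp
  qed
  finally show ?thesis unfolding x0_def w_def by (simp add: algebra_simps)
qed

text \<open>The \<open>P\<close> and line coordinates are reproduced exactly by
  \<open>red_Theta_last\<close>, the complement coordinates by \<open>red_Nc\<close>; only
  \<open>cross\<close> remains as an error.\<close>

lemma red_Theta: "red (Theta (sig u) (emb0 u)) = u + red (Minv (cross u))"
proof -
  define x0 where "x0 = mat_app k L (last_entry (pproj u))"
  have pN: "pproj u \<in> N (k + 1)" using pproj_mem P_subset by blast
  have "red (Theta (sig u) (emb0 u)) = red (Minv (\<lambda>i. dl (sig u) x0 i + (mat_app k M (\<lambda>i. W i u) i + cross u i)))"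
    unfolding Theta_def x0_def by (rule tlinear_cong[OF tlinear_red_Minv]) (rule dl_emb0)
  also have "\<dots> = red (Theta (sig u) x0) + (red (Minv (mat_app k M (\<lambda>i. W i u))) + red (Minv (cross u)))"
    by (simp add: tlinear_add[OF tlinear_red_Minv] Theta_def)
  also have "red (Theta (sig u) x0) = pproj u + sB (lcoord u) (zbar l)"
    unfolding x0_def sig_def by (rule red_Theta_last[OF pN])
  also have "red (Minv (mat_app k M (\<lambda>i. W i u))) = red (\<lambda>i. W i u)"
    by (rule tlinear_cong[OF tlinear_red]) (rule Minv_M)
  also have "red (\<lambda>i. W i u) = (\<Sum>i=1..k+1. W i u)" by (rule red_Nc) (rule W_mem)
  finally show ?thesis using coordinates[of u] by (simp add: algebra_simps)
qed

text \<open>Small along the line and the complements, but merely bounded along \<open>P\<close>,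
  since \<open>c\<close> may be arbitrarily large.\<close>

definition region :: "real \<Rightarrow> real \<Rightarrow> 'b set" where
  "region \<eta> c = {u. norm (lcoord u) < \<eta> \<and> (\<forall>i\<in>{1..k+1}. norm (W i u) < \<eta>) \<and> norm (pproj u) < c}"

lemma region_bounded:
  assumes "\<eta> \<le> 1"
  shows "u \<in> region \<eta> c \<Longrightarrow> norm u \<le> real (k + 1) + c + norm (zbar l)"
proof -
  assume u: "u \<in> region \<eta> c"
  have lc: "norm (lcoord u) \<le> 1" and Wb: "norm (W i u) \<le> 1" if "i \<in> {1..k+1}" for i
    using u assms that unfolding region_def mem_Collect_eq by (linarith, meson less_eq_real_def order_less_le_trans)
  have "norm u \<le> (\<Sum>i=1..k+1. norm (W i u)) + (norm (pproj u) + norm (sB (lcoord u) (zbar l)))"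
    by (subst coordinates[of u]) (intro norm_triangle_mono norm_sum norm_triangle_ineq order_refl)
  also have "\<dots> \<le> real (k + 1) * 1 + (c + 1 * norm (zbar l))"
  proof (intro add_mono)
    have "(\<Sum>i=1..k+1. norm (W i u)) \<le> (\<Sum>i=1..k+1. 1)"
      by (rule sum_mono) (rule Wb)
    then show "(\<Sum>i=1..k+1. norm (W i u)) \<le> real (k + 1) * 1" by simp
    show "norm (pproj u) \<le> c" using u by (simp add: region_def)
    show "norm (sB (lcoord u) (zbar l)) \<le> 1 * norm (zbar l)"
      unfolding B.norm_s by (intro mult_right_mono lc[of 1]) auto
  qed
  finally show ?thesis by simp
qed

text \<open>Each summand is a positive power of \<open>sig u\<close> times a bounded linear function
  of the coordinates \<open>W i u\<close>. Both factors are of size \<eta> on the region, so the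
  Lipschitz constant of the product is of size \<eta>. The condition
  \<open>\<eta> \<le> norm kap\<close> gives \<open>norm (sig u) \<le> 1\<close>, so that higher
  powers are dominated by the first.\<close>

lemma cross_lipschitz:
  obtains K where "K \<ge> 0" "\<And>\<eta> u v c. \<eta> \<le> 1 \<Longrightarrow> u \<in> region \<eta> c \<Longrightarrow> v \<in> region \<eta> c \<Longrightarrow> \<eta> \<le> norm kap \<Longrightarrow>
      norm (red (Minv (cross u)) - red (Minv (cross v))) \<le> K * \<eta> * norm (u - v)"
proof -
  obtain Cl where Cl: "Cl > 0" "\<And>u. norm (lcoord u) \<le> Cl * norm u" by (rule klinear_on_bound[OF klinear_lcoord]) blast
  define k0 where "k0 = norm kap"
  have k0: "k0 > 0" using kap_nonzero by (simp add: k0_def)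
  have sigd: "norm (sig u - sig v) \<le> Cl / k0 * norm (u - v)" for u v
    using Cl(2)[of "u - v"] k0 unfolding sig_def klinear_on_diff[OF klinear_lcoord] diff_divide_distrib[symmetric]
    by (simp add: norm_divide k0_def[symmetric] divide_right_mono)
  have term_lip: "\<exists>K\<ge>0. \<forall>\<eta> u v c. \<eta> \<le> 1 \<longrightarrow> \<eta> \<le> k0 \<longrightarrow> u \<in> region \<eta> c \<longrightarrow> v \<in> region \<eta> c \<longrightarrow>
      norm (sB (b * sig u ^ t) (mat_app k M (\<lambda>i. W i u) j) - sB (b * sig v ^ t) (mat_app k M (\<lambda>i. W i v) j)) \<le> K * \<eta> * norm (u - v)"
    if t: "t \<noteq> 0" and j: "j \<in> {1..k+1}" for b t j
  proof -
    have lin: "klinear_on sB sB UNIV (\<lambda>u. mat_app k M (\<lambda>i. W i u) j)"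
      by (rule klinear_tlinear_compose[OF klinear_W tlinear_M[OF j]])
    obtain Cw where Cw: "Cw > 0" "\<And>u. norm (mat_app k M (\<lambda>i. W i u) j) \<le> Cw * norm u" by (rule klinear_on_bound[OF lin]) blast
    obtain Cm where Cm: "Cm > 0" "\<And>x. norm (mat_app k M x j) \<le> Cm * tnorm k x" by (rule tlinear_bound[OF tlinear_M[OF j]]) blast
    define K where "K = norm b * (Cw / k0 + real t * (Cl / k0) * (Cm * real (k + 1)))"
    have K0: "K \<ge> 0" unfolding K_def using Cw Cl Cm k0 by (intro mult_nonneg_nonneg add_nonneg_nonneg) auto
    have "norm (sB (b * sig u ^ t) (mat_app k M (\<lambda>i. W i u) j) - sB (b * sig v ^ t) (mat_app k M (\<lambda>i. W i v) j)) \<le> K * \<eta> * norm (u - v)"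
      if \<eta>: "\<eta> \<le> 1" "\<eta> \<le> k0" and u: "u \<in> region \<eta> c" and v: "v \<in> region \<eta> c" for \<eta> u v c
    proof -
      have \<eta>0: "\<eta> \<ge> 0" using u norm_ge_zero[of "lcoord u"] unfolding region_def mem_Collect_eq by linarith
      have su: "norm (sig u) \<le> \<eta> / k0" "norm (sig u) \<le> 1" "norm (sig v) \<le> 1"
        using u v k0 \<eta>(2) by (auto simp: region_def sig_def norm_divide k0_def[symmetric] pos_divide_le_eq intro: divide_right_mono)
      have st: "norm (sig u ^ t) \<le> \<eta> / k0"
      proof -
        have "norm (sig u) ^ t \<le> norm (sig u) ^ 1" using su(2) t by (intro power_decreasing) auto
        then show ?thesis using su(1) by (simp add: norm_power)
      qed
      have wv: "norm (mat_app k M (\<lambda>i. W i v) j) \<le> Cm * (real (k + 1) * \<eta>)"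
      proof -
        have "tnorm k (\<lambda>i. W i v) \<le> real (k + 1) * \<eta>"
          by (rule tnorm_le) (use v in \<open>auto simp: region_def less_imp_le\<close>)
        then show ?thesis using order_trans[OF Cm(2)[of "\<lambda>i. W i v"] mult_left_mono] Cm(1) by simp
      qed
      have "sB (b * sig u ^ t) (mat_app k M (\<lambda>i. W i u) j) - sB (b * sig v ^ t) (mat_app k M (\<lambda>i. W i v) j) =
          sB b (sB (sig u ^ t) (mat_app k M (\<lambda>i. W i (u - v)) j) + sB (sig u ^ t - sig v ^ t) (mat_app k M (\<lambda>i. W i v) j))"
        using klinear_on_diff[OF lin, of u v]
        by (simp add: B.scale_right_distrib B.scale_right_diff_distrib B.scale_left_diff_distrib)
      also have "norm \<dots> \<le> norm b * ((\<eta> / k0) * (Cw * norm (u - v)) + (real t * (Cl / k0 * norm (u - v))) * (Cm * (real (k + 1) * \<eta>)))"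
        unfolding B.norm_s
      proof (intro mult_left_mono norm_triangle_mono)
        show "norm (sB (sig u ^ t) (mat_app k M (\<lambda>i. W i (u - v)) j)) \<le> (\<eta> / k0) * (Cw * norm (u - v))"
          unfolding B.norm_s using st Cw k0 \<eta>0 by (intro mult_mono) auto
        have "norm (sig u ^ t - sig v ^ t) \<le> real t * norm (sig u - sig v)" by (rule norm_power_diff_le[OF su(2,3)])
        also have "\<dots> \<le> real t * (Cl / k0 * norm (u - v))" by (intro mult_left_mono sigd) auto
        finally show "norm (sB (sig u ^ t - sig v ^ t) (mat_app k M (\<lambda>i. W i v) j)) \<le> (real t * (Cl / k0 * norm (u - v))) * (Cm * (real (k + 1) * \<eta>))"
          unfolding B.norm_s using wv Cl k0 by (intro mult_mono) auto
      qed simp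
      also have "\<dots> = K * \<eta> * norm (u - v)" by (simp add: K_def algebra_simps)
      finally show ?thesis .
    qed
    then show ?thesis using K0 by blast
  qed
  have lips: "\<exists>K\<ge>0. \<forall>\<eta> u v c. \<eta> \<le> 1 \<longrightarrow> \<eta> \<le> k0 \<longrightarrow> u \<in> region \<eta> c \<longrightarrow> v \<in> region \<eta> c \<longrightarrow>
      norm (cross u i - cross v i) \<le> K * \<eta> * norm (u - v)" if i: "i \<in> {1..k+1}" for i
  proof -
    let ?e = "\<lambda>j t u. if j + q * t = 2*k+2-i \<and> t \<noteq> 0 \<and> j > k
     then sB (fact (2*k+2-i) * (of_nat (j choose t) * sig u ^ t / fact j)) (mat_app k M (\<lambda>i. W i u) (2*k+2-j)) else 0"
    have "\<exists>K\<ge>0. \<forall>\<eta> u v c. \<eta> \<le> 1 \<longrightarrow> \<eta> \<le> k0 \<longrightarrow> u \<in> region \<eta> c \<longrightarrow> v \<in> region \<eta> c \<longrightarrow>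
      norm (?e j t u - ?e j t v) \<le> K * \<eta> * norm (u - v)" if "j \<in> {1..2*k+1}" for j t
    proof (cases "j + q * t = 2*k+2-i \<and> t \<noteq> 0 \<and> j > k")
      case True
      then have "2 * k + 2 - j \<in> {1..k+1}" using that by auto
      moreover have eq: "fact (2*k+2-i) * (of_nat (j choose t) * s / fact j) = (fact (2*k+2-i) * (of_nat (j choose t) / fact j)) * s" for s :: 'k
        by (simp del: fact_Suc)
      ultimately show ?thesis
        using True term_lip[of t "2 * k + 2 - j" "fact (2*k+2-i) * (of_nat (j choose t) / fact j)"]
        unfolding eq by (simp only: simp_thms if_True)
    next
      case False
      then have "?e j t u = 0" for u by (simp only: if_False)
      then show ?thesis by (intro exI[of _ 0]) simp
    qed
    then obtain K where K: "\<And>j t. j \<in> {1..2*k+1} \<Longrightarrow> K j t \<ge> 0" "\<And>j t \<eta> u v c. j \<in> {1..2*k+1} \<Longrightarrow> \<eta> \<le> 1 \<Longrightarrow> \<eta> \<le> k0 \<Longrightarrow> u \<in> region \<eta> c \<Longrightarrow> v \<in> region \<eta> c \<Longrightarrow>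
      norm (?e j t u - ?e j t v) \<le> K j t * \<eta> * norm (u - v)" by metis
    have "norm (cross u i - cross v i) \<le> (\<Sum>j=1..2*k+1. \<Sum>t\<le>j. K j t) * \<eta> * norm (u - v)"
      if "\<eta> \<le> 1" "\<eta> \<le> k0" "u \<in> region \<eta> c" "v \<in> region \<eta> c" for \<eta> u v c
      unfolding cross_def sum_subtractf[symmetric] sum_distrib_right
      by (intro sum_norm_le K(2)[OF _ that])
    then show ?thesis using K(1) by (intro exI[of _ "\<Sum>j=1..2*k+1. \<Sum>t\<le>j. K j t"]) (auto intro!: sum_nonneg simp del: sum.cl_ivl_Suc)
  qed
  obtain K where K: "\<And>i. i \<in> {1..k+1} \<Longrightarrow> K i \<ge> 0" "\<And>i \<eta> u v c. i \<in> {1..k+1} \<Longrightarrow> \<eta> \<le> 1 \<Longrightarrow> \<eta> \<le> k0 \<Longrightarrow> u \<in> region \<eta> c \<Longrightarrow> v \<in> region \<eta> c \<Longrightarrow>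
      norm (cross u i - cross v i) \<le> K i * \<eta> * norm (u - v)" using lips by metis
  obtain C where C: "C > 0" "\<And>y. norm (red (Minv y)) \<le> C * tnorm k y" by (rule tlinear_bound[OF tlinear_red_Minv]) blast
  show thesis
  proof (rule that)
    show "C * (\<Sum>i=1..k+1. K i) \<ge> 0" using C(1) K(1) by (intro mult_nonneg_nonneg sum_nonneg) auto
    fix \<eta> u v c assume a: "\<eta> \<le> 1" "u \<in> region \<eta> c" "v \<in> region \<eta> c" "\<eta> \<le> norm kap"
    have "tnorm k (\<lambda>i. cross u i - cross v i) \<le> (\<Sum>i=1..k+1. K i) * \<eta> * norm (u - v)"
      unfolding tnorm_def sum_distrib_right by (rule sum_mono) (rule K(2), use a in \<open>auto simp: k0_def\<close>)
    then have "C * tnorm k (\<lambda>i. cross u i - cross v i) \<le> C * ((\<Sum>i=1..k+1. K i) * \<eta> * norm (u - v))"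
      using C(1) by (intro mult_left_mono) auto
    then show "norm (red (Minv (cross u)) - red (Minv (cross v))) \<le> C * (\<Sum>i=1..k+1. K i) * \<eta> * norm (u - v)"
      using C(2)[of "\<lambda>i. cross u i - cross v i"] unfolding tlinear_diff[OF tlinear_red_Minv] by (simp add: mult.assoc)
  qed
qed

text \<open>\<open>X\<close> and \<open>Theta\<close> differ only in the first entry, where the tail
  \<open>rho\<close> stands with its explicit factor \<epsilon>; the last two bounds keep this
  factor.\<close>

lemma X_lipschitz:
  obtains K where "K \<ge> 0"
    "\<And>\<epsilon> u v. norm \<epsilon> \<le> 1 \<Longrightarrow> norm u \<le> r \<Longrightarrow> norm v \<le> r \<Longrightarrow> tnorm k (\<lambda>i. X \<epsilon> u i - X \<epsilon> v i) \<le> K * norm (u - v)"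
    "\<And>\<epsilon> u. norm \<epsilon> \<le> 1 \<Longrightarrow> norm u \<le> r \<Longrightarrow> tnorm k (X \<epsilon> u) \<le> K"
    "\<And>\<epsilon> u v. norm \<epsilon> \<le> 1 \<Longrightarrow> norm u \<le> r \<Longrightarrow> norm v \<le> r \<Longrightarrow>
       norm (red (X \<epsilon> u) - red (X \<epsilon> v) - (red (Theta (sig u) (emb0 u)) - red (Theta (sig v) (emb0 v)))) \<le> K * norm \<epsilon> * norm (u - v)"
    "\<And>\<epsilon> u. norm \<epsilon> \<le> 1 \<Longrightarrow> norm u \<le> r \<Longrightarrow> norm (red (X \<epsilon> u) - red (Theta (sig u) (emb0 u))) \<le> K * norm \<epsilon>"
proof -
  obtain K1 where K1: "K1 \<ge> 0"
    "\<And>\<epsilon> u v. norm \<epsilon> \<le> 1 \<Longrightarrow> norm u \<le> r \<Longrightarrow> norm v \<le> r \<Longrightarrow>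
       norm (rho \<epsilon> (sig u) (emb0 u) - rho \<epsilon> (sig v) (emb0 v)) \<le> K1 * norm (u - v)"
    "\<And>\<epsilon> u. norm \<epsilon> \<le> 1 \<Longrightarrow> norm u \<le> r \<Longrightarrow> norm (rho \<epsilon> (sig u) (emb0 u)) \<le> K1"
    by (rule rho_bounds) blast
  have dlb: "lip_bounded (\<lambda>u. dl (sig u) (emb0 u) i)" for i
  proof -
    have "lip_bounded (\<lambda>u. sB (fact (2*k+2-i)) (Co (2*k+2-i) (sig u) (cf (emb0 u))) + - I i)"
      by (intro lip_bounded_add lip_bounded_const lip_bounded_scale[OF B.kspace_axioms] lip_Co)
    then show ?thesis by (simp add: dl_def)
  qed
  have "\<exists>K\<ge>0. (\<forall>u v. norm u \<le> r \<longrightarrow> norm v \<le> r \<longrightarrow> norm (dl (sig u) (emb0 u) i - dl (sig v) (emb0 v) i) \<le> K * norm (u - v))" for i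
    using dlb[of i] unfolding lip_bounded_def by blast
  then obtain K2 where K2: "\<And>i. K2 i \<ge> 0" "\<And>i u v. norm u \<le> r \<Longrightarrow> norm v \<le> r \<Longrightarrow> norm (dl (sig u) (emb0 u) i - dl (sig v) (emb0 v) i) \<le> K2 i * norm (u - v)" by metis
  have "\<exists>K\<ge>0. (\<forall>u. norm u \<le> r \<longrightarrow> norm (dl (sig u) (emb0 u) i) \<le> K)" for i
    by (rule lip_bounded_bound[OF dlb[of i]]) blast
  then obtain K3 where K3: "\<And>i. K3 i \<ge> 0" "\<And>i u. norm u \<le> r \<Longrightarrow> norm (dl (sig u) (emb0 u) i) \<le> K3 i" by metis
  obtain Cm where Cm: "Cm > 0" "\<And>x. tnorm k (Minv x) \<le> Cm * tnorm k x" by (rule tlinear_tuple_bound[of k sB Minv]) (use tlinear_Minv in blast)+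
  obtain Cr where Cr: "Cr > 0" "\<And>x. norm (red x) \<le> Cr * tnorm k x" by (rule tlinear_bound[OF tlinear_red]) blast
  define f where "f = (fact (2*k+1) :: real)"
  have f: "f > 0" by (simp add: f_def del: fact_Suc)
  have t1: "tnorm k (single 1 v) = norm v" for v
  proof -
    have "tnorm k (single 1 v) = (\<Sum>i=1..k+1. if i = 1 then norm v else 0)"
      unfolding tnorm_def by (rule sum.cong) (auto simp: single_def)
    then show ?thesis by (subst (asm) sum.delta) auto
  qed
  have s1: "single 1 (v - w) = (\<lambda>i. single 1 v i - single 1 w i)" for v w by (auto simp: single_def)
  define e1 where "e1 \<epsilon> u = single 1 (sB (\<epsilon> * fact (2*k+1)) (rho \<epsilon> (sig u) (emb0 u)))" for \<epsilon> u
  have Xe: "X \<epsilon> u = (\<lambda>i. Theta (sig u) (emb0 u) i + e1 \<epsilon> u i)" for \<epsilon> u by (auto simp: X_def e1_def)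
  have e1d: "tnorm k (\<lambda>i. e1 \<epsilon> u i - e1 \<epsilon> v i) \<le> f * K1 * norm \<epsilon> * norm (u - v)" if "norm \<epsilon> \<le> 1" "norm u \<le> r" "norm v \<le> r" for \<epsilon> u v
  proof -
    have "tnorm k (\<lambda>i. e1 \<epsilon> u i - e1 \<epsilon> v i) = norm \<epsilon> * f * norm (rho \<epsilon> (sig u) (emb0 u) - rho \<epsilon> (sig v) (emb0 v))"
      unfolding e1_def s1[symmetric] t1 B.scale_right_diff_distrib[symmetric] B.norm_s norm_mult norm_fact f_def ..
    also have "\<dots> \<le> norm \<epsilon> * f * (K1 * norm (u - v))" using f by (intro mult_left_mono K1 that) auto
    finally show ?thesis by (simp add: mult_ac)
  qed
  have e1b: "tnorm k (e1 \<epsilon> u) \<le> f * K1 * norm \<epsilon>" if "norm \<epsilon> \<le> 1" "norm u \<le> r" for \<epsilon> u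
  proof -
    have "tnorm k (e1 \<epsilon> u) = norm \<epsilon> * f * norm (rho \<epsilon> (sig u) (emb0 u))"
      unfolding e1_def t1 B.norm_s norm_mult norm_fact f_def ..
    also have "\<dots> \<le> norm \<epsilon> * f * K1" using f by (intro mult_left_mono K1 that) auto
    finally show ?thesis by (simp add: mult_ac)
  qed
  have Td: "tnorm k (\<lambda>i. Theta (sig u) (emb0 u) i - Theta (sig v) (emb0 v) i) \<le> Cm * (\<Sum>i=1..k+1. K2 i) * norm (u - v)" if "norm u \<le> r" "norm v \<le> r" for u v
  proof -
    let ?d = "\<lambda>i. dl (sig u) (emb0 u) i - dl (sig v) (emb0 v) i"
    have "tnorm k (\<lambda>i. Theta (sig u) (emb0 u) i - Theta (sig v) (emb0 v) i) = tnorm k (Minv ?d)"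
      unfolding tnorm_def Theta_def by (intro sum.cong refl arg_cong[of _ _ norm]) (rule tlinear_diff[OF tlinear_Minv, symmetric])
    also have "\<dots> \<le> Cm * tnorm k ?d" by (rule Cm(2))
    also have "tnorm k ?d \<le> (\<Sum>i=1..k+1. K2 i) * norm (u - v)"
      unfolding tnorm_def sum_distrib_right by (intro sum_mono K2 that)
    finally show ?thesis using Cm(1) by (simp add: mult.assoc mult_left_mono)
  qed
  have Tb: "tnorm k (Theta (sig u) (emb0 u)) \<le> Cm * (\<Sum>i=1..k+1. K3 i)" if "norm u \<le> r" for u
  proof -
    have "tnorm k (Theta (sig u) (emb0 u)) \<le> Cm * tnorm k (dl (sig u) (emb0 u))" unfolding Theta_def by (rule Cm(2))
    also have "tnorm k (dl (sig u) (emb0 u)) \<le> (\<Sum>i=1..k+1. K3 i)" unfolding tnorm_def by (intro sum_mono K3 that)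
    finally show ?thesis using Cm(1) by (simp add: mult_left_mono)
  qed
  define Ka where "Ka = Cm * (\<Sum>i=1..k+1. K2 i) + Cm * (\<Sum>i=1..k+1. K3 i)"
  define K where "K = Ka + f * K1 + Cr * (f * K1)"
  have parts: "0 \<le> Cm * (\<Sum>i=1..k+1. K2 i)" "0 \<le> Cm * (\<Sum>i=1..k+1. K3 i)" "0 \<le> f * K1" "0 \<le> Cr * (f * K1)"
    using Cm(1) f K1(1) Cr(1) K2(1) K3(1)
    by (intro mult_nonneg_nonneg sum_nonneg; simp add: less_imp_le)+
  show thesis
  proof (rule that[of K])
    show "K \<ge> 0" using parts by (simp add: K_def Ka_def)
    fix \<epsilon> :: 'k and u v :: 'b assume a: "norm \<epsilon> \<le> 1" "norm u \<le> r" "norm v \<le> r"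
    have "tnorm k (\<lambda>i. X \<epsilon> u i - X \<epsilon> v i) = tnorm k (\<lambda>i. (Theta (sig u) (emb0 u) i - Theta (sig v) (emb0 v) i) + (e1 \<epsilon> u i - e1 \<epsilon> v i))"
      unfolding Xe by (rule arg_cong[of _ _ "tnorm k"]) (auto simp: fun_eq_iff)
    also have "\<dots> \<le> Cm * (\<Sum>i=1..k+1. K2 i) * norm (u - v) + f * K1 * norm \<epsilon> * norm (u - v)"
      by (rule order_trans[OF tnorm_add add_mono[OF Td[OF a(2,3)] e1d[OF a]]])
    also have "\<dots> \<le> Cm * (\<Sum>i=1..k+1. K2 i) * norm (u - v) + f * K1 * 1 * norm (u - v)"
      using parts a by (intro add_left_mono mult_right_mono mult_left_mono) auto
    also have "\<dots> = (Cm * (\<Sum>i=1..k+1. K2 i) + f * K1) * norm (u - v)" by (simp add: distrib_right)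
    also have "\<dots> \<le> K * norm (u - v)" unfolding K_def Ka_def using parts by (intro mult_right_mono) auto
    finally show "tnorm k (\<lambda>i. X \<epsilon> u i - X \<epsilon> v i) \<le> K * norm (u - v)" .
    have "red (X \<epsilon> u) - red (X \<epsilon> v) - (red (Theta (sig u) (emb0 u)) - red (Theta (sig v) (emb0 v))) = red (\<lambda>i. e1 \<epsilon> u i - e1 \<epsilon> v i)"
      unfolding Xe tlinear_add[OF tlinear_red] tlinear_diff[OF tlinear_red] by simp
    also have "norm \<dots> \<le> Cr * (f * K1 * norm \<epsilon> * norm (u - v))"
      using order_trans[OF Cr(2) mult_left_mono[OF e1d[OF a]]] Cr(1) by simp
    also have "\<dots> = Cr * (f * K1) * (norm \<epsilon> * norm (u - v))" by simp
    also have "\<dots> \<le> K * (norm \<epsilon> * norm (u - v))" unfolding K_def Ka_def using parts by (intro mult_right_mono) auto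
    finally show "norm (red (X \<epsilon> u) - red (X \<epsilon> v) - (red (Theta (sig u) (emb0 u)) - red (Theta (sig v) (emb0 v)))) \<le> K * norm \<epsilon> * norm (u - v)"
      by (simp add: mult.assoc)
  next
    fix \<epsilon> :: 'k and u :: 'b assume a: "norm \<epsilon> \<le> 1" "norm u \<le> r"
    have "tnorm k (X \<epsilon> u) \<le> Cm * (\<Sum>i=1..k+1. K3 i) + f * K1 * norm \<epsilon>"
      unfolding Xe by (rule order_trans[OF tnorm_add add_mono[OF Tb[OF a(2)] e1b[OF a]]])
    also have "\<dots> \<le> Cm * (\<Sum>i=1..k+1. K3 i) + f * K1 * 1" using parts a by (intro add_left_mono mult_left_mono) auto
    also have "\<dots> \<le> K" unfolding K_def Ka_def using parts by simp
    finally show "tnorm k (X \<epsilon> u) \<le> K" .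
    have "red (X \<epsilon> u) - red (Theta (sig u) (emb0 u)) = red (e1 \<epsilon> u)"
      unfolding Xe tlinear_add[OF tlinear_red] by simp
    also have "norm \<dots> \<le> Cr * (f * K1 * norm \<epsilon>)"
      using order_trans[OF Cr(2) mult_left_mono[OF e1b[OF a]]] Cr(1) by simp
    also have "\<dots> = Cr * (f * K1) * norm \<epsilon>" by simp
    also have "\<dots> \<le> K * norm \<epsilon>" unfolding K_def Ka_def using parts by (intro mult_right_mono) auto
    finally show "norm (red (X \<epsilon> u) - red (Theta (sig u) (emb0 u))) \<le> K * norm \<epsilon>" .
  qed
qed

text \<open>To leading order the reparametrisation \<open>\<epsilon> (1 + \<epsilon>\<^sup>q \<sigma>)\<close> only adds a multiple of \<open>\<epsilon>\<^sup>k\<^sup>+\<^sup>1 zbar l\<close>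
  to the curve. This is the direction missing in \<open>P\<close>, so that \<open>F \<epsilon>\<close> is close to the identity.\<close>

theorem chart:
  fixes c \<eta>0 :: real
  assumes "\<eta>0 > 0"
  obtains \<eta> r K where "0 < \<eta>" "\<eta> \<le> \<eta>0" "\<eta> \<le> norm kap / 2" "0 < r" "r \<le> 1" "K > 0"
    "\<And>\<epsilon> u v. norm \<epsilon> < r \<Longrightarrow> u \<in> region \<eta> c \<Longrightarrow> v \<in> region \<eta> c \<Longrightarrow>
        norm (F \<epsilon> u - F \<epsilon> v - (u - v)) \<le> norm (u - v) / 2"
    "\<And>\<epsilon> p. norm \<epsilon> < r \<Longrightarrow> p \<in> P \<Longrightarrow> norm p < c \<Longrightarrow> norm (F \<epsilon> p - p) \<le> K * norm \<epsilon>"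
    "\<And>\<epsilon> u. norm \<epsilon> < r \<Longrightarrow> Cv (emb0 u) (\<epsilon> * (1 + \<epsilon> ^ q * sig u)) = base \<epsilon> + Dl \<epsilon> I + E \<epsilon> (F \<epsilon> u)"
    "\<And>\<epsilon> x. norm \<epsilon> < r \<Longrightarrow> x \<in> Yset \<Longrightarrow> Dx \<epsilon> x = E \<epsilon> (H \<epsilon> x)"
    "\<And>\<epsilon> x. norm \<epsilon> < r \<Longrightarrow> norm (H \<epsilon> x - red x) \<le> K * norm \<epsilon> * tnorm k x"
proof -
  obtain Ke where Ke: "Ke \<ge> 0" "\<And>\<eta> u v c. \<eta> \<le> 1 \<Longrightarrow> u \<in> region \<eta> c \<Longrightarrow> v \<in> region \<eta> c \<Longrightarrow> \<eta> \<le> norm kap \<Longrightarrow>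
      norm (red (Minv (cross u)) - red (Minv (cross v))) \<le> Ke * \<eta> * norm (u - v)"
    by (rule cross_lipschitz) blast
  \<comment> \<open>The last bound leaves a Lipschitz constant of at most \<open>1/4\<close> for
    \<open>cross\<close>; the radius \<open>r\<close> below leaves another \<open>1/4\<close> for
    the terms with a factor \<epsilon>. The bound \<open>norm kap / 2\<close> later keeps
    \<open>1 + \<epsilon>^q * sig u\<close> away from 0.\<close>
  define \<eta> where "\<eta> = min (min 1 \<eta>0) (min (norm kap / 2) (1 / (4 * (Ke + 1))))"
  have \<eta>1: "\<eta> > 0" using assms Ke(1) kap_nonzero by (simp add: \<eta>_def)
  have \<eta>2: "\<eta> \<le> 1" "\<eta> \<le> \<eta>0" "\<eta> \<le> norm kap / 2" "\<eta> \<le> 1 / (4 * (Ke + 1))"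
    unfolding \<eta>_def by linarith+
  have "\<eta> \<le> norm kap" using \<eta>2(3) norm_ge_zero[of kap] by linarith
  note \<eta> = \<eta>1 \<eta>2(1-3) this
  have Ke4: "Ke * \<eta> \<le> 1 / 4"
  proof -
    have "\<eta> * (4 * (Ke + 1)) \<le> 1" using Ke(1) \<eta>2(4) by (simp add: pos_le_divide_eq)
    moreover have "\<eta> * (4 * (Ke + 1)) = 4 * (Ke * \<eta>) + 4 * \<eta>" by (simp add: algebra_simps)
    ultimately show ?thesis using \<eta>(1) by linarith
  qed
  define R1 where "R1 = max c (real (k + 1) + c + norm (zbar l))"
  obtain KX where KX: "KX \<ge> 0"
    "\<And>\<epsilon> u v. norm \<epsilon> \<le> 1 \<Longrightarrow> norm u \<le> R1 \<Longrightarrow> norm v \<le> R1 \<Longrightarrow> tnorm k (\<lambda>i. X \<epsilon> u i - X \<epsilon> v i) \<le> KX * norm (u - v)"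
    "\<And>\<epsilon> u. norm \<epsilon> \<le> 1 \<Longrightarrow> norm u \<le> R1 \<Longrightarrow> tnorm k (X \<epsilon> u) \<le> KX"
    "\<And>\<epsilon> u v. norm \<epsilon> \<le> 1 \<Longrightarrow> norm u \<le> R1 \<Longrightarrow> norm v \<le> R1 \<Longrightarrow>
       norm (red (X \<epsilon> u) - red (X \<epsilon> v) - (red (Theta (sig u) (emb0 u)) - red (Theta (sig v) (emb0 v)))) \<le> KX * norm \<epsilon> * norm (u - v)"
    "\<And>\<epsilon> u. norm \<epsilon> \<le> 1 \<Longrightarrow> norm u \<le> R1 \<Longrightarrow> norm (red (X \<epsilon> u) - red (Theta (sig u) (emb0 u))) \<le> KX * norm \<epsilon>"
    by (rule X_lipschitz) blast
  obtain rH KH where H: "rH > 0" "KH > 0"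
    "\<And>\<epsilon> x y. norm \<epsilon> < rH \<Longrightarrow> H \<epsilon> (\<lambda>i. x i - y i) = H \<epsilon> x - H \<epsilon> y"
    "\<And>\<epsilon> x. norm \<epsilon> < rH \<Longrightarrow> norm (H \<epsilon> x - red x) \<le> KH * norm \<epsilon> * tnorm k x"
    "\<And>\<epsilon> x. norm \<epsilon> < rH \<Longrightarrow> x \<in> Yset \<Longrightarrow> Dx \<epsilon> x = E \<epsilon> (H \<epsilon> x)"
    by (rule H_properties) blast
  define Kt where "Kt = KH * KX + KX"
  have Kt: "Kt \<ge> 0" using KX(1) H(2) by (simp add: Kt_def)
  define r where "r = min (min 1 rH) (1 / (4 * (Kt + 1)))"
  have r: "r > 0" "r \<le> 1" using H(1) Kt by (auto simp: r_def)
  have er: "norm \<epsilon> < rH" "norm \<epsilon> \<le> 1" "Kt * norm \<epsilon> \<le> 1 / 4" if "norm \<epsilon> < r" for \<epsilon> :: 'k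
  proof -
    show "norm \<epsilon> < rH" "norm \<epsilon> \<le> 1" using that by (auto simp: r_def)
    have "norm \<epsilon> < 1 / (4 * (Kt + 1))" using that by (simp add: r_def)
    then have "norm \<epsilon> * (4 * (Kt + 1)) < 1" using Kt by (simp add: pos_less_divide_eq)
    moreover have "norm \<epsilon> * (4 * (Kt + 1)) = 4 * (Kt * norm \<epsilon>) + 4 * norm \<epsilon>" by (simp add: algebra_simps)
    ultimately show "Kt * norm \<epsilon> \<le> 1 / 4" using norm_ge_zero[of \<epsilon>] by linarith
  qed
  have reg: "norm u \<le> R1" if "u \<in> region \<eta> c" for u
    using region_bounded[OF \<eta>(2) that] by (simp add: R1_def)
  show thesis
  proof (rule that[of \<eta> r "KH + Kt"])
    show "0 < \<eta>" "\<eta> \<le> \<eta>0" "\<eta> \<le> norm kap / 2" "0 < r" "r \<le> 1" by (fact \<eta> r)+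
    show "0 < KH + Kt" using H(2) Kt by simp
  next
    fix \<epsilon> :: 'k and u v :: 'b assume "norm \<epsilon> < r" and u: "u \<in> region \<eta> c" and v: "v \<in> region \<eta> c"
    note e = er[OF \<open>norm \<epsilon> < r\<close>] and uR = reg[OF u] and vR = reg[OF v]
    let ?D = "\<lambda>i. X \<epsilon> u i - X \<epsilon> v i"
    \<comment> \<open>The deviation from the identity has three sources: \<open>H\<close> in place
      of \<open>red\<close>, the tail \<open>rho\<close>, and \<open>cross\<close>.\<close>
    have "F \<epsilon> u - F \<epsilon> v = H \<epsilon> ?D" unfolding F_def by (rule H(3)[OF e(1), symmetric])
    then have "F \<epsilon> u - F \<epsilon> v - (u - v) = (H \<epsilon> ?D - red ?D)
        + (red (X \<epsilon> u) - red (X \<epsilon> v) - (red (Theta (sig u) (emb0 u)) - red (Theta (sig v) (emb0 v))))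
        + (red (Minv (cross u)) - red (Minv (cross v)))"
      unfolding red_Theta tlinear_diff[OF tlinear_red] by simp
    also have "norm \<dots> \<le> KH * norm \<epsilon> * (KX * norm (u - v)) + KX * norm \<epsilon> * norm (u - v) + Ke * \<eta> * norm (u - v)"
    proof (intro norm_triangle_mono)
      show "norm (H \<epsilon> ?D - red ?D) \<le> KH * norm \<epsilon> * (KX * norm (u - v))"
        by (rule order_trans[OF H(4)[OF e(1)] mult_left_mono[OF KX(2)[OF e(2) uR vR]]]) (use H(2) in simp)
    qed (use KX(4)[OF e(2) uR vR] Ke(2)[OF \<eta>(2) u v \<eta>(5)] in auto)
    also have "\<dots> = (Kt * norm \<epsilon> + Ke * \<eta>) * norm (u - v)" by (simp add: Kt_def algebra_simps)
    also have "\<dots> \<le> (1 / 4 + 1 / 4) * norm (u - v)" by (intro mult_right_mono add_mono e Ke4) auto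
    finally show "norm (F \<epsilon> u - F \<epsilon> v - (u - v)) \<le> norm (u - v) / 2" by simp
  next
    fix \<epsilon> :: 'k and p assume "norm \<epsilon> < r" and p: "p \<in> P" "norm p < c"
    note e = er[OF \<open>norm \<epsilon> < r\<close>]
    have pR: "norm p \<le> R1" using p(2) unfolding R1_def by linarith
    have pN: "p \<in> N (k + 1)" using p P_subset by blast
    \<comment> \<open>All complement coordinates of \<open>p\<close> vanish; on \<open>P\<close> the
      chart is therefore the identity up to terms with a factor \<epsilon>, although
      \<open>p\<close> is not small.\<close>
    have "cross p i = 0" if "i \<in> {1..k+1}" for i
    proof -
      have W0: "W i p = 0" if "i \<in> {1..k+1}" for i by (rule W_N[OF that pN])
      have "mat_app k M (\<lambda>i. W i p) j = 0" if "j \<in> {1..k+1}" for j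
        using tlinear_cong[OF tlinear_M[OF that], of "\<lambda>i. W i p" "\<lambda>_. 0"] W0 tlinear_0[OF tlinear_M[OF that]] by simp
      moreover have "2 * k + 2 - j \<in> {1..k+1}" if "j \<in> {1..2*k+1}" "j > k" for j using that by auto
      ultimately show ?thesis unfolding cross_def by (intro sum.neutral ballI) auto
    qed
    then have "red (Minv (cross p)) = 0"
      using tlinear_cong[OF tlinear_red_Minv, of "cross p" "\<lambda>_. 0"] tlinear_0[OF tlinear_red_Minv] by simp
    then have "F \<epsilon> p - p = (H \<epsilon> (X \<epsilon> p) - red (X \<epsilon> p)) + (red (X \<epsilon> p) - red (Theta (sig p) (emb0 p)))"
      unfolding red_Theta F_def by simp
    also have "norm \<dots> \<le> KH * norm \<epsilon> * KX + KX * norm \<epsilon>"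
    proof (intro norm_triangle_mono KX(5)[OF e(2) pR])
      show "norm (H \<epsilon> (X \<epsilon> p) - red (X \<epsilon> p)) \<le> KH * norm \<epsilon> * KX"
        by (rule order_trans[OF H(4)[OF e(1)] mult_left_mono[OF KX(3)[OF e(2) pR]]]) (use H(2) in simp)
    qed
    also have "\<dots> = Kt * norm \<epsilon>" by (simp add: Kt_def algebra_simps)
    also have "\<dots> \<le> (KH + Kt) * norm \<epsilon>" using H(2) by (intro mult_right_mono) auto
    finally show "norm (F \<epsilon> p - p) \<le> (KH + Kt) * norm \<epsilon>" .
  next
    fix \<epsilon> :: 'k and u :: 'b assume "norm \<epsilon> < r"
    note e = er[OF this]
    show "Cv (emb0 u) (\<epsilon> * (1 + \<epsilon> ^ q * sig u)) = base \<epsilon> + Dl \<epsilon> I + E \<epsilon> (F \<epsilon> u)"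
      unfolding Cv_Dx H(5)[OF e(1) X_Yset] F_def ..
  next
    fix \<epsilon> :: 'k and x :: "nat \<Rightarrow> 'b" assume "norm \<epsilon> < r"
    note e = er[OF this]
    show "x \<in> Yset \<Longrightarrow> Dx \<epsilon> x = E \<epsilon> (H \<epsilon> x)" by (rule H(5)[OF e(1)])
    have "norm (H \<epsilon> x - red x) \<le> KH * norm \<epsilon> * tnorm k x" by (rule H(4)[OF e(1)])
    also have "\<dots> \<le> (KH + Kt) * norm \<epsilon> * tnorm k x" using Kt by (intro mult_right_mono) auto
    finally show "norm (H \<epsilon> x - red x) \<le> (KH + Kt) * norm \<epsilon> * tnorm k x" .
  qed
qed

text \<open>The map \<open>u - (f u - y)\<close> is a contraction with constant \<open>1/2\<close>,
  and its fixed point solves the equation. Quantitatively, the image of the ball of radius \<rho>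
  contains the ball of radius \<open>\<rho> / 2\<close> around \<open>f u1\<close>.\<close>

lemma perturbed_identity_solve:
  fixes f :: "'b \<Rightarrow> 'b"
  assumes lip: "\<And>u v. u \<in> cball u1 \<rho> \<Longrightarrow> v \<in> cball u1 \<rho> \<Longrightarrow> norm (f u - f v - (u - v)) \<le> norm (u - v) / 2"
    and y: "norm (y - f u1) \<le> \<rho> / 2"
  shows "\<exists>u\<in>cball u1 \<rho>. f u = y"
proof -
  have \<rho>: "\<rho> \<ge> 0" using y norm_ge_zero[of "y - f u1"] by linarith
  define g where "g u = u - (f u - y)" for u
  have gl: "dist (g u) (g v) \<le> 1 / 2 * dist u v" if "u \<in> cball u1 \<rho>" "v \<in> cball u1 \<rho>" for u v
  proof -
    have "norm (g u - g v) = norm (- (f u - f v - (u - v)))" unfolding g_def by (rule arg_cong[of _ _ norm]) (simp add: algebra_simps)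
    also have "\<dots> = norm (f u - f v - (u - v))" by (rule norm_minus_cancel)
    finally show ?thesis using lip[OF that] unfolding dist_norm by simp
  qed
  have u1: "u1 \<in> cball u1 \<rho>" using \<rho> by simp
  have "\<exists>!u\<in>cball u1 \<rho>. g u = u"
  proof (rule Banach_fix[of "cball u1 \<rho>" "1 / 2" g])
    show "g ` cball u1 \<rho> \<subseteq> cball u1 \<rho>"
    proof
      fix z assume "z \<in> g ` cball u1 \<rho>"
      then obtain u where u: "u \<in> cball u1 \<rho>" "z = g u" by blast
      have "dist u1 (g u) \<le> dist u1 (g u1) + dist (g u1) (g u)" by (rule dist_triangle)
      also have "dist u1 (g u1) \<le> \<rho> / 2" using y by (simp add: g_def dist_norm norm_minus_commute)
      also have "dist (g u1) (g u) \<le> 1 / 2 * \<rho>" using gl[OF u1 u(1)] u(1) by simp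
      finally show "z \<in> cball u1 \<rho>" using u(2) by simp
    qed
    show "complete (cball u1 \<rho>)" by (rule closed_cball[THEN complete_eq_closed[THEN iffD2]])
    show "cball u1 \<rho> \<noteq> {}" using u1 by blast
  qed (use gl in auto)
  then obtain u where "u \<in> cball u1 \<rho>" "g u = u" by blast
  then show ?thesis by (intro bexI[of _ u]) (auto simp: g_def)
qed

end

text \<open>Along the ray \<open>x + t h\<close> the equation \<open>D h = 0\<close> makes the
  increment of \<open>f\<close> of order \<open>o(t)\<close>, which contradicts the lower bound for
  nonzero \<open>h\<close>. The condition on \<open>U\<close> concerns this ray, so \<open>U\<close>
  may be relatively open in a subspace.\<close>

lemma kderivative_eq_0_imp_eq_0:
  assumes D: "has_kderivative_on sX sY E U f x D" and h: "h \<in> E" "D h = 0"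
    and real: "\<And>t. sX (of_real t) h = t *\<^sub>R h" "\<And>a. sY a 0 = 0"
    and \<kappa>: "\<kappa> > 0" "\<And>y. y \<in> U \<Longrightarrow> norm (y - x) < d \<Longrightarrow> \<kappa> * norm (y - x) \<le> norm (f y - f x)"
    and d: "d > 0" and U: "\<forall>\<^sub>F t in at_right 0. x + t *\<^sub>R h \<in> U"
  shows "h = 0"
proof (rule ccontr)
  assume "h \<noteq> 0"
  let ?y = "\<lambda>t::real. x + t *\<^sub>R h"
  have t: "(?y \<longlongrightarrow> x) (at_right 0)"
    by (rule tendsto_eq_intros refl tendsto_ident_at)+ simp
  have "\<forall>\<^sub>F t in at_right (0::real). ?y t \<noteq> x"
    using eventually_at_right_less[of 0] by eventually_elim (use \<open>h \<noteq> 0\<close> in simp)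
  with U t have "filterlim ?y (at x within U) (at_right 0)"
    unfolding filterlim_at by (auto elim: eventually_elim2)
  with D have "((\<lambda>t. norm (f (?y t) - f x - D (?y t - x)) / norm (?y t - x)) \<longlongrightarrow> 0) (at_right 0)"
    unfolding has_kderivative_on_def
    using filterlim_compose[of "\<lambda>y. norm (f y - f x - D (y - x)) / norm (y - x)" "nhds 0" "at x within U" ?y] by blast
  then have "\<forall>\<^sub>F t in at_right 0. norm (f (?y t) - f x - D (?y t - x)) / norm (?y t - x) < \<kappa>"
    by (rule order_tendstoD) fact
  moreover have "\<forall>\<^sub>F t in at_right 0. norm (?y t - x) < d"
    using tendstoD[OF t d] by (simp add: dist_norm)
  moreover note U eventually_at_right_less[of "0::real"]
  ultimately have "\<forall>\<^sub>F t in at_right (0::real). False"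
  proof eventually_elim
    case (elim t)
    have "D (t *\<^sub>R h) = sY (of_real t) (D h)"
      using D h(1) unfolding real(1)[symmetric] has_kderivative_on_def klinear_on_def by blast
    then have "D (?y t - x) = 0" using h(2) real(2) by simp
    then have "norm (f (?y t) - f x) < \<kappa> * norm (?y t - x)"
      using elim(1,4) \<open>h \<noteq> 0\<close> by (simp add: divide_less_eq)
    with \<kappa>(2)[OF elim(3,2)] show False by simp
  qed
  then show False by simp
qed

lemma klinear_on_snd:
  assumes "klinear_on sB sY UNIV f"
  shows "klinear_on (scale_prod sB) sY UNIV (\<lambda>x. f (snd x))"
proof -
  obtain C where C: "C > 0" "\<And>x. norm (f x) \<le> C * norm x" by (rule klinear_on_bound[OF assms]) blast
  have "norm (f (snd x)) \<le> C * norm x" for x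
    using order_trans[OF C(2) mult_left_mono[OF norm_snd_le[of "snd x" "fst x"]]] C(1) by (simp add: less_imp_le)
  then show ?thesis unfolding klinear_on_def
    by (auto simp: klinear_onD[OF assms] scale_prod_def split: prod.split intro!: exI[of _ C])
qed

section \<open>The solution family and its uniform smallness\<close>

locale solution_branch = branch +
  fixes nc :: "'a \<Rightarrow> (nat \<Rightarrow> 'b) \<Rightarrow> nat \<Rightarrow> 'b"
  assumes fam: "solution_family sB sC G k zbar N Nc I M L nc"
begin

abbreviation zf :: "'a \<Rightarrow> (nat \<Rightarrow> 'b) \<Rightarrow> 'b" where "zf \<equiv> z_fam sB k zbar I M L nc"

abbreviation zr :: "'a \<Rightarrow> 'b \<Rightarrow> 'b" where "zr \<equiv> z_red sB k zbar I M L nc"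

lemma ansatz_Cv: "ansatz sB k zbar I M L \<epsilon> w n = Cv (\<lambda>j. w j + mat_app k L n j) \<epsilon>"
  unfolding ansatz_def Cv_poly_curve cf_def ..

lemma zr_eq_zf: "zr \<epsilon> p = zf \<epsilon> (last_entry p)"
  by (simp add: z_red_def last_entry_def)

lemma last_entry_param: "p \<in> N (k + 1) \<Longrightarrow> last_entry p \<in> param_space k N"
  unfolding param_space_def using last_entry_mem by (auto simp: last_entry_def)

lemma param_mem: "n \<in> param_space k N \<Longrightarrow> i \<in> {1..k+1} \<Longrightarrow> n i \<in> N i"
  unfolding param_space_def by blast

lemma scaled_eq_iff: "\<epsilon> \<noteq> 0 \<Longrightarrow> scaled_eq sB sC G k zbar I M L \<epsilon> w n = 0 \<longleftrightarrow> G (Cv (\<lambda>j. w j + mat_app k L n j) \<epsilon>) = 0"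
  unfolding scaled_eq_def Let_def ansatz_Cv by (simp add: C.scale_eq_0_iff)

lemma Bcontfun_last: "apply_bcontfun (Bcontfun (last_entry p)) = last_entry p"
  by (rule Bcontfun_inverse) (auto simp: bcontfun_def last_entry_def bounded_iff intro!: exI[of _ "norm p"])

lemma norm_Bcontfun_last: "norm (Bcontfun (last_entry p)) = norm p"
proof (rule antisym)
  show "norm (Bcontfun (last_entry p)) \<le> norm p"
    by (rule norm_bound, unfold Bcontfun_last) (simp add: last_entry_def)
  show "norm p \<le> norm (Bcontfun (last_entry p))"
    using norm_bounded[of "Bcontfun (last_entry p)" "k + 1"] unfolding Bcontfun_last by (simp add: last_entry_def)
qed

text \<open>Unpacks \<open>solution_family\<close>. Smoothness is pulled back from bounded sequences
  to \<epsilon> and \<open>p\<close> through the isometry that puts \<open>p\<close> into the last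
  entry.\<close>

lemma family:
  assumes "b > 0"
  obtains \<epsilon>0 \<delta> where "\<epsilon>0 > 0" "\<delta> > 0"
    "\<And>n \<epsilon> i. n \<in> param_space k N \<Longrightarrow> \<forall>i\<in>{1..k+1}. norm (n i) < b \<Longrightarrow> norm \<epsilon> < \<epsilon>0 \<Longrightarrow> i \<in> {1..k+1} \<Longrightarrow>
       nc \<epsilon> n i \<in> Nc i \<and> norm (nc \<epsilon> n i) < \<delta>"
    "\<And>n i. n \<in> param_space k N \<Longrightarrow> \<forall>i\<in>{1..k+1}. norm (n i) < b \<Longrightarrow> i \<in> {1..k+1} \<Longrightarrow> nc 0 n i = 0"
    "\<And>n \<epsilon>. n \<in> param_space k N \<Longrightarrow> \<forall>i\<in>{1..k+1}. norm (n i) < b \<Longrightarrow> norm \<epsilon> < \<epsilon>0 \<Longrightarrow> \<epsilon> \<noteq> 0 \<Longrightarrow> G (zf \<epsilon> n) = 0"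
    "\<And>n \<epsilon> w i. n \<in> param_space k N \<Longrightarrow> \<forall>i\<in>{1..k+1}. norm (n i) < b \<Longrightarrow> norm \<epsilon> < \<epsilon>0 \<Longrightarrow> \<epsilon> \<noteq> 0 \<Longrightarrow>
       \<forall>i\<in>{1..k+1}. w i \<in> Nc i \<and> norm (w i) < \<delta> \<Longrightarrow> G (Cv (\<lambda>j. w j + mat_app k L n j) \<epsilon>) = 0 \<Longrightarrow>
       i \<in> {1..k+1} \<Longrightarrow> w i = nc \<epsilon> n i"
    "\<And>i. i \<in> {1..k+1} \<Longrightarrow> ksmooth_on (scale_prod sB) sB (UNIV \<times> P)
       {(\<epsilon>, p). norm \<epsilon> < \<epsilon>0 \<and> p \<in> P \<and> norm p < b} (\<lambda>x. nc (fst x) (last_entry (snd x)) i)"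
proof -
  obtain \<epsilon>0 \<delta> where e: "\<epsilon>0 > 0" "\<delta> > 0" and
    f: "\<forall>n\<in>param_space k N. (\<forall>i\<in>{1..k+1}. norm (n i) < b) \<longrightarrow>
           (\<forall>i\<in>{1..k+1}. nc 0 n i = 0) \<and>
           (\<forall>\<epsilon>. norm \<epsilon> < \<epsilon>0 \<longrightarrow>
              (\<forall>i\<in>{1..k+1}. nc \<epsilon> n i \<in> Nc i \<and> norm (nc \<epsilon> n i) < \<delta>) \<and>
              (\<forall>w. (\<forall>i\<in>{1..k+1}. w i \<in> Nc i \<and> norm (w i) < \<delta>) \<longrightarrow>
                 (scaled_eq sB sC G k zbar I M L \<epsilon> w n = 0 \<longleftrightarrow>
                    (\<forall>i\<in>{1..k+1}. w i = nc \<epsilon> n i))))" and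
    s: "\<forall>i\<in>{1..k+1}.
           ksmooth_on (scale_prod (scale_seq sB)) sB
             (UNIV \<times> {m. apply_bcontfun m \<in> param_space k N})
             {(\<epsilon>, m). norm \<epsilon> < \<epsilon>0 \<and> apply_bcontfun m \<in> param_space k N \<and> norm m < b}
             (\<lambda>(\<epsilon>, m). nc \<epsilon> (apply_bcontfun m) i)"
    using fam[unfolded solution_family_def, rule_format, OF assms] by blast
  show thesis
  proof (rule that[OF e])
    fix n assume n: "n \<in> param_space k N" "\<forall>i\<in>{1..k+1}. norm (n i) < b"
    note f = f[rule_format, OF n(1)] 
    have f1: "\<forall>i\<in>{1..k+1}. nc 0 n i = 0" using f n(2) by blast
    have f2: "\<forall>i\<in>{1..k+1}. nc \<epsilon> n i \<in> Nc i \<and> norm (nc \<epsilon> n i) < \<delta>" if "norm \<epsilon> < \<epsilon>0" for \<epsilon>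
      using f n(2) that by blast
    have f3: "scaled_eq sB sC G k zbar I M L \<epsilon> w n = 0 \<longleftrightarrow> (\<forall>i\<in>{1..k+1}. w i = nc \<epsilon> n i)"
      if "norm \<epsilon> < \<epsilon>0" "\<forall>i\<in>{1..k+1}. w i \<in> Nc i \<and> norm (w i) < \<delta>" for \<epsilon> w
      using f n(2) that by blast
    show "nc 0 n i = 0" if "i \<in> {1..k+1}" for i using f1 that by blast
    fix \<epsilon> :: 'a assume \<epsilon>: "norm \<epsilon> < \<epsilon>0"
    show "nc \<epsilon> n i \<in> Nc i \<and> norm (nc \<epsilon> n i) < \<delta>" if "i \<in> {1..k+1}" for i using f2[OF \<epsilon>] that by blast
    assume \<epsilon>0: "\<epsilon> \<noteq> 0"
    show "G (zf \<epsilon> n) = 0"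
      using f3[OF \<epsilon> f2[OF \<epsilon>]] scaled_eq_iff[OF \<epsilon>0, of "nc \<epsilon> n" n] unfolding z_fam_def ansatz_Cv by blast
    show "w i = nc \<epsilon> n i" if "\<forall>i\<in>{1..k+1}. w i \<in> Nc i \<and> norm (w i) < \<delta>"
      "G (Cv (\<lambda>j. w j + mat_app k L n j) \<epsilon>) = 0" "i \<in> {1..k+1}" for w i
      using f3[OF \<epsilon> that(1)] scaled_eq_iff[OF \<epsilon>0, of w n] that(2,3) by blast
  next
    fix i assume i: "i \<in> {1..k+1}"
    define J where "J x = (fst x, Bcontfun (last_entry (snd x)))" for x :: "'a \<times> 'b"
    have "ksmooth_on (scale_prod sB) sB (UNIV \<times> P) {(\<epsilon>, p). norm \<epsilon> < \<epsilon>0 \<and> p \<in> P \<and> norm p < b}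
      (\<lambda>x. (\<lambda>(\<epsilon>, m). nc \<epsilon> (apply_bcontfun m) i) (J x))"
    proof (rule ksmooth_on_precompose[OF _ _ _ _ _ s[rule_format, OF i]])
      show "J (x + y) = J x + J y" for x y
      proof -
        have "last_entry (u + v) i = last_entry u i + last_entry v i" for u v i by (simp add: last_entry_def)
        then show ?thesis by (auto simp: J_def Bcontfun_last intro!: bcontfun_eqI)
      qed
      show "J (scale_prod sB a x) = scale_prod (scale_seq sB) a (J x)" for a x
      proof -
        have "last_entry (sB a v) = (\<lambda>i. sB a (last_entry v i))" for v by (auto simp: last_entry_def fun_eq_iff)
        then show ?thesis by (simp add: J_def scale_prod_def scale_seq_def Bcontfun_last split: prod.split)
      qed
      show "norm (J x) = norm x" for x
        by (cases x) (simp add: J_def norm_Pair norm_Bcontfun_last)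
      show "J x \<in> UNIV \<times> {m. apply_bcontfun m \<in> param_space k N}" if "x \<in> UNIV \<times> P" for x
        using that subsetD[OF P_subset] by (auto simp: J_def Bcontfun_last intro!: last_entry_param)
      show "J x \<in> {(\<epsilon>, m). norm \<epsilon> < \<epsilon>0 \<and> apply_bcontfun m \<in> param_space k N \<and> norm m < b}"
        if "x \<in> {(\<epsilon>, p). norm \<epsilon> < \<epsilon>0 \<and> p \<in> P \<and> norm p < b}" for x
        using that subsetD[OF P_subset] by (auto simp: J_def Bcontfun_last norm_Bcontfun_last intro!: last_entry_param)
    qed
    then show "ksmooth_on (scale_prod sB) sB (UNIV \<times> P)
       {(\<epsilon>, p). norm \<epsilon> < \<epsilon>0 \<and> p \<in> P \<and> norm p < b} (\<lambda>x. nc (fst x) (last_entry (snd x)) i)"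
      by (simp add: J_def Bcontfun_last)
  qed
qed

lemma tnorm_mat_M: obtains K where "K > 0" "\<And>x. tnorm k (mat_app k M x) \<le> K * tnorm k x"
  by (rule tlinear_tuple_bound[where T = "mat_app k M", OF tlinear_M]) auto

lemma tnorm_mat_L: obtains K where "K > 0" "\<And>x. tnorm k (mat_app k L x) \<le> K * tnorm k x"
  by (rule tlinear_tuple_bound[where T = "mat_app k L", OF tlinear_L]) auto

text \<open>Differentiability with \<open>nc 0 n = 0\<close> would give such a bound only locally in
  \<open>n\<close>, as bounded parameter sets need not be compact. The equation itself is uniform:
  it forces \<open>Q (nc \<epsilon> n)\<close> to be of order \<epsilon>, and \<open>Q\<close> is
  bounded below on the complements.\<close>

lemma nc_small:
  assumes "b > 0"
  obtains r K where "r > 0" "K > 0"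
    "\<And>n \<epsilon>. n \<in> param_space k N \<Longrightarrow> \<forall>i\<in>{1..k+1}. norm (n i) < b \<Longrightarrow> norm \<epsilon> < r \<Longrightarrow> tnorm k (nc \<epsilon> n) \<le> K * norm \<epsilon>"
proof -
  obtain \<epsilon>0 \<delta> where e: "\<epsilon>0 > 0" "\<delta> > 0" and
    mem: "\<And>n \<epsilon> i. n \<in> param_space k N \<Longrightarrow> \<forall>i\<in>{1..k+1}. norm (n i) < b \<Longrightarrow> norm \<epsilon> < \<epsilon>0 \<Longrightarrow> i \<in> {1..k+1} \<Longrightarrow>
       nc \<epsilon> n i \<in> Nc i \<and> norm (nc \<epsilon> n i) < \<delta>" and
    zero: "\<And>n i. n \<in> param_space k N \<Longrightarrow> \<forall>i\<in>{1..k+1}. norm (n i) < b \<Longrightarrow> i \<in> {1..k+1} \<Longrightarrow> nc 0 n i = 0" and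
    sol: "\<And>n \<epsilon>. n \<in> param_space k N \<Longrightarrow> \<forall>i\<in>{1..k+1}. norm (n i) < b \<Longrightarrow> norm \<epsilon> < \<epsilon>0 \<Longrightarrow> \<epsilon> \<noteq> 0 \<Longrightarrow> G (zf \<epsilon> n) = 0"
    by (rule family[OF assms]) blast
  obtain KM where KM: "KM > 0" "\<And>x. tnorm k (mat_app k M x) \<le> KM * tnorm k x" by (rule tnorm_mat_M) blast
  obtain KL where KL: "KL > 0" "\<And>x. tnorm k (mat_app k L x) \<le> KL * tnorm k x" by (rule tnorm_mat_L) blast
  obtain KQ where KQ: "KQ > 0" "\<And>w. (\<And>i. i \<in> {1..k+1} \<Longrightarrow> w i \<in> Nc i) \<Longrightarrow> tnorm k w \<le> KQ * norm (Q w)"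
    by (rule Q_lower_bound) blast
  define Rx where "Rx = real (k + 1) * \<delta> + KL * (real (k + 1) * b)"
  have "KM * Rx \<ge> 0" using KM(1) KL(1) e assms by (auto simp: Rx_def)
  then obtain r1 K1 where r1: "r1 > 0" "K1 \<ge> 0"
    "\<And>\<epsilon> \<delta>. norm \<epsilon> < r1 \<Longrightarrow> tnorm k \<delta> \<le> KM * Rx \<Longrightarrow>
      norm (G (base \<epsilon> + Dl \<epsilon> I + Dl \<epsilon> \<delta>) - (\<Sum>d\<le>k. sC (\<epsilon> ^ (k + 1 + d)) (Lam d \<delta>))) \<le> K1 * norm \<epsilon> ^ (2 * k + 2)"
    by (rule G_expansion) blast
  show thesis
  proof (rule that[of "min r1 \<epsilon>0" "KQ * K1 + 1"])
    show "min r1 \<epsilon>0 > 0" "KQ * K1 + 1 > 0" using e r1(1,2) KQ(1) by (auto intro!: add_nonneg_pos)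
    fix n and \<epsilon> :: 'a assume n: "n \<in> param_space k N" "\<forall>i\<in>{1..k+1}. norm (n i) < b" and \<epsilon>: "norm \<epsilon> < min r1 \<epsilon>0"
    show "tnorm k (nc \<epsilon> n) \<le> (KQ * K1 + 1) * norm \<epsilon>"
    proof (cases "\<epsilon> = 0")
      case True
      then show ?thesis using zero[OF n] by (simp add: tnorm_def del: sum.cl_ivl_Suc)
    next
      case False
      have \<epsilon>': "norm \<epsilon> < r1" "norm \<epsilon> < \<epsilon>0" using \<epsilon> by auto
      have w: "nc \<epsilon> n i \<in> Nc i" "norm (nc \<epsilon> n i) \<le> \<delta>" if "i \<in> {1..k+1}" for i
        using mem[OF n \<epsilon>'(2) that] by auto
      have nN: "n i \<in> N i" if "i \<in> {1..k+1}" for i using param_mem[OF n(1) that] .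
      have nb: "norm (n i) \<le> b" if "i \<in> {1..k+1}" for i using n(2) that by (simp add: less_imp_le)
      let ?x = "\<lambda>i. nc \<epsilon> n i + mat_app k L n i"
      have x: "?x \<in> Yset" by (intro Yset_add Nc_Yset w(1) L_Yset nN)
      have "tnorm k ?x \<le> Rx" unfolding Rx_def
        using order_trans[OF tnorm_add add_mono[OF tnorm_le[OF w(2)] order_trans[OF KL(2) mult_left_mono[OF tnorm_le[OF nb]]]]] KL(1)
        by (simp add: less_imp_le)
      then have "tnorm k (mat_app k M ?x) \<le> KM * Rx"
        using order_trans[OF KM(2) mult_left_mono] KM(1) by (simp add: less_imp_le)
      then have "norm (G (base \<epsilon> + Dl \<epsilon> I + Dl \<epsilon> (mat_app k M ?x)) - (\<Sum>d\<le>k. sC (\<epsilon> ^ (k + 1 + d)) (Lam d (mat_app k M ?x)))) \<le> K1 * norm \<epsilon> ^ (2 * k + 2)"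
        by (rule r1(3)[OF \<epsilon>'(1)])
      moreover have "G (base \<epsilon> + Dl \<epsilon> I + Dl \<epsilon> (mat_app k M ?x)) = 0"
        using sol[OF n \<epsilon>'(2) False] unfolding z_fam_def ansatz_Cv Cv_def Dx_def .
      \<comment> \<open>Membership in \<open>Yset\<close> removes all orders below
        \<open>2k+1\<close>, and the part \<open>L n\<close> contributes nothing to the last
        one.\<close>
      moreover have "(\<Sum>d\<le>k. sC (\<epsilon> ^ (k + 1 + d)) (Lam d (mat_app k M ?x))) = sC (\<epsilon> ^ (2 * k + 1)) (Q (nc \<epsilon> n))"
      proof -
        have "(\<Sum>d\<le>k. sC (\<epsilon> ^ (k + 1 + d)) (Lam d (mat_app k M ?x))) = (\<Sum>d\<in>{k}. sC (\<epsilon> ^ (k + 1 + d)) (Lam d (mat_app k M ?x)))"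
          by (rule sum.mono_neutral_right) (use Lam_M_Yset[OF x] in \<open>auto simp: not_le le_less\<close>)
        also have "\<dots> = sC (\<epsilon> ^ (2 * k + 1)) (Q ?x)" by (simp add: Q_def mult_2)
        also have "Q ?x = Q (nc \<epsilon> n)"
          using tlinear_add[OF tlinear_Q, of "nc \<epsilon> n" "mat_app k L n"] Q_L[of n] nN by simp
        finally show ?thesis .
      qed
      ultimately have "norm \<epsilon> ^ (2 * k + 1) * norm (Q (nc \<epsilon> n)) \<le> norm \<epsilon> ^ (2 * k + 1) * (K1 * norm \<epsilon>)"
        by (simp add: norm_power norm_mult ac_simps)
      then have "norm (Q (nc \<epsilon> n)) \<le> K1 * norm \<epsilon>"
        by (rule mult_left_le_imp_le) (use False in simp)
      then have "tnorm k (nc \<epsilon> n) \<le> KQ * (K1 * norm \<epsilon>)"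
        using order_trans[OF KQ(2)[of "nc \<epsilon> n", OF w(1)] mult_left_mono] KQ(1) by (simp add: less_imp_le)
      then show ?thesis by (simp add: algebra_simps add_increasing)
    qed
  qed
qed

text \<open>Tuples with only a first entry already reach every vector, and \<open>Dx\<close> on
  \<open>Yset\<close> factors through \<open>E \<epsilon>\<close>.\<close>

lemma E_surj:
  assumes "\<epsilon> \<noteq> 0" "\<And>x. x \<in> Yset \<Longrightarrow> Dx \<epsilon> x = E \<epsilon> (H \<epsilon> x)"
  shows "\<exists>e. E \<epsilon> e = z"
proof
  show "E \<epsilon> (H \<epsilon> (single 1 (sB (inverse (\<epsilon> ^ (2 * k + 1) / fact (2 * k + 1))) z))) = z"
    unfolding assms(2)[OF single_1_Yset, symmetric] Dx_first
    using assms(1) by (simp del: fact_Suc power_Suc)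
qed

end

text \<open>Collects the constants for which the chart \<open>F\<close>, the lower bound for \<open>E\<close> and the uniqueness of
  \<open>nc\<close> are valid simultaneously.\<close>

locale chart_branch = solution_branch +
  fixes c \<eta> r K :: real
  assumes c: "c > 0" and \<eta>: "\<eta> > 0" "\<eta> \<le> norm kap / 2" and r: "r > 0" "r \<le> 1" and K: "K > 0"
    and F_lipschitz: "\<And>\<epsilon> u v. norm \<epsilon> < r \<Longrightarrow> u \<in> region \<eta> (c + 1) \<Longrightarrow> v \<in> region \<eta> (c + 1) \<Longrightarrow>
        norm (F \<epsilon> u - F \<epsilon> v - (u - v)) \<le> norm (u - v) / 2"
    and F_P: "\<And>\<epsilon> p. norm \<epsilon> < r \<Longrightarrow> p \<in> P \<Longrightarrow> norm p < c + 1 \<Longrightarrow> norm (F \<epsilon> p - p) \<le> K * norm \<epsilon>"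
    and Cv_F: "\<And>\<epsilon> u. norm \<epsilon> < r \<Longrightarrow> Cv (emb0 u) (\<epsilon> * (1 + \<epsilon> ^ q * sig u)) = base \<epsilon> + Dl \<epsilon> I + E \<epsilon> (F \<epsilon> u)"
    and Dx_E: "\<And>\<epsilon> x. norm \<epsilon> < r \<Longrightarrow> x \<in> Yset \<Longrightarrow> Dx \<epsilon> x = E \<epsilon> (H \<epsilon> x)"
    and H_red: "\<And>\<epsilon> x. norm \<epsilon> < r \<Longrightarrow> norm (H \<epsilon> x - red x) \<le> K * norm \<epsilon> * tnorm k x"
    and E_lower: "\<And>\<epsilon>. \<epsilon> \<noteq> 0 \<Longrightarrow> norm \<epsilon> < r \<Longrightarrow> \<exists>\<kappa>>0. \<forall>u. \<kappa> * norm u \<le> norm (E \<epsilon> u)"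
    and nc_mem: "\<And>n \<epsilon> i. n \<in> param_space k N \<Longrightarrow> \<forall>i\<in>{1..k+1}. norm (n i) < c + 1 \<Longrightarrow> norm \<epsilon> < r \<Longrightarrow>
       i \<in> {1..k+1} \<Longrightarrow> nc \<epsilon> n i \<in> Nc i"
    and nc_bound: "\<And>n \<epsilon>. n \<in> param_space k N \<Longrightarrow> \<forall>i\<in>{1..k+1}. norm (n i) < c + 1 \<Longrightarrow> norm \<epsilon> < r \<Longrightarrow>
       tnorm k (nc \<epsilon> n) \<le> K * norm \<epsilon>"
    and K\<eta>: "K * r \<le> \<eta>"
    and zf_solves: "\<And>n \<epsilon>. n \<in> param_space k N \<Longrightarrow> \<forall>i\<in>{1..k+1}. norm (n i) < c + 1 \<Longrightarrow> norm \<epsilon> < r \<Longrightarrow> \<epsilon> \<noteq> 0 \<Longrightarrow>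
       G (zf \<epsilon> n) = 0"
    and nc_unique: "\<And>n \<epsilon> w i. n \<in> param_space k N \<Longrightarrow> \<forall>i\<in>{1..k+1}. norm (n i) < c + 1 \<Longrightarrow> norm \<epsilon> < r \<Longrightarrow> \<epsilon> \<noteq> 0 \<Longrightarrow>
       \<forall>i\<in>{1..k+1}. w i \<in> Nc i \<and> norm (w i) < \<eta> \<Longrightarrow> G (Cv (\<lambda>j. w j + mat_app k L n j) \<epsilon>) = 0 \<Longrightarrow>
       i \<in> {1..k+1} \<Longrightarrow> w i = nc \<epsilon> n i"
    and nc_smooth: "\<And>i. i \<in> {1..k+1} \<Longrightarrow> ksmooth_on (scale_prod sB) sB (UNIV \<times> P)
       {(\<epsilon>, p). norm \<epsilon> < r \<and> p \<in> P \<and> norm p < c + 1} (\<lambda>x. nc (fst x) (last_entry (snd x)) i)"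

lemma (in solution_branch) ex_chart_branch:
  assumes "c > 0"
  shows "\<exists>\<eta> r K. chart_branch sB sC G k l zbar A S N Nc R Rc I M L P nc c \<eta> r K"
proof -
  \<comment> \<open>The margin 1 leaves room for parameters that a change of coordinates moves
    slightly beyond \<open>c\<close>.\<close>
  have c1: "c + 1 > 0" using assms by simp
  obtain \<epsilon>0 \<delta> where fm: "\<epsilon>0 > 0" "\<delta> > 0"
    "\<And>n \<epsilon> i. n \<in> param_space k N \<Longrightarrow> \<forall>i\<in>{1..k+1}. norm (n i) < c + 1 \<Longrightarrow> norm \<epsilon> < \<epsilon>0 \<Longrightarrow> i \<in> {1..k+1} \<Longrightarrow>
       nc \<epsilon> n i \<in> Nc i \<and> norm (nc \<epsilon> n i) < \<delta>"
    "\<And>n \<epsilon>. n \<in> param_space k N \<Longrightarrow> \<forall>i\<in>{1..k+1}. norm (n i) < c + 1 \<Longrightarrow> norm \<epsilon> < \<epsilon>0 \<Longrightarrow> \<epsilon> \<noteq> 0 \<Longrightarrow> G (zf \<epsilon> n) = 0"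
    "\<And>n \<epsilon> w i. n \<in> param_space k N \<Longrightarrow> \<forall>i\<in>{1..k+1}. norm (n i) < c + 1 \<Longrightarrow> norm \<epsilon> < \<epsilon>0 \<Longrightarrow> \<epsilon> \<noteq> 0 \<Longrightarrow>
       \<forall>i\<in>{1..k+1}. w i \<in> Nc i \<and> norm (w i) < \<delta> \<Longrightarrow> G (Cv (\<lambda>j. w j + mat_app k L n j) \<epsilon>) = 0 \<Longrightarrow>
       i \<in> {1..k+1} \<Longrightarrow> w i = nc \<epsilon> n i"
    "\<And>i. i \<in> {1..k+1} \<Longrightarrow> ksmooth_on (scale_prod sB) sB (UNIV \<times> P)
       {(\<epsilon>, p). norm \<epsilon> < \<epsilon>0 \<and> p \<in> P \<and> norm p < c + 1} (\<lambda>x. nc (fst x) (last_entry (snd x)) i)"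
    by (rule family[OF c1]) (rule that; assumption)
  \<comment> \<open>With \<open>\<eta> \<le> \<delta>\<close> the complement coordinates of vectors
    in the region of the chart lie in the uniqueness range of the family.\<close>
  obtain \<eta> rc Kc where ch: "0 < \<eta>" "\<eta> \<le> \<delta>" "\<eta> \<le> norm kap / 2" "0 < rc" "rc \<le> 1" "Kc > 0"
    "\<And>\<epsilon> u v. norm \<epsilon> < rc \<Longrightarrow> u \<in> region \<eta> (c + 1) \<Longrightarrow> v \<in> region \<eta> (c + 1) \<Longrightarrow>
        norm (F \<epsilon> u - F \<epsilon> v - (u - v)) \<le> norm (u - v) / 2"
    "\<And>\<epsilon> p. norm \<epsilon> < rc \<Longrightarrow> p \<in> P \<Longrightarrow> norm p < c + 1 \<Longrightarrow> norm (F \<epsilon> p - p) \<le> Kc * norm \<epsilon>"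
    "\<And>\<epsilon> u. norm \<epsilon> < rc \<Longrightarrow> Cv (emb0 u) (\<epsilon> * (1 + \<epsilon> ^ q * sig u)) = base \<epsilon> + Dl \<epsilon> I + E \<epsilon> (F \<epsilon> u)"
    "\<And>\<epsilon> x. norm \<epsilon> < rc \<Longrightarrow> x \<in> Yset \<Longrightarrow> Dx \<epsilon> x = E \<epsilon> (H \<epsilon> x)"
    "\<And>\<epsilon> x. norm \<epsilon> < rc \<Longrightarrow> norm (H \<epsilon> x - red x) \<le> Kc * norm \<epsilon> * tnorm k x"
    by (rule chart[OF fm(2)]) (rule that; assumption)
  obtain rn Kn where nb: "rn > 0" "Kn > 0"
    "\<And>n \<epsilon>. n \<in> param_space k N \<Longrightarrow> \<forall>i\<in>{1..k+1}. norm (n i) < c + 1 \<Longrightarrow> norm \<epsilon> < rn \<Longrightarrow> tnorm k (nc \<epsilon> n) \<le> Kn * norm \<epsilon>"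
    by (rule nc_small[OF c1]) blast
  obtain rE where rE: "rE > 0" "\<And>\<epsilon>. \<epsilon> \<noteq> 0 \<Longrightarrow> norm \<epsilon> < rE \<Longrightarrow> \<exists>\<kappa>>0. \<forall>u. norm (E \<epsilon> u) \<ge> \<kappa> * norm u"
    by (rule E_lower_bound) blast
  define K where "K = max Kc Kn"
  \<comment> \<open>The last member yields \<open>K * r \<le> \<eta>\<close>, which keeps the family
    \<open>nc\<close> itself inside the region of the chart.\<close>
  define r where "r = Min {\<epsilon>0, rc, rn, rE, \<eta> / K}"
  have K: "K > 0" "Kc \<le> K" "Kn \<le> K" using ch(6) by (auto simp: K_def)
  have r: "r > 0" "r \<le> \<epsilon>0" "r \<le> rc" "r \<le> rn" "r \<le> rE" "r \<le> \<eta> / K"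
    using fm(1) ch(1,4) nb(1) rE(1) K(1) by (auto simp: r_def)
  have le: "Kc * norm \<epsilon> \<le> K * norm \<epsilon>" "Kn * norm \<epsilon> \<le> K * norm \<epsilon>" for \<epsilon> :: 'a
    using K by (auto intro: mult_right_mono)
  have "chart_branch sB sC G k l zbar A S N Nc R Rc I M L P nc c \<eta> r K"
  proof (unfold_locales)
    show "r \<le> 1" using r(3) ch(5) by simp
    show "K * r \<le> \<eta>" using r(6) K(1) by (simp add: field_simps)
    show "norm (F \<epsilon> p - p) \<le> K * norm \<epsilon>" if "norm \<epsilon> < r" "p \<in> P" "norm p < c + 1" for \<epsilon> p
      using ch(8)[of \<epsilon> p] that r(3) le(1)[of \<epsilon>] by linarith
    show "norm (H \<epsilon> x - red x) \<le> K * norm \<epsilon> * tnorm k x" if "norm \<epsilon> < r" for \<epsilon> x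
      using order_trans[OF ch(11) mult_right_mono[OF le(1) tnorm_nonneg], of \<epsilon> x] that r(3) by simp
    show "tnorm k (nc \<epsilon> n) \<le> K * norm \<epsilon>"
      if "n \<in> param_space k N" "\<forall>i\<in>{1..k+1}. norm (n i) < c + 1" "norm \<epsilon> < r" for n \<epsilon>
      using nb(3)[OF that(1,2), of \<epsilon>] that(3) r(4) le(2)[of \<epsilon>] by linarith
    show "w i = nc \<epsilon> n i" if "n \<in> param_space k N" "\<forall>i\<in>{1..k+1}. norm (n i) < c + 1" "norm \<epsilon> < r" "\<epsilon> \<noteq> 0"
       "\<forall>i\<in>{1..k+1}. w i \<in> Nc i \<and> norm (w i) < \<eta>" "G (Cv (\<lambda>j. w j + mat_app k L n j) \<epsilon>) = 0"
       "i \<in> {1..k+1}" for n \<epsilon> w i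
    proof (rule fm(5)[OF that(1,2) _ that(4) _ that(6,7)])
      show "norm \<epsilon> < \<epsilon>0" using that r(2) by simp
      show "\<forall>i\<in>{1..k+1}. w i \<in> Nc i \<and> norm (w i) < \<delta>" using that(5) ch(2) by (auto intro: less_le_trans)
    qed
    show "ksmooth_on (scale_prod sB) sB (UNIV \<times> P)
       {(\<epsilon>, p). norm \<epsilon> < r \<and> p \<in> P \<and> norm p < c + 1} (\<lambda>x. nc (fst x) (last_entry (snd x)) i)" if "i \<in> {1..k+1}" for i
      by (rule ksmooth_on_subset[OF fm(6)[OF that]]) (use r(2) in auto)
  next
    fix \<epsilon> :: 'a assume \<epsilon>: "norm \<epsilon> < r"
    then have e: "norm \<epsilon> < \<epsilon>0" "norm \<epsilon> < rc" "norm \<epsilon> < rE" using r by auto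
    show "norm (F \<epsilon> u - F \<epsilon> v - (u - v)) \<le> norm (u - v) / 2" if "u \<in> region \<eta> (c + 1)" "v \<in> region \<eta> (c + 1)" for u v
      by (rule ch(7)[OF e(2) that])
    show "Cv (emb0 u) (\<epsilon> * (1 + \<epsilon> ^ q * sig u)) = base \<epsilon> + Dl \<epsilon> I + E \<epsilon> (F \<epsilon> u)" for u by (rule ch(9)[OF e(2)])
    show "Dx \<epsilon> x = E \<epsilon> (H \<epsilon> x)" if "x \<in> Yset" for x by (rule ch(10)[OF e(2) that])
    show "\<exists>\<kappa>>0. \<forall>u. norm (E \<epsilon> u) \<ge> \<kappa> * norm u" if "\<epsilon> \<noteq> 0" by (rule rE(2)[OF that e(3)])
    fix n assume n: "n \<in> param_space k N" "\<forall>i\<in>{1..k+1}. norm (n i) < c + 1"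
    show "nc \<epsilon> n i \<in> Nc i" if "i \<in> {1..k+1}" for i using fm(3)[OF n e(1) that] ..
    show "G (zf \<epsilon> n) = 0" if "\<epsilon> \<noteq> 0" by (rule fm(4)[OF n e(1) that])
  qed (fact assms ch K r)+
  then show ?thesis by blast
qed

section \<open>The solution manifold around the approximate curve\<close>

context chart_branch
begin

lemma last_entry_c:
  assumes "p \<in> P" "norm p < c + 1"
  shows "last_entry p \<in> param_space k N" "\<forall>i\<in>{1..k+1}. norm (last_entry p i) < c + 1"
proof -
  show "last_entry p \<in> param_space k N" by (rule last_entry_param[OF subsetD[OF P_subset assms(1)]])
  show "\<forall>i\<in>{1..k+1}. norm (last_entry p i) < c + 1" unfolding last_entry_def using assms(2) c by simp
qed

lemma nc_last:
  assumes "p \<in> P" "norm p < c + 1" "norm \<epsilon> < r" "i \<in> {1..k+1}"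
  shows "nc \<epsilon> (last_entry p) i \<in> Nc i" "norm (nc \<epsilon> (last_entry p) i) < \<eta>"
proof -
  note l = last_entry_c[OF assms(1,2)]
  show "nc \<epsilon> (last_entry p) i \<in> Nc i" by (rule nc_mem[OF l assms(3,4)])
  have "norm (nc \<epsilon> (last_entry p) i) \<le> K * norm \<epsilon>"
    using norm_le_tnorm[OF assms(4)] nc_bound[OF l assms(3)] by (rule order_trans)
  also have "\<dots> < K * r" by (rule mult_strict_left_mono[OF assms(3) K])
  also note K\<eta>
  finally show "norm (nc \<epsilon> (last_entry p) i) < \<eta>" .
qed

lemma Cv_cong: "(\<And>i. i \<in> {1..k+1} \<Longrightarrow> x i = y i) \<Longrightarrow> Cv x \<epsilon> = Cv y \<epsilon>"
  unfolding Cv_def by (rule arg_cong[where f = "(+) _"]) (rule tlinear_cong[OF tlinear_Dx])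

text \<open>\<open>emb0\<close> ignores the coordinate \<open>s\<close> along \<open>zbar l\<close>,
  while \<open>sig\<close> reads it. So \<open>s\<close> is free to be chosen such that \<epsilon>
  is the reparametrised time seen from another base point.\<close>

definition pt :: "'a \<Rightarrow> 'b \<Rightarrow> 'a \<Rightarrow> 'b" where
  "pt \<epsilon> p s = (\<Sum>i=1..k+1. nc \<epsilon> (last_entry p) i) + (p + sB s (zbar l))"

lemma pt:
  assumes "p \<in> P" "norm p < c + 1" "norm \<epsilon> < r"
  shows W_pt: "i \<in> {1..k+1} \<Longrightarrow> W i (pt \<epsilon> p s) = nc \<epsilon> (last_entry p) i"
    and pproj_pt: "pproj (pt \<epsilon> p s) = p" and lcoord_pt: "lcoord (pt \<epsilon> p s) = s"
    and Cv_pt: "Cv (emb0 (pt \<epsilon> p s)) \<epsilon> = zr \<epsilon> p"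
proof -
  note n = nc_last(1)[OF assms]
  show W: "W i (pt \<epsilon> p s) = nc \<epsilon> (last_entry p) i" if "i \<in> {1..k+1}" for i
    unfolding pt_def by (rule W_of_coordinates[OF n assms(1) that])
  show p: "pproj (pt \<epsilon> p s) = p"
    unfolding pt_def by (rule pproj_of_coordinates[OF n assms(1)])
  show "lcoord (pt \<epsilon> p s) = s"
    unfolding pt_def by (rule lcoord_of_coordinates[OF n assms(1)])
  show "Cv (emb0 (pt \<epsilon> p s)) \<epsilon> = zr \<epsilon> p"
    unfolding zr_eq_zf z_fam_def ansatz_Cv by (rule Cv_cong) (simp add: emb0_def W p)
qed

lemma pt_region:
  assumes "p \<in> P" "norm p < c + 1" "norm \<epsilon> < r" "norm s < \<eta>"
  shows "pt \<epsilon> p s \<in> region \<eta> (c + 1)"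
proof -
  note a = assms(1-3)
  show ?thesis unfolding region_def mem_Collect_eq lcoord_pt[OF a] pproj_pt[OF a]
    by (intro conjI ballI assms) (simp only: W_pt[OF a] nc_last(2)[OF a])
qed

lemma zr_solves: "p \<in> P \<Longrightarrow> norm p < c + 1 \<Longrightarrow> norm \<epsilon> < r \<Longrightarrow> \<epsilon> \<noteq> 0 \<Longrightarrow> G (zr \<epsilon> p) = 0"
  unfolding zr_eq_zf by (intro zf_solves last_entry_c)

text \<open>The coordinates \<open>W i v\<close> are small and solve the scaled equation for the
  parameter \<open>pproj v\<close> in the last entry, so uniqueness identifies them with
  \<open>nc\<close>.\<close>

lemma solution_on_zr:
  assumes \<epsilon>: "\<epsilon> \<noteq> 0" "norm \<epsilon> < r" and v: "\<forall>i\<in>{1..k+1}. norm (W i v) < \<eta>" "norm (pproj v) < c + 1"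
    and G: "G (Cv (emb0 v) \<epsilon>) = 0"
  shows "Cv (emb0 v) \<epsilon> = zr \<epsilon> (pproj v)"
proof -
  note n = last_entry_c[OF pproj_mem v(2)]
  have "Cv (emb0 v) \<epsilon> = Cv (\<lambda>j. W j v + mat_app k L (last_entry (pproj v)) j) \<epsilon>"
    by (simp add: emb0_def[abs_def])
  with G have G': "G (Cv (\<lambda>j. W j v + mat_app k L (last_entry (pproj v)) j) \<epsilon>) = 0" by simp
  have "W i v = nc \<epsilon> (last_entry (pproj v)) i" if "i \<in> {1..k+1}" for i
    by (rule nc_unique[OF n \<epsilon>(2,1) _ G' that]) (use v(1) W_mem in blast)
  then show ?thesis
    unfolding zr_eq_zf z_fam_def ansatz_Cv by (intro Cv_cong) (simp add: emb0_def)
qed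

lemma coordinate_bound:
  obtains C where "C > 0" "\<And>v. norm (lcoord v) \<le> C * norm v" "\<And>v. norm (pproj v) \<le> C * norm v"
    "\<And>i v. i \<in> {1..k+1} \<Longrightarrow> norm (W i v) \<le> C * norm v"
proof -
  obtain C1 where C1: "C1 > 0" "\<And>v. norm (lcoord v) \<le> C1 * norm v" by (rule klinear_on_bound[OF klinear_lcoord]) blast
  obtain C2 where C2: "C2 > 0" "\<And>v. norm (pproj v) \<le> C2 * norm v" by (rule klinear_on_bound[OF klinear_pproj]) blast
  have "\<exists>C>0. \<forall>v. norm (W i v) \<le> C * norm v" if "i \<in> {1..k+1}" for i
    by (rule klinear_on_bound[OF klinear_W[OF that]]) blast
  then obtain C3 where C3: "\<And>i. i \<in> {1..k+1} \<Longrightarrow> C3 i > 0" "\<And>i v. i \<in> {1..k+1} \<Longrightarrow> norm (W i v) \<le> C3 i * norm v" by metis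
  have s: "C3 i \<le> (\<Sum>i=1..k+1. C3 i)" if "i \<in> {1..k+1}" for i
    by (rule member_le_sum) (use that C3(1) in \<open>auto simp: less_imp_le\<close>)
  have s0: "(\<Sum>i=1..k+1. C3 i) \<ge> 0" by (rule sum_nonneg) (use C3(1) in \<open>simp add: less_imp_le\<close>)
  show thesis
  proof (rule that[of "C1 + C2 + (\<Sum>i=1..k+1. C3 i)"])
    fix v
    show "norm (lcoord v) \<le> (C1 + C2 + (\<Sum>i=1..k+1. C3 i)) * norm v"
      by (rule order_trans[OF C1(2) mult_right_mono]) (use C2(1) s0 in auto)
    show "norm (pproj v) \<le> (C1 + C2 + (\<Sum>i=1..k+1. C3 i)) * norm v"
      by (rule order_trans[OF C2(2) mult_right_mono]) (use C1(1) s0 in auto)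
    show "norm (W i v) \<le> (C1 + C2 + (\<Sum>i=1..k+1. C3 i)) * norm v" if "i \<in> {1..k+1}" for i
      by (rule order_trans[OF C3(2)[OF that] mult_right_mono]) (use C1(1) C2(1) s[OF that] in auto)
  qed (use C1(1) C2(1) s0 in auto)
qed

lemma UNIV_P_diff: "x \<in> {(\<epsilon>, p). Q1 \<epsilon> \<and> p \<in> P \<and> Q2 p} \<Longrightarrow> y \<in> {(\<epsilon>, p). Q1 \<epsilon> \<and> p \<in> P \<and> Q2 p} \<Longrightarrow> y - x \<in> UNIV \<times> P"
  for x y :: "'a \<times> 'b"
  by (cases x; cases y) (simp add: B.subspace_diff[OF subspace_P])

lemma zr_smooth:
  "ksmooth_on (scale_prod sB) sB (UNIV \<times> P) {(\<epsilon>, p). norm \<epsilon> < r \<and> p \<in> P \<and> norm p < c + 1} (\<lambda>(\<epsilon>, p). zr \<epsilon> p)"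
    (is "ksmooth_on ?s _ ?E ?U _")
proof -
  have scal: "klinear_on sB sB UNIV (sB a)" for a
    unfolding klinear_on_def by (auto simp: B.scale_right_distrib mult.commute intro!: exI[of _ "norm a"])
  have L_lin: "klinear_on ?s sB UNIV (\<lambda>x. mat_app k L (last_entry (snd x)) j)" if "j \<in> {1..k+1}" for j
  proof -
    have id: "klinear_on sB sB UNIV (\<lambda>v. v)" unfolding klinear_on_def by (auto intro!: exI[of _ 1])
    have "klinear_on sB sB UNIV (\<lambda>v. mat_app k L (last_entry v) j)"
      by (rule klinear_tlinear_compose[OF klinear_last[OF id] tlinear_L[OF that]])
    from klinear_on_snd[OF this] show ?thesis .
  qed
  have M_lin: "klinear_on sB sB UNIV (M i j)" if "i \<in> {1..k+1}" "j \<in> {1..k+1}" for i j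
    using unit_M that unfolding unit_upper_matrix_def by blast
  let ?y = "\<lambda>x i. I i + mat_app k M (\<lambda>j. nc (fst x) (last_entry (snd x)) j + mat_app k L (last_entry (snd x)) j) i"
  have y: "ksmooth_on ?s sB ?E ?U (\<lambda>x. ?y x i)" if "i \<in> {1..k+1}" for i
    unfolding mat_app_def[of k M]
    by (intro ksmooth_on_add ksmooth_on_sum ksmooth_on_const B.kspace_axioms finite_atLeastAtMost
        ksmooth_on_compose_klinear[OF M_lin[OF that]] nc_smooth ksmooth_on_klinear L_lin)
  have z: "ksmooth_on ?s sB ?E ?U (\<lambda>x. completion k zbar (?y x) j)" if "j \<in> {1..2*k+1}" for j
  proof (cases "j \<le> k")
    case True
    then show ?thesis unfolding completion_def by (simp add: ksmooth_on_const B.kspace_axioms)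
  next
    case False
    then have "2 * k + 2 - j \<in> {1..k+1}" using that by auto
    from y[OF this] show ?thesis using False unfolding completion_def by simp
  qed
  have "ksmooth_on ?s sB ?E ?U (\<lambda>x. \<Sum>j=1..2*k+1. sB (fst x ^ j) (sB (inverse (fact j)) (completion k zbar (?y x) j)))"
  proof (intro ksmooth_on_sum B.kspace_axioms finite_atLeastAtMost)
    fix j assume j: "j \<in> {1..2*k+1}"
    show "ksmooth_on ?s sB ?E ?U (\<lambda>x. sB (fst x ^ j) (sB (inverse (fact j)) (completion k zbar (?y x) j)))"
      by (rule ksmooth_on_scale_fst_power[OF B.kspace_axioms ksmooth_on_compose_klinear[OF scal z[OF j]]])
         (rule UNIV_P_diff)
  qed
  then show ?thesis
    by (rule ksmooth_on_cong)
       (auto simp: zr_eq_zf z_fam_def ansatz_def poly_curve_def divide_inverse simp del: fact_Suc sum.cl_ivl_Suc)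
qed

text \<open>Both points are viewed from the same time \<epsilon>: a suitable line coordinate
  \<open>s\<close> makes \<epsilon>' a reparametrisation of \<epsilon>. They then differ by
  \<open>E \<epsilon>\<close> applied to a difference of values of \<open>F \<epsilon>\<close>,
  where \<open>F \<epsilon>\<close> contracts by at most the factor \<open>1/2\<close> and
  \<open>E \<epsilon>\<close> by at most \<kappa>. The changes of time and parameter are recovered
  from \<open>lcoord\<close> and \<open>pproj\<close>.\<close>

lemma zr_expanding:
  assumes x: "\<epsilon> \<noteq> 0" "norm \<epsilon> < r" "p \<in> P" "norm p < c + 1"
  obtains \<kappa> d where "\<kappa> > 0" "d > 0"
    "\<And>\<epsilon>' p'. norm (\<epsilon>' - \<epsilon>) < d \<Longrightarrow> p' \<in> P \<Longrightarrow> norm (p' - p) < d \<Longrightarrow>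
       \<kappa> * (norm (\<epsilon>' - \<epsilon>) + norm (p' - p)) \<le> norm (zr \<epsilon>' p' - zr \<epsilon> p)"
proof -
  obtain \<kappa> where \<kappa>: "\<kappa> > 0" "\<And>u. \<kappa> * norm u \<le> norm (E \<epsilon> u)" using E_lower[OF x(1,2)] by blast
  obtain C where C: "C > 0" "\<And>v. norm (lcoord v) \<le> C * norm v" "\<And>v. norm (pproj v) \<le> C * norm v"
    by (rule coordinate_bound) blast
  \<comment> \<open>The ratio between the coordinate \<open>s\<close> and
    \<open>\<epsilon>' - \<epsilon>\<close> below; the bound \<open>\<eta> / \<mu>\<close> in
    \<open>d\<close> keeps \<open>s\<close> within the region of the chart.\<close>
  define \<mu> where "\<mu> = norm kap / norm \<epsilon> ^ (q + 1)"
  have \<mu>: "\<mu> > 0" using kap_nonzero x(1) by (simp add: \<mu>_def)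
  define d where "d = min (\<eta> / \<mu>) (min (r - norm \<epsilon>) (c + 1 - norm p))"
  define m where "m = min \<mu> 1"
  have m: "m > 0" "m \<le> \<mu>" "m \<le> 1" using \<mu> by (auto simp: m_def)
  show thesis
  proof (rule that[of "\<kappa> * m / (4 * C)" d])
    show "\<kappa> * m / (4 * C) > 0" using \<kappa>(1) C(1) m by simp
    show "d > 0" using \<eta> \<mu> x by (simp add: d_def)
    fix \<epsilon>' p' assume y: "norm (\<epsilon>' - \<epsilon>) < d" "p' \<in> P" "norm (p' - p) < d"
    have \<epsilon>': "norm \<epsilon>' < r" using y(1) norm_triangle_sub[of \<epsilon>' \<epsilon>] unfolding d_def by linarith
    have p': "norm p' < c + 1" using y(3) norm_triangle_sub[of p' p] unfolding d_def by linarith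
    \<comment> \<open>The solution of
      \<open>\<epsilon> * (1 + \<epsilon>^q * (s / kap)) = \<epsilon>'\<close>.\<close>
    define s where "s = kap * ((\<epsilon>' / \<epsilon> - 1) / \<epsilon> ^ q)"
    have ns: "norm s = \<mu> * norm (\<epsilon>' - \<epsilon>)"
    proof -
      have "s = kap * (\<epsilon>' - \<epsilon>) / \<epsilon> ^ (q + 1)" using x(1) by (simp add: s_def field_simps)
      then show ?thesis by (simp add: \<mu>_def norm_mult norm_divide norm_power)
    qed
    have "\<mu> * norm (\<epsilon>' - \<epsilon>) < \<mu> * (\<eta> / \<mu>)"
      using y(1) by (intro mult_strict_left_mono \<mu>) (simp add: d_def)
    then have s: "norm s < \<eta>" unfolding ns using \<mu> by simp
    have s0: "norm (0::'a) < \<eta>" using \<eta> by simp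
    let ?v = "pt \<epsilon> p 0" and ?v' = "pt \<epsilon>' p' s"
    note pt0 = pt[OF x(3,4,2)] and pt' = pt[OF y(2) p' \<epsilon>']
    have "\<epsilon> * (1 + \<epsilon> ^ q * sig ?v) = \<epsilon>" by (simp add: sig_def pt0(3))
    with Cv_F[OF x(2), of ?v] have z: "zr \<epsilon> p = base \<epsilon> + Dl \<epsilon> I + E \<epsilon> (F \<epsilon> ?v)" by (simp only: pt0(4))
    have "\<epsilon> * (1 + \<epsilon> ^ q * sig ?v') = \<epsilon>'"
      using x(1) kap_nonzero by (simp add: sig_def pt'(3) s_def field_simps)
    with Cv_F[OF x(2), of ?v'] have z': "zr \<epsilon>' p' = base \<epsilon> + Dl \<epsilon> I + E \<epsilon> (F \<epsilon> ?v')" by (simp only: pt'(4))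
    have "norm (?v' - ?v) / 2 \<le> norm (F \<epsilon> ?v' - F \<epsilon> ?v)"
    proof -
      have "norm (F \<epsilon> ?v' - F \<epsilon> ?v - (?v' - ?v)) \<le> norm (?v' - ?v) / 2"
        by (rule F_lipschitz[OF x(2)]) (intro pt_region y(2) p' \<epsilon>' s x s0)+
      moreover have "norm (?v' - ?v) \<le> norm (F \<epsilon> ?v' - F \<epsilon> ?v) + norm (F \<epsilon> ?v' - F \<epsilon> ?v - (?v' - ?v))"
        using norm_triangle_ineq4[of "F \<epsilon> ?v' - F \<epsilon> ?v" "F \<epsilon> ?v' - F \<epsilon> ?v - (?v' - ?v)"] by simp
      ultimately show ?thesis by linarith
    qed
    then have "\<kappa> * (norm (?v' - ?v) / 2) \<le> \<kappa> * norm (F \<epsilon> ?v' - F \<epsilon> ?v)" using \<kappa>(1) by (intro mult_left_mono) auto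
    also have "\<dots> \<le> norm (E \<epsilon> (F \<epsilon> ?v' - F \<epsilon> ?v))" by (rule \<kappa>(2))
    also have "E \<epsilon> (F \<epsilon> ?v' - F \<epsilon> ?v) = zr \<epsilon>' p' - zr \<epsilon> p" unfolding z z' klinear_on_diff[OF klinear_E] by simp
    finally have low: "\<kappa> * (norm (?v' - ?v) / 2) \<le> norm (zr \<epsilon>' p' - zr \<epsilon> p)" .
    have "\<mu> * norm (\<epsilon>' - \<epsilon>) \<le> C * norm (?v' - ?v)"
      using C(2)[of "?v' - ?v"] unfolding klinear_on_diff[OF klinear_lcoord] pt0(3) pt'(3) ns[symmetric] by simp
    moreover have "norm (p' - p) \<le> C * norm (?v' - ?v)"
      using C(3)[of "?v' - ?v"] unfolding klinear_on_diff[OF klinear_pproj] pt0(2) pt'(2) .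
    moreover have "m * (norm (\<epsilon>' - \<epsilon>) + norm (p' - p)) \<le> \<mu> * norm (\<epsilon>' - \<epsilon>) + 1 * norm (p' - p)"
      unfolding distrib_left by (intro add_mono mult_right_mono m) auto
    ultimately have "m * (norm (\<epsilon>' - \<epsilon>) + norm (p' - p)) \<le> 2 * (C * norm (?v' - ?v))" by linarith
    then have "\<kappa> / (4 * C) * (m * (norm (\<epsilon>' - \<epsilon>) + norm (p' - p))) \<le> \<kappa> / (4 * C) * (2 * (C * norm (?v' - ?v)))"
      using \<kappa>(1) C(1) by (intro mult_left_mono) auto
    also have "\<dots> = \<kappa> * (norm (?v' - ?v) / 2)" using C(1) by simp
    also note low
    finally show "\<kappa> * m / (4 * C) * (norm (\<epsilon>' - \<epsilon>) + norm (p' - p)) \<le> norm (zr \<epsilon>' p' - zr \<epsilon> p)" by simp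
  qed
qed

definition dom :: "real \<Rightarrow> ('a \<times> 'b) set" where
  "dom \<rho> = {(\<epsilon>, p). 0 < norm \<epsilon> \<and> norm \<epsilon> < \<rho> \<and> p \<in> P \<and> norm p < c}"

lemma zr_smooth_dom: "\<rho> \<le> r \<Longrightarrow> ksmooth_on (scale_prod sB) sB (UNIV \<times> P) (dom \<rho>) (\<lambda>(\<epsilon>, p). zr \<epsilon> p)"
  by (rule ksmooth_on_subset[OF zr_smooth]) (auto simp: dom_def)

lemma dom_diff: "x \<in> dom \<rho> \<Longrightarrow> y \<in> dom \<rho> \<Longrightarrow> y - x \<in> UNIV \<times> P"
  unfolding dom_def by (cases x; cases y) (simp add: B.subspace_diff[OF subspace_P])

lemma zr_derivative:
  assumes \<rho>: "\<rho> \<le> r" and x: "(\<epsilon>, p) \<in> dom \<rho>"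
  shows "\<exists>D. has_kderivative_on (scale_prod sB) sB (UNIV \<times> P) (dom \<rho>) (\<lambda>(\<epsilon>, p). zr \<epsilon> p) (\<epsilon>, p) D \<and>
    (\<forall>a. \<forall>q\<in>P. D (a, q) = 0 \<longrightarrow> a = 0 \<and> q = 0)"
proof -
  have "\<exists>D. has_kderivative_on (scale_prod sB) sB (UNIV \<times> P) (dom \<rho>) (\<lambda>(\<epsilon>, p). zr \<epsilon> p) (\<epsilon>, p) D"
    by (rule ksmooth_on_has_kderivative[OF zr_smooth_dom[OF \<rho>] x])
       (use B.subspace_0[OF subspace_P] dom_diff[OF x] in \<open>auto simp: scale_prod_def zero_prod_def\<close>)
  then obtain D where D: "has_kderivative_on (scale_prod sB) sB (UNIV \<times> P) (dom \<rho>) (\<lambda>(\<epsilon>, p). zr \<epsilon> p) (\<epsilon>, p) D" ..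
  have x': "\<epsilon> \<noteq> 0" "norm \<epsilon> < r" "p \<in> P" "norm p < c + 1" using x \<rho> by (auto simp: dom_def)
  obtain \<kappa> d where \<kappa>: "\<kappa> > 0" "d > 0"
    "\<And>\<epsilon>' p'. norm (\<epsilon>' - \<epsilon>) < d \<Longrightarrow> p' \<in> P \<Longrightarrow> norm (p' - p) < d \<Longrightarrow>
       \<kappa> * (norm (\<epsilon>' - \<epsilon>) + norm (p' - p)) \<le> norm (zr \<epsilon>' p' - zr \<epsilon> p)"
    by (rule zr_expanding[OF x']) blast
  have "(a, q) = 0" if q: "q \<in> P" and z: "D (a, q) = 0" for a q
  proof (rule kderivative_eq_0_imp_eq_0[OF D _ z _ _ \<kappa>(1) _ \<kappa>(2)])
    show "(a, q) \<in> UNIV \<times> P" using q by simp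
    show "scale_prod sB (of_real t) (a, q) = t *\<^sub>R (a, q)" for t
      by (simp add: scale_prod_def scaleR_conv_of_real)
    show "\<kappa> * norm (y - (\<epsilon>, p)) \<le> norm ((case y of (\<epsilon>, p) \<Rightarrow> zr \<epsilon> p) - (case (\<epsilon>, p) of (\<epsilon>, p) \<Rightarrow> zr \<epsilon> p))"
      if y: "y \<in> dom \<rho>" "norm (y - (\<epsilon>, p)) < d" for y
    proof (cases y)
      case (Pair \<epsilon>' p')
      have "norm (\<epsilon>' - \<epsilon>) \<le> norm (y - (\<epsilon>, p))" "norm (p' - p) \<le> norm (y - (\<epsilon>, p))"
        using norm_fst_le[of "\<epsilon>' - \<epsilon>" "p' - p"] norm_snd_le[of "p' - p" "\<epsilon>' - \<epsilon>"] by (auto simp: Pair)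
      then have "\<kappa> * (norm (\<epsilon>' - \<epsilon>) + norm (p' - p)) \<le> norm (zr \<epsilon>' p' - zr \<epsilon> p)"
        using y by (intro \<kappa>(3)) (auto simp: Pair dom_def)
      moreover have "norm (y - (\<epsilon>, p)) \<le> norm (\<epsilon>' - \<epsilon>) + norm (p' - p)"
        using norm_Pair_le[of "\<epsilon>' - \<epsilon>" "p' - p"] by (simp add: Pair)
      then have "\<kappa> * norm (y - (\<epsilon>, p)) \<le> \<kappa> * (norm (\<epsilon>' - \<epsilon>) + norm (p' - p))" using \<kappa>(1) by (intro mult_left_mono) auto
      ultimately show ?thesis by (simp add: Pair)
    qed
    have l1: "((\<lambda>t. norm (\<epsilon> + t *\<^sub>R a)) \<longlongrightarrow> norm \<epsilon>) (at_right 0)" and l2: "((\<lambda>t. norm (p + t *\<^sub>R q)) \<longlongrightarrow> norm p) (at_right 0)"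
      by (rule tendsto_eq_intros refl tendsto_ident_at | simp)+
    have "\<forall>\<^sub>F t in at_right 0. 0 < norm (\<epsilon> + t *\<^sub>R a)" "\<forall>\<^sub>F t in at_right 0. norm (\<epsilon> + t *\<^sub>R a) < \<rho>"
      "\<forall>\<^sub>F t in at_right 0. norm (p + t *\<^sub>R q) < c"
      by (rule order_tendstoD[OF l1] order_tendstoD[OF l2], use x in \<open>simp add: dom_def\<close>)+
    then show "\<forall>\<^sub>F t in at_right 0. (\<epsilon>, p) + t *\<^sub>R (a, q) \<in> dom \<rho>"
    proof eventually_elim
      case (elim t)
      have "p + t *\<^sub>R q \<in> P"
        using B.subspace_add[OF subspace_P x'(3) B.subspace_scale[OF subspace_P q, of "of_real t"]] by simp
      then show ?case using elim by (simp add: dom_def)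
    qed
  qed simp
  with D show ?thesis by (auto simp: zero_prod_def)
qed

text \<open>Values of all nearby curves, solutions or not, at all small nonzero times. The direction
  \<open>zbar l\<close>, which \<open>emb0\<close> ignores, is supplied by the variation of the
  time.\<close>

definition nbhd :: "real \<Rightarrow> 'b set" where
  "nbhd \<rho> = {Cv (emb0 v) \<epsilon> | v \<epsilon>. 0 < norm \<epsilon> \<and> norm \<epsilon> < \<rho> \<and> (\<forall>i\<in>{1..k+1}. norm (W i v) < \<eta>) \<and> norm (pproj v) < c}"

text \<open>Seen from the time \<epsilon> of a given point, each nearby \<open>z\<close> is
  \<open>base \<epsilon> + Dl \<epsilon> I + E \<epsilon> y\<close> with \<open>y\<close> close to
  \<open>F \<epsilon> u\<close>, because \<open>E \<epsilon>\<close> is onto and bounded below. The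
  contraction argument gives \<open>y = F \<epsilon> w\<close>, and \<open>Cv_F\<close> reads the
  point as a curve value at a slightly changed time.\<close>

lemma open_nbhd:
  assumes \<rho>: "\<rho> \<le> r"
  shows "open (nbhd \<rho>)"
  unfolding open_dist
proof
  fix z0 assume "z0 \<in> nbhd \<rho>"
  then obtain v \<epsilon> where z0: "z0 = Cv (emb0 v) \<epsilon>" and \<epsilon>: "\<epsilon> \<noteq> 0" "norm \<epsilon> < \<rho>" and v: "\<forall>i\<in>{1..k+1}. norm (W i v) < \<eta>" "norm (pproj v) < c"
    unfolding nbhd_def by auto
  have \<epsilon>r: "norm \<epsilon> < r" using \<epsilon> \<rho> by simp
  \<comment> \<open>Setting the coordinate along \<open>zbar l\<close> to 0 leaves
    \<open>emb0\<close> unchanged and makes \<open>sig u = 0\<close>, so that the reparametrised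
    time is \<epsilon> itself.\<close>
  define u where "u = (\<Sum>i=1..k+1. W i v) + (pproj v + sB 0 (zbar l))"
  have u: "W i u = W i v" if "i \<in> {1..k+1}" for i
    unfolding u_def by (rule W_of_coordinates[OF W_mem pproj_mem that])
  have up: "pproj u = pproj v" unfolding u_def by (rule pproj_of_coordinates[OF W_mem pproj_mem])
  have ul: "lcoord u = 0" unfolding u_def by (rule lcoord_of_coordinates[OF W_mem pproj_mem])
  have "Cv (emb0 v) \<epsilon> = Cv (emb0 u) \<epsilon>" by (rule Cv_cong) (simp add: emb0_def u up)
  also have "\<dots> = base \<epsilon> + Dl \<epsilon> I + E \<epsilon> (F \<epsilon> u)" using Cv_F[OF \<epsilon>r, of u] by (simp add: sig_def ul)
  finally have z0': "z0 = base \<epsilon> + Dl \<epsilon> I + E \<epsilon> (F \<epsilon> u)" using z0 by simp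
  \<comment> \<open>The last two conditions keep the changed time nonzero and below \<rho>.\<close>
  define O' where "O' = {w. norm (lcoord w) < \<eta>} \<inter> (\<Inter>i\<in>{1..k+1}. {w. norm (W i w) < \<eta>}) \<inter> {w. norm (pproj w) < c}
    \<inter> {w. 0 < norm (\<epsilon> * (1 + \<epsilon> ^ q * sig w))} \<inter> {w. norm (\<epsilon> * (1 + \<epsilon> ^ q * sig w)) < \<rho>}"
  have cont: "continuous_on UNIV lcoord" "continuous_on UNIV pproj" "\<And>i. i \<in> {1..k+1} \<Longrightarrow> continuous_on UNIV (W i)"
    by (rule linear_continuous_on, rule klinear_on_bounded_linear[OF B.kspace_axioms kspace_mult klinear_lcoord],
      rule linear_continuous_on, rule klinear_on_bounded_linear[OF B.kspace_axioms B.kspace_axioms klinear_pproj],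
      rule linear_continuous_on, rule klinear_on_bounded_linear[OF B.kspace_axioms B.kspace_axioms klinear_W])
  have "open O'"
    unfolding O'_def sig_def
    by (intro open_Int open_INT finite_atLeastAtMost ballI open_Collect_less continuous_intros cont) (simp_all add: kap_nonzero)
  moreover have "u \<in> O'" unfolding O'_def using v \<epsilon> \<eta> by (simp add: u up ul sig_def)
  ultimately obtain \<delta> where \<delta>: "\<delta> > 0" "cball u \<delta> \<subseteq> O'" using open_contains_cball by blast
  have reg: "w \<in> region \<eta> (c + 1)" if "w \<in> cball u \<delta>" for w
    using subsetD[OF \<delta>(2) that] unfolding O'_def region_def by auto
  obtain \<kappa> where \<kappa>: "\<kappa> > 0" "\<And>u. \<kappa> * norm u \<le> norm (E \<epsilon> u)" using E_lower[OF \<epsilon>(1) \<epsilon>r] by blast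
  have "z \<in> nbhd \<rho>" if z: "dist z z0 < \<kappa> * (\<delta> / 2)" for z
  proof -
    obtain e where e: "E \<epsilon> e = z - z0" using E_surj[OF \<epsilon>(1) Dx_E[OF \<epsilon>r]] by blast
    have "\<kappa> * norm e < \<kappa> * (\<delta> / 2)" using \<kappa>(2)[of e] z unfolding e dist_norm by linarith
    then have "norm e \<le> \<delta> / 2" using \<kappa>(1) by simp
    then have "\<exists>w\<in>cball u \<delta>. F \<epsilon> w = F \<epsilon> u + e"
      by (intro perturbed_identity_solve F_lipschitz[OF \<epsilon>r] reg) auto
    then obtain w where w: "w \<in> cball u \<delta>" "F \<epsilon> w = F \<epsilon> u + e" by blast
    have "z = base \<epsilon> + Dl \<epsilon> I + E \<epsilon> (F \<epsilon> w)"
      unfolding w(2) klinear_onD(1)[OF klinear_E] e z0' by simp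
    also have "\<dots> = Cv (emb0 w) (\<epsilon> * (1 + \<epsilon> ^ q * sig w))" by (rule Cv_F[OF \<epsilon>r, symmetric])
    finally show ?thesis using subsetD[OF \<delta>(2) w(1)] unfolding nbhd_def O'_def by blast
  qed
  then show "\<exists>e>0. \<forall>z. dist z z0 < e \<longrightarrow> z \<in> nbhd \<rho>" using \<kappa>(1) \<delta>(1) by (intro exI[of _ "\<kappa> * (\<delta> / 2)"]) auto
qed

lemma z_zero_nbhd:
  assumes "0 < norm \<epsilon>" "norm \<epsilon> < \<rho>"
  shows "z_zero sB l k zbar I \<epsilon> \<in> nbhd \<rho>"
proof -
  have W0: "W i 0 = 0" if "i \<in> {1..k+1}" for i by (rule klinear_on_0[OF klinear_W[OF that]])
  have p0: "pproj 0 = 0" by (rule klinear_on_0[OF klinear_pproj])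
  have "last_entry 0 = (\<lambda>_. 0)" by (auto simp: last_entry_def)
  then have "emb0 0 i = 0" if "i \<in> {1..k+1}" for i
    unfolding emb0_def using W0[OF that] p0 tlinear_0[OF tlinear_L[OF that]] by simp
  then have "Cv (emb0 0) \<epsilon> = Cv (\<lambda>_. 0) \<epsilon>" by (rule Cv_cong)
  also have "\<dots> = base \<epsilon> + Dl \<epsilon> I" unfolding Cv_def tlinear_0[OF tlinear_Dx] by simp
  also have "base \<epsilon> = (\<Sum>j=l..k. sB (\<epsilon> ^ j / fact j) (zbar j))"
    unfolding base_def poly_curve_def
    by (rule sum.mono_neutral_right) (use l zbelow in \<open>auto simp del: fact_Suc\<close>)
  finally have "z_zero sB l k zbar I \<epsilon> = Cv (emb0 0) \<epsilon>" unfolding z_zero_def Dl_alt by simp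
  then show ?thesis unfolding nbhd_def mem_Collect_eq
    by (intro exI[of _ 0] exI[of _ \<epsilon>] conjI assms ballI) (use W0 p0 \<eta> c in auto)
qed

lemma solutions_nbhd:
  assumes \<rho>: "\<rho> \<le> r"
  shows "{z \<in> nbhd \<rho>. G z = 0} = {zr \<epsilon> p | \<epsilon> p. 0 < norm \<epsilon> \<and> norm \<epsilon> < \<rho> \<and> p \<in> P \<and> norm p < c}"
proof (intro Set.equalityI subsetI)
  fix z assume "z \<in> {z \<in> nbhd \<rho>. G z = 0}"
  then obtain v \<epsilon> where z: "z = Cv (emb0 v) \<epsilon>" "G (Cv (emb0 v) \<epsilon>) = 0" and \<epsilon>: "0 < norm \<epsilon>" "norm \<epsilon> < \<rho>"
    and v: "\<forall>i\<in>{1..k+1}. norm (W i v) < \<eta>" "norm (pproj v) < c"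
    unfolding nbhd_def by blast
  have "z = zr \<epsilon> (pproj v)" unfolding z(1) using \<epsilon> \<rho> v(2) by (intro solution_on_zr z v) auto
  then show "z \<in> {zr \<epsilon> p | \<epsilon> p. 0 < norm \<epsilon> \<and> norm \<epsilon> < \<rho> \<and> p \<in> P \<and> norm p < c}"
    using \<epsilon> v(2) pproj_mem by blast
next
  fix z assume "z \<in> {zr \<epsilon> p | \<epsilon> p. 0 < norm \<epsilon> \<and> norm \<epsilon> < \<rho> \<and> p \<in> P \<and> norm p < c}"
  then obtain \<epsilon> p where z: "z = zr \<epsilon> p" and a: "0 < norm \<epsilon>" "norm \<epsilon> < \<rho>" "p \<in> P" "norm p < c" by blast
  have b: "norm p < c + 1" "norm \<epsilon> < r" "\<epsilon> \<noteq> 0" using a \<rho> by auto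
  note pt = pt[OF a(3) b(1,2), where s = 0]
  have "zr \<epsilon> p \<in> nbhd \<rho>"
    unfolding nbhd_def mem_Collect_eq
  proof (intro exI conjI ballI)
    show "zr \<epsilon> p = Cv (emb0 (pt \<epsilon> p 0)) \<epsilon>" by (rule pt(4)[symmetric])
    show "norm (W i (pt \<epsilon> p 0)) < \<eta>" if "i \<in> {1..k+1}" for i
      unfolding pt(1)[OF that] by (rule nc_last(2)[OF a(3) b(1,2) that])
    show "norm (pproj (pt \<epsilon> p 0)) < c" unfolding pt(2) by (rule a)
  qed (fact a)+
  then show "z \<in> {z \<in> nbhd \<rho>. G z = 0}" using z zr_solves[OF a(3) b] by simp
qed

lemma base_Dl_0: "base 0 + Dl 0 y = 0"
  unfolding poly_curve_completion[symmetric] poly_curve_def by (rule sum.neutral) simp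

text \<open>The vector \<open>H \<epsilon> x\<close> of the given solution is close to
  \<open>F \<epsilon> p\<close>, hence equal to \<open>F \<epsilon> u\<close> for some
  \<open>u\<close> near \<open>p\<close>. Then \<open>Cv_F\<close> exhibits the point as a curve
  value at another time, and uniqueness puts it on the manifold. The new parameter
  \<open>pproj u\<close> is only close to \<open>p\<close>, which is why the bound \<open>c\<close>
  is relaxed to \<open>c'\<close>.\<close>

lemma family_in_manifold:
  assumes \<rho>: "0 < \<rho>" "\<rho> \<le> r" and c': "c' > c"
  shows "\<exists>\<epsilon>1>0. \<exists>\<delta>>0. \<forall>\<epsilon> n \<alpha> p.
         norm \<epsilon> < \<epsilon>1 \<and> n \<in> param_space k N \<and> (\<forall>i\<in>{1..k}. norm (n i) < \<delta>) \<and>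
         norm \<alpha> < \<delta> \<and> p \<in> P \<and> norm p < c \<and> n (k+1) = sB \<alpha> (zbar l) + p \<longrightarrow>
         (\<exists>\<epsilon>' p'. norm \<epsilon>' < \<rho> \<and> (\<epsilon> \<noteq> 0 \<longrightarrow> \<epsilon>' \<noteq> 0) \<and> p' \<in> P \<and> norm p' < c' \<and> zf \<epsilon> n = zr \<epsilon>' p')"
proof -
  obtain C where C: "C > 0" "\<And>v. norm (lcoord v) \<le> C * norm v" "\<And>v. norm (pproj v) \<le> C * norm v"
    "\<And>i v. i \<in> {1..k+1} \<Longrightarrow> norm (W i v) \<le> C * norm v" by (rule coordinate_bound) blast
  obtain KL where KL: "KL > 0" "\<And>x. tnorm k (mat_app k L x) \<le> KL * tnorm k x" by (rule tnorm_mat_L) blast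
  \<comment> \<open>The tolerance for each coordinate: \<eta> for the chart, \<open>c' - c\<close>
    for the bound on the new parameter, 1 for the margin of the family. A ball of radius \<tau>
    around \<open>p\<close> respects it.\<close>
  define \<mu> where "\<mu> = Min {\<eta>, c' - c, 1}"
  define \<tau> where "\<tau> = \<mu> / (2 * C)"
  define Rx where "Rx = K + KL * (real (k + 1) * (c + 1))"
  \<comment> \<open>With \<delta> below, the terms with a factor \<epsilon> and the term
    \<open>\<alpha> zbar l\<close> each contribute at most \<open>\<tau> / 4\<close> to the distance
    from \<open>F \<epsilon> p\<close>; the bound \<open>\<rho> / 2\<close> leaves room for doubling
    the time.\<close>
  define \<epsilon>1 where "\<epsilon>1 = min (\<rho> / 2) (\<tau> / (4 * (K * (Rx + 2))))"
  define \<delta> where "\<delta> = min 1 (min (1 / (norm (zbar l) + 1)) (\<tau> / (4 * (norm (zbar l) + 1))))"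
  have \<mu>: "\<mu> > 0" "\<mu> \<le> \<eta>" "\<mu> \<le> c' - c" "\<mu> \<le> 1" using \<eta> c' by (auto simp: \<mu>_def)
  have \<tau>: "\<tau> > 0" "C * \<tau> < \<mu>" using \<mu> C(1) by (auto simp: \<tau>_def)
  have Rx: "Rx > 0" unfolding Rx_def using K KL(1) c by (auto intro!: add_pos_nonneg)
  then have KR: "K * (Rx + 2) > 0" using K by simp
  have \<epsilon>1: "\<epsilon>1 > 0" "\<epsilon>1 \<le> \<rho> / 2" "\<epsilon>1 \<le> \<tau> / (4 * (K * (Rx + 2)))" using \<rho> \<tau> KR by (auto simp: \<epsilon>1_def)
  have zp: "norm (zbar l) + 1 > 0" by (simp add: add_nonneg_pos)
  have \<delta>: "\<delta> > 0" "\<delta> \<le> 1" "\<delta> \<le> 1 / (norm (zbar l) + 1)" "\<delta> \<le> \<tau> / (4 * (norm (zbar l) + 1))"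
    using \<tau> zp by (auto simp: \<delta>_def)
  have "\<exists>\<epsilon>' p'. norm \<epsilon>' < \<rho> \<and> (\<epsilon> \<noteq> 0 \<longrightarrow> \<epsilon>' \<noteq> 0) \<and> p' \<in> P \<and> norm p' < c' \<and> zf \<epsilon> n = zr \<epsilon>' p'"
    if \<epsilon>: "norm \<epsilon> < \<epsilon>1" and n: "n \<in> param_space k N" and nk: "\<forall>i\<in>{1..k}. norm (n i) < \<delta>"
      and \<alpha>: "norm \<alpha> < \<delta>" and p: "p \<in> P" "norm p < c" and top: "n (k + 1) = sB \<alpha> (zbar l) + p" for \<epsilon> n \<alpha> p
  proof (cases "\<epsilon> = 0")
    case True
    have "zf 0 n = 0" "zr 0 0 = 0"
      unfolding zr_eq_zf z_fam_def ansatz_def poly_curve_completion base_Dl_0 by simp_all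
    then show ?thesis
      using True \<rho>(1) c' c B.subspace_0[OF subspace_P] by (intro exI[of _ 0]) auto
  next
    case False
    have \<epsilon>r: "norm \<epsilon> < r" using \<epsilon> \<epsilon>1(2) \<rho> by linarith
    have p1: "norm p < c + 1" using p by simp
    have \<alpha>z: "norm \<alpha> * norm (zbar l) \<le> \<delta> * (norm (zbar l) + 1)"
      using \<alpha> \<delta>(1) by (intro mult_mono) auto
    have "\<delta> * (norm (zbar l) + 1) \<le> 1" using \<delta>(3) zp by (simp add: pos_le_divide_eq)
    then have "norm (n (k + 1)) < c + 1"
      using norm_triangle_ineq[of "sB \<alpha> (zbar l)" p] \<alpha>z p(2) unfolding top B.norm_s by linarith
    then have nb: "\<forall>i\<in>{1..k+1}. norm (n i) < c + 1"
    proof (intro ballI)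
      fix i assume i: "i \<in> {1..k+1}"
      show "norm (n i) < c + 1"
      proof (cases "i = k + 1")
        case False
        then have "norm (n i) < \<delta>" using i nk by auto
        then show ?thesis using \<delta>(2) c by linarith
      qed (use \<open>norm (n (k + 1)) < c + 1\<close> in simp)
    qed
    have nN: "n i \<in> N i" if "i \<in> {1..k+1}" for i by (rule param_mem[OF n that])
    have w: "nc \<epsilon> n i \<in> Nc i" if "i \<in> {1..k+1}" for i by (rule nc_mem[OF n nb \<epsilon>r that])
    have wb: "tnorm k (nc \<epsilon> n) \<le> K * norm \<epsilon>" by (rule nc_bound[OF n nb \<epsilon>r])
    define x where "x = (\<lambda>i. nc \<epsilon> n i + mat_app k L n i)"
    have x: "x \<in> Yset" unfolding x_def by (intro Yset_add Nc_Yset w L_Yset nN)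
    have xb: "tnorm k x \<le> Rx"
    proof -
      have "tnorm k n \<le> real (k + 1) * (c + 1)" by (rule tnorm_le) (use nb in \<open>auto simp: less_imp_le\<close>)
      then have "tnorm k (mat_app k L n) \<le> KL * (real (k + 1) * (c + 1))"
        using order_trans[OF KL(2) mult_left_mono] KL(1) by (simp add: less_imp_le)
      moreover have "K * norm \<epsilon> \<le> K * 1" using K \<epsilon>r r by (intro mult_left_mono) auto
      ultimately show ?thesis
        unfolding Rx_def x_def using tnorm_add[of k "nc \<epsilon> n" "mat_app k L n"] wb by linarith
    qed
    \<comment> \<open>The parameters \<open>n_1, ..., n_k\<close> disappear under
      \<open>red\<close>; explicitly they survive only in \<open>H \<epsilon> x - red x\<close>,
      which carries a factor \<epsilon>.\<close>
    have redx: "red x = (\<Sum>i=1..k+1. nc \<epsilon> n i) + (sB \<alpha> (zbar l) + p)"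
      unfolding x_def using tlinear_add[OF tlinear_red, of "nc \<epsilon> n" "mat_app k L n"] red_Nc[of "nc \<epsilon> n"] red_L[of n "mat_app k L n"] w nN top
      by simp
    have near: "norm (H \<epsilon> x - F \<epsilon> p) \<le> \<tau> / 2"
    proof -
      have "H \<epsilon> x - F \<epsilon> p = (H \<epsilon> x - red x) + (\<Sum>i=1..k+1. nc \<epsilon> n i) + sB \<alpha> (zbar l) + (p - F \<epsilon> p)"
        unfolding redx by simp
      also have "norm \<dots> \<le> K * norm \<epsilon> * Rx + K * norm \<epsilon> + \<delta> * (norm (zbar l) + 1) + K * norm \<epsilon>"
      proof (intro norm_triangle_mono)
        show "norm (H \<epsilon> x - red x) \<le> K * norm \<epsilon> * Rx"
          by (rule order_trans[OF H_red[OF \<epsilon>r] mult_left_mono[OF xb]]) (use K in simp)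
        show "norm (\<Sum>i=1..k+1. nc \<epsilon> n i) \<le> K * norm \<epsilon>"
          using norm_sum[of "nc \<epsilon> n" "{1..k+1}"] wb unfolding tnorm_def by linarith
        show "norm (sB \<alpha> (zbar l)) \<le> \<delta> * (norm (zbar l) + 1)" using \<alpha>z by simp
        show "norm (p - F \<epsilon> p) \<le> K * norm \<epsilon>" using F_P[OF \<epsilon>r p(1) p1] by (simp add: norm_minus_commute)
      qed
      also have "\<dots> = K * (Rx + 2) * norm \<epsilon> + \<delta> * (norm (zbar l) + 1)" by (simp add: algebra_simps)
      also have "\<dots> \<le> \<tau> / 4 + \<tau> / 4"
      proof (rule add_mono)
        have "K * (Rx + 2) * norm \<epsilon> \<le> K * (Rx + 2) * (\<tau> / (4 * (K * (Rx + 2))))"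
          using \<epsilon> \<epsilon>1(3) KR by (intro mult_left_mono) auto
        also have "\<dots> = \<tau> / 4" using KR by (metis mult.commute nonzero_mult_divide_mult_cancel_left2 order_less_irrefl times_divide_eq_right)
        finally show "K * (Rx + 2) * norm \<epsilon> \<le> \<tau> / 4" .
        show "\<delta> * (norm (zbar l) + 1) \<le> \<tau> / 4" using \<delta>(4) zp by (simp add: field_simps)
      qed
      finally show ?thesis by simp
    qed
    have small: "norm (lcoord u) < \<mu>" "norm (pproj u - p) < \<mu>" "i \<in> {1..k+1} \<Longrightarrow> norm (W i u) < \<mu>" if "u \<in> cball p \<tau>" for u i
    proof -
      have "C * norm (u - p) \<le> C * \<tau>" using that C(1) by (simp add: dist_norm norm_minus_commute)
      then have less: "C * norm (u - p) < \<mu>" using \<tau> by linarith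
      have pc: "p = (\<Sum>i=1..k+1. 0) + (p + sB 0 (zbar l))" by simp
      have z: "0 \<in> Nc i" if "i \<in> {1..k+1}" for i by (rule B.subspace_0[OF subspace_Nc[OF that]])
      have "lcoord p = 0" by (subst pc, rule lcoord_of_coordinates) (use z p in auto)
      then show "norm (lcoord u) < \<mu>" using C(2)[of "u - p"] less unfolding klinear_on_diff[OF klinear_lcoord] by simp
      have "pproj p = p" by (subst pc, rule pproj_of_coordinates) (use z p in auto)
      then show "norm (pproj u - p) < \<mu>" using C(3)[of "u - p"] less unfolding klinear_on_diff[OF klinear_pproj] by simp
      assume i: "i \<in> {1..k+1}"
      have "W i p = 0" by (rule W_N[OF i subsetD[OF P_subset p(1)]])
      then show "norm (W i u) < \<mu>" using C(4)[OF i, of "u - p"] less unfolding klinear_on_diff[OF klinear_W[OF i]] by simp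
    qed
    have pu: "norm (pproj u) < c + \<mu>" if "u \<in> cball p \<tau>" for u
      using small(2)[OF that] norm_triangle_sub[of "pproj u" p] p(2) by linarith
    have reg: "u \<in> region \<eta> (c + 1)" if "u \<in> cball p \<tau>" for u
      unfolding region_def mem_Collect_eq
      using small(1)[OF that] less_le_trans[OF small(3)[OF that] \<mu>(2)] pu[OF that] \<mu> by auto
    have "\<exists>u\<in>cball p \<tau>. F \<epsilon> u = H \<epsilon> x"
      by (rule perturbed_identity_solve) (intro F_lipschitz[OF \<epsilon>r] reg near | assumption)+
    then obtain u where u: "u \<in> cball p \<tau>" "F \<epsilon> u = H \<epsilon> x" by blast
    define \<epsilon>' where "\<epsilon>' = \<epsilon> * (1 + \<epsilon> ^ q * sig u)"
    have "zf \<epsilon> n = base \<epsilon> + Dl \<epsilon> I + E \<epsilon> (F \<epsilon> u)"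
      unfolding z_fam_def ansatz_Cv Cv_def x_def[symmetric] Dx_E[OF \<epsilon>r x] u(2) ..
    then have zf: "zf \<epsilon> n = Cv (emb0 u) \<epsilon>'" unfolding \<epsilon>'_def Cv_F[OF \<epsilon>r] .
    \<comment> \<open>From \<open>\<eta> \<le> norm kap / 2\<close>. The new time is therefore
      nonzero and at most twice as large as \<epsilon> in norm.\<close>
    have half: "norm (\<epsilon> ^ q * sig u) \<le> 1 / 2"
    proof -
      have "norm (lcoord u) \<le> norm kap / 2" using small(1)[OF u(1)] \<mu>(2) \<eta>(2) by linarith
      then have "norm (sig u) \<le> 1 / 2" using kap_nonzero by (simp add: sig_def norm_divide pos_divide_le_eq)
      moreover have "norm \<epsilon> ^ q \<le> 1" using \<epsilon>r r by (intro power_le_one) auto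
      ultimately have "norm \<epsilon> ^ q * norm (sig u) \<le> 1 * (1 / 2)" by (intro mult_mono) auto
      then show ?thesis by (simp add: norm_mult norm_power)
    qed
    have "norm (1 + \<epsilon> ^ q * sig u) \<le> 2" using norm_triangle_ineq[of 1 "\<epsilon> ^ q * sig u"] half by simp
    then have "norm \<epsilon>' \<le> norm \<epsilon> * 2" unfolding \<epsilon>'_def norm_mult by (intro mult_left_mono) auto
    then have \<epsilon>'1: "norm \<epsilon>' < \<rho>" "norm \<epsilon>' < r" using \<epsilon> \<epsilon>1(2) \<rho> by linarith+
    have \<epsilon>'0: "\<epsilon>' \<noteq> 0"
    proof
      assume "\<epsilon>' = 0"
      then have "\<epsilon> ^ q * sig u = - 1" using False unfolding \<epsilon>'_def by (simp add: eq_neg_iff_add_eq_0 add.commute)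
      then show False using half by simp
    qed
    have pu1: "norm (pproj u) < c + 1" "norm (pproj u) < c'" using pu[OF u(1)] \<mu> by linarith+
    have "G (Cv (emb0 u) \<epsilon>') = 0" using zf_solves[OF n nb \<epsilon>r False] unfolding zf .
    then have "Cv (emb0 u) \<epsilon>' = zr \<epsilon>' (pproj u)"
      using small(3)[OF u(1)] \<mu>(2) by (intro solution_on_zr \<epsilon>'0 \<epsilon>'1 pu1 ballI) (auto intro: less_le_trans)
    with zf \<epsilon>'0 \<epsilon>'1 pu1 pproj_mem show ?thesis by (intro exI[of _ \<epsilon>'] exI[of _ "pproj u"]) auto
  qed
  then show ?thesis using \<epsilon>1(1) \<delta>(1) by blast
qed

end

text \<open>The filter at 0 expresses that \<epsilon> is sufficiently small: the conclusions hold
  for every radius \<open>r\<close> below a bound that depends on \<open>c\<close>. In the third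
  part \<open>\<alpha> zbar l + p\<close> is traded for a nearby parameter \<open>p'\<close>, whose
  norm may slightly exceed \<open>c\<close>; hence the quantification over
  \<open>c' > c\<close>.\<close>

theorem corollary3:
  fixes sB :: "'k::{real_normed_field,banach} \<Rightarrow> 'b::banach \<Rightarrow> 'b"
    and sC :: "'k \<Rightarrow> 'c::banach \<Rightarrow> 'c"
    and G :: "'b \<Rightarrow> 'c"
    and k l :: nat
    and zbar :: "nat \<Rightarrow> 'b"
    and A S :: "nat \<Rightarrow> 'b \<Rightarrow> 'c"
    and N Nc :: "nat \<Rightarrow> 'b set" and R Rc :: "nat \<Rightarrow> 'c set"
    and I :: "nat \<Rightarrow> 'b" and M L :: "nat \<Rightarrow> nat \<Rightarrow> 'b \<Rightarrow> 'b"
    and nc :: "'k \<Rightarrow> (nat \<Rightarrow> 'b) \<Rightarrow> nat \<Rightarrow> 'b"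
    and P :: "'b set"
    and c :: real
  assumes "kbanach sB" and "kbanach sC"
    and "kanalytic_at sB sC G 0" and "G 0 = 0"
    and "k \<ge> 1"
    and "\<exists>z\<in>X_set sB sC G (2*k). \<forall>j\<in>{1..k}. z j = zbar j"
    and "deriv_expansion sB sC G k zbar A"
    and "operator_chain sB sC A k N Nc R Rc S"
    and "sum_operator_surj k N S"
    and "solution_matrices sB sC G k zbar N I M L"
    and "solution_family sB sC G k zbar N Nc I M L nc"
    and "l \<in> {1..k}" and "zbar l \<noteq> 0" and "\<forall>j\<in>{1..<l}. zbar j = 0"
    and "closed_direct_sum sB (N (k+1)) P (range (\<lambda>a. sB a (zbar l)))"
    and "c > 0"
  shows "\<forall>\<^sub>F r in at_right (0::real).
      (ksmooth_on (scale_prod sB) sB (UNIV \<times> P)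
         {(\<epsilon>, p). 0 < norm \<epsilon> \<and> norm \<epsilon> < r \<and> p \<in> P \<and> norm p < c}
         (\<lambda>(\<epsilon>, p). z_red sB k zbar I M L nc \<epsilon> p) \<and>
       (\<forall>\<epsilon> p. 0 < norm \<epsilon> \<and> norm \<epsilon> < r \<and> p \<in> P \<and> norm p < c \<longrightarrow>
          (\<exists>D. has_kderivative_on (scale_prod sB) sB (UNIV \<times> P)
                 {(\<epsilon>, p). 0 < norm \<epsilon> \<and> norm \<epsilon> < r \<and> p \<in> P \<and> norm p < c}
                 (\<lambda>(\<epsilon>, p). z_red sB k zbar I M L nc \<epsilon> p) (\<epsilon>, p) D \<and>
               (\<forall>a. \<forall>q\<in>P. D (a, q) = 0 \<longrightarrow> a = 0 \<and> q = 0))))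
    \<and> (\<exists>W0. open W0 \<and> (\<forall>\<epsilon>. 0 < norm \<epsilon> \<and> norm \<epsilon> < r \<longrightarrow> z_zero sB l k zbar I \<epsilon> \<in> W0) \<and>
         {z \<in> W0. G z = 0} =
         {z_red sB k zbar I M L nc \<epsilon> p | \<epsilon> p. 0 < norm \<epsilon> \<and> norm \<epsilon> < r \<and> p \<in> P \<and> norm p < c})
    \<and> (\<forall>c'>c. \<exists>\<epsilon>1>0. \<exists>\<delta>>0. \<forall>\<epsilon> n \<alpha> p.
         norm \<epsilon> < \<epsilon>1 \<and> n \<in> param_space k N \<and> (\<forall>i\<in>{1..k}. norm (n i) < \<delta>) \<and>
         norm \<alpha> < \<delta> \<and> p \<in> P \<and> norm p < c \<and> n (k+1) = sB \<alpha> (zbar l) + p \<longrightarrow>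
         (\<exists>\<epsilon>' p'. norm \<epsilon>' < r \<and> (\<epsilon> \<noteq> 0 \<longrightarrow> \<epsilon>' \<noteq> 0) \<and> p' \<in> P \<and> norm p' < c' \<and>
            z_fam sB k zbar I M L nc \<epsilon> n = z_red sB k zbar I M L nc \<epsilon>' p'))"
proof -
  have kB: "kspace sB" and kC: "kspace sC"
    using assms(1,2) unfolding kspace_def by auto
  interpret branch sB sC G k l zbar A S N Nc R Rc I M L P
    using assms kB kC by (intro branch.intro analytic_map.intro branch_axioms.intro analytic_map_axioms.intro) auto
  interpret solution_branch sB sC G k l zbar A S N Nc R Rc I M L P nc
    by unfold_locales fact
  obtain \<eta> r0 K where "chart_branch sB sC G k l zbar A S N Nc R Rc I M L P nc c \<eta> r0 K"
    using ex_chart_branch[OF \<open>c > 0\<close>] by blast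
  then interpret ch: chart_branch sB sC G k l zbar A S N Nc R Rc I M L P nc c \<eta> r0 K .
  show ?thesis
  proof (rule eventually_at_rightI[OF _ ch.r(1)], intro conjI allI impI)
    fix r :: real assume "r \<in> {0<..<r0}"
    then have r: "0 < r" "r \<le> r0" by auto
    show "ksmooth_on (scale_prod sB) sB (UNIV \<times> P)
         {(\<epsilon>, p). 0 < norm \<epsilon> \<and> norm \<epsilon> < r \<and> p \<in> P \<and> norm p < c} (\<lambda>(\<epsilon>, p). zr \<epsilon> p)"
      by (rule ch.zr_smooth_dom[OF r(2), unfolded ch.dom_def])
    show "\<exists>D. has_kderivative_on (scale_prod sB) sB (UNIV \<times> P)
                 {(\<epsilon>, p). 0 < norm \<epsilon> \<and> norm \<epsilon> < r \<and> p \<in> P \<and> norm p < c} (\<lambda>(\<epsilon>, p). zr \<epsilon> p) (\<epsilon>, p) D \<and>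
               (\<forall>a. \<forall>q\<in>P. D (a, q) = 0 \<longrightarrow> a = 0 \<and> q = 0)"
      if "0 < norm \<epsilon> \<and> norm \<epsilon> < r \<and> p \<in> P \<and> norm p < c" for \<epsilon> p
      by (rule ch.zr_derivative[OF r(2), unfolded ch.dom_def]) (use that in simp)
    show "\<exists>W0. open W0 \<and> (\<forall>\<epsilon>. 0 < norm \<epsilon> \<and> norm \<epsilon> < r \<longrightarrow> z_zero sB l k zbar I \<epsilon> \<in> W0) \<and>
         {z \<in> W0. G z = 0} = {zr \<epsilon> p | \<epsilon> p. 0 < norm \<epsilon> \<and> norm \<epsilon> < r \<and> p \<in> P \<and> norm p < c}"
      by (intro exI[of _ "ch.nbhd r"] conjI allI impI ch.open_nbhd ch.solutions_nbhd r ch.z_zero_nbhd) auto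
  qed (use ch.family_in_manifold in auto)
qed

end
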